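(* Let $j,\ell$ be integers with $1\le j\le \ell$ and $\gcd(j,\ell)=1$. Then, as $x\to\infty$, $$\sum_{\substack{2\le n\le x\\ p_1(n)\equiv j\ (\mathrm{mod}\ \ell)}}\frac{\mu(n)\omega(n)^2}{n}=O\!\left(\frac{(\log\log x)^{7/2}}{\sqrt{\log x}}\right).$$ Hence $$\sum_{\substack{n=2\\ p_1(n)\equiv j\ (\mathrm{mod}\ \ell)}}^{\infty}\frac{\mu(n)\omega(n)^2}{n}=0,$$ the series converging as the limit of its partial sums over $n\le x$.
   Context: $\mu$ is the Möbius function, $\omega(n)$ is the number of distinct prime factors of $n$, and for an integer $n\ge2$, $p_1(n)$ denotes the smallest prime factor of $n$. Implied constants may depend on $\ell$. *)

theory Defs
  imports
    Complex_Main
    "HOL-Library.Landau_Symbols"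
    "HOL-Computational_Algebra.Squarefree"
    "HOL-Number_Theory.Cong"
begin

definition omega :: "nat \<Rightarrow> nat" where
  "omega n = card (prime_factors n)"

definition moebius :: "nat \<Rightarrow> int" where
  "moebius n = (if squarefree n then (-1) ^ omega n else 0)"

(* Only meaningful for n >= 2: the minimum is over the empty set for n = 0 and n = 1. *)
definition smallest_prime_factor :: "nat \<Rightarrow> nat" where
  "smallest_prime_factor n = Min (prime_factors n)"

end

theory Submission
  imports
    "HOL-Complex_Analysis.Complex_Analysis"
    "HOL-Number_Theory.Prime_Powers"
    "HOL-Number_Theory.Residues"
    "HOL-Real_Asymp.Real_Asymp"
    Defs
begin

text \<open>
  Writing \<open>n = p m\<close> with \<open>p = p\<^sub>1(n)\<close> gives \<open>\<mu>(n) \<omega>(n)\<^sup>2 / n = - \<mu>(m) (\<omega>(m) + 1)\<^sup>2 / (p m)\<close> with \<open>m\<close> free of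
  primes up to \<open>p\<close>. The unrestricted sum over \<open>n\<close> is small, so the indicator of \<open>p \<equiv> j\<close> may be replaced by
  \<open>a\<^sub>p = [p \<equiv> j] - h\<close>, where \<open>h\<close> is the density of the progression; by Mertens' theorem in progressions
  \<open>\<Sum>\<^bsub>p \<le> t\<^esub> a\<^sub>p / p = c + O(1 / log t)\<close>. For \<open>p \<le> exp (sqrt (log x))\<close> the inner sums over \<open>m\<close> are small
  by themselves: \<open>\<Sum>\<^bsub>n \<le> u\<^esub> \<mu>(n) / n\<close> decays faster than any power of \<open>log u\<close> (zeta is large enough just left of the line
  of abscissa 1, and Newman's contour converts this into a rate), this decay survives sifting out small primes, and \<open>\<omega>\<close> is expanded as a sum
  over primes. For larger \<open>p\<close> the order of summation is exchanged, so that the sum over \<open>p\<close> becomes a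
  difference of two of these error terms; the remaining sums over \<open>m\<close> are again decomposed along the smallest prime factor,
  or bounded by a sieve when that factor exceeds \<open>x / m\<close>.
\<close>

section \<open>Arithmetic of the sifted sums\<close>

text \<open>Write L = log log x. The cut at p = exp (sqrt (log x)) balances two losses. The inner
  sum belonging to p is O(L^2 max (log p) (sqrt (log x)) / log x), which is good only while log p is
  small; beyond the cut the saving comes from the error O(1 / log t) in Mertens' theorem with log t
  at least sqrt (log x). Both sides give 1 / sqrt (log x). Of the powers of L, two come from
  \<omega>^2 and one from summing 1/p over the smallest prime, so L^3 / sqrt (log x) is what
  results, and 7/2 leaves room. The obstacle is uniformity in the sifting limit z. Sifting out the
  primes up to z multiplies a bound t^(-e) by the product of 1 / (1 - p^(e-1)), and this is a fixed
  power of log x as long as e log z stays bounded. So the decay by a high power of log u is first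
  traded for a power bound with a tiny exponent e, of size 1 / max (log z) (sqrt (log x)), and the
  fixed power lost in sifting is then affordable. This trade works only for u above exp (44 L max
  (log z) (sqrt (log x))), and shorter sums are handled by the trivial bound 1.\<close>

abbreviation mu :: "nat \<Rightarrow> real" where
  "mu n \<equiv> real_of_int (moebius n)"

text \<open>Sifting is by a set \<open>D\<close> of primes instead of a bound, so that single primes
  can be inserted one at a time. Positivity is included because 0 would qualify for empty
  \<open>D\<close>.\<close>

definition free_of :: "nat set \<Rightarrow> nat \<Rightarrow> bool" where
  "free_of D n \<longleftrightarrow> n > 0 \<and> (\<forall>p\<in>D. \<not> p dvd n)"

definition primes_upto :: "real \<Rightarrow> nat set" where
  "primes_upto z = {p. prime p \<and> real p \<le> z}"

definition msum :: "nat set \<Rightarrow> real \<Rightarrow> real" where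
  "msum D u = (\<Sum>n | free_of D n \<and> real n \<le> u. mu n / real n)"

lemma finite_nat_le_real [simp]: "finite {n::nat. real n \<le> u}"
  by (rule finite_subset[of _ "{..nat \<lfloor>u\<rfloor>}"]) (auto simp: le_nat_floor)

lemma finite_nat_le_real' [simp]:
  "finite {n::nat. P n \<and> real n \<le> u}" "finite {n::nat. real n \<le> u \<and> P n}"
  "finite {n::nat. P n \<and> real n \<le> u \<and> Q n}"
  "finite {n::nat. P n \<and> Q n \<and> real n \<le> u}"
  by (rule finite_subset[OF _ finite_nat_le_real[of u]]; auto)+

lemma finite_primes_upto [simp]: "finite (primes_upto z)"
  by (auto simp: primes_upto_def)

lemma free_of_1 [simp]: "(\<forall>p\<in>D. prime p) \<Longrightarrow> free_of D 1"
  "(\<forall>p\<in>D. prime p) \<Longrightarrow> free_of D (Suc 0)"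
  by (auto simp: free_of_def)

lemma free_of_pos: "free_of D n \<Longrightarrow> n > 0"
  by (simp add: free_of_def)

lemma free_of_insert: "free_of (insert q D) n \<longleftrightarrow> free_of D n \<and> \<not> q dvd n"
  by (auto simp: free_of_def)

lemma msum_eq_0: "u < 1 \<Longrightarrow> msum D u = 0"
  unfolding msum_def by (intro sum.neutral) (auto simp: free_of_def)

lemma free_of_mult:
  assumes "prime q" "q \<notin> D" "\<forall>p\<in>D. prime p"
  shows "free_of D (q * m) \<longleftrightarrow> free_of D m"
  using assms prime_gt_0_nat[OF assms(1)] unfolding free_of_def
  by (auto simp: prime_dvd_mult_iff dest: primes_dvd_imp_eq)

lemma moebius_1 [simp]: "moebius 1 = 1" "moebius (Suc 0) = 1"
  by (auto simp: moebius_def omega_def)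

lemma omega_1 [simp]: "omega 1 = 0" "omega (Suc 0) = 0"
  by (auto simp: omega_def)

lemma abs_moebius_le: "\<bar>moebius n\<bar> \<le> 1"
  by (auto simp: moebius_def power_abs)

lemma abs_mu_le: "\<bar>mu n\<bar> \<le> 1"
  using abs_moebius_le[of n] by linarith

lemma omega_mult_prime:
  assumes "prime p" "\<not> p dvd m" "m > 0"
  shows "omega (p * m) = Suc (omega m)"
proof -
  have "prime_factors (p * m) = insert p (prime_factors m)"
    using assms by (auto simp: prime_factorization_mult prime_factorization_prime)
  moreover have "p \<notin> prime_factors m" using assms by auto
  ultimately show ?thesis by (simp add: omega_def)
qed

lemma squarefree_mult_prime_iff:
  assumes "prime p" "\<not> p dvd m"
  shows "squarefree (p * m) \<longleftrightarrow> squarefree (m::nat)"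
proof -
  have "coprime p m" using assms by (simp add: prime_imp_coprime)
  thus ?thesis using assms(1)
    by (meson dvd_triv_right squarefree_mono squarefree_mult_coprime squarefree_prime)
qed

lemma moebius_mult_prime:
  assumes "prime p" "\<not> p dvd m" "m > 0"
  shows "moebius (p * m) = - moebius m"
  using assms by (simp add: moebius_def omega_mult_prime squarefree_mult_prime_iff)

lemma moebius_mult_dvd:
  assumes "prime p" "p dvd m"
  shows "moebius (p * m) = 0"
proof -
  have "p ^ 2 dvd p * m" using assms(2) by (simp add: power2_eq_square)
  hence "\<not> squarefree (p * m)" using assms(1) unfolding squarefree_def
    by (metis not_prime_unit)
  thus ?thesis by (simp add: moebius_def)
qed

lemma omega_eq_sum_dvd:
  assumes "m > 0" "real m \<le> u"
  shows "real (omega m) = (\<Sum>q\<in>primes_upto u. if q dvd m then 1 else 0)"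
proof -
  have "prime_factors m = {q\<in>primes_upto u. q dvd m}"
    using assms by (auto simp: primes_upto_def prime_factors_dvd dest: dvd_imp_le)
  thus ?thesis by (simp add: omega_def sum.If_cases Int_def)
qed

text \<open>Substitute n = q m. If q divides m as well, then mu(q m) = 0, so the cofactor is
  automatically free of q; otherwise mu(q m) = - mu(m) gives the sign.\<close>

lemma sum_mu_multiples:
  fixes f :: "nat \<Rightarrow> real"
  assumes q: "prime q" "q \<notin> D" "\<forall>p\<in>D. prime p"
  shows "(\<Sum>n | free_of D n \<and> real n \<le> u. if q dvd n then mu n * f n else 0) =
         - (\<Sum>m | free_of (insert q D) m \<and> real m \<le> u / real q. mu m * f (q * m))"
proof -
  have q0: "q > 0" using q(1) by (simp add: prime_gt_0_nat)
  let ?A = "{n. (free_of D n \<and> real n \<le> u) \<and> q dvd n}"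
  let ?B = "{m. free_of D m \<and> real m \<le> u / real q}"
  have "(\<Sum>n | free_of D n \<and> real n \<le> u. if q dvd n then mu n * f n else 0) = (\<Sum>n\<in>?A. mu n * f n)"
    by (intro sum.mono_neutral_cong_right) auto
  also have "\<dots> = (\<Sum>m\<in>?B. mu (q * m) * f (q * m))"
  proof (rule sum.reindex_bij_witness[of _ "\<lambda>m. q * m" "\<lambda>n. n div q"])
    fix n assume n: "n \<in> ?A"
    then obtain m where m: "n = q * m" by blast
    moreover have "free_of D m" using n m free_of_mult[OF q] by simp
    ultimately show "n div q \<in> ?B" using n q0 by (simp add: pos_le_divide_eq mult.commute)
  qed (use q q0 in \<open>auto simp: free_of_mult pos_le_divide_eq mult.commute[of "real q"]\<close>)
  also have "\<dots> = (\<Sum>m | free_of (insert q D) m \<and> real m \<le> u / real q. mu (q * m) * f (q * m))"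
    using q by (intro sum.mono_neutral_right) (auto simp: free_of_insert moebius_mult_dvd)
  also have "\<dots> = (\<Sum>m | free_of (insert q D) m \<and> real m \<le> u / real q. - (mu m * f (q * m)))"
    using q by (intro sum.cong) (auto simp: free_of_insert moebius_mult_prime free_of_pos)
  finally show ?thesis by (simp add: sum_negf)
qed

text \<open>Splits n by divisibility by q. Solved for \<open>msum (insert q D) u\<close> it is a
  recursion that expresses the more heavily sifted sum through itself at u/q.\<close>

lemma msum_insert:
  assumes q: "prime q" "q \<notin> D" "\<forall>p\<in>D. prime p"
  shows "msum D u = msum (insert q D) u - msum (insert q D) (u / real q) / real q"
proof -
  have "msum D u = (\<Sum>n | free_of D n \<and> real n \<le> u. (if q dvd n then 0 else mu n * (1 / real n)))
      + (\<Sum>n | free_of D n \<and> real n \<le> u. if q dvd n then mu n * (1 / real n) else 0)"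
    unfolding msum_def by (subst sum.distrib[symmetric]) (auto intro!: sum.cong)
  also have "(\<Sum>n | free_of D n \<and> real n \<le> u. (if q dvd n then 0 else mu n * (1 / real n)))
     = msum (insert q D) u" unfolding msum_def
    by (intro sum.mono_neutral_cong_right) (auto simp: free_of_insert)
  finally show ?thesis
    using sum_mu_multiples[OF q, where u = u and f = "\<lambda>n. 1 / real n"]
    by (simp add: msum_def sum_divide_distrib mult.commute)
qed

text \<open>One factor omega(m) is opened as a sum over the primes q dividing m, and q is then split
  off. The argument \<open>omega m - 1\<close> of \<open>g\<close> is chosen so that it becomes the
  omega of the cofactor once q is gone. Constant \<open>g\<close> and \<open>g\<close> the identity
  give the first two factorial moments.\<close>

lemma sum_mu_omega:
  assumes D: "\<forall>p\<in>D. prime p"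
  shows "(\<Sum>m | free_of D m \<and> real m \<le> y. mu m / real m * (real (omega m) * g (omega m - 1)))
    = - (\<Sum>q\<in>primes_upto y - D. 1 / real q *
          (\<Sum>m | free_of (insert q D) m \<and> real m \<le> y / real q. mu m / real m * g (omega m)))"
proof -
  have "(\<Sum>m | free_of D m \<and> real m \<le> y. mu m / real m * (real (omega m) * g (omega m - 1)))
     = (\<Sum>m | free_of D m \<and> real m \<le> y. \<Sum>q\<in>primes_upto y.
          if q dvd m then mu m * (g (omega m - 1) / real m) else 0)"
  proof (intro sum.cong refl)
    fix m assume m: "m \<in> {m. free_of D m \<and> real m \<le> y}"
    hence "real (omega m) = (\<Sum>q\<in>primes_upto y. if q dvd m then 1 else 0)"
      by (intro omega_eq_sum_dvd) (auto simp: free_of_pos)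
    hence "mu m / real m * (real (omega m) * g (omega m - 1)) =
      (\<Sum>q\<in>primes_upto y. (if q dvd m then 1 else 0) * (mu m * (g (omega m - 1) / real m)))"
      by (simp only: sum_distrib_right[symmetric]) simp
    also have "\<dots> = (\<Sum>q\<in>primes_upto y. if q dvd m then mu m * (g (omega m - 1) / real m) else 0)"
      by (intro sum.cong) auto
    finally show "mu m / real m * (real (omega m) * g (omega m - 1)) = \<dots>" .
  qed
  also have "\<dots> = (\<Sum>q\<in>primes_upto y. \<Sum>m | free_of D m \<and> real m \<le> y.
          if q dvd m then mu m * (g (omega m - 1) / real m) else 0)"
    by (rule sum.swap)
  also have "\<dots> = (\<Sum>q\<in>primes_upto y - D. \<Sum>m | free_of D m \<and> real m \<le> y.
          if q dvd m then mu m * (g (omega m - 1) / real m) else 0)"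
    by (intro sum.mono_neutral_right) (auto simp: free_of_def)
  also have "\<dots> = (\<Sum>q\<in>primes_upto y - D. - (\<Sum>m | free_of (insert q D) m \<and> real m \<le> y / real q.
       mu m * (g (omega (q * m) - 1) / real (q * m))))"
    using D by (intro sum.cong refl sum_mu_multiples) (auto simp: primes_upto_def)
  also have "\<dots> = (\<Sum>q\<in>primes_upto y - D. - (1 / real q * (\<Sum>m | free_of (insert q D) m \<and> real m \<le> y / real q.
       mu m / real m * g (omega m))))"
    unfolding sum_distrib_left
    by (intro sum.cong refl arg_cong[of _ _ uminus])
       (auto simp: omega_mult_prime free_of_insert free_of_pos primes_upto_def)
  finally show ?thesis by (simp add: sum_negf)
qed

lemma sum_dvd_swap:
  fixes g :: "nat \<Rightarrow> nat \<Rightarrow> 'a :: comm_monoid_add"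
  shows "(\<Sum>n=1..N. \<Sum>d | d dvd n. g d (n div d)) = (\<Sum>d=1..N. \<Sum>k=1..N div d. g d k)"
proof -
  have "(\<Sum>n=1..N. \<Sum>d | d dvd n. g d (n div d)) = (\<Sum>(n,d)\<in>Sigma {1..N} (\<lambda>n. {d. d dvd n}). g d (n div d))"
    by (intro sum.Sigma) auto
  also have "\<dots> = (\<Sum>(d,k)\<in>Sigma {1..N} (\<lambda>d. {1..N div d}). g d k)"
  proof (rule sum.reindex_bij_witness[of _ "\<lambda>(d,k). (d * k, d)" "\<lambda>(n,d). (d, n div d)"])
    fix x assume x: "x \<in> Sigma {1..N} (\<lambda>n. {d. d dvd n})"
    then obtain d k where dk: "x = (d * k, d)" "1 \<le> d * k" "d * k \<le> N" by (auto elim!: dvdE)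
    moreover have "d > 0" "k > 0" using dk(2) by (auto intro!: Nat.gr0I)
    moreover have "d \<le> d * k" using \<open>k > 0\<close> by simp
    ultimately show "(case x of (n, d) \<Rightarrow> (d, n div d)) \<in> Sigma {1..N} (\<lambda>d. {1..N div d})"
      using order_trans[OF \<open>d \<le> d * k\<close> dk(3)]
      by (simp add: less_eq_div_iff_mult_less_eq mult.commute Suc_le_eq)
  qed (auto simp: less_eq_div_iff_mult_less_eq mult.commute Suc_le_eq)
  also have "\<dots> = (\<Sum>d=1..N. \<Sum>k=1..N div d. g d k)"
    by (intro sum.Sigma[symmetric]) auto
  finally show ?thesis .
qed

section \<open>Trivial and power bounds for sifted Moebius sums\<close>

lemma sum_moebius_divisors:
  assumes D: "\<forall>p\<in>D. prime p" and n: "n > 0"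
  shows "(\<Sum>d | d dvd n. if free_of D d then moebius d else 0) =
         (if \<forall>p. prime p \<longrightarrow> p dvd n \<longrightarrow> p \<in> D then 1 else 0)"
proof (cases "\<forall>p. prime p \<longrightarrow> p dvd n \<longrightarrow> p \<in> D")
  case True
  have "(\<Sum>d | d dvd n. if free_of D d then moebius d else 0) = (\<Sum>d\<in>{1::nat}. 1)"
  proof (rule sum.mono_neutral_cong_right)
    show "\<forall>i\<in>{d. d dvd n} - {1}. (if free_of D i then moebius i else 0) = 0"
    proof
      fix d assume d: "d \<in> {d. d dvd n} - {1}"
      then obtain p where "prime p" "p dvd d" using prime_factor_nat by blast
      with d True have "p \<in> D" by auto
      with \<open>p dvd d\<close> show "(if free_of D d then moebius d else 0) = 0" by (auto simp: free_of_def)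
    qed
  qed (use n D in auto)
  with True show ?thesis by simp
next
  case False
  \<comment> \<open>Divisors d prime to q pair off with q d, and the two contributions cancel;
    divisors containing q^2 have mu = 0.\<close>
  then obtain q where q: "prime q" "q dvd n" "q \<notin> D" by auto
  let ?T = "{d. d dvd n \<and> free_of D d}" and ?S = "{d. d dvd n \<and> free_of D d \<and> \<not> q dvd d}"
  have fin: "finite ?T" using n by auto
  have "(\<Sum>d | d dvd n. if free_of D d then moebius d else 0) = (\<Sum>d\<in>?T. moebius d)"
    using n by (intro sum.mono_neutral_cong_right) auto
  also have "\<dots> = (\<Sum>d\<in>?S \<union> (*) q ` ?S. moebius d)"
  proof (rule sum.mono_neutral_right[OF fin])
    show "?S \<union> (*) q ` ?S \<subseteq> ?T"
    proof safe
      fix d assume d: "d dvd n" "free_of D d" "\<not> q dvd d"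
      have "coprime q d" using q(1) d(3) by (simp add: prime_imp_coprime)
      thus "q * d dvd n" using q(2) d(1) by (simp add: divides_mult)
      show "free_of D (q * d)" using d q D by (simp add: free_of_mult)
    qed
    show "\<forall>d\<in>?T - (?S \<union> (*) q ` ?S). moebius d = 0"
    proof
      fix d assume d: "d \<in> ?T - (?S \<union> (*) q ` ?S)"
      hence "q dvd d" by auto
      then obtain e where e: "d = q * e" by blast
      have "free_of D e" using d q D by (auto simp: e free_of_mult)
      hence "q dvd e" using d by (auto simp: e dest: dvd_mult_right)
      thus "moebius d = 0" using q e by (simp add: moebius_mult_dvd)
    qed
  qed
  also have "\<dots> = (\<Sum>d\<in>?S. moebius d) + (\<Sum>d\<in>(*) q ` ?S. moebius d)"
    using n by (intro sum.union_disjoint) auto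
  also have "(\<Sum>d\<in>(*) q ` ?S. moebius d) = (\<Sum>d\<in>?S. moebius (q * d))"
    using q(1) by (subst sum.reindex) (auto simp: inj_on_def)
  also have "\<dots> = (\<Sum>d\<in>?S. - moebius d)"
    using q by (intro sum.cong) (auto simp: moebius_mult_prime free_of_pos)
  finally show ?thesis using False by (simp add: sum_negf)
qed

text \<open>Summing the divisor identity over n \<le> N counts the n composed of primes of
  \<open>D\<close>, and equals N times \<open>msum D u\<close> up to the fractional parts of N/d.
  These errors come only from \<open>D\<close>-free d other than 1, each at most 1, and such d are
  disjoint from the counted n. Both together number at most N, which makes the constant exactly 1
  for every \<open>D\<close>.\<close>

lemma abs_msum_le_1:
  assumes D: "\<forall>p\<in>D. prime p"
  shows "\<bar>msum D u\<bar> \<le> 1"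
proof (cases "u \<ge> 1")
  case False
  thus ?thesis by (simp add: msum_eq_0)
next
  case True
  define N where "N = nat \<lfloor>u\<rfloor>"
  have N: "N > 0" using True by (simp add: N_def)
  have le_iff: "real n \<le> u \<longleftrightarrow> n \<le> N" for n
    using True by (simp add: N_def le_nat_iff le_floor_iff)
  let ?F = "{d\<in>{1..N}. free_of D d}"
  let ?smooth = "\<lambda>n. \<forall>p. prime p \<longrightarrow> p dvd n \<longrightarrow> p \<in> D"
  have m: "msum D u = (\<Sum>d\<in>?F. mu d / real d)"
    unfolding msum_def by (intro sum.cong) (auto simp: le_iff free_of_def)
  have "(\<Sum>n=1..N. \<Sum>d | d dvd n. if free_of D d then moebius d else 0) =
        (\<Sum>d=1..N. \<Sum>k=1..N div d. if free_of D d then moebius d else 0)"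
    using sum_dvd_swap[of "\<lambda>d k. if free_of D d then moebius d else 0" N] .
  also have "\<dots> = (\<Sum>d\<in>?F. moebius d * int (N div d))"
    by (intro sum.mono_neutral_cong_right) auto
  also have "(\<Sum>n=1..N. \<Sum>d | d dvd n. if free_of D d then moebius d else 0) =
             (\<Sum>n=1..N. if ?smooth n then 1 else 0)"
    using D by (intro sum.cong refl sum_moebius_divisors) auto
  also have "\<dots> = int (card {n\<in>{1..N}. ?smooth n})"
    by (simp add: sum.If_cases Int_def)
  finally have eq: "real (card {n\<in>{1..N}. ?smooth n}) = (\<Sum>d\<in>?F. mu d * real (N div d))"
    by (metis (mono_tags, lifting) of_int_mult of_int_of_nat_eq of_int_sum sum.cong)
  have "\<bar>real N * msum D u - real (card {n\<in>{1..N}. ?smooth n})\<bar>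
      = \<bar>\<Sum>d\<in>?F. mu d * (real N / real d - real (N div d))\<bar>"
    unfolding eq m by (simp add: sum_distrib_left sum_subtractf algebra_simps)
  also have "\<dots> \<le> (\<Sum>d\<in>?F. \<bar>mu d * (real N / real d - real (N div d))\<bar>)"
    by (rule sum_abs)
  also have "\<dots> \<le> (\<Sum>d\<in>?F. if d = 1 then 0 else 1)"
  proof (rule sum_mono)
    fix d assume d: "d \<in> ?F"
    have "\<bar>real N / real d - real (N div d)\<bar> \<le> 1"
      using floor_divide_of_nat_eq[of N d, where ?'a = real] by linarith
    hence "\<bar>mu d\<bar> * \<bar>real N / real d - real (N div d)\<bar> \<le> 1 * 1"
      using abs_mu_le by (intro mult_mono) auto
    thus "\<bar>mu d * (real N / real d - real (N div d))\<bar> \<le> (if d = 1 then 0 else 1)"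
      by (simp add: abs_mult)
  qed
  also have "\<dots> = (\<Sum>d\<in>?F - {1}. 1)"
    by (intro sum.mono_neutral_cong_right) auto
  also have "\<dots> = real (card (?F - {1}))" by simp
  finally have *: "\<bar>real N * msum D u - real (card {n\<in>{1..N}. ?smooth n})\<bar> \<le> real (card (?F - {1}))" .
  have disj: "{n\<in>{1..N}. ?smooth n} \<inter> (?F - {1}) = {}"
  proof -
    have "n = 1" if "?smooth n" "free_of D n" for n
    proof (rule ccontr)
      assume "n \<noteq> 1"
      then obtain p where "prime p" "p dvd n" using prime_factor_nat by blast
      thus False using that by (meson free_of_def)
    qed
    thus ?thesis by blast
  qed
  have "card {n\<in>{1..N}. ?smooth n} + card (?F - {1}) = card ({n\<in>{1..N}. ?smooth n} \<union> (?F - {1}))"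
    using disj by (intro card_Un_disjoint[symmetric]) auto
  also have "\<dots> \<le> card {1..N}" by (intro card_mono) auto
  finally have "real (card {n\<in>{1..N}. ?smooth n}) + real (card (?F - {1})) \<le> real N" by simp
  with * have "\<bar>real N * msum D u\<bar> \<le> real N" by linarith
  with N show ?thesis by (simp add: abs_mult)
qed

text \<open>Iterating the recursion of \<open>msum_insert\<close> over t, t/q, t/q^2, ... multiplies
  a bound K t^(-e) by the geometric series with ratio q^(e-1). Only smaller arguments occur, so a
  hypothesis on t \<le> U is enough.\<close>

lemma msum_decay:
  assumes fin: "finite D" and D: "\<forall>p\<in>D. prime p"
    and K: "\<And>t. t \<le> U \<Longrightarrow> t \<ge> 1 \<Longrightarrow> \<bar>msum {} t\<bar> \<le> K * t powr (-e)" and K0: "K \<ge> 0" and e: "e < 1"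
  shows "t \<le> U \<Longrightarrow> t \<ge> 1 \<Longrightarrow> \<bar>msum D t\<bar> \<le> K * t powr (-e) * (\<Prod>q\<in>D. 1 / (1 - real q powr (e - 1)))"
  using fin D
proof (induction D arbitrary: t rule: finite_induct)
  case empty
  thus ?case using K by simp
next
  case (insert q D)
  define r where "r = real q powr (e - 1)"
  have q: "prime q" "q \<ge> 2" using insert.prems by (auto simp: prime_ge_2_nat)
  have "r < 1" using q(2) e by (simp add: r_def powr_less_one)
  have "r > 0" using q(2) by (simp add: r_def)
  define P where "P = (\<Prod>q\<in>D. 1 / (1 - real q powr (e - 1)))"
  have "P \<ge> 0" unfolding P_def using insert.prems e
    by (intro prod_nonneg) (auto simp: prime_gt_Suc_0_nat prime_gt_0_nat dest!: bspec intro!: less_imp_le powr_less_one)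
  \<comment> \<open>The recursion passes from t to t/q \<le> t/2, hence the induction on k with t <
    2^k. It starts at t < 1, where the sum is empty.\<close>
  have main: "\<bar>msum (insert q D) t\<bar> \<le> K * t powr (-e) * P * (1 / (1 - r))"
    if "t \<le> U" "t < 2 ^ k" for k t using that
  proof (induction k arbitrary: t)
    case 0
    hence "msum (insert q D) t = 0" by (simp add: msum_eq_0)
    thus ?case using K0 \<open>P \<ge> 0\<close> \<open>r < 1\<close> by (simp add: mult_nonneg_nonneg)
  next
    case (Suc k)
    show ?case
    proof (cases "t \<ge> 1")
      case False
      hence "msum (insert q D) t = 0" by (simp add: msum_eq_0)
      thus ?thesis using K0 \<open>P \<ge> 0\<close> \<open>r < 1\<close> by (simp add: mult_nonneg_nonneg)
    next
      case True
      have tq: "t / real q < 2 ^ k"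
      proof -
        have "t < 2 ^ k * 2" using Suc.prems by simp
        also have "\<dots> \<le> 2 ^ k * real q" using q(2) by simp
        finally show ?thesis using q(2) by (simp add: field_simps)
      qed
      have "t / real q \<le> t" using True q(2) by (simp add: field_simps)
      hence IH: "\<bar>msum (insert q D) (t / real q)\<bar> \<le> K * (t / real q) powr (-e) * P * (1 / (1 - r))"
        using Suc.IH[of "t / real q"] tq Suc.prems by simp
      have IH': "\<bar>msum D t\<bar> \<le> K * t powr (-e) * P"
        using insert.IH[of t] True Suc.prems insert.prems by (auto simp: P_def)
      have "(t / real q) powr (-e) / real q = t powr (-e) * r"
        using True q(2) by (simp add: r_def powr_divide powr_minus powr_diff field_simps)
      hence IH2: "\<bar>msum (insert q D) (t / real q)\<bar> / real q \<le> K * t powr (-e) * P * (r / (1 - r))"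
      proof -
        have "\<bar>msum (insert q D) (t / real q)\<bar> / real q
          \<le> (K * (t / real q) powr (-e) * P * (1 / (1 - r))) / real q"
          by (intro divide_right_mono IH) auto
        also have "\<dots> = K * ((t / real q) powr (-e) / real q) * P * (1 / (1 - r))" by simp
        also have "\<dots> = K * t powr (-e) * P * (r / (1 - r))"
          by (simp only: \<open>(t / real q) powr (-e) / real q = t powr (-e) * r\<close>) simp
        finally show ?thesis .
      qed
      have "msum (insert q D) t = msum D t + msum (insert q D) (t / real q) / real q"
        using msum_insert[of q D t] q insert by auto
      hence "\<bar>msum (insert q D) t\<bar> \<le> \<bar>msum D t\<bar> + \<bar>msum (insert q D) (t / real q)\<bar> / real q"
        using abs_triangle_ineq[of "msum D t" "msum (insert q D) (t / real q) / real q"] by (simp add: abs_divide)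
      also have "\<dots> \<le> K * t powr (-e) * P + K * t powr (-e) * P * (r / (1 - r))"
        using IH' IH2 by linarith
      also have "\<dots> = K * t powr (-e) * P * (1 / (1 - r))"
        using \<open>r < 1\<close> by (simp add: field_simps)
      finally show ?thesis .
    qed
  qed
  obtain k where "t < 2 ^ k" using real_arch_pow[of 2 t] by auto
  from main[OF insert.prems(1) this] show ?case
    using insert.hyps by (simp add: P_def r_def mult_ac)
qed

section \<open>Splitting off the smallest prime factor\<close>

lemma smallest_prime_factor_mult:
  assumes "prime p" "free_of (primes_upto (real p)) m"
  shows "smallest_prime_factor (p * m) = p" "\<not> p dvd m"
proof -
  show "\<not> p dvd m" using assms by (auto simp: free_of_def primes_upto_def)
  have "prime_factors (p * m) = insert p (prime_factors m)"
    using assms free_of_pos[OF assms(2)]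
    by (auto simp: prime_factorization_mult prime_factorization_prime)
  moreover have "q \<ge> p" if "q \<in> prime_factors m" for q
  proof (rule ccontr)
    assume "\<not> p \<le> q"
    moreover have "prime q" "q dvd m" using that by auto
    ultimately show False using assms(2) by (auto simp: free_of_def primes_upto_def)
  qed
  ultimately show "smallest_prime_factor (p * m) = p"
    unfolding smallest_prime_factor_def by (intro Min_eqI) auto
qed

lemma smallest_prime_factor_props:
  assumes "n \<ge> 2"
  shows "prime (smallest_prime_factor n)" "smallest_prime_factor n dvd n"
    "\<And>q. prime q \<Longrightarrow> q dvd n \<Longrightarrow> smallest_prime_factor n \<le> q"
proof -
  obtain p where "prime p" "p dvd n" using prime_factor_nat[of n] assms by auto
  hence "prime_factors n \<noteq> {}" using assms by (auto simp: prime_factors_dvd)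
  hence *: "smallest_prime_factor n \<in> prime_factors n"
    unfolding smallest_prime_factor_def by (intro Min_in) auto
  thus "prime (smallest_prime_factor n)" "smallest_prime_factor n dvd n" by auto
  fix q assume "prime q" "q dvd n"
  thus "smallest_prime_factor n \<le> q" using assms unfolding smallest_prime_factor_def
    by (intro Min_le) (auto simp: prime_factors_dvd)
qed

text \<open>The map from n to (p, n/p), p the smallest prime factor, is injective, but the cofactor
  is free of p itself only if p^2 does not divide n. The detour through squarefree numbers is
  harmless, as the Moebius factor vanishes elsewhere on both sides.\<close>

lemma sum_mu_smallest_prime_factor:
  fixes f :: "nat \<Rightarrow> real"
  assumes A: "finite A" "\<And>n. n \<in> A \<Longrightarrow> n \<ge> 2"
  shows "(\<Sum>n\<in>A. mu n * f n) =
    - (\<Sum>(p, m) | prime p \<and> free_of (primes_upto (real p)) m \<and> p * m \<in> A. mu m * f (p * m))"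
proof -
  let ?B = "{(p, m). prime p \<and> free_of (primes_upto (real p)) m \<and> p * m \<in> A}"
  have "(\<Sum>n\<in>A. mu n * f n) = (\<Sum>n\<in>{n\<in>A. squarefree n}. mu n * f n)"
    using A by (intro sum.mono_neutral_right) (auto simp: moebius_def)
  also have "\<dots> = (\<Sum>(p, m)\<in>{pm\<in>?B. squarefree (fst pm * snd pm)}. mu (p * m) * f (p * m))"
  proof (rule sum.reindex_bij_witness[of _ "\<lambda>(p,m). p * m" "\<lambda>n. (smallest_prime_factor n, n div smallest_prime_factor n)"])
    fix n assume n: "n \<in> {n\<in>A. squarefree n}"
    hence n2: "n \<ge> 2" using A by auto
    let ?p = "smallest_prime_factor n"
    note sp = smallest_prime_factor_props[OF n2]
    have eq: "?p * (n div ?p) = n" using sp(2) by simp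
    show "(case (?p, n div ?p) of (p, m) \<Rightarrow> p * m) = n" using eq by simp
    have "free_of (primes_upto (real ?p)) (n div ?p)"
      unfolding free_of_def
    proof safe
      show "n div ?p > 0" using eq n2 by (metis Nat.gr0I mult_0_right not_numeral_le_zero)
      fix q assume q: "q \<in> primes_upto (real ?p)" "q dvd n div ?p"
      hence "q dvd n" using eq by (metis dvd_mult)
      hence "q = ?p" using q sp(3)[of q] by (auto simp: primes_upto_def)
      hence "?p ^ 2 dvd n" using q(2) eq by (metis dvd_refl mult_dvd_mono power2_eq_square)
      thus False using n sp(1) unfolding squarefree_def by auto
    qed
    thus "(?p, n div ?p) \<in> {pm\<in>?B. squarefree (fst pm * snd pm)}"
      using n eq sp by simp
    show "(case (?p, n div ?p) of (p, m) \<Rightarrow> mu (p * m) * f (p * m)) = mu n * f n"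
      using eq by simp
  next
    fix pm assume pm: "pm \<in> {pm\<in>?B. squarefree (fst pm * snd pm)}"
    obtain p m where pm': "pm = (p, m)" by force
    have p: "prime p" "free_of (primes_upto (real p)) m" using pm pm' by auto
    hence "p > 0" by (simp add: prime_gt_0_nat)
    thus "(smallest_prime_factor (case pm of (p, m) \<Rightarrow> p * m),
         (case pm of (p, m) \<Rightarrow> p * m) div smallest_prime_factor (case pm of (p, m) \<Rightarrow> p * m)) = pm"
      using smallest_prime_factor_mult[OF p] by (simp add: pm')
    show "(case pm of (p, m) \<Rightarrow> p * m) \<in> {n\<in>A. squarefree n}" using pm pm' by auto
  qed
  also have "\<dots> = (\<Sum>(p, m)\<in>?B. mu (p * m) * f (p * m))"
  proof (rule sum.mono_neutral_left)
    have "?B \<subseteq> (\<lambda>n. (smallest_prime_factor n, n div smallest_prime_factor n)) ` A"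
    proof safe
      fix p m assume p: "prime p" "free_of (primes_upto (real p)) m" "p * m \<in> A"
      hence "p > 0" by (simp add: prime_gt_0_nat)
      thus "(p, m) \<in> (\<lambda>n. (smallest_prime_factor n, n div smallest_prime_factor n)) ` A"
        using p smallest_prime_factor_mult[OF p(1,2)] by (intro image_eqI[of _ _ "p * m"]) auto
    qed
    thus "finite ?B" using A(1) finite_subset by blast
  qed (auto simp: moebius_def split: if_splits)
  also have "\<dots> = (\<Sum>(p, m)\<in>?B. - (mu m * f (p * m)))"
  proof (intro sum.cong refl, clarify)
    fix p m assume p: "prime p" "free_of (primes_upto (real p)) m"
    show "mu (p * m) * f (p * m) = - (mu m * f (p * m))"
      using moebius_mult_prime[OF p(1) smallest_prime_factor_mult(2)[OF p] free_of_pos[OF p(2)]] by simp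
  qed
  finally show ?thesis by (simp add: sum_negf case_prod_unfold)
qed

section \<open>Chebyshev and Mertens estimates\<close>

abbreviation mang :: "nat \<Rightarrow> real" where
  "mang n \<equiv> mangoldt n"

definition psi :: "nat \<Rightarrow> real" where
  "psi N = (\<Sum>n=1..N. mang n)"

lemma sum_ln_eq: "(\<Sum>n=1..N. ln (real n)) = (\<Sum>d=1..N. mang d * real (N div d))"
proof -
  have "(\<Sum>n=1..N. ln (real n)) = (\<Sum>n=1..N. \<Sum>d | d dvd n. mang d)"
    by (intro sum.cong) (auto simp: mangoldt_sum)
  also have "\<dots> = (\<Sum>d=1..N. \<Sum>k=1..N div d. mang d)"
    using sum_dvd_swap[of "\<lambda>d k. mang d" N] .
  finally show ?thesis by (simp add: mult.commute)
qed

lemma ln_fact_sum: "ln (fact N :: real) = (\<Sum>n=1..N. ln (real n))"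
  by (induction N) (simp_all add: ln_mult)

lemma psi_mono: "m \<le> n \<Longrightarrow> psi m \<le> psi n"
  unfolding psi_def by (intro sum_mono2) (auto simp: mangoldt_nonneg)

text \<open>Chebyshev's argument: log of binom(2n, n) is the sum of Lambda(d) (floor(2n/d) - 2
  floor(n/d)). The bracket is never negative and equals 1 for n < d \<le> 2n, while binom(2n, n)
  \<le> 4^n.\<close>

lemma psi_double: "psi (2 * n) \<le> psi n + 2 * real n * ln 2"
proof -
  have "psi (2 * n) - psi n = (\<Sum>d\<in>{1..2*n} - {1..n}. mang d)"
    unfolding psi_def by (subst sum_diff) auto
  also have "\<dots> \<le> (\<Sum>d\<in>{1..2*n} - {1..n}. mang d * (real (2 * n div d) - 2 * real (n div d)))"
  proof (intro sum_mono)
    fix d assume d: "d \<in> {1..2*n} - {1..n}"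
    hence "n div d = 0" "2 * n div d \<ge> 1" by (auto simp: Suc_le_eq div_greater_zero_iff)
    thus "mang d \<le> mang d * (real (2 * n div d) - 2 * real (n div d))"
      using mult_left_mono[of 1 "real (2 * n div d)" "mang d"] mangoldt_nonneg[of d] by simp
  qed
  also have "\<dots> \<le> (\<Sum>d\<in>{1..2*n}. mang d * (real (2 * n div d) - 2 * real (n div d)))"
  proof (intro sum_mono2)
    fix d assume "d \<in> {1..2*n} - ({1..2*n} - {1..n})"
    hence "d > 0" by auto
    moreover have "2 * (d * (n div d)) \<le> 2 * n" by (intro mult_le_mono2 times_div_less_eq_dividend)
    ultimately have "2 * (n div d) \<le> 2 * n div d"
      by (simp add: less_eq_div_iff_mult_less_eq mult_ac)
    hence "2 * real (n div d) \<le> real (2 * n div d)" by (metis of_nat_le_iff of_nat_mult of_nat_numeral)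
    thus "0 \<le> mang d * (real (2 * n div d) - 2 * real (n div d))"
      by (intro mult_nonneg_nonneg mangoldt_nonneg) simp
  qed auto
  also have "\<dots> = (\<Sum>d=1..2*n. mang d * real (2 * n div d)) - 2 * (\<Sum>d=1..2*n. mang d * real (n div d))"
    by (simp add: sum_subtractf sum_distrib_left algebra_simps)
  also have "(\<Sum>d=1..2*n. mang d * real (n div d)) = (\<Sum>d=1..n. mang d * real (n div d))"
    by (intro sum.mono_neutral_right) auto
  also have "(\<Sum>d=1..2*n. mang d * real (2 * n div d)) - 2 * \<dots> = ln (fact (2 * n)) - 2 * ln (fact n)"
    by (simp only: ln_fact_sum sum_ln_eq)
  also have "\<dots> = ln (real ((2 * n) choose n))"
  proof -
    have "real ((2 * n) choose n) = fact (2 * n) / (fact n * fact n)"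
      by (subst binomial_fact) (auto simp: mult_2)
    thus ?thesis by (simp add: ln_div ln_mult)
  qed
  also have "\<dots> \<le> ln (2 ^ (2 * n))"
  proof (subst ln_le_cancel_iff)
    have "(2 * n) choose n \<le> (\<Sum>k\<le>2*n. (2 * n) choose k)" by (intro member_le_sum) auto
    hence "(2 * n) choose n \<le> 2 ^ (2 * n)" by (simp add: choose_row_sum)
    thus "real ((2 * n) choose n) \<le> 2 ^ (2 * n)" by (metis of_nat_le_iff of_nat_numeral of_nat_power)
  qed (auto simp: zero_less_binomial_iff)
  also have "\<dots> = 2 * real n * ln 2" by (simp add: ln_realpow)
  finally show ?thesis by simp
qed

lemma psi_le: "psi N \<le> 6 * real N"
proof (induction N rule: less_induct)
  case (less N)
  show ?case
  proof (cases "N \<ge> 2")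
    case True
    \<comment> \<open>Rounding up keeps N \<le> 2n. The induction then gives 6n + 2n = 8n \<le> 4(N
      + 1), which is at most 6N from N = 2 on.\<close>
    define n where "n = (N + 1) div 2"
    have n: "n < N" "N \<le> 2 * n" "2 * n \<le> N + 1" using True by (auto simp: n_def)
    have "psi N \<le> psi (2 * n)" using n by (intro psi_mono)
    also have "\<dots> \<le> psi n + 2 * real n * ln 2" by (rule psi_double)
    also have "2 * real n * ln 2 \<le> 2 * real n * 1" using ln_2_less_1 by (intro mult_left_mono) auto
    also have "psi n \<le> 6 * real n" by (rule less.IH[OF n(1)])
    finally have "psi N \<le> 8 * real n" by simp
    also have "\<dots> \<le> 6 * real N" using n True by linarith
    finally show ?thesis .
  next
    case False
    hence "N = 0 \<or> N = 1" by auto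
    thus ?thesis by (auto simp: psi_def)
  qed
qed

lemma ln_fact_bounds:
  "ln (fact N :: real) \<le> real N * ln (real N)" "ln (fact N :: real) \<ge> real N * ln (real N) - real N"
proof -
  have "(\<Sum>n=1..N. ln (real n)) \<le> (\<Sum>n=1..N. ln (real N))" by (intro sum_mono) auto
  thus "ln (fact N :: real) \<le> real N * ln (real N)" by (simp add: ln_fact_sum)
  show "ln (fact N :: real) \<ge> real N * ln (real N) - real N"
  proof (induction N)
    case (Suc N)
    have "real N * ln (1 + 1 / real N) \<le> 1"
    proof (cases "N = 0")
      case False
      hence "real N * ln (1 + 1 / real N) \<le> real N * (1 / real N)"
        by (intro mult_left_mono ln_add_one_self_le_self) auto
      thus ?thesis using False by simp
    qed auto
    moreover have "real N * ln (real (Suc N)) = real N * ln (real N) + real N * ln (1 + 1 / real N)"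
    proof (cases "N = 0")
      case False
      hence "1 + 1 / real N = real (Suc N) / real N" by (simp add: field_simps)
      thus ?thesis using False by (simp add: ln_div algebra_simps)
    qed auto
    moreover have "ln (fact (Suc N) :: real) = ln (real (Suc N)) + ln (fact N)"
      by (simp add: ln_mult)
    ultimately show ?case using Suc by (simp add: algebra_simps)
  qed auto
qed

text \<open>Compares log N!, the sum of Lambda(d) floor(N/d), with N times the sum of Lambda(d)/d.
  Dropping the floors costs at most psi(N) \<le> 6N, and log N! is N log N up to N.\<close>

lemma mertens_mangoldt:
  assumes "N > 0"
  shows "\<bar>(\<Sum>d=1..N. mang d / real d) - ln (real N)\<bar> \<le> 6"
proof -
  let ?S = "\<Sum>d=1..N. mang d / real d"
  have frac: "0 \<le> real N / real d - real (N div d)" "real N / real d - real (N div d) \<le> 1" for d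
    using floor_divide_of_nat_eq[of N d, where ?'a = real] by linarith+
  have fact_eq: "ln (fact N) = (\<Sum>d=1..N. mang d * real (N div d))"
    by (simp only: ln_fact_sum sum_ln_eq)
  have "real N * ?S - ln (fact N) = (\<Sum>d=1..N. mang d * (real N / real d - real (N div d)))"
    unfolding fact_eq by (simp add: sum_distrib_left sum_subtractf algebra_simps)
  moreover have "(\<Sum>d=1..N. mang d * (real N / real d - real (N div d))) \<ge> 0"
    using frac by (intro sum_nonneg mult_nonneg_nonneg mangoldt_nonneg) auto
  moreover have "(\<Sum>d=1..N. mang d * (real N / real d - real (N div d))) \<le> (\<Sum>d=1..N. mang d * 1)"
    using frac by (intro sum_mono mult_left_mono mangoldt_nonneg) auto
  ultimately have "real N * ?S \<ge> ln (fact N)" "real N * ?S \<le> ln (fact N) + 6 * real N"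
    using psi_le[of N] by (auto simp: psi_def)
  hence "real N * ?S \<ge> real N * (ln (real N) - 1)" "real N * ?S \<le> real N * (ln (real N) + 6)"
    using ln_fact_bounds[of N] by (auto simp: algebra_simps)
  hence "?S \<ge> ln (real N) - 1" "?S \<le> ln (real N) + 6"
    using assms by (auto simp only: mult_le_cancel_left_pos of_nat_0_less_iff)
  thus ?thesis by simp
qed

text \<open>A prime p contributes log p times the sum of p^(-k) over k \<ge> 2, at most 2 log p /
  p^2. With log p \<le> 2 sqrt p this is dominated by the convergent series of p^(-3/2).\<close>

lemma prime_power_sum_bound:
  "\<exists>C. \<forall>N. (\<Sum>n\<in>{n\<in>{1..N}. \<not> prime n}. mang n / real n) \<le> C"
proof -
  have sm: "summable (\<lambda>n. 8 * real (Suc n) powr (-3/2))"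
    by (intro summable_mult) (subst summable_Suc_iff, simp add: summable_real_powr_iff)
  have "(\<Sum>n\<in>{n\<in>{1..N}. \<not> prime n}. mang n / real n) \<le> (\<Sum>n. 8 * real (Suc n) powr (-3/2))" for N
  proof -
    let ?A = "{n\<in>{1..N}. \<not> prime n}"
    let ?P = "{p\<in>{1..N}. prime p}"
    have "(\<Sum>n\<in>?A. mang n / real n) = (\<Sum>n\<in>{n\<in>?A. primepow n}. mang n / real n)"
      by (intro sum.mono_neutral_right) (auto simp: mangoldt_def)
    also have "\<dots> \<le> (\<Sum>n\<in>(\<lambda>(p, k). p ^ k) ` (?P \<times> {2..N}). mang n / real n)"
    proof (intro sum_mono2)
      show "{n\<in>?A. primepow n} \<subseteq> (\<lambda>(p, k). p ^ k) ` (?P \<times> {2..N})"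
      proof
        fix n assume n: "n \<in> {n\<in>?A. primepow n}"
        then obtain p k where pk: "prime p" "k > 0" "n = p ^ k" by (auto simp: primepow_def)
        have "k \<noteq> 1" using n pk by auto
        have "k < p ^ k" using pk(1) by (intro power_gt_expt) (auto simp: prime_gt_Suc_0_nat)
        moreover have "p ^ 1 \<le> p ^ k" using pk by (intro power_increasing) (auto simp: prime_gt_0_nat Suc_le_eq)
        ultimately have "p \<le> N" "k \<le> N" using n pk by auto
        thus "n \<in> (\<lambda>(p, k). p ^ k) ` (?P \<times> {2..N})"
          using pk \<open>k \<noteq> 1\<close> by (intro image_eqI[of _ _ "(p, k)"]) (auto simp: prime_gt_0_nat Suc_le_eq)
      qed
    qed (auto simp: mangoldt_nonneg)
    also have "\<dots> = (\<Sum>(p, k)\<in>?P \<times> {2..N}. mang (p ^ k) / real (p ^ k))"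
    proof (subst sum.reindex)
      show "inj_on (\<lambda>(p, k). p ^ k) (?P \<times> {2..N})"
        by (rule inj_onI) (auto simp: prime_power_inj'')
    qed (auto simp: case_prod_unfold)
    also have "\<dots> = (\<Sum>p\<in>?P. \<Sum>k=2..N. mang (p ^ k) / real (p ^ k))"
      by (intro sum.Sigma[symmetric]) auto
    also have "\<dots> \<le> (\<Sum>p\<in>?P. 8 * real p powr (-3/2))"
    proof (intro sum_mono)
      fix p assume p: "p \<in> ?P"
      hence p2: "p \<ge> 2" by (auto simp: prime_ge_2_nat)
      have "(\<Sum>k=2..N. mang (p ^ k) / real (p ^ k)) = ln (real p) * (\<Sum>k=2..N. (1 / real p) ^ k)"
        using p by (auto simp: sum_distrib_left mangoldt_primepow power_one_over field_simps intro!: sum.cong)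
      moreover have "(\<Sum>k=2..N. (1 / real p) ^ k) \<le> 2 / real p ^ 2"
      proof -
        define r where "r = 1 / real p"
        have r: "0 < r" "r \<le> 1/2" using p2 by (auto simp: r_def field_simps)
        have "(\<Sum>k=2..N. r ^ k) * (1 - r) \<le> r ^ 2"
        proof (induction N)
          case (Suc N)
          show ?case
          proof (cases "N \<ge> 1")
            case True
            have "(\<Sum>k=2..M. r ^ k) * (1 - r) = r ^ 2 - r ^ (M + 1)" if "M \<ge> 1" for M
              using that
            proof (induction M rule: dec_induct)
              case (step m)
              have "(\<Sum>k=2..Suc m. r ^ k) * (1 - r) = (\<Sum>k=2..m. r ^ k) * (1 - r) + r ^ Suc m * (1 - r)"
                using step by (simp add: distrib_right)
              also have "\<dots> = r ^ 2 - r ^ (Suc m + 1)" using step by (simp add: algebra_simps)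
              finally show ?case .
            qed (simp add: power2_eq_square)
            from this[of "Suc N"] show ?thesis using r by simp
          qed (use r in auto)
        qed auto
        hence "(\<Sum>k=2..N. r ^ k) \<le> r ^ 2 / (1 - r)" using r by (simp add: field_simps)
        also have "\<dots> \<le> r ^ 2 / (1 / 2)" using r by (intro divide_left_mono) auto
        finally show ?thesis by (simp add: r_def power_one_over)
      qed
      moreover have "ln (real p) \<le> 2 * real p powr (1/2)"
      proof -
        have "ln (real p) = 2 * ln (real p powr (1/2))" using p2 by (simp add: ln_powr)
        also have "ln (real p powr (1/2)) \<le> real p powr (1/2)" using p2
          by (intro ln_bound) auto
        finally show ?thesis by simp
      qed
      moreover have "2 * real p powr (1/2) * (2 / real p ^ 2) = 4 * real p powr (-3/2)"
      proof -
        have "real p powr (1/2) / real p ^ 2 = real p powr (1/2 - 2)"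
          using p2 by (subst powr_diff) (simp add: powr_numeral)
        thus ?thesis by simp
      qed
      ultimately have "(\<Sum>k=2..N. mang (p ^ k) / real (p ^ k)) \<le> 4 * real p powr (-3/2)"
        using mult_mono[of "ln (real p)" "2 * real p powr (1/2)" "\<Sum>k=2..N. (1 / real p) ^ k" "2 / real p ^ 2"]
          sum_nonneg[of "{2..N}" "\<lambda>k. (1 / real p) ^ k"] by simp
      thus "(\<Sum>k=2..N. mang (p ^ k) / real (p ^ k)) \<le> 8 * real p powr (-3/2)"
        using powr_ge_zero[of "real p" "-3/2"] by linarith
    qed
    also have "\<dots> \<le> (\<Sum>p=1..N. 8 * real p powr (-3/2))" by (intro sum_mono2) auto
    also have "\<dots> = (\<Sum>n<N. 8 * real (Suc n) powr (-3/2))"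
      by (intro sum.reindex_bij_witness[of _ Suc "\<lambda>n. n - 1"]) auto
    also have "\<dots> \<le> (\<Sum>n. 8 * real (Suc n) powr (-3/2))"
      by (intro sum_le_suminf sm) auto
    finally show ?thesis .
  qed
  thus ?thesis by blast
qed

text \<open>Partial summation with an arbitrary starting index M. The values lie in a normed space
  so that it serves real prime sums as well as complex character sums.\<close>

lemma abel_sum:
  fixes a :: "nat \<Rightarrow> 'a :: real_normed_vector" and g :: "nat \<Rightarrow> real"
  assumes K: "\<And>n. M < n \<Longrightarrow> n \<le> N \<Longrightarrow> norm (\<Sum>i\<in>{M<..n}. a i) \<le> K" and MN: "M < N"
    and g: "\<And>n. M < n \<Longrightarrow> n \<le> N \<Longrightarrow> g n \<ge> 0" "\<And>n. M < n \<Longrightarrow> n < N \<Longrightarrow> g (Suc n) \<le> g n"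
  shows "norm (\<Sum>i\<in>{M<..N}. g i *\<^sub>R a i) \<le> K * g (Suc M)"
proof -
  let ?A = "\<lambda>n. \<Sum>i\<in>{M<..n}. a i"
  have eq: "(\<Sum>i\<in>{M<..n}. g i *\<^sub>R a i) = g n *\<^sub>R ?A n + (\<Sum>i\<in>{M<..<n}. (g i - g (Suc i)) *\<^sub>R ?A i)"
    if "Suc M \<le> n" for n using that
  proof (induction n rule: dec_induct)
    case base
    have "{M<..Suc M} = {Suc M}" "{M<..<Suc M} = {}" by auto
    thus ?case by simp
  next
    case (step n)
    have s: "{M<..Suc n} = insert (Suc n) {M<..n}" "{M<..<Suc n} = insert n {M<..<n}" using step by auto
    have "(\<Sum>i\<in>{M<..Suc n}. g i *\<^sub>R a i) = g (Suc n) *\<^sub>R a (Suc n) + (\<Sum>i\<in>{M<..n}. g i *\<^sub>R a i)"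
      unfolding s by simp
    also have "\<dots> = g (Suc n) *\<^sub>R a (Suc n) + g n *\<^sub>R ?A n + (\<Sum>i\<in>{M<..<n}. (g i - g (Suc i)) *\<^sub>R ?A i)"
      using step by simp
    also have "\<dots> = g (Suc n) *\<^sub>R ?A (Suc n) + (\<Sum>i\<in>{M<..<Suc n}. (g i - g (Suc i)) *\<^sub>R ?A i)"
      unfolding s by (simp add: algebra_simps)
    finally show ?case .
  qed
  have tel: "(\<Sum>i\<in>{M<..<n}. g i - g (Suc i)) = g (Suc M) - g n" if "Suc M \<le> n" for n using that
  proof (induction n rule: dec_induct)
    case base
    have "{M<..<Suc M} = {}" by auto
    thus ?case by simp
  next
    case (step n)
    have "{M<..<Suc n} = insert n {M<..<n}" using step by auto
    thus ?case using step by simp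
  qed
  have "norm (\<Sum>i\<in>{M<..N}. g i *\<^sub>R a i) \<le> norm (g N *\<^sub>R ?A N) + (\<Sum>i\<in>{M<..<N}. norm ((g i - g (Suc i)) *\<^sub>R ?A i))"
    using MN by (subst eq) (auto intro: order_trans[OF norm_triangle_ineq add_left_mono[OF norm_sum]] simp del: norm_scaleR)
  also have "\<dots> \<le> g N * K + (\<Sum>i\<in>{M<..<N}. (g i - g (Suc i)) * K)"
    unfolding norm_scaleR using g MN K
    by (intro add_mono sum_mono mult_mono) (auto simp: order.trans[OF norm_ge_zero K])
  also have "\<dots> = K * g (Suc M)"
  proof -
    have tel': "(\<Sum>i\<in>{M<..<N}. g i - g (Suc i)) = g (Suc M) - g N" using tel[of N] MN by simp
    show ?thesis unfolding sum_distrib_right[symmetric] tel' by (simp add: algebra_simps)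
  qed
  finally show ?thesis .
qed

lemma sum_prime_ln_div:
  "\<exists>C. \<forall>N>0. \<bar>(\<Sum>p\<in>{p\<in>{1..N}. prime p}. ln (real p) / real p) - ln (real N)\<bar> \<le> C"
proof -
  obtain C where C: "\<And>N. (\<Sum>n\<in>{n\<in>{1..N}. \<not> prime n}. mang n / real n) \<le> C"
    using prime_power_sum_bound by blast
  have "\<bar>(\<Sum>p\<in>{p\<in>{1..N}. prime p}. ln (real p) / real p) - ln (real N)\<bar> \<le> 6 + C" if "N > 0" for N
  proof -
    have "(\<Sum>d=1..N. mang d / real d) = (\<Sum>d\<in>{p\<in>{1..N}. prime p} \<union> {n\<in>{1..N}. \<not> prime n}. mang d / real d)"
      by (intro sum.cong) auto
    also have "\<dots> = (\<Sum>d\<in>{p\<in>{1..N}. prime p}. mang d / real d) + (\<Sum>n\<in>{n\<in>{1..N}. \<not> prime n}. mang n / real n)"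
      by (intro sum.union_disjoint) auto
    also have "(\<Sum>d\<in>{p\<in>{1..N}. prime p}. mang d / real d) = (\<Sum>p\<in>{p\<in>{1..N}. prime p}. ln (real p) / real p)"
      by (intro sum.cong) auto
    finally have "(\<Sum>d=1..N. mang d / real d) = \<dots> + (\<Sum>n\<in>{n\<in>{1..N}. \<not> prime n}. mang n / real n)" .
    moreover have "(\<Sum>n\<in>{n\<in>{1..N}. \<not> prime n}. mang n / real n) \<ge> 0"
      by (intro sum_nonneg) (auto simp: mangoldt_nonneg)
    ultimately show ?thesis using mertens_mangoldt[OF that] C[of N] by linarith
  qed
  thus ?thesis by blast
qed

text \<open>Abel summation with weight 1/log n. Subtracting log n - log (n-1) from the prime weight
  turns Mertens' bounded error into bounded partial sums, and the weighted sum of what was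
  subtracted is dominated by a telescoping sum of log log.\<close>

lemma sum_inverse_primes_le_nat:
  "\<exists>C>0. \<forall>M N. 2 \<le> M \<longrightarrow> M \<le> N \<longrightarrow>
    (\<Sum>q\<in>{q\<in>{M<..N}. prime q}. 1 / real q) \<le> ln (ln (real N) / ln (real M)) + C / ln (real M)"
proof -
  obtain C where C: "\<And>N. N > 0 \<Longrightarrow> \<bar>(\<Sum>p\<in>{p\<in>{1..N}. prime p}. ln (real p) / real p) - ln (real N)\<bar> \<le> C"
    using sum_prime_ln_div by blast
  define a where "a = (\<lambda>n. (if prime n then ln (real n) / real n else 0) - (ln (real n) - ln (real (n - 1))))"
  have C0: "C \<ge> 0" using C[of 1] by linarith
  have bound: "(\<Sum>q\<in>{q\<in>{M<..N}. prime q}. 1 / real q) \<le> ln (ln (real N) / ln (real M)) + (2 * C + 1) / ln (real M)"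
    if MN: "2 \<le> M" "M \<le> N" for M N
  proof (cases "M = N")
    case True
    thus ?thesis using MN C0 by (auto intro!: divide_nonneg_nonneg)
  next
    case False
    hence lt: "M < N" using MN by simp
    have lnM: "ln (real M) > 0" using MN by simp
    have A: "\<bar>\<Sum>i\<in>{M<..n}. a i\<bar> \<le> 2 * C" if n: "M < n" for n
    proof -
      have t1: "(\<Sum>i\<in>{M<..n}. ln (real i) - ln (real (i - 1))) = ln (real n) - ln (real M)"
      proof -
        have "Suc M \<le> n" using n by simp
        thus ?thesis
        proof (induction n rule: dec_induct)
          case base
          have "{M<..Suc M} = {Suc M}" by auto
          thus ?case by simp
        next
          case (step n)
          have "{M<..Suc n} = insert (Suc n) {M<..n}" using step by auto
          thus ?case using step by simp
        qed
      qed
      have "(\<Sum>i\<in>{M<..n}. if prime i then ln (real i) / real i else 0) =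
         (\<Sum>p\<in>{p\<in>{1..n}. prime p} - {p\<in>{1..M}. prime p}. ln (real p) / real p)"
        by (intro sum.mono_neutral_cong_right) auto
      also have "\<dots> = (\<Sum>p\<in>{p\<in>{1..n}. prime p}. ln (real p) / real p) - (\<Sum>p\<in>{p\<in>{1..M}. prime p}. ln (real p) / real p)"
        using n by (intro sum_diff) auto
      finally have "(\<Sum>i\<in>{M<..n}. a i) = ((\<Sum>p\<in>{p\<in>{1..n}. prime p}. ln (real p) / real p) - ln (real n)) -
          ((\<Sum>p\<in>{p\<in>{1..M}. prime p}. ln (real p) / real p) - ln (real M))"
        using t1 sum_subtractf[of "\<lambda>i. if prime i then ln (real i) / real i else 0" "\<lambda>i. ln (real i) - ln (real (i - 1))" "{M<..n}"]
        unfolding a_def by linarith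
      thus ?thesis using C[of n] C[of M] MN n by linarith
    qed
    define g where "g = (\<lambda>n. 1 / ln (real n))"
    have "\<bar>\<Sum>i\<in>{M<..N}. g i *\<^sub>R a i\<bar> \<le> 2 * C * g (Suc M)"
      unfolding real_norm_def[symmetric]
      by (intro abel_sum lt) (use A MN in \<open>auto simp: g_def intro!: divide_left_mono mult_pos_pos\<close>)
    also have "\<dots> \<le> 2 * C * (1 / ln (real M))"
      using MN C0 by (intro mult_left_mono) (auto simp: g_def intro!: divide_left_mono mult_pos_pos)
    finally have 1: "\<bar>\<Sum>i\<in>{M<..N}. g i *\<^sub>R a i\<bar> \<le> 2 * C / ln (real M)" by simp
    have 2: "(\<Sum>i\<in>{M<..N}. g i * (ln (real i) - ln (real (i - 1)))) \<le> ln (ln (real N)) - ln (ln (real M))"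
    proof -
      have "Suc M \<le> N" using lt by simp
      \<comment> \<open>The inequality log y \<le> y - 1 at y = log n / log (n+1).\<close>
      have step': "g (Suc n) * (ln (real (Suc n)) - ln (real n)) \<le> ln (ln (real (Suc n))) - ln (ln (real n))"
        if n: "n \<ge> 2" for n
      proof -
        have l: "ln (real n) > 0" "ln (real (Suc n)) > 0" using n by auto
        have "ln (ln (real n) / ln (real (Suc n))) \<le> ln (real n) / ln (real (Suc n)) - 1"
          using l by (intro ln_le_minus_one) auto
        thus ?thesis using l by (simp add: g_def ln_div field_simps)
      qed
      from \<open>Suc M \<le> N\<close> show ?thesis
      proof (induction N rule: dec_induct)
        case base
        have "{M<..Suc M} = {Suc M}" by auto
        thus ?case using step'[of M] MN by simp
      next
        case (step n)
        have "{M<..Suc n} = insert (Suc n) {M<..n}" using step by auto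
        thus ?case using step step'[of n] MN by simp
      qed
    qed
    have "(\<Sum>q\<in>{q\<in>{M<..N}. prime q}. 1 / real q) = (\<Sum>i\<in>{M<..N}. g i * (if prime i then ln (real i) / real i else 0))"
      using MN by (intro sum.mono_neutral_cong_left) (auto simp: g_def)
    also have "\<dots> = (\<Sum>i\<in>{M<..N}. g i *\<^sub>R a i) + (\<Sum>i\<in>{M<..N}. g i * (ln (real i) - ln (real (i - 1))))"
      unfolding sum.distrib[symmetric] by (intro sum.cong) (auto simp: a_def algebra_simps)
    also have "\<dots> \<le> 2 * C / ln (real M) + (ln (ln (real N)) - ln (ln (real M)))"
      using 1 2 by linarith
    also have "\<dots> \<le> (2 * C + 1) / ln (real M) + (ln (ln (real N)) - ln (ln (real M)))"
      using lnM by (intro add_right_mono divide_right_mono) auto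
    also have "ln (ln (real N)) - ln (ln (real M)) = ln (ln (real N) / ln (real M))"
      using MN by (subst ln_div) auto
    finally show ?thesis by simp
  qed
  show ?thesis
    by (rule exI[of _ "2 * C + 1"]) (use bound C0 in auto)
qed

section \<open>Dirichlet characters\<close>

definition dchars :: "nat \<Rightarrow> (nat \<Rightarrow> complex) set" where
  "dchars l = {\<xi>. \<xi> 1 = 1 \<and> (\<forall>a b. \<xi> (a * b) = \<xi> a * \<xi> b) \<and>
     (\<forall>a b. [a = b] (mod l) \<longrightarrow> \<xi> a = \<xi> b) \<and> (\<forall>a. \<xi> a \<noteq> 0 \<longleftrightarrow> coprime a l)}"

definition principal_char :: "nat \<Rightarrow> nat \<Rightarrow> complex" where
  "principal_char l a = (if coprime a l then 1 else 0)"

text \<open>A character of a subgroup of the unit group modulo l, the subgroup being represented by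
  the union \<open>H\<close> of its residue classes. Closure under products makes \<open>H\<close> a
  subgroup because the group is finite.\<close>

definition partial_char :: "nat \<Rightarrow> nat set \<Rightarrow> (nat \<Rightarrow> complex) \<Rightarrow> bool" where
  "partial_char l H f \<longleftrightarrow> 1 \<in> H \<and> f 1 = 1 \<and> (\<forall>a\<in>H. coprime a l) \<and>
     (\<forall>a\<in>H. \<forall>b. [a = b] (mod l) \<longrightarrow> b \<in> H \<and> f b = f a) \<and>
     (\<forall>a\<in>H. \<forall>b\<in>H. a * b \<in> H \<and> f (a * b) = f a * f b)"

lemma partial_charD:
  assumes "partial_char l H f"
  shows "1 \<in> H" "f 1 = 1" "a \<in> H \<Longrightarrow> coprime a l"
    "a \<in> H \<Longrightarrow> [a = b] (mod l) \<Longrightarrow> b \<in> H" "a \<in> H \<Longrightarrow> [a = b] (mod l) \<Longrightarrow> f b = f a"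
    "a \<in> H \<Longrightarrow> b \<in> H \<Longrightarrow> a * b \<in> H" "a \<in> H \<Longrightarrow> b \<in> H \<Longrightarrow> f (a * b) = f a * f b"
  using assms unfolding partial_char_def by blast+

lemma partial_char_power:
  assumes "partial_char l H f" "a \<in> H"
  shows "a ^ k \<in> H \<and> f (a ^ k) = f a ^ k"
proof (induction k)
  case 0
  show ?case using partial_charD(1,2)[OF assms(1)] by simp
next
  case (Suc k)
  thus ?case using partial_charD(6,7)[OF assms(1) assms(2), of "a ^ k"] by simp
qed

lemma partial_char_inverse:
  assumes p: "partial_char l H f" and a: "a \<in> H" and l: "l > 0"
  obtains a' where "a' \<in> H" "[a * a' = 1] (mod l)" "f a * f a' = 1"
proof -
  define t where "t = totient l - 1"
  have "totient l > 0" using l by (simp add: totient_gt_0_iff)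
  hence t: "Suc t = totient l" by (simp add: t_def)
  have "coprime a l" using partial_charD(3)[OF p a] .
  hence c: "[a * a ^ t = 1] (mod l)" using euler_theorem[of a l] t by (metis power_Suc)
  have at: "a ^ t \<in> H" using partial_char_power[OF p a] by simp
  have "f a * f (a ^ t) = f (a * a ^ t)" using partial_charD(7)[OF p a at] by simp
  also have "\<dots> = 1"
  proof -
    have "[1 = a * a ^ t] (mod l)" using c by (rule cong_sym)
    from partial_charD(5)[OF p partial_charD(1)[OF p] this] show ?thesis
      using partial_charD(2)[OF p] by simp
  qed
  finally show ?thesis using that[OF at c] by simp
qed

text \<open>Extension from \<open>H\<close> to the subgroup generated by \<open>H\<close> and b.
  Here r is the order of b modulo \<open>H\<close>, and the value at b may be any r-th root w of
  f(b^r). On h b^k the new value is f(h) w^k; the work is to show that it does not depend on the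
  representation.\<close>

lemma partial_char_extend_step:
  assumes p: "partial_char l H f" and l: "l > 0" and b: "coprime b l"
    and r: "r > 0" "b ^ r \<in> H" "\<And>s. 0 < s \<Longrightarrow> s < r \<Longrightarrow> b ^ s \<notin> H" and w: "w ^ r = f (b ^ r)"
  shows "\<exists>H' f'. partial_char l H' f' \<and> H \<subseteq> H' \<and> b \<in> H' \<and> (\<forall>a\<in>H. f' a = f a) \<and> f' b = w"
proof -
  have Hcong: "a \<in> H \<Longrightarrow> [a = c] (mod l) \<Longrightarrow> c \<in> H \<and> f c = f a" for a c
    using partial_charD(4,5)[OF p] by blast
  have Hmult: "a \<in> H \<Longrightarrow> c \<in> H \<Longrightarrow> a * c \<in> H \<and> f (a * c) = f a * f c" for a c
    using partial_charD(6,7)[OF p] by blast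
  have H1: "1 \<in> H" "f 1 = 1" using partial_charD(1,2)[OF p] by simp_all
  have Hcop: "a \<in> H \<Longrightarrow> coprime a l" for a using partial_charD(3)[OF p] .
  have bk: "coprime (b ^ k) l" for k using b by simp
  \<comment> \<open>Division of m by r with remainder s: multiplying by an inverse of (b^r)^q shows
    that b^s lies in \<open>H\<close>, so s = 0 by the minimality of r.\<close>
  have bH: "r dvd m \<and> f (b ^ m) = w ^ m" if m: "b ^ m \<in> H" for m
  proof -
    define q s where "q = m div r" and "s = m mod r"
    have ms: "m = r * q + s" by (simp add: q_def s_def)
    have bq: "(b ^ r) ^ q \<in> H" "f ((b ^ r) ^ q) = f (b ^ r) ^ q" using partial_char_power[OF p r(2)] by auto
    obtain g where g: "g \<in> H" "[(b ^ r) ^ q * g = 1] (mod l)" "f ((b ^ r) ^ q) * f g = 1"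
      using partial_char_inverse[OF p bq(1) l] by blast
    have "[((b ^ r) ^ q * g) * b ^ s = 1 * b ^ s] (mod l)" using g(2) by (rule cong_scalar_right)
    moreover have "((b ^ r) ^ q * g) * b ^ s = g * b ^ m" unfolding ms power_add power_mult by (simp only: mult_ac)
    ultimately have "[g * b ^ m = b ^ s] (mod l)" by simp
    moreover have "g * b ^ m \<in> H" using Hmult g(1) m by blast
    ultimately have "b ^ s \<in> H" using Hcong by blast
    moreover have "s < r" using r(1) by (simp add: s_def)
    ultimately have "s = 0" using r(3) by blast
    hence "m = r * q" using ms by simp
    thus ?thesis using bq(2) w by (simp add: power_mult)
  qed
  have uniq_le: "f h * w ^ k = f h' * w ^ k'"
    if h: "h \<in> H" "h' \<in> H" "[h * b ^ k = h' * b ^ k'] (mod l)" "k \<le> k'" for h h' k k'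
  proof -
    define m where "m = k' - k"
    have k': "k' = m + k" using h(4) by (simp add: m_def)
    have "[h * b ^ k = (h' * b ^ m) * b ^ k] (mod l)" using h(3) by (simp add: k' power_add mult_ac)
    hence c: "[h = h' * b ^ m] (mod l)" using bk cong_mult_rcancel_nat by blast
    obtain g where g: "g \<in> H" "[h' * g = 1] (mod l)" "f h' * f g = 1"
      using partial_char_inverse[OF p h(2) l] by blast
    have "[g * h = g * (h' * b ^ m)] (mod l)" using c by (rule cong_scalar_left)
    also have "g * (h' * b ^ m) = (h' * g) * b ^ m" by simp
    also have "[(h' * g) * b ^ m = 1 * b ^ m] (mod l)" using g(2) by (rule cong_scalar_right)
    finally have "[g * h = b ^ m] (mod l)" by simp
    hence bm: "b ^ m \<in> H" "f (b ^ m) = f g * f h" using Hcong Hmult g(1) h(1) by metis+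
    have "f h' * w ^ k' = (f h' * w ^ m) * w ^ k" by (simp add: k' power_add)
    also have "f h' * w ^ m = (f h' * f g) * f h" using bH[OF bm(1)] bm(2) by simp
    finally show ?thesis using g(3) by simp
  qed
  have uniq: "f h * w ^ k = f h' * w ^ k'"
    if "h \<in> H" "h' \<in> H" "[h * b ^ k = h' * b ^ k'] (mod l)" for h h' k k'
    using uniq_le[of h h' k k'] uniq_le[of h' h k' k] that by (metis cong_sym linear)
  \<comment> \<open>The exponent k is left unbounded, so products of representations are
    representations without reduction modulo r; uniqueness of the value has just been proved for all
    k.\<close>
  define rep where "rep = (\<lambda>a h k. h \<in> H \<and> [a = h * b ^ k] (mod l))"
  define H' where "H' = {a. \<exists>h k. rep a h k}"
  define f' where "f' = (\<lambda>a. SOME z. \<exists>h k. rep a h k \<and> z = f h * w ^ k)"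
  have f'_eq: "f' a = f h * w ^ k" if "rep a h k" for a h k
  proof -
    have "\<exists>h k. rep a h k \<and> f' a = f h * w ^ k"
      unfolding f'_def by (rule someI_ex) (use that in blast)
    then obtain h' k' where "rep a h' k'" "f' a = f h' * w ^ k'" by blast
    moreover from this that have "[h' * b ^ k' = h * b ^ k] (mod l)"
      unfolding rep_def by (metis cong_sym cong_trans)
    ultimately show ?thesis using uniq that unfolding rep_def by metis
  qed
  have repH: "rep a a 0" if "a \<in> H" for a using that by (simp add: rep_def)
  have repb: "rep b 1 1" using H1 by (simp add: rep_def)
  have repcong: "rep c h k" if "rep a h k" "[a = c] (mod l)" for a c h k
    using that unfolding rep_def by (metis cong_sym cong_trans)
  have repmult: "rep (a * c) (h * h') (k + k')" if "rep a h k" "rep c h' k'" for a c h h' k k'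
  proof -
    have "[a * c = (h * b ^ k) * (h' * b ^ k')] (mod l)" using that unfolding rep_def by (intro cong_mult) auto
    moreover have "(h * b ^ k) * (h' * b ^ k') = (h * h') * b ^ (k + k')" by (simp add: power_add mult_ac)
    ultimately show ?thesis using that Hmult unfolding rep_def by simp
  qed
  have "partial_char l H' f'" unfolding partial_char_def
  proof (intro conjI ballI allI impI)
    show "1 \<in> H'" using repH[OF H1(1)] by (auto simp: H'_def)
    show "f' 1 = 1" using f'_eq[OF repH[OF H1(1)]] H1 by simp
  next
    fix a assume "a \<in> H'"
    then obtain h k where "h \<in> H" "[a = h * b ^ k] (mod l)" by (auto simp: H'_def rep_def)
    moreover have "coprime (h * b ^ k) l" using Hcop[OF \<open>h \<in> H\<close>] bk by simp
    ultimately show "coprime a l" by (metis cong_imp_coprime cong_sym)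
  next
    fix a c assume a: "a \<in> H'" "[a = c] (mod l)"
    then obtain h k where "rep a h k" by (auto simp: H'_def)
    with repcong[OF this a(2)] show "c \<in> H'" "f' c = f' a" by (auto simp: H'_def f'_eq)
  next
    fix a c assume "a \<in> H'" "c \<in> H'"
    then obtain h k h' k' where "rep a h k" "rep c h' k'" by (auto simp: H'_def)
    moreover from repmult[OF this] have "rep (a * c) (h * h') (k + k')" .
    moreover have "h \<in> H" "h' \<in> H" using calculation by (auto simp: rep_def)
    ultimately show "a * c \<in> H'" "f' (a * c) = f' a * f' c"
      using Hmult by (auto simp: H'_def f'_eq power_add)
  qed
  moreover have "H \<subseteq> H'" using repH by (auto simp: H'_def)
  moreover have "b \<in> H'" using repb by (auto simp: H'_def)
  moreover have "\<forall>a\<in>H. f' a = f a" using f'_eq[OF repH] by simp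
  moreover have "f' b = w" using f'_eq[OF repb] H1 by simp
  ultimately show ?thesis by blast
qed

lemma least_power_in:
  assumes p: "partial_char l H f" and l: "l > 0" and b: "coprime b l"
  obtains r where "r > 0" "b ^ r \<in> H" "\<And>s. 0 < s \<Longrightarrow> s < r \<Longrightarrow> b ^ s \<notin> H"
proof -
  define r where "r = (LEAST r. r > 0 \<and> b ^ r \<in> H)"
  have "totient l > 0" using l by (simp add: totient_gt_0_iff)
  moreover have "[1 = b ^ totient l] (mod l)" using euler_theorem[OF b] by (rule cong_sym)
  hence "b ^ totient l \<in> H" using partial_charD(1,4)[OF p] by blast
  ultimately have ex: "totient l > 0 \<and> b ^ totient l \<in> H" by simp
  hence "r > 0 \<and> b ^ r \<in> H" unfolding r_def by (rule LeastI)
  moreover have "b ^ s \<notin> H" if "0 < s" "s < r" for s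
    using not_less_Least[of s "\<lambda>r. r > 0 \<and> b ^ r \<in> H"] that by (auto simp: r_def)
  ultimately show ?thesis using that by blast
qed

text \<open>Induction on the number of unit residues outside \<open>H\<close>. A nonzero complex
  value always has an r-th root, so every single extension is possible; on non-units the character
  is set to 0.\<close>

lemma partial_char_extend:
  assumes "partial_char l H f" and l: "l > 0"
  shows "\<exists>\<xi>\<in>dchars l. \<forall>a\<in>H. \<xi> a = f a"
  using assms(1)
proof (induction "card {a. a < l \<and> coprime a l \<and> a \<notin> H}" arbitrary: H f rule: less_induct)
  case less
  note p = less.prems
  show ?case
  proof (cases "\<exists>b<l. coprime b l \<and> b \<notin> H")
    case False
    have H: "a \<in> H \<longleftrightarrow> coprime a l" for a
    proof
      assume a: "coprime a l"
      hence "coprime (a mod l) l" using l by simp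
      hence "a mod l \<in> H" using False l by auto
      moreover have "[a mod l = a] (mod l)" by simp
      ultimately show "a \<in> H" using partial_charD(4)[OF p] by blast
    qed (rule partial_charD(3)[OF p])
    have nz: "f a \<noteq> 0" if "a \<in> H" for a
      using partial_char_inverse[OF p that l] by (metis mult_zero_left zero_neq_one)
    define \<xi> where "\<xi> = (\<lambda>a. if coprime a l then f a else 0)"
    have "\<xi> \<in> dchars l" unfolding dchars_def mem_Collect_eq
    proof (intro conjI allI impI)
      show "\<xi> 1 = 1" using partial_charD(2)[OF p] by (simp add: \<xi>_def)
      show "\<xi> (a * b) = \<xi> a * \<xi> b" for a b
        using partial_charD(7)[OF p] by (simp add: \<xi>_def H)
      show "\<xi> a = \<xi> b" if "[a = b] (mod l)" for a b
      proof -
        have "coprime a l \<longleftrightarrow> coprime b l" using that by (metis cong_imp_coprime cong_sym)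
        thus ?thesis using partial_charD(5)[OF p _ that] by (simp add: \<xi>_def H)
      qed
      show "(\<xi> a \<noteq> 0) = coprime a l" for a using nz H by (auto simp: \<xi>_def)
    qed
    thus ?thesis using H by (intro bexI[of _ \<xi>]) (auto simp: \<xi>_def)
  next
    case True
    then obtain b where b: "b < l" "coprime b l" "b \<notin> H" by blast
    obtain r where r: "r > 0" "b ^ r \<in> H" "\<And>s. 0 < s \<Longrightarrow> s < r \<Longrightarrow> b ^ s \<notin> H"
      using least_power_in[OF p l b(2)] by metis
    have nz: "f (b ^ r) \<noteq> 0" using partial_char_inverse[OF p r(2) l] by (metis mult_zero_left zero_neq_one)
    define w where "w = exp (Ln (f (b ^ r)) / of_nat r)"
    have "w ^ r = f (b ^ r)" using nz r(1) by (simp add: w_def exp_of_nat_mult[symmetric])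
    from partial_char_extend_step[OF p l b(2) r this]
    obtain H' f' where H': "partial_char l H' f'" "H \<subseteq> H'" "b \<in> H'" "\<forall>a\<in>H. f' a = f a" by blast
    have "{a. a < l \<and> coprime a l \<and> a \<notin> H'} \<subset> {a. a < l \<and> coprime a l \<and> a \<notin> H}"
      using H' b by auto
    hence "card {a. a < l \<and> coprime a l \<and> a \<notin> H'} < card {a. a < l \<and> coprime a l \<and> a \<notin> H}"
      by (intro psubset_card_mono) auto
    from less.hyps[OF this H'(1)] show ?thesis using H' by (metis subsetD)
  qed
qed

lemma partial_char_one:
  "partial_char l {a. [a = 1] (mod l)} (\<lambda>_. 1)"
  unfolding partial_char_def
proof (intro conjI ballI allI impI)
  fix a assume "a \<in> {a. [a = 1] (mod l)}"
  thus "coprime a l" by (metis coprime_1_left cong_imp_coprime cong_sym mem_Collect_eq)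
next
  fix a b assume "a \<in> {a. [a = 1] (mod l)}" "b \<in> {a. [a = 1] (mod l)}"
  thus "a * b \<in> {a. [a = 1] (mod l)}" using cong_mult[of a 1 l b 1] by simp
qed (auto intro: cong_trans cong_sym)

text \<open>Start from the trivial character on the class of 1. The order r of a modulo that class
  exceeds 1, so w = exp (2 pi i / r) is an admissible value at a and differs from 1.\<close>

lemma dchars_separate:
  assumes l: "l > 0" and a: "coprime a l" "\<not> [a = 1] (mod l)"
  shows "\<exists>\<xi>\<in>dchars l. \<xi> a \<noteq> 1"
proof -
  let ?H = "{a. [a = 1] (mod l)}"
  obtain r where r: "r > 0" "a ^ r \<in> ?H" "\<And>s. 0 < s \<Longrightarrow> s < r \<Longrightarrow> a ^ s \<notin> ?H"
    using least_power_in[OF partial_char_one l a(1)] by metis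
  have r1: "r > 1"
  proof (rule ccontr)
    assume "\<not> r > 1"
    hence "r = 1" using r(1) by simp
    thus False using r(2) a(2) by simp
  qed
  define w where "w = cis (2 * pi / real r)"
  have wr: "w ^ r = 1"
  proof -
    have "w ^ r = cis (real r * (2 * pi / real r))" unfolding w_def by (rule Complex.DeMoivre)
    also have "real r * (2 * pi / real r) = 2 * pi" using r1 by simp
    finally show ?thesis by simp
  qed
  have w1: "w \<noteq> 1"
  proof
    assume "w = 1"
    hence "cos (2 * pi / real r) = 1" by (simp add: w_def complex_eq_iff)
    then obtain n :: int where "2 * pi / real r = of_int n * 2 * pi" using cos_one_2pi_int by blast
    hence "1 = of_int n * real r" using r1 by (simp add: field_simps)
    hence "1 = n * int r" by (metis of_int_1 of_int_eq_iff of_int_mult of_int_of_nat_eq)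
    hence "int r dvd 1" by (metis dvd_triv_right)
    thus False using r1 by simp
  qed
  obtain H' f' where H': "partial_char l H' f'" "a \<in> H'" "f' a = w"
    using partial_char_extend_step[OF partial_char_one l a(1) r, of w] wr by auto
  obtain \<xi> where "\<xi> \<in> dchars l" "\<forall>x\<in>H'. \<xi> x = f' x" using partial_char_extend[OF H'(1) l] by blast
  thus ?thesis using H' w1 by (intro bexI[of _ \<xi>]) auto
qed

section \<open>Orthogonality relations and character sums\<close>

lemma dchars_1: "\<xi> \<in> dchars l \<Longrightarrow> \<xi> 1 = 1"
  and dchars_mult: "\<xi> \<in> dchars l \<Longrightarrow> \<xi> (a * b) = \<xi> a * \<xi> b"
  and dchars_cong: "\<xi> \<in> dchars l \<Longrightarrow> [a = b] (mod l) \<Longrightarrow> \<xi> a = \<xi> b"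
  and dchars_nz: "\<xi> \<in> dchars l \<Longrightarrow> \<xi> a \<noteq> 0 \<longleftrightarrow> coprime a l"
  by (auto simp: dchars_def)

lemma dchars_power: "\<xi> \<in> dchars l \<Longrightarrow> \<xi> (a ^ k) = \<xi> a ^ k"
  by (induction k) (simp_all add: dchars_1[simplified] dchars_mult)

lemma dchars_root:
  assumes "\<xi> \<in> dchars l" "coprime a l"
  shows "\<xi> a ^ totient l = 1"
  using dchars_cong[OF assms(1) euler_theorem[OF assms(2)]] dchars_power[OF assms(1)] dchars_1[OF assms(1)] by simp

lemma norm_dchars_le:
  assumes "\<xi> \<in> dchars l" "l > 0"
  shows "norm (\<xi> a) \<le> 1"
proof (cases "coprime a l")
  case True
  have "norm (\<xi> a) ^ totient l = 1" using dchars_root[OF assms(1) True] by (metis norm_one norm_power)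
  thus ?thesis using assms(2) power_le_one_iff[of "norm (\<xi> a)" "totient l"] by (simp add: totient_gt_0_iff)
next
  case False
  thus ?thesis using dchars_nz[OF assms(1), of a] by simp
qed

lemma finite_dchars:
  assumes l: "l > 0"
  shows "finite (dchars l)"
proof (rule finite_subset)
  let ?V = "insert 0 {z::complex. z ^ totient l = 1}"
  have "finite ?V" using l by (intro finite.insertI finite_roots_unity) (simp add: Suc_le_eq totient_gt_0_iff)
  thus "finite ((\<lambda>f a. f (a mod l)) ` (PiE {..<l} (\<lambda>_. ?V)))" by (intro finite_imageI finite_PiE) auto
  show "dchars l \<subseteq> (\<lambda>f a. f (a mod l)) ` (PiE {..<l} (\<lambda>_. ?V))"
  proof
    fix \<xi> assume c: "\<xi> \<in> dchars l"
    have "\<xi> = (\<lambda>a. restrict \<xi> {..<l} (a mod l))"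
    proof
      fix a
      have "\<xi> a = \<xi> (a mod l)" using c by (intro dchars_cong) auto
      thus "\<xi> a = restrict \<xi> {..<l} (a mod l)" using l by simp
    qed
    moreover have "restrict \<xi> {..<l} \<in> PiE {..<l} (\<lambda>_. ?V)"
      using dchars_root[OF c] dchars_nz[OF c] by auto
    ultimately show "\<xi> \<in> (\<lambda>f a. f (a mod l)) ` (PiE {..<l} (\<lambda>_. ?V))" by blast
  qed
qed

lemma principal_char_in: "l > 0 \<Longrightarrow> principal_char l \<in> dchars l"
proof -
  assume "l > 0"
  have "coprime a l \<longleftrightarrow> coprime b l" if "[a = b] (mod l)" for a b
    using that by (metis cong_imp_coprime cong_sym)
  thus ?thesis by (auto simp: dchars_def principal_char_def)
qed

lemma dchars_times:
  assumes "\<xi> \<in> dchars l" "\<psi> \<in> dchars l"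
  shows "(\<lambda>a. \<xi> a * \<psi> a) \<in> dchars l"
proof -
  have "\<xi> a * \<psi> a = \<xi> b * \<psi> b" if "[a = b] (mod l)" for a b
    using dchars_cong[OF assms(1) that] dchars_cong[OF assms(2) that] by simp
  moreover have "\<xi> a * \<psi> a \<noteq> 0 \<longleftrightarrow> coprime a l" for a
    using dchars_nz[OF assms(1), of a] dchars_nz[OF assms(2), of a] by simp
  moreover have "\<xi> (a * b) * \<psi> (a * b) = (\<xi> a * \<psi> a) * (\<xi> b * \<psi> b)" for a b
    by (simp add: dchars_mult[OF assms(1)] dchars_mult[OF assms(2)])
  moreover have "\<xi> 1 * \<psi> 1 = 1" using dchars_1[OF assms(1)] dchars_1[OF assms(2)] by simp
  ultimately show ?thesis unfolding dchars_def by blast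
qed

text \<open>Multiplication by a character whose value at a is not 1 permutes the characters, so the
  sum is unchanged when multiplied by that value.\<close>

lemma sum_dchars_eq_0:
  assumes l: "l > 0" and a: "coprime a l" "\<not> [a = 1] (mod l)"
  shows "(\<Sum>\<xi>\<in>dchars l. \<xi> a) = 0"
proof -
  obtain \<psi> where psi: "\<psi> \<in> dchars l" "\<psi> a \<noteq> 1" using dchars_separate[OF assms] by blast
  let ?m = "\<lambda>\<xi> a. \<psi> a * \<xi> a"
  have inj: "inj_on ?m (dchars l)"
  proof (rule inj_onI)
    fix \<xi> \<xi>' assume c: "\<xi> \<in> dchars l" "\<xi>' \<in> dchars l" "?m \<xi> = ?m \<xi>'"
    show "\<xi> = \<xi>'"
    proof
      fix n show "\<xi> n = \<xi>' n"
      proof (cases "coprime n l")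
        case True
        thus ?thesis using fun_cong[OF c(3), of n] dchars_nz[OF psi(1), of n] by simp
      qed (use dchars_nz c in metis)
    qed
  qed
  have "?m ` dchars l = dchars l"
    by (rule endo_inj_surj[OF finite_dchars[OF l] _ inj]) (use dchars_times psi in auto)
  hence "(\<Sum>\<xi>\<in>dchars l. \<xi> a) = (\<Sum>\<xi>\<in>?m ` dchars l. \<xi> a)" by simp
  also have "\<dots> = (\<Sum>\<xi>\<in>dchars l. \<psi> a * \<xi> a)" by (subst sum.reindex[OF inj]) simp
  also have "\<dots> = \<psi> a * (\<Sum>\<xi>\<in>dchars l. \<xi> a)" by (simp add: sum_distrib_left)
  finally show ?thesis using psi(2) by (simp add: algebra_simps)
qed

text \<open>Orthogonality with an inverse j' of j in place of complex conjugates: xi(j') xi(n) =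
  xi(j' n), and j' n is congruent to 1 exactly when n is congruent to j.\<close>

lemma sum_dchars_indicator:
  assumes l: "l > 0" and j: "[j' * j = 1] (mod l)"
  shows "(\<Sum>\<xi>\<in>dchars l. \<xi> j' * \<xi> n) = (if [n = j] (mod l) then of_nat (card (dchars l)) else 0)"
proof -
  have cj: "coprime j' l" using j by (metis coprime_1_left cong_imp_coprime cong_sym coprime_mult_left_iff)
  have eq: "(\<Sum>\<xi>\<in>dchars l. \<xi> j' * \<xi> n) = (\<Sum>\<xi>\<in>dchars l. \<xi> (j' * n))"
    by (intro sum.cong) (auto simp: dchars_mult)
  have iff: "[j' * n = 1] (mod l) \<longleftrightarrow> [n = j] (mod l)"
  proof
    assume "[j' * n = 1] (mod l)"
    hence "[j' * n = j' * j] (mod l)" using j by (metis cong_sym cong_trans)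
    thus "[n = j] (mod l)" using cj by (simp add: cong_mult_lcancel_nat)
  next
    assume "[n = j] (mod l)"
    hence "[j' * n = j' * j] (mod l)" by (rule cong_scalar_left)
    thus "[j' * n = 1] (mod l)" using j by (rule cong_trans)
  qed
  show ?thesis
  proof (cases "[n = j] (mod l)")
    case True
    hence "\<xi> (j' * n) = 1" if "\<xi> \<in> dchars l" for \<xi>
      using dchars_cong[OF that, of "j' * n" 1] dchars_1[OF that] iff by simp
    hence "(\<Sum>\<xi>\<in>dchars l. \<xi> (j' * n)) = (\<Sum>\<xi>\<in>dchars l. 1)" by (intro sum.cong refl)
    thus ?thesis using True unfolding eq by simp
  next
    case False
    show ?thesis
    proof (cases "coprime (j' * n) l")
      case True
      thus ?thesis using False iff sum_dchars_eq_0[OF l True] unfolding eq by simp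
    next
      case nc: False
      hence "\<xi> (j' * n) = 0" if "\<xi> \<in> dchars l" for \<xi> using dchars_nz[OF that] by blast
      hence "(\<Sum>\<xi>\<in>dchars l. \<xi> (j' * n)) = (\<Sum>\<xi>\<in>dchars l. 0)" by (intro sum.cong refl)
      thus ?thesis using False unfolding eq by simp
    qed
  qed
qed

lemma sum_period_eq_0:
  assumes c: "\<xi> \<in> dchars l" "\<xi> \<noteq> principal_char l" and l: "l > 0"
  shows "(\<Sum>a<l. \<xi> a) = 0"
proof -
  obtain b where b: "\<xi> b \<noteq> principal_char l b" using c(2) by blast
  hence cb: "coprime b l" "\<xi> b \<noteq> 1" using dchars_nz[OF c(1), of b] by (auto simp: principal_char_def split: if_splits)
  let ?m = "\<lambda>a. a * b mod l"
  have inj: "inj_on ?m {..<l}"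
  proof (rule inj_onI)
    fix x y assume "x \<in> {..<l}" "y \<in> {..<l}" "x * b mod l = y * b mod l"
    moreover from this have "[x * b = y * b] (mod l)" by (simp add: cong_def)
    hence "[x = y] (mod l)" using cb cong_mult_rcancel_nat by blast
    ultimately show "x = y" by (simp add: cong_def)
  qed
  have "?m ` {..<l} = {..<l}" by (rule endo_inj_surj[OF _ _ inj]) (use l in auto)
  hence "(\<Sum>a<l. \<xi> a) = (\<Sum>a\<in>?m ` {..<l}. \<xi> a)" by simp
  also have "\<dots> = (\<Sum>a<l. \<xi> (a * b mod l))" by (subst sum.reindex[OF inj]) simp
  also have "\<dots> = (\<Sum>a<l. \<xi> a * \<xi> b)"
  proof (intro sum.cong refl)
    fix a
    have "\<xi> (a * b mod l) = \<xi> (a * b)" using c(1) by (intro dchars_cong) auto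
    thus "\<xi> (a * b mod l) = \<xi> a * \<xi> b" using dchars_mult[OF c(1)] by simp
  qed
  also have "\<dots> = (\<Sum>a<l. \<xi> a) * \<xi> b" by (simp add: sum_distrib_right)
  finally show ?thesis using cb(2) by (simp add: algebra_simps)
qed

text \<open>Full periods cancel, leaving fewer than l terms of norm at most 1; a sum over an
  interval is a difference of two initial sums.\<close>

lemma norm_sum_dchars_le:
  assumes c: "\<xi> \<in> dchars l" "\<xi> \<noteq> principal_char l" and l: "l > 0"
  shows "norm (\<Sum>n<N. \<xi> n) \<le> real l" "norm (\<Sum>n\<in>{M<..N'}. \<xi> n) \<le> 2 * real l"
proof -
  have main: "norm (\<Sum>n<N. \<xi> n) \<le> real l" for N
  proof -
    have block: "(\<Sum>n=m*l..<m*l+l. \<xi> n) = 0" for m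
    proof -
      have "(\<Sum>n=m*l..<m*l+l. \<xi> n) = (\<Sum>a<l. \<xi> (a + m * l))"
        by (intro sum.reindex_bij_witness[of _ "\<lambda>a. a + m * l" "\<lambda>n. n - m * l"]) auto
      also have "\<dots> = (\<Sum>a<l. \<xi> a)" using c(1) by (intro sum.cong refl dchars_cong) (auto simp: cong_def)
      finally show ?thesis using sum_period_eq_0[OF c l] by simp
    qed
    have "(\<Sum>n<N. \<xi> n) = (\<Sum>n\<in>{..<N div l * l} \<union> {N div l * l..<N}. \<xi> n)"
      by (intro sum.cong) (auto intro: less_le_trans[OF _ div_times_less_eq_dividend])
    also have "\<dots> = (\<Sum>n<N div l * l. \<xi> n) + (\<Sum>n=N div l * l..<N. \<xi> n)"
      by (intro sum.union_disjoint) auto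
    also have "(\<Sum>n<N div l * l. \<xi> n) = 0"
      unfolding sum.nat_group[symmetric] by (simp add: block)
    finally have "norm (\<Sum>n<N. \<xi> n) \<le> (\<Sum>n=N div l * l..<N. norm (\<xi> n))" by (simp add: norm_sum)
    also have "\<dots> \<le> (\<Sum>n=N div l * l..<N. 1)" by (intro sum_mono norm_dchars_le[OF c(1) l])
    also have "\<dots> = real (N - N div l * l)" by simp
    also have "N - N div l * l = N mod l" by (simp add: minus_div_mult_eq_mod)
    also have "real (N mod l) \<le> real l" using l by (simp add: less_imp_le)
    finally show ?thesis .
  qed
  thus "norm (\<Sum>n<N. \<xi> n) \<le> real l" .
  show "norm (\<Sum>n\<in>{M<..N'}. \<xi> n) \<le> 2 * real l"
  proof (cases "M \<le> N'")
    case True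
    have "{M<..N'} = {..<Suc N'} - {..<Suc M}" by auto
    hence "(\<Sum>n\<in>{M<..N'}. \<xi> n) = (\<Sum>n<Suc N'. \<xi> n) - (\<Sum>n<Suc M. \<xi> n)"
      using True by (simp only:) (rule sum_diff; auto)
    thus ?thesis using main[of "Suc N'"] main[of "Suc M"] norm_triangle_ineq4 order_trans
      by (smt (verit, best))
  qed auto
qed

text \<open>Abel summation bounds every segment by 2l divided by its first index, which gives
  convergence and the explicit tail at once.\<close>

lemma dchar_series:
  assumes c: "\<xi> \<in> dchars l" "\<xi> \<noteq> principal_char l" and l: "l > 0"
  obtains L where "\<And>M. norm (L - (\<Sum>n=1..M. \<xi> n / of_nat n)) \<le> 2 * real l / real (Suc M)"
proof -
  let ?S = "\<lambda>M. \<Sum>n=1..M. \<xi> n / of_nat n"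
  have diff: "norm (?S N - ?S M) \<le> 2 * real l / real (Suc M)" if "M \<le> N" for M N
  proof (cases "M = N")
    case False
    hence MN: "M < N" using that by simp
    have "?S N - ?S M = (\<Sum>n\<in>{M<..N}. \<xi> n / of_nat n)"
    proof -
      have "{M<..N} = {1..N} - {1..M}" by auto
      thus ?thesis using that by (simp only:) (subst sum_diff; auto)
    qed
    also have "\<dots> = (\<Sum>n\<in>{M<..N}. (1 / real n) *\<^sub>R \<xi> n)"
      by (intro sum.cong) (auto simp: scaleR_conv_of_real field_simps)
    also have "norm \<dots> \<le> 2 * real l * (1 / real (Suc M))"
      by (intro abel_sum MN norm_sum_dchars_le[OF c l]) (auto intro!: divide_left_mono)
    finally show ?thesis by simp
  qed auto
  have "(\<lambda>M. 2 * real l / real (Suc M)) \<longlonglongrightarrow> 0" by real_asymp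
  have "Cauchy ?S"
  proof (rule CauchyI)
    fix e :: real assume e: "e > 0"
    have "(\<lambda>M. 2 * real l / real (Suc M)) \<longlonglongrightarrow> 0" by real_asymp
    hence "\<forall>\<^sub>F M in sequentially. 2 * real l / real (Suc M) < e" using e by (rule order_tendstoD)
    then obtain K where K: "\<And>M. M \<ge> K \<Longrightarrow> 2 * real l / real (Suc M) < e" by (auto simp: eventually_at_top_linorder)
    show "\<exists>M. \<forall>m\<ge>M. \<forall>n\<ge>M. norm (?S m - ?S n) < e"
    proof (intro exI[of _ K] allI impI)
      fix m n assume mn: "m \<ge> K" "n \<ge> K"
      show "norm (?S m - ?S n) < e"
      proof (cases "n \<le> m")
        case True
        thus ?thesis using diff[of n m] K[of n] mn by linarith
      next
        case False
        thus ?thesis using diff[of m n] K[of m] mn unfolding norm_minus_commute[of "?S m"] by linarith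
      qed
    qed
  qed
  then obtain L where L: "?S \<longlonglongrightarrow> L" using Cauchy_convergent convergent_def by blast
  have "norm (L - ?S M) \<le> 2 * real l / real (Suc M)" for M
  proof (rule tendsto_upperbound[of "\<lambda>N. norm (?S N - ?S M)" _ sequentially])
    show "(\<lambda>N. norm (?S N - ?S M)) \<longlonglongrightarrow> norm (L - ?S M)" by (intro tendsto_intros L)
    show "\<forall>\<^sub>F N in sequentially. norm (?S N - ?S M) \<le> 2 * real l / real (Suc M)"
      using diff by (auto simp: eventually_at_top_linorder)
  qed auto
  thus ?thesis by (rule that)
qed

section \<open>Nonvanishing of the L-values at 1\<close>

text \<open>The value L(1, xi) of a non-principal character, selected by the tail estimate that the
  later arguments use; this estimate determines it uniquely.\<close>

definition L_one :: "nat \<Rightarrow> (nat \<Rightarrow> complex) \<Rightarrow> complex" where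
  "L_one l \<xi> = (SOME L. \<forall>M. norm (L - (\<Sum>n=1..M. \<xi> n / of_nat n)) \<le> 2 * real l / real (Suc M))"

lemma L_one_bound:
  assumes c: "\<xi> \<in> dchars l" "\<xi> \<noteq> principal_char l" and l: "l > 0"
  shows "norm (L_one l \<xi> - (\<Sum>n=1..M. \<xi> n / of_nat n)) \<le> 2 * real l / real (Suc M)"
proof -
  have "\<exists>L. \<forall>M. norm (L - (\<Sum>n=1..M. \<xi> n / of_nat n)) \<le> 2 * real l / real (Suc M)"
    using dchar_series[OF c l] by metis
  from someI_ex[OF this] show ?thesis unfolding L_one_def by blast
qed

definition Smang :: "(nat \<Rightarrow> complex) \<Rightarrow> nat \<Rightarrow> complex" where
  "Smang \<xi> N = (\<Sum>d=1..N. \<xi> d * of_real (mang d / real d))"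

lemma ln_div_antimono:
  assumes "n \<ge> 3"
  shows "ln (real (Suc n)) / real (Suc n) \<le> ln (real n) / real n"
proof -
  have n: "real n > 0" using assms by simp
  have "ln (real n) \<ge> 1"
  proof -
    have "exp 1 \<le> real n" using exp_le assms by linarith
    thus ?thesis using n by (simp add: ln_ge_iff)
  qed
  have "real (Suc n) = real n * (1 + 1 / real n)" using n by (simp add: field_simps)
  hence "ln (real (Suc n)) = ln (real n) + ln (1 + 1 / real n)"
    using n by (simp only:) (subst ln_mult; auto simp: add_pos_pos)
  also have "\<dots> \<le> ln (real n) + 1 / real n" using n by (intro add_left_mono ln_add_one_self_le_self) auto
  finally have "real n * ln (real (Suc n)) \<le> real n * (ln (real n) + 1 / real n)"
    using n by (intro mult_left_mono) auto
  also have "\<dots> = real n * ln (real n) + 1" using n by (simp add: field_simps)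
  also have "\<dots> \<le> real n * ln (real n) + ln (real n)" using \<open>ln (real n) \<ge> 1\<close> by simp
  finally show ?thesis using n by (simp add: field_simps)
qed

text \<open>Twist log = Lambda * 1 by xi: the sum of xi(n) log n / n becomes the sum over d of xi(d)
  Lambda(d)/d times the partial sum of L(1, xi) up to N/d. Replacing the latter by its limit costs
  at most 2l psi(N)/N, and the left side is bounded by Abel summation. Then divide by L(1,
  xi).\<close>

lemma Smang_bounded:
  assumes c: "\<xi> \<in> dchars l" "\<xi> \<noteq> principal_char l" and l: "l > 0" and L: "L_one l \<xi> \<noteq> 0"
  shows "\<exists>C. \<forall>N. norm (Smang \<xi> N) \<le> C"
proof -
  let ?T = "\<lambda>N. \<Sum>n=1..N. \<xi> n * of_real (ln (real n) / real n)"
  \<comment> \<open>log n / n decreases only from n = 3 on, so the first three terms are kept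
    apart.\<close>
  define C1 where "C1 = (\<Sum>n=1..3. norm (\<xi> n * of_real (ln (real n) / real n)))"
  have T: "norm (?T N) \<le> C1 + 2 * real l * (ln 4 / 4)" for N
  proof (cases "N \<le> 3")
    case True
    have "norm (?T N) \<le> (\<Sum>n=1..N. norm (\<xi> n * of_real (ln (real n) / real n)))" by (rule norm_sum)
    also have "\<dots> \<le> C1" unfolding C1_def using True by (intro sum_mono2) auto
    finally show ?thesis by (simp add: add_increasing2)
  next
    case False
    have "{1..N} = {1..3} \<union> {3<..N}" using False by auto
    hence "?T N = ?T 3 + (\<Sum>n\<in>{3<..N}. \<xi> n * of_real (ln (real n) / real n))"
      by (simp only:) (rule sum.union_disjoint; auto)
    also have "(\<Sum>n\<in>{3<..N}. \<xi> n * of_real (ln (real n) / real n)) = (\<Sum>n\<in>{3<..N}. (ln (real n) / real n) *\<^sub>R \<xi> n)"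
      by (simp add: scaleR_conv_of_real mult.commute)
    finally have "norm (?T N) \<le> norm (?T 3) + norm (\<Sum>n\<in>{3<..N}. (ln (real n) / real n) *\<^sub>R \<xi> n)"
      by (simp only: norm_triangle_ineq)
    also have "norm (?T 3) \<le> C1" unfolding C1_def by (rule norm_sum)
    also have "norm (\<Sum>n\<in>{3<..N}. (ln (real n) / real n) *\<^sub>R \<xi> n) \<le> 2 * real l * (ln (real (Suc 3)) / real (Suc 3))"
      using False by (intro abel_sum norm_sum_dchars_le[OF c l] ln_div_antimono) auto
    finally show ?thesis by simp
  qed
  have "norm (L_one l \<xi> * Smang \<xi> N) \<le> C1 + 2 * real l * (ln 4 / 4) + 12 * real l" for N
  proof (cases "N = 0")
    case True
    have "C1 \<ge> 0" unfolding C1_def by (intro sum_nonneg) auto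
    thus ?thesis using True by (simp add: Smang_def)
  next
    case False
    have "?T N = (\<Sum>n=1..N. \<Sum>d | d dvd n. (\<xi> d * of_real (mang d / real d)) * (\<xi> (n div d) / of_nat (n div d)))"
    proof (intro sum.cong refl)
      fix n assume n: "n \<in> {1..N}"
      have "(\<Sum>d | d dvd n. (\<xi> d * of_real (mang d / real d)) * (\<xi> (n div d) / of_nat (n div d)))
          = (\<Sum>d | d dvd n. \<xi> n * of_real (mang d / real n))"
      proof (intro sum.cong refl)
        fix d assume "d \<in> {d. d dvd n}"
        then obtain k where k: "n = d * k" by auto
        have "d > 0" "k > 0" using n k by (auto intro!: Nat.gr0I)
        thus "(\<xi> d * of_real (mang d / real d)) * (\<xi> (n div d) / of_nat (n div d)) = \<xi> n * of_real (mang d / real n)"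
          by (simp add: k dchars_mult[OF c(1)] field_simps)
      qed
      also have "\<dots> = \<xi> n * of_real ((\<Sum>d | d dvd n. mang d) / real n)"
        by (simp add: sum_distrib_left sum_divide_distrib)
      also have "(\<Sum>d | d dvd n. mang d) = ln (real n)" using n by (subst mangoldt_sum) auto
      finally show "\<xi> n * of_real (ln (real n) / real n) =
        (\<Sum>d | d dvd n. (\<xi> d * of_real (mang d / real d)) * (\<xi> (n div d) / of_nat (n div d)))" by simp
    qed
    also have "\<dots> = (\<Sum>d=1..N. \<Sum>k=1..N div d. (\<xi> d * of_real (mang d / real d)) * (\<xi> k / of_nat k))"
      by (rule sum_dvd_swap)
    also have "\<dots> = (\<Sum>d=1..N. (\<xi> d * of_real (mang d / real d)) * (\<Sum>k=1..N div d. \<xi> k / of_nat k))"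
      by (simp only: sum_distrib_left)
    finally have eqT: "L_one l \<xi> * Smang \<xi> N - ?T N =
       (\<Sum>d=1..N. (\<xi> d * of_real (mang d / real d)) * (L_one l \<xi> - (\<Sum>k=1..N div d. \<xi> k / of_nat k)))"
      by (simp add: Smang_def sum_distrib_left sum_subtractf algebra_simps)
    have "norm (L_one l \<xi> * Smang \<xi> N - ?T N) \<le> (\<Sum>d=1..N. norm ((\<xi> d * of_real (mang d / real d)) * (L_one l \<xi> - (\<Sum>k=1..N div d. \<xi> k / of_nat k))))"
      unfolding eqT by (rule norm_sum)
    also have "\<dots> \<le> (\<Sum>d=1..N. mang d * (2 * real l / real N))"
    proof (intro sum_mono)
      fix d assume d: "d \<in> {1..N}"
      have "real N / real d \<le> real (Suc (N div d))"
        using floor_divide_of_nat_eq[of N d, where ?'a = real] by linarith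
      hence "2 * real l / real (Suc (N div d)) \<le> 2 * real l / (real N / real d)"
        using d by (intro divide_left_mono) auto
      hence b: "norm (L_one l \<xi> - (\<Sum>k=1..N div d. \<xi> k / of_nat k)) \<le> 2 * real l * real d / real N"
        using L_one_bound[OF c l, of "N div d"] by simp
      have "norm (\<xi> d * of_real (mang d / real d)) \<le> 1 * (mang d / real d)"
        unfolding norm_mult using norm_dchars_le[OF c(1) l] mangoldt_nonneg[of d] by (intro mult_mono) (auto simp: norm_divide)
      hence "norm ((\<xi> d * of_real (mang d / real d)) * (L_one l \<xi> - (\<Sum>k=1..N div d. \<xi> k / of_nat k)))
        \<le> (1 * (mang d / real d)) * (2 * real l * real d / real N)"
        unfolding norm_mult[of "\<xi> d * of_real (mang d / real d)"] using b mangoldt_nonneg[of d] by (intro mult_mono) auto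
      also have "\<dots> = mang d * (2 * real l / real N)" using d by simp
      finally show "norm ((\<xi> d * of_real (mang d / real d)) * (L_one l \<xi> - (\<Sum>k=1..N div d. \<xi> k / of_nat k))) \<le> mang d * (2 * real l / real N)" .
    qed
    also have "\<dots> = psi N * (2 * real l / real N)" by (simp only: psi_def sum_distrib_right)
    also have "\<dots> \<le> (6 * real N) * (2 * real l / real N)" by (intro mult_right_mono psi_le) auto
    also have "\<dots> = 12 * real l" using False by simp
    finally have "norm (L_one l \<xi> * Smang \<xi> N - ?T N) \<le> 12 * real l" .
    thus ?thesis using T[of N] norm_triangle_sub[of "L_one l \<xi> * Smang \<xi> N" "?T N"] by linarith
  qed
  hence "norm (Smang \<xi> N) \<le> (C1 + 2 * real l * (ln 4 / 4) + 12 * real l) / norm (L_one l \<xi>)" for N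
    using L by (simp add: norm_mult pos_le_divide_eq mult.commute)
  thus ?thesis by blast
qed

text \<open>Write log (x/d) = log (n/d) + log (x/n). The first part gives mu * log = Lambda, the
  second the divisor sum of mu, which singles out n = 1.\<close>

lemma sum_moebius_ln:
  assumes n: "n > 0" and x: "x > 0"
  shows "(\<Sum>d | d dvd n. mu d * ln (x / real d)) = mang n + (if n = 1 then ln x else 0)"
proof -
  have mu_sum: "(\<Sum>d | d dvd m. mu d) = (if m = 1 then 1 else 0)" if m: "m > 0" for m
  proof -
    have "(\<Sum>d | d dvd m. if free_of {} d then moebius d else 0) = (\<Sum>d | d dvd m. moebius d)"
      using m by (intro sum.cong) (auto simp: free_of_def intro!: Nat.gr0I)
    moreover have "(\<forall>p. prime p \<longrightarrow> p dvd m \<longrightarrow> p \<in> {}) \<longleftrightarrow> m = 1"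
      using prime_factor_nat[of m] by auto
    ultimately have "(\<Sum>d | d dvd m. moebius d) = (if m = 1 then 1 else 0)"
      using sum_moebius_divisors[of "{}" m] m by simp
    thus ?thesis by (metis (no_types, lifting) of_int_0 of_int_1 of_int_sum sum.cong)
  qed
  have "(\<Sum>d | d dvd n. mu d * ln (real (n div d))) = (\<Sum>d | d dvd n. \<Sum>e | e dvd n div d. mu d * mang e)"
  proof (intro sum.cong refl)
    fix d assume "d \<in> {d. d dvd n}"
    hence "n div d > 0" using n by (auto elim!: dvdE intro!: Nat.gr0I)
    hence "ln (real (n div d)) = (\<Sum>e | e dvd n div d. mang e)" by (subst mangoldt_sum) auto
    thus "mu d * ln (real (n div d)) = (\<Sum>e | e dvd n div d. mu d * mang e)" by (simp only: sum_distrib_left)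
  qed
  also have "\<dots> = (\<Sum>(d,e)\<in>Sigma {d. d dvd n} (\<lambda>d. {e. e dvd n div d}). mu d * mang e)"
    using n by (intro sum.Sigma) (auto elim!: dvdE)
  also have "\<dots> = (\<Sum>(e,d)\<in>Sigma {e. e dvd n} (\<lambda>e. {d. d dvd n div e}). mu d * mang e)"
    using n by (intro sum.reindex_bij_witness[of _ "\<lambda>(e,d). (d,e)" "\<lambda>(d,e). (e,d)"])
      (auto elim!: dvdE simp: mult_ac)
  also have "\<dots> = (\<Sum>e | e dvd n. \<Sum>d | d dvd n div e. mu d * mang e)"
    using n by (intro sum.Sigma[symmetric]) (auto elim!: dvdE)
  also have "\<dots> = (\<Sum>e | e dvd n. if e = n then mang n else 0)"
  proof (intro sum.cong refl)
    fix e assume "e \<in> {e. e dvd n}"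
    then obtain k where k: "n = e * k" by auto
    have e: "e > 0" "k > 0" using n k by (auto intro!: Nat.gr0I)
    have "(\<Sum>d | d dvd n div e. mu d * mang e) = (\<Sum>d | d dvd n div e. mu d) * mang e" by (simp only: sum_distrib_right)
    also have "(\<Sum>d | d dvd n div e. mu d) = (if n div e = 1 then 1 else 0)" using e k by (intro mu_sum) simp
    finally show "(\<Sum>d | d dvd n div e. mu d * mang e) = (if e = n then mang n else 0)" using e k by auto
  qed
  also have "\<dots> = mang n" using n by simp
  finally have 1: "(\<Sum>d | d dvd n. mu d * ln (real (n div d))) = mang n" .
  have "(\<Sum>d | d dvd n. mu d * ln (x / real d)) = (\<Sum>d | d dvd n. mu d * ln (real (n div d)) + mu d * ln (x / real n))"
  proof (intro sum.cong refl)
    fix d assume "d \<in> {d. d dvd n}"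
    then obtain k where k: "n = d * k" by auto
    have "d > 0" "k > 0" using n k by (auto intro!: Nat.gr0I)
    thus "mu d * ln (x / real d) = mu d * ln (real (n div d)) + mu d * ln (x / real n)"
      using x by (simp add: k ln_div ln_mult algebra_simps)
  qed
  also have "\<dots> = mang n + (\<Sum>d | d dvd n. mu d) * ln (x / real n)"
    using 1 by (simp only: sum.distrib sum_distrib_right)
  finally show ?thesis using mu_sum[OF n] by auto
qed

text \<open>If the L-value vanishes, Moebius inversion of \<open>\<Lambda> = -\<mu> ln * 1\<close> twists into \<open>\<Sum> \<xi>(n)\<Lambda>(n)/n = -ln N + O(1)\<close>; summing over all characters, nonnegativity of the progression sum then allows at most one such character.\<close>

lemma Smang_zero:
  assumes c: "\<xi> \<in> dchars l" "\<xi> \<noteq> principal_char l" and l: "l > 0" and L: "L_one l \<xi> = 0" and N: "N > 0"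
  shows "norm (Smang \<xi> N + of_real (ln (real N))) \<le> 2 * real l"
proof -
  have "Smang \<xi> N + of_real (ln (real N)) = (\<Sum>n=1..N. \<xi> n * of_real ((mang n + (if n = 1 then ln (real N) else 0)) / real n))"
  proof -
    have "(\<Sum>n=1..N. \<xi> n * of_real ((mang n + (if n = 1 then ln (real N) else 0)) / real n))
      = Smang \<xi> N + (\<Sum>n=1..N. if n = 1 then of_real (ln (real N)) else 0)"
      unfolding Smang_def sum.distrib[symmetric]
      by (intro sum.cong refl) (auto simp: dchars_1[OF c(1), simplified] add_divide_distrib algebra_simps)
    thus ?thesis using N by simp
  qed
  also have "\<dots> = (\<Sum>n=1..N. \<Sum>d | d dvd n. (\<xi> d * of_real (mu d * ln (real N / real d) / real d)) * (\<xi> (n div d) / of_nat (n div d)))"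
  proof (intro sum.cong refl)
    fix n assume n: "n \<in> {1..N}"
    have "(\<Sum>d | d dvd n. (\<xi> d * of_real (mu d * ln (real N / real d) / real d)) * (\<xi> (n div d) / of_nat (n div d)))
       = (\<Sum>d | d dvd n. \<xi> n * of_real (mu d * ln (real N / real d) / real n))"
    proof (intro sum.cong refl)
      fix d assume "d \<in> {d. d dvd n}"
      then obtain k where k: "n = d * k" by auto
      have "d > 0" "k > 0" using n k by (auto intro!: Nat.gr0I)
      thus "(\<xi> d * of_real (mu d * ln (real N / real d) / real d)) * (\<xi> (n div d) / of_nat (n div d)) =
         \<xi> n * of_real (mu d * ln (real N / real d) / real n)"
        by (simp add: k dchars_mult[OF c(1)] field_simps)
    qed
    also have "\<dots> = \<xi> n * of_real ((\<Sum>d | d dvd n. mu d * ln (real N / real d)) / real n)"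
      by (simp add: sum_distrib_left sum_divide_distrib)
    also have "(\<Sum>d | d dvd n. mu d * ln (real N / real d)) = mang n + (if n = 1 then ln (real N) else 0)"
      using n N by (intro sum_moebius_ln) auto
    finally show "\<xi> n * of_real ((mang n + (if n = 1 then ln (real N) else 0)) / real n) =
      (\<Sum>d | d dvd n. (\<xi> d * of_real (mu d * ln (real N / real d) / real d)) * (\<xi> (n div d) / of_nat (n div d)))" by simp
  qed
  also have "\<dots> = (\<Sum>d=1..N. \<Sum>k=1..N div d. (\<xi> d * of_real (mu d * ln (real N / real d) / real d)) * (\<xi> k / of_nat k))"
    by (rule sum_dvd_swap)
  also have "\<dots> = (\<Sum>d=1..N. (\<xi> d * of_real (mu d * ln (real N / real d) / real d)) * (\<Sum>k=1..N div d. \<xi> k / of_nat k))"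
    by (simp only: sum_distrib_left)
  finally have eqT: "Smang \<xi> N + of_real (ln (real N)) =
    (\<Sum>d=1..N. (\<xi> d * of_real (mu d * ln (real N / real d) / real d)) * (\<Sum>k=1..N div d. \<xi> k / of_nat k))" .
  have "norm (Smang \<xi> N + of_real (ln (real N))) \<le> (\<Sum>d=1..N. norm ((\<xi> d * of_real (mu d * ln (real N / real d) / real d)) * (\<Sum>k=1..N div d. \<xi> k / of_nat k)))"
    unfolding eqT by (rule norm_sum)
  \<comment> \<open>With L(1, xi) = 0 the partial sum up to N/d is minus a tail, of size O(d/N). The
    remaining factor log (N/d) sums to at most N over d \<le> N.\<close>
  also have "\<dots> \<le> (\<Sum>d=1..N. ln (real N / real d) * (2 * real l / real N))"
  proof (intro sum_mono)
    fix d assume d: "d \<in> {1..N}"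
    have l0: "ln (real N / real d) \<ge> 0" using d by (auto intro!: ln_ge_zero)
    have "real N / real d \<le> real (Suc (N div d))"
      using floor_divide_of_nat_eq[of N d, where ?'a = real] by linarith
    hence "2 * real l / real (Suc (N div d)) \<le> 2 * real l / (real N / real d)"
      using d by (intro divide_left_mono) auto
    hence b: "norm (\<Sum>k=1..N div d. \<xi> k / of_nat k) \<le> 2 * real l * real d / real N"
      using L_one_bound[OF c l, of "N div d"] L by simp
    have "\<bar>mu d * ln (real N / real d) / real d\<bar> \<le> 1 * ln (real N / real d) / real d"
    proof -
      have e: "\<bar>mu d * ln (real N / real d) / real d\<bar> = \<bar>mu d\<bar> * ln (real N / real d) / real d"
        using l0 by (simp add: abs_mult)
      show ?thesis unfolding e by (intro divide_right_mono mult_right_mono abs_mu_le l0) auto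
    qed
    hence "norm (\<xi> d * of_real (mu d * ln (real N / real d) / real d)) \<le> 1 * (1 * ln (real N / real d) / real d)"
      unfolding norm_mult norm_of_real using norm_dchars_le[OF c(1) l] by (intro mult_mono) auto
    hence "norm ((\<xi> d * of_real (mu d * ln (real N / real d) / real d)) * (\<Sum>k=1..N div d. \<xi> k / of_nat k))
      \<le> (1 * (1 * ln (real N / real d) / real d)) * (2 * real l * real d / real N)"
      unfolding norm_mult[of "\<xi> d * of_real (mu d * ln (real N / real d) / real d)"] using b l0 by (intro mult_mono) auto
    also have "\<dots> = ln (real N / real d) * (2 * real l / real N)" using d by simp
    finally show "norm ((\<xi> d * of_real (mu d * ln (real N / real d) / real d)) * (\<Sum>k=1..N div d. \<xi> k / of_nat k))
      \<le> ln (real N / real d) * (2 * real l / real N)" .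
  qed
  also have "\<dots> = (\<Sum>d=1..N. ln (real N / real d)) * (2 * real l / real N)" by (simp only: sum_distrib_right)
  also have "(\<Sum>d=1..N. ln (real N / real d)) = real N * ln (real N) - ln (fact N)"
  proof -
    have "(\<Sum>d=1..N. ln (real N / real d)) = (\<Sum>d=1..N. ln (real N) - ln (real d))"
      by (intro sum.cong) (auto simp: ln_div)
    thus ?thesis by (simp add: sum_subtractf ln_fact_sum)
  qed
  also have "(real N * ln (real N) - ln (fact N)) * (2 * real l / real N) \<le> real N * (2 * real l / real N)"
    using ln_fact_bounds(2)[of N] by (intro mult_right_mono) auto
  also have "\<dots> = 2 * real l" using N by simp
  finally show ?thesis .
qed

lemma L_one_eqI:
  assumes c: "\<xi> \<in> dchars l" "\<xi> \<noteq> principal_char l" and l: "l > 0"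
    and L: "\<And>M. norm (L - (\<Sum>n=1..M. \<xi> n / of_nat n)) \<le> 2 * real l / real (Suc M)"
  shows "L_one l \<xi> = L"
proof -
  have "norm (L_one l \<xi> - L) \<le> 4 * real l / real (Suc M)" for M
  proof -
    have "norm (L_one l \<xi> - L) \<le> norm (L_one l \<xi> - (\<Sum>n=1..M. \<xi> n / of_nat n)) + norm (L - (\<Sum>n=1..M. \<xi> n / of_nat n))"
      using norm_triangle_ineq4[of "L_one l \<xi> - (\<Sum>n=1..M. \<xi> n / of_nat n)" "L - (\<Sum>n=1..M. \<xi> n / of_nat n)"] by simp
    also have "\<dots> \<le> 2 * real l / real (Suc M) + 2 * real l / real (Suc M)"
      by (intro add_mono L L_one_bound c l)
    finally show ?thesis by simp
  qed
  moreover have "(\<lambda>M. 4 * real l / real (Suc M)) \<longlonglongrightarrow> 0" by real_asymp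
  ultimately have "norm (L_one l \<xi> - L) \<le> 0"
    by (intro LIMSEQ_le_const[of "\<lambda>M. 4 * real l / real (Suc M)"]) auto
  thus ?thesis by simp
qed

lemma dchars_cnj: "\<xi> \<in> dchars l \<Longrightarrow> (\<lambda>n. cnj (\<xi> n)) \<in> dchars l"
  unfolding dchars_def by (auto; metis)

text \<open>Vanishing L-values come in conjugate pairs; for a non-real character this produces the
  second zero that the counting argument excludes.\<close>

lemma L_one_cnj_zero:
  assumes c: "\<xi> \<in> dchars l" "\<xi> \<noteq> principal_char l" and l: "l > 0" and L: "L_one l \<xi> = 0"
  shows "(\<lambda>n. cnj (\<xi> n)) \<noteq> principal_char l" "L_one l (\<lambda>n. cnj (\<xi> n)) = 0"
proof -
  show ne: "(\<lambda>n. cnj (\<xi> n)) \<noteq> principal_char l"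
  proof
    assume eq: "(\<lambda>n. cnj (\<xi> n)) = principal_char l"
    have "\<xi> n = principal_char l n" for n
      using fun_cong[OF eq, of n] by (metis complex_cnj_cnj complex_cnj_one complex_cnj_zero principal_char_def)
    thus False using c(2) by blast
  qed
  show "L_one l (\<lambda>n. cnj (\<xi> n)) = 0"
  proof (rule L_one_eqI[OF dchars_cnj[OF c(1)] ne l])
    fix M
    have "(\<Sum>n=1..M. cnj (\<xi> n) / of_nat n) = cnj (\<Sum>n=1..M. \<xi> n / of_nat n)" by simp
    hence "norm (0 - (\<Sum>n=1..M. cnj (\<xi> n) / of_nat n)) = norm (0 - (\<Sum>n=1..M. \<xi> n / of_nat n))"
      by (simp only: norm_minus_cancel diff_0 complex_mod_cnj)
    thus "norm (0 - (\<Sum>n=1..M. cnj (\<xi> n) / of_nat n)) \<le> 2 * real l / real (Suc M)"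
      using L_one_bound[OF c l, of M] L by simp
  qed
qed

section \<open>Divisor sums of a real character\<close>

context
  fixes x :: "nat \<Rightarrow> real"
  assumes x1: "x 1 = 1" and xmult: "\<And>a b. x (a * b) = x a * x b" and xval: "\<And>a. x a \<in> {-1, 0, 1}"
begin

lemma divisor_sum_prime_power:
  assumes p: "prime p" "\<not> p dvd m" and m: "m > 0"
  shows "(\<Sum>d | d dvd p ^ k * m. x d) = (\<Sum>i\<le>k. x p ^ i) * (\<Sum>d | d dvd m. x d)"
proof -
  have p0: "p > 0" using p by (simp add: prime_gt_0_nat)
  have xpow: "x (p ^ i) = x p ^ i" for i
    by (induction i) (simp_all add: xmult x1[simplified])
  have cop: "coprime (p ^ i) d" if "d dvd m" for i d
    using p that by (meson coprime_power_left_iff dvd_trans prime_imp_coprime)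
  have inj: "inj_on (\<lambda>(i, d). p ^ i * d) ({..k} \<times> {d. d dvd m})"
  proof (rule inj_onI, clarify)
    fix i d i' d' assume a: "d dvd m" "d' dvd m" "p ^ i * d = p ^ i' * d'"
    have "\<not> p dvd d" "\<not> p dvd d'" "d \<noteq> 0" "d' \<noteq> 0" using a p m by (auto intro: dvd_trans)
    hence "multiplicity p (p ^ i * d) = i" "multiplicity p (p ^ i' * d') = i'"
      using p0 by (auto intro!: multiplicity_eqI)
    hence "i = i'" using a(3) by simp
    thus "i = i' \<and> d = d'" using a(3) p0 by simp
  qed
  have img: "{d. d dvd p ^ k * m} = (\<lambda>(i, d). p ^ i * d) ` ({..k} \<times> {d. d dvd m})"
  proof safe
    fix d assume "d dvd p ^ k * m"
    then obtain b c where bc: "d = b * c" "b dvd p ^ k" "c dvd m" using division_decomp by blast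
    then obtain i where "i \<le> k" "b = p ^ i" using p by (auto simp: divides_primepow_nat)
    thus "d \<in> (\<lambda>(i, d). p ^ i * d) ` ({..k} \<times> {d. d dvd m})" using bc by (intro image_eqI[of _ _ "(i, c)"]) auto
  qed (auto intro!: mult_dvd_mono le_imp_power_dvd)
  have "(\<Sum>d | d dvd p ^ k * m. x d) = (\<Sum>(i, d)\<in>{..k} \<times> {d. d dvd m}. x p ^ i * x d)"
    unfolding img by (subst sum.reindex[OF inj]) (simp add: case_prod_unfold xmult xpow)
  also have "\<dots> = (\<Sum>i\<le>k. \<Sum>d | d dvd m. x p ^ i * x d)"
    by (rule sum.Sigma[symmetric]) (use m in auto)
  also have "\<dots> = (\<Sum>i\<le>k. x p ^ i) * (\<Sum>d | d dvd m. x d)"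
    by (simp only: sum_product)
  finally show ?thesis .
qed

lemma geometric_nonneg: "(\<Sum>i\<le>k. x p ^ i) \<ge> 0" "even k \<Longrightarrow> (\<Sum>i\<le>k. x p ^ i) \<ge> 1"
proof -
  consider "x p = -1" | "x p = 0" | "x p = 1" using xval[of p] by auto
  hence "(\<Sum>i\<le>k. x p ^ i) \<ge> 0 \<and> (even k \<longrightarrow> (\<Sum>i\<le>k. x p ^ i) \<ge> 1)"
  proof cases
    case 1
    have "(\<Sum>i\<le>k. (-1::real) ^ i) = (if even k then 1 else 0)" by (induction k) auto
    thus ?thesis using 1 by simp
  next
    case 2
    have "(\<Sum>i\<le>k. (0::real) ^ i) = 1" by (induction k) auto
    thus ?thesis using 2 by simp
  qed simp
  thus "(\<Sum>i\<le>k. x p ^ i) \<ge> 0" "even k \<Longrightarrow> (\<Sum>i\<le>k. x p ^ i) \<ge> 1" by auto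
qed

lemma divisor_sum_nonneg: "n > 0 \<Longrightarrow> (\<Sum>d | d dvd n. x d) \<ge> 0"
proof (induction n rule: less_induct)
  case (less n)
  show ?case
  proof (cases "n = 1")
    case True
    thus ?thesis using x1 by simp
  next
    case False
    then obtain p where p: "prime p" "p dvd n" using prime_factor_nat by blast
    obtain m where m: "n = p ^ multiplicity p n * m" "\<not> p dvd m"
      by (rule multiplicity_decompose'[of n p]) (use less.prems p in auto)
    have "multiplicity p n > 0" using p less.prems by (simp add: prime_multiplicity_gt_zero_iff)
    hence "p ^ multiplicity p n > 1" using p by (intro one_less_power prime_gt_1_nat) auto
    moreover have m0: "m > 0" using m less.prems by (auto intro!: Nat.gr0I)
    ultimately have "m < n" using m(1) by (metis mult_less_mono1 nat_mult_1)
    hence "(\<Sum>d | d dvd m. x d) \<ge> 0" using less.IH m0 by blast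
    thus ?thesis using m(1) divisor_sum_prime_power[OF p(1) m(2) m0, of "multiplicity p n"]
      geometric_nonneg(1)[where k = "multiplicity p n" and p = p] by simp
  qed
qed

text \<open>In a square all exponents are even, so each local factor is a sum of an odd number of
  successive powers of -1, 0 or 1, starting with 1, and hence at least 1.\<close>

lemma divisor_sum_square: "n > 0 \<Longrightarrow> (\<Sum>d | d dvd n ^ 2. x d) \<ge> 1"
proof (induction n rule: less_induct)
  case (less n)
  show ?case
  proof (cases "n = 1")
    case True
    thus ?thesis using x1 by simp
  next
    case False
    then obtain p where p: "prime p" "p dvd n" using prime_factor_nat by blast
    define k where "k = multiplicity p n"
    obtain m where m: "n = p ^ k * m" "\<not> p dvd m"
      unfolding k_def by (rule multiplicity_decompose'[of n p]) (use less.prems p in auto)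
    have "k > 0" using p less.prems by (simp add: prime_multiplicity_gt_zero_iff k_def)
    hence "p ^ k > 1" using p by (intro one_less_power prime_gt_1_nat) auto
    moreover have m0: "m > 0" using m less.prems by (auto intro!: Nat.gr0I)
    ultimately have "m < n" using m(1) by (metis mult_less_mono1 nat_mult_1)
    hence IH: "(\<Sum>d | d dvd m ^ 2. x d) \<ge> 1" using less.IH m0 by blast
    have "n ^ 2 = p ^ (2 * k) * m ^ 2" by (simp add: m(1) power_mult_distrib power_mult[symmetric] mult.commute)
    moreover have "\<not> p dvd m ^ 2" using m(2) p(1) by (simp add: prime_dvd_power_iff)
    ultimately have "(\<Sum>d | d dvd n ^ 2. x d) = (\<Sum>i\<le>2 * k. x p ^ i) * (\<Sum>d | d dvd m ^ 2. x d)"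
      using divisor_sum_prime_power[OF p(1), of "m ^ 2" "2 * k"] m0 by simp
    also have "\<dots> \<ge> 1 * 1" using geometric_nonneg(2)[where k = "2 * k" and p = p] IH
      by (intro mult_mono) auto
    finally show ?thesis by simp
  qed
qed

text \<open>Each of the K squares contributes at least 1 and nothing is negative. Growth like the
  square root of the length already contradicts boundedness.\<close>

lemma sum_divisor_sums_ge: "(\<Sum>n=1..K^2. \<Sum>d | d dvd n. x d) \<ge> real K"
proof -
  have "(\<Sum>k=1..K. (1::real)) \<le> (\<Sum>k=1..K. \<Sum>d | d dvd k ^ 2. x d)"
    by (intro sum_mono divisor_sum_square) auto
  also have "\<dots> = (\<Sum>n\<in>(\<lambda>k. k ^ 2) ` {1..K}. \<Sum>d | d dvd n. x d)"
    by (subst sum.reindex) (auto simp: inj_on_def)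
  also have "\<dots> \<le> (\<Sum>n=1..K^2. \<Sum>d | d dvd n. x d)"
    by (intro sum_mono2) (auto intro!: divisor_sum_nonneg power_mono)
  finally show ?thesis by simp
qed

end

section \<open>Lambert series and nonvanishing for real characters\<close>

lemma lambert_poly:
  fixes s :: real
  assumes "0 \<le> s" "s \<le> 1"
  shows "(real n + 1) * s ^ n \<le> 1 + real n * s ^ (n + 1)"
proof (induction n)
  case (Suc n)
  have "s * ((real n + 1) * s ^ n) \<le> s * (1 + real n * s ^ (n + 1))"
    using Suc assms by (intro mult_left_mono) auto
  moreover have "0 \<le> (1 - s) * (1 - s ^ (n + 1))"
    using assms by (intro mult_nonneg_nonneg) (auto intro!: mult_le_one power_le_one)
  ultimately show ?case by (simp add: algebra_simps)
qed simp

text \<open>The inequality of arithmetic and geometric means for 1, t, ..., t^n, whose geometric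
  mean is t^(n/2). Writing t = s^2 avoids half-integral exponents, and \<open>lambert_poly\<close>
  supplies the induction step.\<close>

lemma geometric_lower:
  fixes s :: real
  assumes "0 \<le> s" "s \<le> 1"
  shows "(real n + 1) * s ^ n \<le> (\<Sum>i<Suc n. (s\<^sup>2) ^ i)"
proof (induction n)
  case (Suc n)
  have "(\<Sum>i<Suc (Suc n). (s\<^sup>2) ^ i) = 1 + s\<^sup>2 * (\<Sum>i<Suc n. (s\<^sup>2) ^ i)"
    by (subst sum.lessThan_Suc_shift) (simp add: sum_distrib_left distrib_left)
  also have "\<dots> \<ge> 1 + s\<^sup>2 * ((real n + 1) * s ^ n)"
    using Suc by (intro add_left_mono mult_left_mono) auto
  also have "1 + s\<^sup>2 * ((real n + 1) * s ^ n) = 1 + real (Suc n) * s ^ (Suc n + 1)"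
    by (simp add: power2_eq_square algebra_simps)
  also have "\<dots> \<ge> (real (Suc n) + 1) * s ^ Suc n" by (rule lambert_poly[OF assms])
  finally show ?case .
qed simp

text \<open>Monsky's proof: the Lambert series \<open>\<Sum> \<xi>(n) t^n / (1 - t^n)\<close> is unbounded as \<open>t\<close> tends to 1, whereas \<open>L(1,\<xi>) = 0\<close> and the monotonicity of the weights below keep it bounded.\<close>

definition monsky :: "real \<Rightarrow> nat \<Rightarrow> real" where
  "monsky t n = 1 / (real n * (1 - t)) - t ^ n / (1 - t ^ n)"

text \<open>With S(n) = 1 + t + ... + t^(n-1), monotonicity reduces to n (n+1) t^n \<le> S(n)
  S(n+1). Two uses of \<open>geometric_lower\<close> bound the product from below by n (n+1)
  s^(2n-1), and s \<le> 1 turns this into t^n.\<close>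

lemma monsky_props:
  assumes t: "0 < t" "t < 1" and n: "n > 0"
  shows "monsky t n \<ge> 0" "monsky t (Suc n) \<le> monsky t n" "monsky t 1 = 1"
proof -
  define S where "S = (\<lambda>n. \<Sum>i<n. t ^ i)"
  have geo: "1 - t ^ m = (1 - t) * S m" for m unfolding S_def by (rule one_diff_power_eq)
  have Spos: "S m > 0" if "m > 0" for m unfolding S_def using that t by (intro sum_pos) auto
  have eq: "monsky t m = (1 / real m - t ^ m / S m) / (1 - t)" if "m > 0" for m
    unfolding monsky_def geo by (simp add: diff_divide_distrib mult.commute)
  have "real n * t ^ n = (\<Sum>i<n. t ^ n)" by simp
  also have "\<dots> \<le> S n" unfolding S_def using t by (intro sum_mono power_decreasing) auto
  finally have "t ^ n / S n \<le> 1 / real n" using Spos[OF n] n by (simp add: field_simps)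
  thus "monsky t n \<ge> 0" unfolding eq[OF n] using t by simp
  show "monsky t 1 = 1" unfolding monsky_def using t by (simp add: field_simps)
  define s where "s = sqrt t"
  have s: "0 \<le> s" "s \<le> 1" "s\<^sup>2 = t" using t by (auto simp: s_def)
  obtain m where m: "n = Suc m" using n by (cases n) auto
  have "(real m + 1) * s ^ m \<le> S n" "(real n + 1) * s ^ n \<le> S (Suc n)"
    using geometric_lower[OF s(1,2), of m] geometric_lower[OF s(1,2), of n] by (simp_all add: S_def s(3) m)
  hence "((real m + 1) * s ^ m) * ((real n + 1) * s ^ n) \<le> S n * S (Suc n)"
    using s Spos[of n] n by (intro mult_mono) auto
  moreover have "real n * (real n + 1) * t ^ n \<le> ((real m + 1) * s ^ m) * ((real n + 1) * s ^ n)"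
  proof -
    have "t ^ n = s ^ n * s ^ n" by (simp add: s(3)[symmetric] power2_eq_square power_mult_distrib)
    also have "\<dots> \<le> s ^ m * s ^ n" using s by (intro mult_right_mono power_decreasing) (auto simp: m)
    finally have "real n * (real n + 1) * t ^ n \<le> real n * (real n + 1) * (s ^ m * s ^ n)"
      by (intro mult_left_mono) auto
    thus ?thesis by (simp add: m algebra_simps)
  qed
  ultimately have key: "real n * (real n + 1) * t ^ n \<le> S n * S (Suc n)" by linarith
  have rec: "S (Suc n) = 1 + t * S n"
    unfolding S_def by (subst sum.lessThan_Suc_shift) (simp add: sum_distrib_left)
  have "t ^ n / S n - t ^ Suc n / S (Suc n) = t ^ n * (S (Suc n) - t * S n) / (S n * S (Suc n))"
    using Spos[OF n] Spos[of "Suc n"] by (simp add: field_simps)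
  also have "\<dots> = t ^ n / (S n * S (Suc n))" by (simp add: rec)
  also have "\<dots> \<le> 1 / (real n * (real n + 1))"
  proof -
    have "c / b \<le> 1 / a" if "a > 0" "b > 0" "a * c \<le> b" for a b c :: real
      using that by (simp add: field_simps)
    thus ?thesis using key Spos[OF n] Spos[of "Suc n"] n by simp
  qed
  also have "\<dots> = 1 / real n - 1 / real (Suc n)" using n by (simp add: field_simps)
  finally have "1 / real (Suc n) - t ^ Suc n / S (Suc n) \<le> 1 / real n - t ^ n / S n" by linarith
  thus "monsky t (Suc n) \<le> monsky t n" unfolding eq[OF n] eq[OF zero_less_Suc]
    using t by (intro divide_right_mono) auto
qed

lemma real_char_L_nonzero:
  assumes c: "\<xi> \<in> dchars l" "\<xi> \<noteq> principal_char l" and l: "l > 0" and re: "(\<lambda>n. cnj (\<xi> n)) = \<xi>"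
  shows "L_one l \<xi> \<noteq> 0"
proof
  assume L: "L_one l \<xi> = 0"
  define x where "x = (\<lambda>n. Re (\<xi> n))"
  have xi: "\<xi> n = of_real (x n)" for n
    using fun_cong[OF re, of n] by (simp add: x_def complex_eq_iff)
  have x1: "x 1 = 1" using dchars_1[OF c(1)] by (simp add: x_def)
  have xmult: "x (a * b) = x a * x b" for a b
  proof -
    have "complex_of_real (x (a * b)) = of_real (x a * x b)" using dchars_mult[OF c(1), of a b] by (simp add: xi)
    thus ?thesis by (simp only: of_real_eq_iff)
  qed
  have xle: "\<bar>x a\<bar> \<le> 1" for a using norm_dchars_le[OF c(1) l, of a] by (simp add: xi)
  have xval: "x a \<in> {-1, 0, 1}" for a
  proof (cases "coprime a l")
    case True
    have "complex_of_real (x a ^ totient l) = 1" using dchars_root[OF c(1) True] by (simp add: xi)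
    hence "x a ^ totient l = 1" by (simp only: of_real_eq_1_iff)
    hence "\<bar>x a\<bar> ^ totient l = 1" by (metis abs_one power_abs)
    moreover have "\<bar>x a\<bar> ^ totient l \<le> \<bar>x a\<bar> ^ 1"
      using xle[of a] l by (intro power_decreasing) (auto simp: Suc_le_eq totient_gt_0_iff)
    ultimately have "\<bar>x a\<bar> \<ge> 1" by simp
    thus ?thesis using xle[of a] by auto
  next
    case False
    hence "\<xi> a = 0" using dchars_nz[OF c(1)] by blast
    thus ?thesis by (simp add: xi)
  qed
  define A where "A = (\<lambda>n. \<Sum>d | d dvd n. x d)"
  have A0: "A n \<ge> 0" if "n > 0" for n unfolding A_def using divisor_sum_nonneg[of x, OF x1 xmult xval that] .
  \<comment> \<open>A finite form of the Lambert series argument. The geometric sums split into the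
    partial sum of L(1, xi) divided by 1 - t, a part weighted by \<open>monsky\<close>, and the
    remainder from cutting at n \<le> M. Only the bound for the middle part survives as M
    grows.\<close>
  have bound: "(\<Sum>n=1..M. A n * t ^ n) \<le> 2 * real l + 2 * real l / (real (Suc M) * (1 - t)) + real M * t ^ M / (1 - t)"
    if t: "0 < t" "t < 1" and M: "M > 0" for t M
  proof -
    have "(\<Sum>n=1..M. A n * t ^ n) = (\<Sum>n=1..M. \<Sum>d | d dvd n. x d * t ^ (d * (n div d)))"
      unfolding A_def sum_distrib_right by (intro sum.cong refl) auto
    also have "\<dots> = (\<Sum>d=1..M. \<Sum>k=1..M div d. x d * t ^ (d * k))" by (rule sum_dvd_swap)
    also have "\<dots> = (\<Sum>d=1..M. x d / real d * (1 / (1 - t)) - monsky t d * x d - x d * (t ^ (d * (M div d + 1)) / (1 - t ^ d)))"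
    proof (intro sum.cong refl)
      fix d assume d: "d \<in> {1..M}"
      define q where "q = t ^ d"
      have "t ^ d \<le> t ^ 1" using t d by (intro power_decreasing) auto
      hence q: "q < 1" using t by (simp add: q_def)
      have "(\<Sum>k=1..K. q ^ k) = (q - q ^ (K + 1)) / (1 - q)" for K
      proof -
        have "(\<Sum>k=1..K. q ^ k) * (1 - q) = q - q ^ (K + 1)"
        proof (induction K)
          case (Suc K)
          have "(\<Sum>k=1..Suc K. q ^ k) * (1 - q) = (\<Sum>k=1..K. q ^ k) * (1 - q) + q ^ Suc K * (1 - q)"
            by (simp add: distrib_right)
          also have "(\<Sum>k=1..K. q ^ k) * (1 - q) = q - q ^ (K + 1)" by (rule Suc)
          also have "q - q ^ (K + 1) + q ^ Suc K * (1 - q) = q - q ^ (Suc K + 1)" by (simp add: algebra_simps)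
          finally show ?case .
        qed simp
        thus ?thesis using q by (simp add: field_simps)
      qed
      from this[of "M div d"] have geo: "(\<Sum>k=1..M div d. t ^ (d * k)) = (t ^ d - t ^ (d * (M div d + 1))) / (1 - t ^ d)"
        by (simp only: q_def power_mult)
      have "(\<Sum>k=1..M div d. x d * t ^ (d * k)) = x d * (\<Sum>k=1..M div d. t ^ (d * k))" by (simp only: sum_distrib_left)
      also have "\<dots> = x d * (t ^ d / (1 - t ^ d)) - x d * (t ^ (d * (M div d + 1)) / (1 - t ^ d))"
        unfolding geo diff_divide_distrib by (simp only: right_diff_distrib)
      also have "t ^ d / (1 - t ^ d) = 1 / (real d * (1 - t)) - monsky t d" by (simp add: monsky_def)
      finally show "(\<Sum>k=1..M div d. x d * t ^ (d * k)) =
          x d / real d * (1 / (1 - t)) - monsky t d * x d - x d * (t ^ (d * (M div d + 1)) / (1 - t ^ d))"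
        by (simp add: algebra_simps)
    qed
    also have "\<dots> = (\<Sum>d=1..M. x d / real d) * (1 / (1 - t)) - (\<Sum>d=1..M. monsky t d * x d)
       - (\<Sum>d=1..M. x d * (t ^ (d * (M div d + 1)) / (1 - t ^ d)))"
      by (simp only: sum_subtractf sum_distrib_right)
    finally have eq: "(\<Sum>n=1..M. A n * t ^ n) = \<dots>" .
    have 1: "(\<Sum>d=1..M. x d / real d) * (1 / (1 - t)) \<le> 2 * real l / real (Suc M) * (1 / (1 - t))"
    proof (intro mult_right_mono)
      have "(\<Sum>d=1..M. \<xi> d / of_nat d) = of_real (\<Sum>d=1..M. x d / real d)" by (simp add: xi)
      hence "\<bar>\<Sum>d=1..M. x d / real d\<bar> \<le> 2 * real l / real (Suc M)"
        using L_one_bound[OF c l, of M] L by (simp only: diff_0 norm_minus_cancel norm_of_real)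
      thus "(\<Sum>d=1..M. x d / real d) \<le> 2 * real l / real (Suc M)" by linarith
    qed (use t in auto)
    have 2: "- (\<Sum>d=1..M. monsky t d * x d) \<le> 2 * real l"
    proof -
      have "norm (\<Sum>d\<in>{0<..M}. monsky t d *\<^sub>R \<xi> d) \<le> 2 * real l * monsky t (Suc 0)"
        using M t by (intro abel_sum norm_sum_dchars_le[OF c l] monsky_props) auto
      moreover have "(\<Sum>d\<in>{0<..M}. monsky t d *\<^sub>R \<xi> d) = of_real (\<Sum>d=1..M. monsky t d * x d)"
        unfolding of_real_sum by (intro sum.cong) (auto simp: xi scaleR_conv_of_real)
      moreover have "monsky t (Suc 0) = 1" using monsky_props(3)[OF t, of 1] by simp
      ultimately have "\<bar>\<Sum>d=1..M. monsky t d * x d\<bar> \<le> 2 * real l" by (simp only: norm_of_real mult_1_right)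
      thus ?thesis by linarith
    qed
    have 3: "- (\<Sum>d=1..M. x d * (t ^ (d * (M div d + 1)) / (1 - t ^ d))) \<le> real M * t ^ M / (1 - t)"
    proof -
      have "- (\<Sum>d=1..M. x d * (t ^ (d * (M div d + 1)) / (1 - t ^ d))) = (\<Sum>d=1..M. (- x d) * (t ^ (d * (M div d + 1)) / (1 - t ^ d)))"
        by (simp add: sum_negf)
      also have "\<dots> \<le> (\<Sum>d=1..M. 1 * (t ^ M / (1 - t)))"
      proof (intro sum_mono mult_mono frac_le)
        fix d assume d: "d \<in> {1..M}"
        show "- x d \<le> 1" using xle[of d] by linarith
        have "M < d * (M div d + 1)"
          using d by (metis One_nat_def Suc_eq_plus1 atLeastAtMost_iff dividend_less_times_div less_le_trans zero_less_one mult.commute mult_Suc_right add.commute)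
        thus "t ^ (d * (M div d + 1)) \<le> t ^ M" using t by (intro power_decreasing) auto
        have "t ^ d \<le> t ^ 1" using t d by (intro power_decreasing) auto
        thus "1 - t \<le> 1 - t ^ d" by simp
        thus "0 \<le> t ^ (d * (M div d + 1)) / (1 - t ^ d)" using t by (intro divide_nonneg_nonneg) auto
      qed (use t in auto)
      also have "\<dots> = real M * t ^ M / (1 - t)" by simp
      finally show ?thesis .
    qed
    have "2 * real l / real (Suc M) * (1 / (1 - t)) = 2 * real l / (real (Suc M) * (1 - t))" by simp
    thus ?thesis using 1 2 3 unfolding eq by linarith
  qed
  have bound2: "(\<Sum>n=1..K. A n * t ^ n) \<le> 2 * real l" if t: "0 < t" "t < 1" for t K
  proof (rule LIMSEQ_le_const)
    show "(\<lambda>M. 2 * real l + 2 * real l / (real (Suc M) * (1 - t)) + real M * t ^ M / (1 - t)) \<longlonglongrightarrow> 2 * real l"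
    proof -
      have "(\<lambda>M. 2 * real l / (real (Suc M) * (1 - t))) \<longlonglongrightarrow> 0" using t by real_asymp
      moreover have "(\<lambda>M. real M * t ^ M / (1 - t)) \<longlonglongrightarrow> 0" using t by real_asymp
      ultimately have "(\<lambda>M. 2 * real l + 2 * real l / (real (Suc M) * (1 - t)) + real M * t ^ M / (1 - t)) \<longlonglongrightarrow> 2 * real l + 0 + 0"
        by (intro tendsto_add tendsto_const)
      thus ?thesis by simp
    qed
    show "\<exists>N. \<forall>M\<ge>N. (\<Sum>n=1..K. A n * t ^ n) \<le> 2 * real l + 2 * real l / (real (Suc M) * (1 - t)) + real M * t ^ M / (1 - t)"
    proof (intro exI[of _ "K + 1"] allI impI)
      fix M assume M: "M \<ge> K + 1"
      have "(\<Sum>n=1..K. A n * t ^ n) \<le> (\<Sum>n=1..M. A n * t ^ n)"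
        using M A0 t by (intro sum_mono2) auto
      also have "\<dots> \<le> 2 * real l + 2 * real l / (real (Suc M) * (1 - t)) + real M * t ^ M / (1 - t)"
        using M by (intro bound t) auto
      finally show "(\<Sum>n=1..K. A n * t ^ n) \<le> \<dots>" .
    qed
  qed
  \<comment> \<open>For a fixed number of terms t may tend to 1, since the bound 2l depends neither
    on t nor on K.\<close>
  have "(\<Sum>n=1..K. A n) \<le> 2 * real l" for K
  proof -
    have "((\<lambda>t. \<Sum>n=1..K. A n * t ^ n) \<longlongrightarrow> (\<Sum>n=1..K. A n * 1 ^ n)) (at_left 1)"
      by (intro tendsto_intros)
    moreover have "\<forall>\<^sub>F t in at_left 1. (\<Sum>n=1..K. A n * t ^ n) \<le> 2 * real l"
      using eventually_at_left_real[of 0 "1::real"] by (auto elim!: eventually_mono intro!: bound2[simplified])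
    ultimately have "(\<Sum>n=1..K. A n * 1 ^ n) \<le> 2 * real l"
      by (intro tendsto_upperbound[of _ _ "at_left 1"]) auto
    thus ?thesis by simp
  qed
  \<comment> \<open>Taking (2l + 1)^2 terms gives a sum of at least 2l + 1, above the bound
    2l.\<close>
  from this[of "(2 * l + 1) ^ 2"] sum_divisor_sums_ge[of x "2 * l + 1", OF x1 xmult xval] show False
    unfolding A_def by simp
qed

definition Sprime :: "(nat \<Rightarrow> complex) \<Rightarrow> nat \<Rightarrow> complex" where
  "Sprime \<xi> N = (\<Sum>p\<in>{p\<in>{1..N}. prime p}. \<xi> p * of_real (ln (real p) / real p))"

text \<open>Only proper prime powers are dropped; the constant is uniform in the character and the
  modulus.\<close>

lemma Sprime_Smang:
  "\<exists>C. \<forall>\<xi> l N. \<xi> \<in> dchars l \<longrightarrow> l > 0 \<longrightarrow> norm (Smang \<xi> N - Sprime \<xi> N) \<le> C"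
proof -
  obtain C where C: "\<And>N. (\<Sum>n\<in>{n\<in>{1..N}. \<not> prime n}. mang n / real n) \<le> C"
    using prime_power_sum_bound by blast
  have "norm (Smang \<xi> N - Sprime \<xi> N) \<le> C" if c: "\<xi> \<in> dchars l" and l: "l > 0" for \<xi> l N
  proof -
    let ?f = "\<lambda>d. \<xi> d * of_real (mang d / real d)"
    have "Smang \<xi> N = (\<Sum>d\<in>{p\<in>{1..N}. prime p} \<union> {n\<in>{1..N}. \<not> prime n}. ?f d)"
      unfolding Smang_def by (intro sum.cong) auto
    also have "\<dots> = (\<Sum>d\<in>{p\<in>{1..N}. prime p}. ?f d) + (\<Sum>d\<in>{n\<in>{1..N}. \<not> prime n}. ?f d)"
      by (intro sum.union_disjoint) auto
    also have "(\<Sum>d\<in>{p\<in>{1..N}. prime p}. ?f d) = Sprime \<xi> N"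
      unfolding Sprime_def by (intro sum.cong) auto
    finally have "norm (Smang \<xi> N - Sprime \<xi> N) = norm (\<Sum>d\<in>{n\<in>{1..N}. \<not> prime n}. ?f d)" by simp
    also have "\<dots> \<le> (\<Sum>d\<in>{n\<in>{1..N}. \<not> prime n}. norm (?f d))" by (rule norm_sum)
    also have "\<dots> \<le> (\<Sum>d\<in>{n\<in>{1..N}. \<not> prime n}. 1 * (mang d / real d))"
      unfolding norm_mult using norm_dchars_le[OF c l] mangoldt_nonneg
      by (intro sum_mono mult_mono) (auto simp: norm_divide)
    also have "\<dots> \<le> C" using C[of N] by simp
    finally show ?thesis .
  qed
  thus ?thesis by blast
qed

lemma Sprime_principal:
  assumes l: "l > 0"
  shows "\<exists>C. \<forall>N. norm (Sprime (principal_char l) N - of_real (\<Sum>p\<in>{p\<in>{1..N}. prime p}. ln (real p) / real p)) \<le> C"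
proof -
  define C where "C = (\<Sum>p\<in>prime_factors l. ln (real p) / real p)"
  have "norm (Sprime (principal_char l) N - of_real (\<Sum>p\<in>{p\<in>{1..N}. prime p}. ln (real p) / real p)) \<le> C" for N
  proof -
    have "Sprime (principal_char l) N - of_real (\<Sum>p\<in>{p\<in>{1..N}. prime p}. ln (real p) / real p)
      = (\<Sum>p\<in>{p\<in>{1..N}. prime p}. (principal_char l p - 1) * of_real (ln (real p) / real p))"
      unfolding Sprime_def of_real_sum left_diff_distrib sum_subtractf by simp
    also have "norm \<dots> \<le> (\<Sum>p\<in>{p\<in>{1..N}. prime p}. norm ((principal_char l p - 1) * of_real (ln (real p) / real p)))"
      by (rule norm_sum)
    also have "\<dots> = (\<Sum>p\<in>{p\<in>{1..N}. prime p} \<inter> prime_factors l. ln (real p) / real p)"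
    proof (rule sum.mono_neutral_cong_right)
      show "\<forall>p\<in>{p\<in>{1..N}. prime p} - {p\<in>{1..N}. prime p} \<inter> prime_factors l.
         norm ((principal_char l p - 1) * of_real (ln (real p) / real p)) = 0"
      proof
        fix p assume p: "p \<in> {p\<in>{1..N}. prime p} - {p\<in>{1..N}. prime p} \<inter> prime_factors l"
        hence "\<not> p dvd l" using l by (auto simp: prime_factors_dvd)
        hence "coprime p l" using p by (intro prime_imp_coprime) auto
        thus "norm ((principal_char l p - 1) * of_real (ln (real p) / real p)) = 0" by (simp add: principal_char_def)
      qed
      fix p assume p: "p \<in> {p\<in>{1..N}. prime p} \<inter> prime_factors l"
      hence "\<not> coprime p l" by (metis IntD1 IntD2 in_prime_factors_imp_dvd mem_Collect_eq not_coprimeI dvd_refl not_prime_unit)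
      thus "norm ((principal_char l p - 1) * of_real (ln (real p) / real p)) = ln (real p) / real p"
        using p by (auto simp: principal_char_def norm_divide)
    qed auto
    also have "\<dots> \<le> C" unfolding C_def
      by (intro sum_mono2) (auto simp: prime_gt_0_nat Suc_le_eq intro!: divide_nonneg_nonneg ln_ge_zero dest: in_prime_factors_imp_prime)
    finally show ?thesis .
  qed
  thus ?thesis by blast
qed

text \<open>Real characters are covered by \<open>real_char_L_nonzero\<close>. A non-real one with
  vanishing value has its conjugate as a second one; then the sum over all characters, a nonnegative
  multiple of the prime sum over p congruent to 1, would be at most - log N + O(1).\<close>

lemma L_one_nonzero:
  assumes l: "l > 0" and c0: "\<xi> \<in> dchars l" "\<xi> \<noteq> principal_char l"
  shows "L_one l \<xi> \<noteq> 0"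
proof
  assume L0: "L_one l \<xi> = 0"
  define X where "X = dchars l"
  define Z where "Z = {\<xi>\<in>X. \<xi> \<noteq> principal_char l \<and> L_one l \<xi> = 0}"
  have finX: "finite X" unfolding X_def by (rule finite_dchars[OF l])
  have finZ: "finite Z" using finX by (simp add: Z_def)
  let ?cx = "\<lambda>n. cnj (\<xi> n)"
  have "?cx \<noteq> \<xi>" using real_char_L_nonzero[OF c0 l] L0 by blast
  moreover have "{\<xi>, ?cx} \<subseteq> Z" using c0 L0 L_one_cnj_zero[OF c0 l L0] dchars_cnj[OF c0(1)] by (auto simp: Z_def X_def)
  ultimately have card2: "card Z \<ge> 2" using card_mono[OF finZ, of "{\<xi>, ?cx}"] by (auto simp: card_insert_if)
  obtain C1 where C1: "\<And>\<xi> N. \<xi> \<in> X \<Longrightarrow> norm (Smang \<xi> N - Sprime \<xi> N) \<le> C1"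
    using Sprime_Smang l unfolding X_def by blast
  obtain C2 where C2: "\<And>N. norm (Sprime (principal_char l) N - of_real (\<Sum>p\<in>{p\<in>{1..N}. prime p}. ln (real p) / real p)) \<le> C2"
    using Sprime_principal[OF l] by blast
  obtain C3 where C3: "\<And>N. N > 0 \<Longrightarrow> \<bar>(\<Sum>p\<in>{p\<in>{1..N}. prime p}. ln (real p) / real p) - ln (real N)\<bar> \<le> C3"
    using sum_prime_ln_div by blast
  have "\<exists>C. \<forall>N>0. Re (Sprime \<psi> N) \<le> C - (if \<psi> \<in> Z then ln (real N) else if \<psi> = principal_char l then - ln (real N) else 0)"
    if psi: "\<psi> \<in> X" for \<psi>
  proof -
    consider "\<psi> = principal_char l" | "\<psi> \<in> Z" "\<psi> \<noteq> principal_char l" | "\<psi> \<notin> Z" "\<psi> \<noteq> principal_char l" by blast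
    thus ?thesis
    proof cases
      case 1
      have nz: "\<psi> \<notin> Z" using 1 by (simp add: Z_def)
      have "Re (Sprime \<psi> N) \<le> C2 + C3 + ln (real N)" if N: "N > 0" for N
        using abs_Re_le_cmod[of "Sprime \<psi> N - of_real (\<Sum>p\<in>{p\<in>{1..N}. prime p}. ln (real p) / real p)"] C2[of N] C3[OF N] 1
        by simp
      thus ?thesis using 1 nz by (intro exI[of _ "C2 + C3"]) auto
    next
      case 2
      have "Re (Sprime \<psi> N) \<le> C1 + 2 * real l - ln (real N)" if N: "N > 0" for N
      proof -
        have "norm (Smang \<psi> N + of_real (ln (real N))) \<le> 2 * real l"
          using 2 l N by (intro Smang_zero) (auto simp: Z_def X_def)
        hence "Re (Smang \<psi> N) + ln (real N) \<le> 2 * real l"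
          using abs_Re_le_cmod[of "Smang \<psi> N + of_real (ln (real N))"] by simp
        moreover have "Re (Sprime \<psi> N) - Re (Smang \<psi> N) \<le> C1"
          using abs_Re_le_cmod[of "Smang \<psi> N - Sprime \<psi> N"] C1[OF psi, of N] by simp
        ultimately show ?thesis by linarith
      qed
      thus ?thesis using 2 by (intro exI[of _ "C1 + 2 * real l"]) auto
    next
      case 3
      then obtain C where C: "\<And>N. norm (Smang \<psi> N) \<le> C"
        using Smang_bounded[of \<psi> l] psi l by (auto simp: Z_def X_def)
      have "Re (Sprime \<psi> N) \<le> C + C1" for N
        using abs_Re_le_cmod[of "Smang \<psi> N - Sprime \<psi> N"] C1[OF psi, of N] abs_Re_le_cmod[of "Smang \<psi> N"] C[of N] by simp
      thus ?thesis using 3 by (intro exI[of _ "C + C1"]) auto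
    qed
  qed
  then obtain K where K: "\<And>\<psi> N. \<psi> \<in> X \<Longrightarrow> N > 0 \<Longrightarrow> Re (Sprime \<psi> N) \<le> K \<psi> - (if \<psi> \<in> Z then ln (real N) else if \<psi> = principal_char l then - ln (real N) else 0)"
    by metis
  have bd: "ln (real N) \<le> (\<Sum>\<psi>\<in>X. K \<psi>)" if N: "N > 0" for N
  proof -
    have "0 \<le> Re (\<Sum>\<psi>\<in>X. Sprime \<psi> N)"
    proof -
      have "(\<Sum>\<psi>\<in>X. Sprime \<psi> N) = (\<Sum>p\<in>{p\<in>{1..N}. prime p}. (\<Sum>\<psi>\<in>X. \<psi> p) * of_real (ln (real p) / real p))"
        unfolding Sprime_def sum_distrib_right by (rule sum.swap)
      also have "\<dots> = (\<Sum>p\<in>{p\<in>{1..N}. prime p}. of_real (if [p = 1] (mod l) then real (card X) * (ln (real p) / real p) else 0))"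
      proof (intro sum.cong refl)
        fix p
        have "(\<Sum>\<psi>\<in>X. \<psi> p) = (\<Sum>\<psi>\<in>X. \<psi> 1 * \<psi> p)" unfolding X_def
          by (intro sum.cong refl) (simp add: dchars_1[simplified])
        also have "\<dots> = (if [p = 1] (mod l) then of_nat (card X) else 0)"
          unfolding X_def by (intro sum_dchars_indicator l) simp
        finally show "(\<Sum>\<psi>\<in>X. \<psi> p) * of_real (ln (real p) / real p) =
            of_real (if [p = 1] (mod l) then real (card X) * (ln (real p) / real p) else 0)" by simp
      qed
      also have "Re \<dots> = (\<Sum>p\<in>{p\<in>{1..N}. prime p}. if [p = 1] (mod l) then real (card X) * (ln (real p) / real p) else 0)"
        by (simp only: Re_sum Re_complex_of_real)
      also have "\<dots> \<ge> 0" by (intro sum_nonneg) auto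
      finally show ?thesis .
    qed
    also have "Re (\<Sum>\<psi>\<in>X. Sprime \<psi> N) \<le> (\<Sum>\<psi>\<in>X. K \<psi> - (if \<psi> \<in> Z then ln (real N) else if \<psi> = principal_char l then - ln (real N) else 0))"
      unfolding Re_sum using N by (intro sum_mono K)
    also have "\<dots> = (\<Sum>\<psi>\<in>X. K \<psi>) - ((\<Sum>\<psi>\<in>X. if \<psi> \<in> Z then ln (real N) else 0) + (\<Sum>\<psi>\<in>X. if \<psi> = principal_char l then - ln (real N) else 0))"
      unfolding sum_subtractf sum.distrib[symmetric]
      by (intro arg_cong2[of _ _ _ _ "(-)"] refl sum.cong) (auto simp: Z_def)
    also have "(\<Sum>\<psi>\<in>X. if \<psi> \<in> Z then ln (real N) else 0) = real (card Z) * ln (real N)"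
    proof -
      have "X \<inter> {\<psi>. \<psi> \<in> Z} = Z" by (auto simp: Z_def)
      thus ?thesis using finX by (simp add: sum.If_cases)
    qed
    also have "(\<Sum>\<psi>\<in>X. if \<psi> = principal_char l then - ln (real N) else 0) = - ln (real N)"
      using finX principal_char_in[OF l] by (simp add: X_def)
    finally have "(real (card Z) - 1) * ln (real N) \<le> (\<Sum>\<psi>\<in>X. K \<psi>)" by (simp add: algebra_simps)
    moreover have "1 * ln (real N) \<le> (real (card Z) - 1) * ln (real N)"
      using card2 N by (intro mult_right_mono) auto
    ultimately show ?thesis by linarith
  qed
  obtain N :: nat where "real N > exp (\<Sum>\<psi>\<in>X. K \<psi>)" using reals_Archimedean2 by blast
  moreover from this have "N > 0" by (metis exp_gt_zero gr0I less_numeral_extra(3) less_trans of_nat_0)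
  ultimately have "ln (real N) > (\<Sum>\<psi>\<in>X. K \<psi>)" by (metis exp_gt_zero exp_ln exp_less_cancel_iff less_trans)
  with bd[OF \<open>N > 0\<close>] show False by simp
qed

section \<open>Mertens' theorem in arithmetic progressions\<close>

text \<open>The density is the reciprocal of the number of characters; its value \<open>1 / \<phi>(l)\<close> plays no role here.\<close>

lemma prime_progression_ln_div:
  assumes l: "l > 0" and j: "coprime j l"
  shows "\<exists>h C. \<forall>N. \<bar>\<Sum>p\<in>{p\<in>{1..N}. prime p}. ((if [p = j] (mod l) then 1 else 0) - h) * (ln (real p) / real p)\<bar> \<le> C"
proof -
  define X where "X = dchars l"
  have finX: "finite X" unfolding X_def by (rule finite_dchars[OF l])
  have p0: "principal_char l \<in> X" unfolding X_def by (rule principal_char_in[OF l])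
  define n where "n = real (card X)"
  have n: "n > 0" using p0 finX by (auto simp: n_def card_gt_0_iff)
  obtain j' where j': "[j * j' = 1] (mod l)" using cong_solve_coprime_nat[OF j] by auto
  hence j'': "[j' * j = 1] (mod l)" by (simp add: mult.commute)
  have cj: "coprime j' l" using j'' by (metis coprime_1_left cong_imp_coprime cong_sym coprime_mult_left_iff)
  obtain C1 where C1: "\<And>\<xi> N. \<xi> \<in> X \<Longrightarrow> norm (Smang \<xi> N - Sprime \<xi> N) \<le> C1"
    using Sprime_Smang l unfolding X_def by blast
  obtain C2 where C2: "\<And>N. norm (Sprime (principal_char l) N - of_real (\<Sum>p\<in>{p\<in>{1..N}. prime p}. ln (real p) / real p)) \<le> C2"
    using Sprime_principal[OF l] by blast
  have "\<exists>C. \<forall>N. norm (Sprime \<psi> N) \<le> C" if psi: "\<psi> \<in> X - {principal_char l}" for \<psi>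
  proof -
    obtain C where C: "\<And>N. norm (Smang \<psi> N) \<le> C"
      using Smang_bounded[of \<psi> l] L_one_nonzero[of l \<psi>] psi l by (auto simp: X_def)
    have "norm (Sprime \<psi> N) \<le> C + C1" for N
    proof -
      have "norm (Sprime \<psi> N) \<le> norm (Smang \<psi> N) + norm (Smang \<psi> N - Sprime \<psi> N)"
        using norm_triangle_ineq4[of "Smang \<psi> N" "Smang \<psi> N - Sprime \<psi> N"] by simp
      thus ?thesis using C[of N] C1[of \<psi> N] psi by simp
    qed
    thus ?thesis by blast
  qed
  then obtain K where K: "\<And>\<psi> N. \<psi> \<in> X - {principal_char l} \<Longrightarrow> norm (Sprime \<psi> N) \<le> K \<psi>" by metis
  define C where "C = ((\<Sum>\<psi>\<in>X - {principal_char l}. K \<psi>) + C2) / n"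
  have "\<bar>\<Sum>p\<in>{p\<in>{1..N}. prime p}. ((if [p = j] (mod l) then 1 else 0) - 1 / n) * (ln (real p) / real p)\<bar> \<le> C" for N
  proof -
    let ?P = "{p\<in>{1..N}. prime p}"
    let ?S = "\<Sum>p\<in>?P. ((if [p = j] (mod l) then 1 else 0) - 1 / n) * (ln (real p) / real p)"
    let ?T = "\<Sum>p\<in>?P. ln (real p) / real p"
    \<comment> \<open>Orthogonality: multiplying by the value at j' and summing over the characters
      singles out the p congruent to j, with weight n, the number of characters.\<close>
    have "(\<Sum>\<psi>\<in>X. \<psi> j' * Sprime \<psi> N) = (\<Sum>\<psi>\<in>X. \<Sum>p\<in>?P. \<psi> j' * \<psi> p * of_real (ln (real p) / real p))"
      by (simp add: Sprime_def sum_distrib_left mult_ac)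
    also have "\<dots> = (\<Sum>p\<in>?P. \<Sum>\<psi>\<in>X. \<psi> j' * \<psi> p * of_real (ln (real p) / real p))" by (rule sum.swap)
    also have "\<dots> = (\<Sum>p\<in>?P. (\<Sum>\<psi>\<in>X. \<psi> j' * \<psi> p) * of_real (ln (real p) / real p))" by (simp only: sum_distrib_right)
    also have "\<dots> = (\<Sum>p\<in>?P. of_real (n * (if [p = j] (mod l) then 1 else 0) * (ln (real p) / real p)))"
      unfolding X_def sum_dchars_indicator[OF l j''] by (intro sum.cong) (auto simp: n_def X_def)
    finally have e1: "(\<Sum>\<psi>\<in>X. \<psi> j' * Sprime \<psi> N) = of_real (\<Sum>p\<in>?P. n * (if [p = j] (mod l) then 1 else 0) * (ln (real p) / real p))"
      by (simp only: of_real_sum)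
    have "n * ?S = (\<Sum>p\<in>?P. n * (if [p = j] (mod l) then 1 else 0) * (ln (real p) / real p)) - ?T"
      unfolding sum_distrib_left sum_subtractf[symmetric] using n by (intro sum.cong) (auto simp: algebra_simps)
    hence e2: "complex_of_real (n * ?S) = (\<Sum>\<psi>\<in>X. \<psi> j' * Sprime \<psi> N) - of_real ?T"
      by (simp only: e1 of_real_diff)
    \<comment> \<open>The principal character carries the main term and differs from the full prime
      sum by O(1). The other characters contribute bounded sums because their L-values do not
      vanish.\<close>
    have "(\<Sum>\<psi>\<in>X. \<psi> j' * Sprime \<psi> N) = Sprime (principal_char l) N + (\<Sum>\<psi>\<in>X - {principal_char l}. \<psi> j' * Sprime \<psi> N)"
      using finX p0 cj by (subst sum.remove[of _ "principal_char l"]) (auto simp: principal_char_def)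
    hence "complex_of_real (n * ?S) = (Sprime (principal_char l) N - of_real ?T) + (\<Sum>\<psi>\<in>X - {principal_char l}. \<psi> j' * Sprime \<psi> N)"
      using e2 by simp
    hence "norm (complex_of_real (n * ?S)) \<le> norm (Sprime (principal_char l) N - of_real ?T) + norm (\<Sum>\<psi>\<in>X - {principal_char l}. \<psi> j' * Sprime \<psi> N)"
      by (simp only: norm_triangle_ineq)
    also have "norm (\<Sum>\<psi>\<in>X - {principal_char l}. \<psi> j' * Sprime \<psi> N) \<le> (\<Sum>\<psi>\<in>X - {principal_char l}. norm (\<psi> j' * Sprime \<psi> N))" by (rule norm_sum)
    also have "\<dots> \<le> (\<Sum>\<psi>\<in>X - {principal_char l}. 1 * K \<psi>)"
      unfolding norm_mult by (intro sum_mono mult_mono K norm_dchars_le[OF _ l]) (auto simp: X_def)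
    also have "norm (Sprime (principal_char l) N - of_real ?T) \<le> C2" by (rule C2)
    finally have "\<bar>n * ?S\<bar> \<le> C2 + (\<Sum>\<psi>\<in>X - {principal_char l}. 1 * K \<psi>)" by (simp only: norm_of_real add_right_mono)
    hence "n * \<bar>?S\<bar> \<le> C * n" using n by (simp add: abs_mult C_def)
    thus ?thesis using n by (simp add: mult.commute[of n])
  qed
  thus ?thesis by blast
qed

lemma primes_upto_Suc_interval: "t \<ge> 0 \<Longrightarrow> primes_upto t = {p\<in>{1..nat \<lfloor>t\<rfloor>}. prime p}"
  by (auto simp: primes_upto_def le_nat_floor prime_gt_0_nat Suc_le_eq le_nat_iff le_floor_iff)

text \<open>Abel summation with weight 1/log n removes the factor log p and yields a Cauchy sequence
  with an explicit rate. The limit c cancels later, because these sums enter only through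
  differences.\<close>

lemma prime_progression_inverse:
  assumes l: "l > 0" and j: "coprime j l"
  shows "\<exists>h c C. C > 0 \<and> (\<forall>t\<ge>2. \<bar>(\<Sum>p\<in>primes_upto t. ((if [p = j] (mod l) then 1 else 0) - h) / real p) - c\<bar> \<le> C / ln t)"
proof -
  obtain h C where C: "\<And>N. \<bar>\<Sum>p\<in>{p\<in>{1..N}. prime p}. ((if [p = j] (mod l) then 1 else 0) - h) * (ln (real p) / real p)\<bar> \<le> C"
    using prime_progression_ln_div[OF assms] by blast
  have C0: "C \<ge> 0" using C[of 0] by simp
  define b where "b = (\<lambda>p. (if [p = j] (mod l) then 1 else 0) - h)"
  define a where "a = (\<lambda>p. if prime p then b p * (ln (real p) / real p) else 0)"
  define F where "F = (\<lambda>N::nat. \<Sum>p\<in>{p\<in>{1..N}. prime p}. b p / real p)"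
  have diff: "\<bar>F N - F M\<bar> \<le> 2 * C / ln (real (Suc M))" if MN: "M \<ge> 1" "M \<le> N" for M N
  proof (cases "M = N")
    case False
    hence lt: "M < N" using MN by simp
    have A: "\<bar>\<Sum>i\<in>{M<..n}. a i\<bar> \<le> 2 * C" if n: "M < n" for n
    proof -
      have "(\<Sum>i\<in>{M<..n}. a i) = (\<Sum>p\<in>{p\<in>{1..n}. prime p} - {p\<in>{1..M}. prime p}. b p * (ln (real p) / real p))"
        unfolding a_def by (intro sum.mono_neutral_cong_right) auto
      also have "\<dots> = (\<Sum>p\<in>{p\<in>{1..n}. prime p}. b p * (ln (real p) / real p)) - (\<Sum>p\<in>{p\<in>{1..M}. prime p}. b p * (ln (real p) / real p))"
        using n by (intro sum_diff) auto
      finally show ?thesis using C[of n] C[of M] unfolding b_def by linarith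
    qed
    have "F N - F M = (\<Sum>p\<in>{p\<in>{1..N}. prime p} - {p\<in>{1..M}. prime p}. b p / real p)"
      unfolding F_def using lt by (intro sum_diff[symmetric]) auto
    also have "\<dots> = (\<Sum>i\<in>{M<..N}. (1 / ln (real i)) *\<^sub>R a i)"
      using MN by (intro sum.mono_neutral_cong_left) (auto simp: a_def)
    finally have "\<bar>F N - F M\<bar> = norm (\<Sum>i\<in>{M<..N}. (1 / ln (real i)) *\<^sub>R a i)" by simp
    also have "\<dots> \<le> 2 * C * (1 / ln (real (Suc M)))"
      by (intro abel_sum lt) (use A MN in \<open>auto intro!: divide_left_mono mult_pos_pos\<close>)
    finally show ?thesis by simp
  qed (use C0 MN in \<open>auto intro!: divide_nonneg_nonneg ln_ge_zero\<close>)
  have lim0: "(\<lambda>M. 2 * C / ln (real (Suc M))) \<longlonglongrightarrow> 0" by real_asymp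
  have "Cauchy F"
  proof (rule CauchyI)
    fix e :: real assume e: "e > 0"
    have "\<forall>\<^sub>F M in sequentially. 2 * C / ln (real (Suc M)) < e" using order_tendstoD(2)[OF lim0 e] .
    then obtain K where K: "\<And>M. M \<ge> K \<Longrightarrow> 2 * C / ln (real (Suc M)) < e" by (auto simp: eventually_at_top_linorder)
    show "\<exists>M. \<forall>m\<ge>M. \<forall>n\<ge>M. norm (F m - F n) < e"
    proof (intro exI[of _ "max 1 K"] allI impI)
      fix m n assume mn: "m \<ge> max 1 K" "n \<ge> max 1 K"
      show "norm (F m - F n) < e"
      proof (cases "n \<le> m")
        case True
        thus ?thesis using diff[of n m] K[of n] mn by simp
      next
        case False
        thus ?thesis using diff[of m n] K[of m] mn by (simp add: abs_minus_commute)
      qed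
    qed
  qed
  then obtain c where c: "F \<longlonglongrightarrow> c" using Cauchy_convergent convergent_def by blast
  have lim: "\<bar>F M - c\<bar> \<le> 2 * C / ln (real (Suc M))" if "M \<ge> 1" for M
  proof -
    have "\<bar>c - F M\<bar> \<le> 2 * C / ln (real (Suc M))"
    proof (rule tendsto_upperbound[of "\<lambda>N. \<bar>F N - F M\<bar>" _ sequentially])
      show "(\<lambda>N. \<bar>F N - F M\<bar>) \<longlonglongrightarrow> \<bar>c - F M\<bar>" by (intro tendsto_intros c)
      show "\<forall>\<^sub>F N in sequentially. \<bar>F N - F M\<bar> \<le> 2 * C / ln (real (Suc M))"
        using diff that by (auto simp: eventually_at_top_linorder)
    qed auto
    thus ?thesis by (simp add: abs_minus_commute)
  qed
  have "\<bar>(\<Sum>p\<in>primes_upto t. b p / real p) - c\<bar> \<le> (2 * C + 1) / ln t" if t: "t \<ge> 2" for t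
  proof -
    \<comment> \<open>The rate holds with M + 1 in the logarithm, and t \<le> M + 1; so rounding t
      down to an integer does not weaken the bound 1 / log t.\<close>
    define M where "M = nat \<lfloor>t\<rfloor>"
    have M: "M \<ge> 1" "t \<le> real (Suc M)" using t by (auto simp: M_def le_nat_iff) linarith
    have "(\<Sum>p\<in>primes_upto t. b p / real p) = F M"
      unfolding F_def M_def using t by (subst primes_upto_Suc_interval) auto
    hence "\<bar>(\<Sum>p\<in>primes_upto t. b p / real p) - c\<bar> \<le> 2 * C / ln (real (Suc M))" using lim[OF M(1)] by simp
    also have "\<dots> \<le> (2 * C + 1) / ln t" using M t C0 by (intro frac_le) auto
    finally show ?thesis .
  qed
  moreover have "2 * C + 1 > 0" using C0 by simp
  ultimately show ?thesis unfolding b_def by blast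
qed

section \<open>Newman's contour integral\<close>

lemma powr_diff_mvt:
  fixes a :: real
  assumes "x > 0" "x < y"
  shows "\<exists>z. x < z \<and> z < y \<and> y powr a - x powr a = (y - x) * (a * z powr (a - 1))"
proof (rule MVT2[OF assms(2)])
  fix z assume "x \<le> z" "z \<le> y"
  thus "((\<lambda>x. x powr a) has_real_derivative a * z powr (a - 1)) (at z)"
    using assms by (intro has_real_derivative_powr) auto
qed

text \<open>Comparison with the integral of u^(a-1). For a \<ge> 1 the integrand does not decrease
  and the last term has to be added separately; for a < 1 it decreases and the integral alone is an
  upper bound.\<close>

lemma sum_powr_le:
  assumes "N > 0" "(a::real) > 0"
  shows "(\<Sum>n=1..N. real n powr (a - 1)) \<le> real N powr (a - 1) + real N powr a / a"
proof (cases "a \<ge> 1")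
  case True
  have "(\<Sum>n=1..<N. real n powr (a - 1)) \<le> real N powr a / a" if "N > 0" for N
    using that
  proof (induction N rule: nat_induct_non_zero)
    case (Suc n)
    obtain z where z: "real n < z" "z < real (Suc n)"
      "real (Suc n) powr a - real n powr a = (real (Suc n) - real n) * (a * z powr (a - 1))"
      using powr_diff_mvt[of "real n" "real (Suc n)" a] Suc.hyps by auto
    have "real n powr (a - 1) \<le> z powr (a - 1)" using z True by (intro powr_mono2) auto
    hence "real n powr (a - 1) \<le> (real (Suc n) powr a - real n powr a) / a"
      using z assms by (simp add: field_simps)
    thus ?case using Suc by (simp add: diff_divide_distrib)
  qed (use assms in auto)
  moreover have "{1..N} = insert N {1..<N}" using assms by auto
  ultimately show ?thesis using assms by simp
next
  case False
  have "(\<Sum>n=1..N. real n powr (a - 1)) \<le> real N powr a / a" if "N > 0" for N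
    using that
  proof (induction N rule: nat_induct_non_zero)
    case 1
    show ?case using False assms by (simp add: field_simps)
  next
    case (Suc n)
    obtain z where z: "real n < z" "z < real (Suc n)"
      "real (Suc n) powr a - real n powr a = (real (Suc n) - real n) * (a * z powr (a - 1))"
      using powr_diff_mvt[of "real n" "real (Suc n)" a] Suc.hyps by auto
    have "real (Suc n) powr (a - 1) \<le> z powr (a - 1)" using z False Suc.hyps
      by (intro powr_mono2') auto
    hence "real (Suc n) powr (a - 1) \<le> (real (Suc n) powr a - real n powr a) / a"
      using z assms by (simp add: field_simps)
    thus ?case using Suc by (simp add: diff_divide_distrib)
  qed
  from this[of N] show ?thesis using assms by (smt (verit) powr_ge_zero)
qed

lemma sum_powr_tail_le:
  assumes "N > 0" "N \<le> M" "(x::real) > 0"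
  shows "(\<Sum>n=N+1..M. real n powr (-1-x)) \<le> (real N powr (-x) - real M powr (-x)) / x"
  using assms(2)
proof (induction M rule: dec_induct)
  case (step n)
  have n: "n > 0" using step assms by auto
  obtain z where z: "real n < z" "z < real (Suc n)"
      "real (Suc n) powr (-x) - real n powr (-x) = (real (Suc n) - real n) * ((-x) * z powr ((-x) - 1))"
    using powr_diff_mvt[of "real n" "real (Suc n)" "-x"] n by auto
  have "real (Suc n) powr (-1-x) \<le> z powr (-1-x)" using z n assms
    by (intro powr_mono2') auto
  hence "real (Suc n) powr (-1-x) \<le> z powr (-x-1)" by (simp only: diff_conv_add_uminus add.commute)
  hence "x * real (Suc n) powr (-1-x) \<le> x * z powr (-x-1)"
    using assms by (intro mult_left_mono) auto
  moreover have "real (Suc n) powr (-x) - real n powr (-x) = - (x * z powr (-x-1))"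
    using z(3) by simp
  ultimately have "x * real (Suc n) powr (-1-x) \<le> real n powr (-x) - real (Suc n) powr (-x)"
    by linarith
  hence "real (Suc n) powr (-1-x) \<le> (real n powr (-x) - real (Suc n) powr (-x)) / x"
    using assms by (simp only: pos_le_divide_eq mult.commute)
  thus ?case using step by (simp add: diff_divide_distrib)
qed simp

lemma norm_of_nat_powr: "norm ((of_nat n :: complex) powr s) = real n powr Re s"
  by (simp add: norm_powr_real_powr)

lemma circle_integral_split:
  assumes h: "h holomorphic_on UNIV" and R: "R > 0"
  shows "((\<lambda>z. h z / z) has_contour_integral
           2 * of_real pi * \<i> * h 0
           - contour_integral (part_circlepath 0 R (-pi/2) (pi/2)) (\<lambda>z. h z / z))
         (part_circlepath 0 R (pi/2) (3*pi/2))"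
proof -
  let ?f = "\<lambda>z. h z / z"
  let ?g = "\<lambda>t. ?f (0 + R * cis t) * R * \<i> * cis t"
  have cont: "continuous_on S ?f" if "0 \<notin> S" for S
    using that by (intro continuous_intros holomorphic_on_imp_continuous_on holomorphic_on_subset[OF h]) auto
  have inta: "?g integrable_on {a..b}" if "a < b" for a b
  proof -
    have "?f contour_integrable_on (part_circlepath 0 R a b)"
      using that R by (intro contour_integrable_continuous_part_circlepath cont)
        (auto dest: in_path_image_part_circlepath)
    thus ?thesis using that by (simp add: contour_integrable_part_circlepath_iff)
  qed
  \<comment> \<open>The standard circle starts at angle 0, whereas the two arcs meet at -pi/2 and
    pi/2. The rotated integrand \<open>k\<close> shifts the parameter by -pi/2.\<close>
  define k where "k = (\<lambda>z. h (-\<i> * z))"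
  have "k holomorphic_on UNIV" unfolding k_def
    by (intro holomorphic_on_compose_gen[OF _ h, unfolded o_def] holomorphic_intros) auto
  hence "((\<lambda>z. k z / (z - 0)) has_contour_integral (2 * of_real pi * \<i> * k 0)) (circlepath 0 R)"
    using R by (intro Cauchy_integral_circlepath_simple) (auto intro: holomorphic_on_subset)
  hence "((\<lambda>t. k (0 + R * cis t) / (0 + R * cis t) * R * \<i> * cis t) has_integral 2 * of_real pi * \<i> * h 0) {0..2*pi}"
    by (subst (asm) circlepath_def, subst (asm) has_contour_integral_part_circlepath_iff) (auto simp: k_def)
  also have "(\<lambda>t. k (0 + R * cis t) / (0 + R * cis t) * R * \<i> * cis t) = (\<lambda>t. ?g (t + (-pi/2)))"
  proof
    fix t
    have "cis (t + (-pi/2)) = -\<i> * cis t"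
      by (simp add: cis_mult[symmetric] complex_eq_iff cos_diff sin_diff cos_add sin_add)
    moreover have "cis t \<noteq> 0" by simp
    ultimately show "k (0 + R * cis t) / (0 + R * cis t) * R * \<i> * cis t = ?g (t + (-pi/2))"
      using R by (simp add: k_def field_simps)
  qed
  also have "(\<lambda>t. ?g (t + (-pi/2))) = ?g \<circ> ((+) (-pi/2))"
    by (simp only: o_def add.commute)
  finally have "(?g has_integral 2 * of_real pi * \<i> * h 0) {0 + (-pi/2)..2*pi + (-pi/2)}"
    by (simp only: has_integral_shift_Icc_real)
  moreover have "0 + (-pi/2) = -pi/2" "2*pi + (-pi/2) = 3*pi/2" by simp_all
  ultimately have full: "(?g has_integral 2 * of_real pi * \<i> * h 0) {-pi/2..3*pi/2}"
    by (simp only:)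
  have "integral {-pi/2..pi/2} ?g + integral {pi/2..3*pi/2} ?g = integral {-pi/2..3*pi/2} ?g"
    using pi_gt_zero by (intro Henstock_Kurzweil_Integration.integral_combine has_integral_integrable[OF full]) auto
  hence "integral {pi/2..3*pi/2} ?g = 2 * of_real pi * \<i> * h 0 - integral {-pi/2..pi/2} ?g"
    using integral_unique[OF full] by (simp add: algebra_simps)
  moreover have "(?g has_integral integral {pi/2..3*pi/2} ?g) {pi/2..3*pi/2}"
    using inta[of "pi/2" "3*pi/2"] by (auto simp: has_integral_integral)
  moreover have "contour_integral (part_circlepath 0 R (-pi/2) (pi/2)) ?f = integral {-pi/2..pi/2} ?g"
    by (intro contour_integral_part_circlepath_eq) auto
  ultimately show ?thesis
    by (subst has_contour_integral_part_circlepath_iff) auto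
qed

text \<open>On norm z = R one has 1/z = cnj z / R^2, so the kernel 1/z + z/R^2 equals 2 Re z / R^2.
  Its zeros at the ends of the arcs cancel the factor 1 / Re z in the estimates of the Dirichlet
  polynomial and of its tail.\<close>

lemma norm_newman_kernel_circle:
  assumes "norm z = R" "R > 0"
  shows "norm ((1 + z\<^sup>2 / of_real R ^ 2) / z) = 2 * \<bar>Re z\<bar> / R\<^sup>2"
proof -
  have z0: "z \<noteq> 0" using assms by auto
  have "z * cnj z = of_real (R ^ 2)"
    using assms by (simp add: complex_norm_square[symmetric])
  hence "(of_real R)\<^sup>2 = z * cnj z" by simp
  hence "(1 + z\<^sup>2 / of_real R ^ 2) / z = (cnj z + z) / of_real R ^ 2"
    using z0 assms by (simp add: field_simps power2_eq_square)
  also have "\<dots> = of_real (2 * Re z / R\<^sup>2)"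
    by (simp add: complex_add_cnj add.commute[of "cnj z"])
  finally show ?thesis using assms by (simp only: norm_of_real) (simp add: abs_mult)
qed

text \<open>The end points, where Re z = 0, are excluded; the bound for arc integrals tolerates a
  finite exceptional set.\<close>

lemma Re_pos_right_arc:
  assumes "z \<in> path_image (part_circlepath 0 R (-pi/2) (pi/2)) - {\<i> * of_real R, - \<i> * of_real R}" "R > 0"
  shows "Re z > 0" "norm z = R"
proof -
  obtain t where t: "-pi/2 \<le> t" "t \<le> pi/2" "z = of_real R * exp (\<i> * of_real t)"
    using assms by (auto simp: path_image_part_circlepath)
  show "norm z = R" using t assms by (simp add: norm_mult)
  have "t \<noteq> pi/2"
  proof
    assume "t = pi/2"
    have "exp (\<i> * complex_of_real pi / 2) = \<i>" using cis_conv_exp[of "pi/2"] by simp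
    thus False using assms(1) unfolding t(3) \<open>t = pi/2\<close>
      by (simp add: cis_conv_exp[symmetric] mult.commute)
  qed
  moreover have "t \<noteq> -(pi/2)"
  proof
    assume "t = -(pi/2)"
    hence "cis t = - \<i>" by (simp add: complex_eq_iff)
    hence "z = - \<i> * of_real R" using t by (simp add: cis_conv_exp[symmetric])
    thus False using assms by auto
  qed
  ultimately have "cos t > 0" using t by (intro cos_gt_zero_pi) auto
  thus "Re z > 0" using t assms by (simp add: cis_conv_exp[symmetric])
qed

lemma Re_neg_left_arc:
  assumes "z \<in> path_image (part_circlepath 0 R (pi/2) (3*pi/2)) - {\<i> * of_real R, - \<i> * of_real R}" "R > 0"
  shows "Re z < 0" "norm z = R"
proof -
  obtain t where t: "pi/2 \<le> t" "t \<le> 3*pi/2" "z = of_real R * exp (\<i> * of_real t)"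
    using assms by (auto simp: path_image_part_circlepath)
  show "norm z = R" using t assms by (simp add: norm_mult)
  have "t \<noteq> pi/2"
  proof
    assume "t = pi/2"
    have "exp (\<i> * complex_of_real pi / 2) = \<i>" using cis_conv_exp[of "pi/2"] by simp
    thus False using assms(1) unfolding t(3) \<open>t = pi/2\<close>
      by (simp add: cis_conv_exp[symmetric] mult.commute)
  qed
  moreover have "t - pi \<noteq> pi/2"
  proof
    assume "t - pi = pi/2"
    hence *: "t = pi/2 + pi" by simp
    have "cis t = - \<i>" unfolding * by (simp only: cis_mult[symmetric]) simp
    hence "z = - \<i> * of_real R" using t by (simp add: cis_conv_exp[symmetric])
    thus False using assms by auto
  qed
  ultimately have "cos (t - pi) > 0" using t by (intro cos_gt_zero_pi) auto
  hence "cos t < 0" by (simp add: cos_diff)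
  thus "Re z < 0" using t assms by (simp add: cis_conv_exp[symmetric] mult_pos_neg)
qed

text \<open>The partial sum is an integral over the right half of the circle of radius \<open>R\<close> against the kernel \<open>N^z (1/z + z/R^2)\<close>. Since the Dirichlet series is \<open>z * G z\<close>, it has no residue at 0, and its integral can be pushed to abscissa \<open>-d\<close>.\<close>

lemma newman_bound:
  fixes a :: "nat \<Rightarrow> complex" and G :: "complex \<Rightarrow> complex"
  assumes a: "\<And>n. norm (a n) \<le> 1" and N: "N > 0" and R: "R \<ge> 1" and d: "0 < d" "d \<le> 1" and B: "B \<ge> 0"
    and hol: "G holomorphic_on {z. Re z \<ge> -d \<and> \<bar>Im z\<bar> \<le> R}"
    and ser: "\<And>z. Re z > 0 \<Longrightarrow> \<bar>Im z\<bar> \<le> R \<Longrightarrow>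
                (\<lambda>n. a (Suc n) * of_nat (Suc n) powr (-(1+z))) sums (z * G z)"
    and bd: "\<And>z. -d \<le> Re z \<Longrightarrow> Re z \<le> 0 \<Longrightarrow> \<bar>Im z\<bar> \<le> R \<Longrightarrow> norm (G z) \<le> B"
  shows "norm (\<Sum>n=1..N. a n / of_nat n) \<le> 2 / R + 1 / real N + B * R * real N powr (-d) + B * d\<^sup>2 / R"
proof -
  define S where "S = (\<lambda>z. \<Sum>n=1..N. a n * of_nat n powr (-(1+z)))"
  define E where "E = (\<lambda>z::complex. of_nat N powr z * (1 + z\<^sup>2 / of_real R ^ 2))"
  define h where "h = (\<lambda>z. S z * E z)"
  define Phi where "Phi = (\<lambda>z. G z * E z)"
  let ?D = "{z. Re z \<ge> -d \<and> \<bar>Im z\<bar> \<le> R}"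
  let ?Ap = "part_circlepath 0 R (-pi/2) (pi/2)" and ?Am = "part_circlepath 0 R (pi/2) (3*pi/2)"
  let ?K = "{\<i> * of_real R, - \<i> * of_real R}"
  have R0: "R > 0" using R by simp
  have holE: "E holomorphic_on UNIV" unfolding E_def using R0
    by (intro holomorphic_intros) auto
  have holh: "h holomorphic_on UNIV" unfolding h_def S_def
    by (intro holomorphic_intros holE)
  have holPhi: "Phi holomorphic_on ?D" unfolding Phi_def
    by (intro holomorphic_intros hol holomorphic_on_subset[OF holE]) auto
  have h0: "h 0 = (\<Sum>n=1..N. a n / of_nat n)"
    using N by (simp add: h_def S_def E_def powr_minus field_simps)
  have nE: "norm (E z) = real N powr Re z * norm (1 + z\<^sup>2 / of_real R ^ 2)" for z
    by (simp add: E_def norm_mult norm_of_nat_powr)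
  have nEz: "norm (E z / z) = real N powr Re z * (2 * \<bar>Re z\<bar> / R\<^sup>2)" if "norm z = R" for z
  proof -
    have eq: "E z / z = of_nat N powr z * ((1 + z\<^sup>2 / of_real R ^ 2) / z)" by (simp add: E_def)
    show ?thesis unfolding eq norm_mult norm_of_nat_powr norm_newman_kernel_circle[OF that R0] ..
  qed
  have Im_arc: "\<bar>Im z\<bar> \<le> R" if "norm z = R" for z
    using abs_Im_le_cmod[of z] that by simp

  define I1 where "I1 = contour_integral ?Ap (\<lambda>z. h z / z)"
  have Am: "((\<lambda>z. h z / z) has_contour_integral 2 * of_real pi * \<i> * h 0 - I1) ?Am"
    unfolding I1_def by (rule circle_integral_split[OF holh R0])
  \<comment> \<open>Left arc: the polynomial S is entire, and with x = - Re z its size N^x / x is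
    met by the kernel N^(-x) 2x / R^2. The extra N^(x-1) is the source of the term 1/N.\<close>
  have bound1: "norm (2 * of_real pi * \<i> * h 0 - I1) \<le> (2 / (R * real N) + 2 / R\<^sup>2) * R * (3*pi/2 - pi/2)"
  proof (rule has_contour_integral_bound_part_circlepath_strong[OF Am, of ?K])
    fix z assume z: "z \<in> path_image ?Am - ?K"
    define x where "x = - Re z"
    have x: "x > 0" "norm z = R" using Re_neg_left_arc[OF z R0] by (auto simp: x_def)
    have xR: "x \<le> R" using x abs_Re_le_cmod[of z] by (simp add: x_def)
    have "norm (S z) \<le> (\<Sum>n=1..N. norm (a n * of_nat n powr (-(1+z))))"
      unfolding S_def by (rule norm_sum)
    also have "\<dots> \<le> (\<Sum>n=1..N. 1 * real n powr (-1 - Re z))"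
      unfolding norm_mult norm_of_nat_powr by (intro sum_mono mult_mono a) auto
    also have "-1 - Re z = x - 1" by (simp add: x_def)
    also have "(\<Sum>n=1..N. 1 * real n powr (x - 1)) = (\<Sum>n=1..N. real n powr (x - 1))" by simp
    also have "\<dots> \<le> real N powr (x - 1) + real N powr x / x"
      using sum_powr_le[OF N x(1)] by simp
    finally have S: "norm (S z) \<le> real N powr (x - 1) + real N powr x / x" .
    have "norm (h z / z) = norm (S z) * norm (E z / z)" by (simp add: h_def norm_mult norm_divide)
    also have "\<dots> = norm (S z) * (real N powr (-x) * (2 * x / R\<^sup>2))"
      using x nEz[of z] by (simp add: x_def)
    also have "\<dots> \<le> (real N powr (x - 1) + real N powr x / x) * (real N powr (-x) * (2 * x / R\<^sup>2))"
      using x by (intro mult_right_mono S) auto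
    also have "\<dots> = (1 / real N + 1 / x) * (2 * x / R\<^sup>2)"
    proof -
      define P where "P = real N powr x"
      have "P > 0" using N by (simp add: P_def)
      have eqs: "real N powr (x - 1) = P / real N" "real N powr (-x) = 1 / P"
        using N by (simp_all add: P_def powr_diff powr_minus field_simps)
      show ?thesis unfolding eqs P_def[symmetric] using N x R0 \<open>P > 0\<close> by (simp add: field_simps)
    qed
    also have "\<dots> = 2 * (x / R) / (R * real N) + 2 / R\<^sup>2"
      using N x R0 by (simp add: field_simps power2_eq_square)
    also have "\<dots> \<le> 2 * 1 / (R * real N) + 2 / R\<^sup>2"
      using xR R0 N by (intro add_mono divide_right_mono mult_left_mono) auto
    finally show "norm (h z / z) \<le> 2 / (R * real N) + 2 / R\<^sup>2" by simp
  qed (use R0 N in auto)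

  have arc_sub: "path_image ?Ap \<subseteq> ?D"
  proof
    fix z assume z: "z \<in> path_image ?Ap"
    show "z \<in> ?D"
    proof (cases "z \<in> ?K")
      case True
      thus ?thesis using R0 d by auto
    next
      case False
      hence "Re z > 0" "norm z = R" using Re_pos_right_arc[of z R] z R0 by auto
      thus ?thesis using Im_arc d by auto
    qed
  qed
  have cont_Phi: "continuous_on S Phi" if "S \<subseteq> ?D" for S
    using holPhi that by (meson continuous_on_subset holomorphic_on_imp_continuous_on)
  have intPhi: "Phi contour_integrable_on ?Ap"
    by (intro contour_integrable_continuous_part_circlepath cont_Phi arc_sub)
  have inth: "(\<lambda>z. h z / z) contour_integrable_on ?Ap"
    using R0 by (intro contour_integrable_continuous_part_circlepath continuous_intros
      holomorphic_on_imp_continuous_on holomorphic_on_subset[OF holh])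
      (auto dest: in_path_image_part_circlepath)
  define J where "J = contour_integral ?Ap Phi"
  have "((\<lambda>z. h z / z - Phi z) has_contour_integral I1 - J) ?Ap"
    unfolding I1_def J_def by (intro has_contour_integral_diff has_contour_integral_integral inth intPhi)
  \<comment> \<open>Right arc: series minus polynomial is a tail of size N^(-x) / x, which the
    kernel N^x 2x / R^2 compensates.\<close>
  hence bound2: "norm (I1 - J) \<le> (2 / R\<^sup>2) * R * (pi/2 - (-pi/2))"
  proof (rule has_contour_integral_bound_part_circlepath_strong[of _ _ _ _ _ _ ?K])
    fix z assume z: "z \<in> path_image ?Ap - ?K"
    define x where "x = Re z"
    have x: "x > 0" "norm z = R" using Re_pos_right_arc[OF z R0] by (auto simp: x_def)
    have z0: "z \<noteq> 0" using x R0 by auto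
    let ?f = "\<lambda>n. a (Suc n) * of_nat (Suc n) powr (-(1+z))"
    have sums: "?f sums (z * G z)"
      using x Im_arc by (intro ser) (auto simp: x_def)
    have "(\<lambda>M. norm ((\<Sum>n<M. ?f n) - S z)) \<longlonglongrightarrow> norm (z * G z - S z)"
      using sums by (intro tendsto_intros) (simp add: sums_def)
    moreover have "norm ((\<Sum>n<M. ?f n) - S z) \<le> real N powr (-x) / x" if "M \<ge> N" for M
    proof -
      have "(\<Sum>n<M. ?f n) = (\<Sum>n=1..M. a n * of_nat n powr (-(1+z)))"
        by (intro sum.reindex_bij_witness[of _ "\<lambda>n. n - 1" Suc]) auto
      also have "\<dots> - S z = (\<Sum>n=N+1..M. a n * of_nat n powr (-(1+z)))"
      proof -
        have "{1..M} = {1..N} \<union> {N+1..M}" using that by auto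
        thus ?thesis unfolding S_def by (simp add: sum.union_disjoint)
      qed
      finally have "norm ((\<Sum>n<M. ?f n) - S z) \<le> (\<Sum>n=N+1..M. norm (a n * of_nat n powr (-(1+z))))"
        by (simp add: norm_sum)
      also have "\<dots> \<le> (\<Sum>n=N+1..M. 1 * real n powr (-1-x))"
        unfolding norm_mult norm_of_nat_powr by (intro sum_mono mult_mono a) (auto simp: x_def)
      also have "\<dots> \<le> (real N powr (-x) - real M powr (-x)) / x"
        using sum_powr_tail_le[OF N that x(1)] by simp
      also have "\<dots> \<le> real N powr (-x) / x" using x by (intro divide_right_mono) auto
      finally show ?thesis .
    qed
    ultimately have S: "norm (z * G z - S z) \<le> real N powr (-x) / x"
      by (intro tendsto_upperbound[of _ _ sequentially]) (auto simp: eventually_at_top_linorder)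
    have eq: "h z / z - Phi z = - ((z * G z - S z) * (E z / z))"
      using z0 by (simp add: h_def Phi_def field_simps)
    have "norm (h z / z - Phi z) = norm (z * G z - S z) * norm (E z / z)"
      unfolding eq norm_minus_cancel norm_mult ..
    also have "\<dots> = norm (z * G z - S z) * (real N powr x * (2 * x / R\<^sup>2))"
      unfolding nEz[OF x(2)] using x by (simp add: x_def)
    also have "\<dots> \<le> real N powr (-x) / x * (real N powr x * (2 * x / R\<^sup>2))"
      using x by (intro mult_right_mono S) auto
    also have "\<dots> = 2 / R\<^sup>2" using x N by (simp add: powr_minus field_simps)
    finally show "norm (h z / z - Phi z) \<le> 2 / R\<^sup>2" .
  qed (use R0 in auto)

  let ?p1 = "\<i> * of_real R" and ?p2 = "-of_real d + \<i> * of_real R" and ?p3 = "-of_real d - \<i> * of_real R"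
    and ?p4 = "- \<i> * of_real R"
  have ends: "pathstart ?Ap = ?p4" "pathfinish ?Ap = ?p1"
  proof -
    have "exp (\<i> * complex_of_real pi / 2) = \<i>" "exp (- (\<i> * complex_of_real pi / 2)) = - \<i>"
      using cis_conv_exp[of "pi/2"] cis_conv_exp[of "-(pi/2)"] by (simp_all add: complex_eq_iff)
    thus "pathstart ?Ap = ?p4" "pathfinish ?Ap = ?p1" by simp_all
  qed
  have convD: "convex ?D"
  proof -
    have "?D = {z. Re z \<ge> -d} \<inter> {z. Im z \<le> R} \<inter> {z. Im z \<ge> -R}" by auto
    thus ?thesis by (simp add: convex_Int convex_halfspace_Re_ge convex_halfspace_Im_ge convex_halfspace_Im_le)
  qed
  have seg: "closed_segment ?p1 ?p2 \<subseteq> ?D" "closed_segment ?p2 ?p3 \<subseteq> ?D" "closed_segment ?p3 ?p4 \<subseteq> ?D"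
    using R0 d by (intro closed_segment_subset convD; simp)+
  have li: "Phi contour_integrable_on linepath ?p1 ?p2" "Phi contour_integrable_on linepath ?p2 ?p3"
    "Phi contour_integrable_on linepath ?p3 ?p4"
    by (intro contour_integrable_continuous_linepath cont_Phi seg)+
  define J1 where "J1 = contour_integral (linepath ?p1 ?p2) Phi"
  define J2 where "J2 = contour_integral (linepath ?p2 ?p3) Phi"
  define J3 where "J3 = contour_integral (linepath ?p3 ?p4) Phi"
  \<comment> \<open>The right arc is closed by three segments through the half strip;
    \<open>Phi\<close> is holomorphic there, so the arc integral is bounded by the integrals over
    the segments.\<close>
  let ?g = "?Ap +++ linepath ?p1 ?p2 +++ linepath ?p2 ?p3 +++ linepath ?p3 ?p4"
  have "(Phi has_contour_integral 0) ?g"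
    by (rule Cauchy_theorem_convex_simple[OF holPhi convD])
       (use seg arc_sub ends in \<open>auto simp: path_image_join intro!: valid_path_join\<close>)
  moreover have "(Phi has_contour_integral (J + (J1 + (J2 + J3)))) ?g"
    unfolding J_def J1_def J2_def J3_def
    by (intro has_contour_integral_join has_contour_integral_integral intPhi li)
       (use ends in \<open>auto intro!: valid_path_join\<close>)
  ultimately have "J + (J1 + (J2 + J3)) = 0" by (rule has_contour_integral_unique[symmetric])
  hence J: "norm J \<le> norm J1 + norm J2 + norm J3"
    by (metis add_eq_0_iff norm_minus_cancel norm_triangle_ineq norm_triangle_mono order_refl add.assoc)

  \<comment> \<open>On the horizontal segments 1 + z^2/R^2 has a zero within distance d. This small
    factor reduces their contribution to O(B d^2 / R).\<close>
  have bd_hor: "norm (Phi z) \<le> B * (3 * d / R)" if z: "-d \<le> Re z" "Re z \<le> 0" "\<bar>Im z\<bar> = R" for z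
  proof -
    have "1 + z\<^sup>2 / of_real R ^ 2 = ((z - \<i> * of_real R) * (z + \<i> * of_real R)) / of_real R ^ 2"
      using R0 by (simp add: field_simps power2_eq_square)
    moreover have "norm ((z - \<i> * of_real R) * (z + \<i> * of_real R)) \<le> d * (3 * R)"
    proof -
      have n2R: "norm (2 * \<i> * complex_of_real R) = 2 * R" using R0 by (simp add: norm_mult)
      consider "Im z = R" | "Im z = -R" using z R0 by linarith
      thus ?thesis
      proof cases
        case 1
        hence "z - \<i> * of_real R = of_real (Re z)" by (auto simp: complex_eq_iff)
        hence n1: "norm (z - \<i> * of_real R) \<le> d" using z d by (simp only: norm_of_real)
        have "norm (z + \<i> * of_real R) = norm ((z - \<i> * of_real R) + 2 * \<i> * of_real R)" by (simp add: add.commute)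
        hence "norm (z + \<i> * of_real R) \<le> d + 2 * R"
          using n1 n2R norm_triangle_ineq[of "z - \<i> * of_real R" "2 * \<i> * of_real R"] by linarith
        thus ?thesis using n1 d R unfolding norm_mult by (intro mult_mono) auto
      next
        case 2
        hence "z + \<i> * of_real R = of_real (Re z)" by (auto simp: complex_eq_iff)
        hence n1: "norm (z + \<i> * of_real R) \<le> d" using z d by (simp only: norm_of_real)
        have "norm (z - \<i> * of_real R) = norm ((z + \<i> * of_real R) - 2 * \<i> * of_real R)" by simp
        hence "norm (z - \<i> * of_real R) \<le> d + 2 * R"
          using n1 n2R norm_triangle_ineq4[of "z + \<i> * of_real R" "2 * \<i> * of_real R"] by linarith
        thus ?thesis using n1 d R unfolding norm_mult mult.commute[of d] by (intro mult_mono) auto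
      qed
    qed
    ultimately have k: "norm (1 + z\<^sup>2 / of_real R ^ 2) \<le> d * (3 * R) / R\<^sup>2"
      using R0 by (simp add: norm_divide norm_power divide_right_mono)
    have "real N powr Re z \<le> 1" using N z powr_mono[of "Re z" 0 "real N"] by simp
    hence "norm (E z) \<le> 1 * (d * (3 * R) / R\<^sup>2)"
      unfolding nE using k by (intro mult_mono) auto
    moreover have "norm (G z) \<le> B" using bd z by auto
    ultimately have "norm (Phi z) \<le> B * (1 * (d * (3 * R) / R\<^sup>2))"
      unfolding Phi_def norm_mult using B by (intro mult_mono) auto
    thus ?thesis using R0 by (simp add: power2_eq_square mult_ac)
  qed
  have J1b: "norm J1 \<le> B * (3 * d / R) * norm (?p2 - ?p1)"
    unfolding J1_def
  proof (rule contour_integral_bound_linepath[OF li(1)])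
    fix z assume "z \<in> closed_segment ?p1 ?p2"
    then obtain u where u: "0 \<le> u" "u \<le> 1" "z = (1 - u) *\<^sub>R ?p1 + u *\<^sub>R ?p2" by (auto simp: in_segment)
    have "Re z = - u * d" "Im z = R" by (auto simp: u(3) algebra_simps)
    thus "norm (Phi z) \<le> B * (3 * d / R)"
      using u d R0 mult_left_le_one_le[of d u] by (intro bd_hor) auto
  qed (use B d R0 in auto)
  have J3b: "norm J3 \<le> B * (3 * d / R) * norm (?p4 - ?p3)"
    unfolding J3_def
  proof (rule contour_integral_bound_linepath[OF li(3)])
    fix z assume "z \<in> closed_segment ?p3 ?p4"
    then obtain u where u: "0 \<le> u" "u \<le> 1" "z = (1 - u) *\<^sub>R ?p3 + u *\<^sub>R ?p4" by (auto simp: in_segment)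
    have "Re z = - ((1 - u) * d)" "Im z = -R" by (auto simp: u(3) algebra_simps)
    moreover have "(1 - u) * d \<le> d" "0 \<le> (1 - u) * d"
      using u d by (auto intro: mult_left_le_one_le mult_nonneg_nonneg)
    ultimately show "norm (Phi z) \<le> B * (3 * d / R)"
      using R0 by (intro bd_hor) linarith+
  qed (use B d R0 in auto)
  have J2b: "norm J2 \<le> B * real N powr (-d) * 3 * norm (?p3 - ?p2)"
    unfolding J2_def
  proof (rule contour_integral_bound_linepath[OF li(2)])
    fix z assume "z \<in> closed_segment ?p2 ?p3"
    then obtain u where u: "0 \<le> u" "u \<le> 1" "z = (1 - u) *\<^sub>R ?p2 + u *\<^sub>R ?p3" by (auto simp: in_segment)
    have Re: "Re z = - d" and "Im z = (1 - 2 * u) * R" by (auto simp: u(3) algebra_simps)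
    moreover have "\<bar>(1 - 2 * u) * R\<bar> \<le> 1 * R" unfolding abs_mult using u R0 by (intro mult_mono) auto
    ultimately have Im: "\<bar>Im z\<bar> \<le> R" by simp
    have "norm z ^ 2 = d\<^sup>2 + Im z ^ 2" by (simp add: cmod_power2 Re)
    also have "\<dots> \<le> R\<^sup>2 + R\<^sup>2"
    proof (intro add_mono)
      show "d\<^sup>2 \<le> R\<^sup>2" using d R by (intro power_mono) auto
      show "(Im z)\<^sup>2 \<le> R\<^sup>2" using Im R0 abs_le_square_iff[of "Im z" R] by auto
    qed
    finally have "norm (z\<^sup>2 / of_real R ^ 2) \<le> 2"
      using R0 by (simp add: norm_divide norm_power field_simps)
    hence "norm (1 + z\<^sup>2 / of_real R ^ 2) \<le> 3"
      using norm_triangle_ineq[of 1 "z\<^sup>2 / of_real R ^ 2"] by simp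
    hence "norm (E z) \<le> real N powr (-d) * 3"
      unfolding nE Re by (intro mult_left_mono) auto
    moreover have "norm (G z) \<le> B" using Re Im d by (intro bd) auto
    ultimately have "norm (Phi z) \<le> B * (real N powr (-d) * 3)"
      unfolding Phi_def norm_mult using B by (intro mult_mono) auto
    thus "norm (Phi z) \<le> B * real N powr (-d) * 3" by (simp add: mult_ac)
  qed (use B in auto)
  have n12: "norm (?p2 - ?p1) = d" "norm (?p4 - ?p3) = d"
    using d by simp_all
  have n23: "norm (?p3 - ?p2) = 2 * R"
  proof -
    have "?p3 - ?p2 = - (2 * R * \<i>)" by (simp add: complex_eq_iff)
    thus ?thesis using R0 by (simp add: norm_mult)
  qed
  have "2 * pi * norm (h 0) = norm (2 * of_real pi * \<i> * h 0)" by (simp add: norm_mult)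
  also have "\<dots> = norm ((2 * of_real pi * \<i> * h 0 - I1) + (I1 - J) + J)" by simp
  also have "\<dots> \<le> norm (2 * of_real pi * \<i> * h 0 - I1) + norm (I1 - J) + norm J"
    by (intro norm_triangle_le add_mono order_refl norm_triangle_ineq)
  also have "\<dots> \<le> (2 / (R * real N) + 2 / R\<^sup>2) * R * (3*pi/2 - pi/2) + (2 / R\<^sup>2) * R * (pi/2 - (-pi/2))
      + (B * (3 * d / R) * d + B * real N powr (-d) * 3 * (2 * R) + B * (3 * d / R) * d)"
    using bound1 bound2 J J1b J2b J3b unfolding n12 n23 by linarith
  also have "\<dots> = 2 * pi * (2 / R + 1 / real N) + 6 * (B * R * real N powr (-d) + B * d\<^sup>2 / R)"
    using R0 N by (simp add: field_simps power2_eq_square)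
  \<comment> \<open>Uses 6 \<le> 2 pi, so that the factor 2 pi cancels throughout.\<close>
  also have "\<dots> \<le> 2 * pi * (2 / R + 1 / real N) + 2 * pi * (B * R * real N powr (-d) + B * d\<^sup>2 / R)"
    using pi_gt3 B R0 by (intro add_left_mono mult_right_mono) auto
  finally have "2 * pi * norm (h 0) \<le> 2 * pi * (2 / R + 1 / real N + B * R * real N powr (-d) + B * d\<^sup>2 / R)"
    by (simp add: algebra_simps)
  hence "norm (h 0) \<le> 2 / R + 1 / real N + B * R * real N powr (-d) + B * d\<^sup>2 / R"
    by (subst (asm) mult_le_cancel_left_pos) auto
  thus ?thesis using h0 by simp
qed

section \<open>The zeta function near the line of abscissa 1\<close>

text \<open>Equals (s - 1) times the difference of (n+2)^(-s) and the integral of u^(-s) from n+1 to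
  n+2. For Re s > 1 the sum over n is (s - 1) \<zeta>(s) - s, but it converges for all Re s >
  0.\<close>

definition zeta_term :: "nat \<Rightarrow> complex \<Rightarrow> complex" where
  "zeta_term n s = (s - 1) * of_nat (n + 2) powr (-s) + of_nat (n + 2) powr (1 - s) - of_nat (n + 1) powr (1 - s)"

text \<open>\<open>zeta1 s = (s - 1) * \<zeta>(s)\<close>, so \<open>zeta1 1 = 1\<close>.\<close>

definition zeta1 :: "complex \<Rightarrow> complex" where
  "zeta1 s = s + (\<Sum>n. zeta_term n s)"

text \<open>The mean value bound is used twice on the segment from n+1 to n+2: for u^(-s), and for
  u^(1-s) plus a linear function of matching slope, whose derivative is (s - 1) times a difference
  of the first kind.\<close>

lemma norm_zeta_term_le:
  assumes "Re s \<ge> -1"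
  shows "norm (zeta_term n s) \<le> norm s * norm (s - 1) * real (Suc n) powr (-1 - Re s)"
proof -
  define m where "m = real (Suc n)"
  define B where "B = norm s * m powr (-1 - Re s)"
  define S where "S = complex_of_real ` {m..m+1}"
  have m: "m \<ge> 1" by (simp add: m_def)
  have S: "convex S" unfolding S_def by (intro convex_linear_image) (auto simp: linear_iff scaleR_conv_of_real)
  have npos: "z \<notin> \<real>\<^sub>\<le>\<^sub>0" if "z \<in> S" for z
    using that m by (auto simp: S_def complex_nonpos_Reals_iff)
  have endS: "of_real (m + 1) \<in> S" "of_real m \<in> S" unfolding S_def by (intro imageI; simp)+
  have inner: "norm (of_real (m + 1) powr (-s) - z powr (-s)) \<le> B" if zS: "z \<in> S" for z
  proof -
    have "norm (of_real (m + 1) powr (-s) - z powr (-s)) \<le> B * norm (of_real (m + 1) - z)"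
    proof (rule field_differentiable_bound[OF S _ _ endS(1) zS])
      fix w assume w: "w \<in> S"
      show "((\<lambda>z. z powr (-s)) has_field_derivative ((-s) * w powr (-s - 1))) (at w within S)"
        using npos[OF w] by (rule has_field_derivative_at_within[OF has_field_derivative_powr])
      obtain x where x: "w = of_real x" "m \<le> x" using w by (auto simp: S_def)
      have "norm (w powr (-s - 1)) = x powr (- Re s - 1)" using x m by (simp add: norm_powr_real_powr)
      also have "\<dots> \<le> m powr (- Re s - 1)" using assms x m by (intro powr_mono2') auto
      also have "- Re s - 1 = -1 - Re s" by simp
      finally show "norm ((-s) * w powr (-s - 1)) \<le> B"
        by (simp add: B_def norm_mult mult_left_mono)
    qed
    also have "norm (of_real (m + 1) - z) \<le> 1"
    proof -
      obtain x where x: "z = of_real x" "m \<le> x" "x \<le> m + 1" using zS by (auto simp: S_def)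
      have "norm (complex_of_real (m + 1) - of_real x) = \<bar>m + 1 - x\<bar>"
        by (simp only: of_real_diff[symmetric] norm_of_real)
      thus ?thesis using x by simp
    qed
    finally show ?thesis by (simp add: B_def mult_left_mono)
  qed
  define c where "c = complex_of_real (m + 1) powr (-s)"
  define f where "f = (\<lambda>z. (s - 1) * c * z + z powr (1 - s))"
  have "norm (f (of_real (m + 1)) - f (of_real m)) \<le> (norm (s - 1) * B) * norm (complex_of_real (m + 1) - of_real m)"
  proof (rule field_differentiable_bound[OF S _ _ endS])
    fix w assume w: "w \<in> S"
    show "(f has_field_derivative ((s - 1) * c + (1 - s) * w powr (1 - s - 1))) (at w within S)"
      unfolding f_def using npos[OF w]
      by (auto intro!: derivative_eq_intros has_field_derivative_at_within[OF has_field_derivative_powr])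
    have "(s - 1) * c + (1 - s) * w powr (1 - s - 1) = (s - 1) * (c - w powr (-s))"
      by (simp add: algebra_simps)
    thus "norm ((s - 1) * c + (1 - s) * w powr (1 - s - 1)) \<le> norm (s - 1) * B"
      using inner[OF w] by (simp add: norm_mult c_def mult_left_mono)
  qed
  moreover have "f (of_real (m + 1)) - f (of_real m) = zeta_term n s"
    by (simp add: f_def c_def zeta_term_def m_def algebra_simps)
  ultimately show ?thesis by (simp add: B_def m_def mult_ac)
qed

lemma summable_powr_Suc: "(c::real) > 0 \<Longrightarrow> summable (\<lambda>n. real (Suc n) powr (-1 - c))"
  by (subst summable_Suc_iff) (simp add: summable_real_powr_iff)

lemma suminf_powr_tail_le:
  assumes "(c::real) > 0" "M > 0"
  shows "(\<Sum>n. real (Suc (n + M)) powr (-1 - c)) \<le> real M powr (-c) / c"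
proof (rule suminf_le_const)
  show "summable (\<lambda>n. real (Suc (n + M)) powr (-1 - c))"
    using summable_ignore_initial_segment[OF summable_powr_Suc[OF assms(1)], of M] by simp
  fix k
  have "(\<Sum>n<k. real (Suc (n + M)) powr (-1 - c)) = (\<Sum>n=M+1..M+k. real n powr (-1 - c))"
    by (intro sum.reindex_bij_witness[of _ "\<lambda>n. n - (M + 1)" "\<lambda>n. n + M + 1"]) (auto simp: add_ac)
  also have "\<dots> \<le> (real M powr (-c) - real (M + k) powr (-c)) / c"
    using assms by (intro sum_powr_tail_le) auto
  also have "\<dots> \<le> real M powr (-c) / c" using assms by (intro divide_right_mono) auto
  finally show "(\<Sum>n<k. real (Suc (n + M)) powr (-1 - c)) \<le> real M powr (-c) / c" .
qed

lemma summable_zeta_term: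
  assumes "Re s > 0"
  shows "summable (\<lambda>n. norm (zeta_term n s))"
proof (rule summable_comparison_test')
  show "summable (\<lambda>n. norm s * norm (s - 1) * real (Suc n) powr (-1 - Re s))"
    by (intro summable_mult summable_powr_Suc assms)
  fix n :: nat
  show "norm (norm (zeta_term n s)) \<le> norm s * norm (s - 1) * real (Suc n) powr (-1 - Re s)"
    using norm_zeta_term_le[of s n] assms by simp
qed

lemma sum_zeta_term:
  "s + (\<Sum>n<M. zeta_term n s) = (s - 1) * (\<Sum>n=1..M+1. of_nat n powr (-s)) + of_nat (M + 1) powr (1 - s)"
  by (induction M) (simp_all add: zeta_term_def algebra_simps)

text \<open>Truncated Euler-Maclaurin formula with explicit remainder; M is later chosen close to
  the bound on the imaginary part.\<close>

lemma zeta1_approx: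
  assumes s: "Re s > 0" and M: "M > 0"
  shows "norm (zeta1 s - ((s - 1) * (\<Sum>n=1..M+1. of_nat n powr (-s)) + of_nat (M + 1) powr (1 - s)))
      \<le> norm s * norm (s - 1) * (real M powr (- Re s) / Re s)"
proof -
  have sm: "summable (\<lambda>n. zeta_term n s)" using summable_zeta_term[OF s] by (rule summable_norm_cancel)
  have "zeta1 s = s + (\<Sum>n<M. zeta_term n s) + (\<Sum>n. zeta_term (n + M) s)"
    unfolding zeta1_def by (subst suminf_split_initial_segment[OF sm, of M]) simp
  hence "zeta1 s - ((s - 1) * (\<Sum>n=1..M+1. of_nat n powr (-s)) + of_nat (M + 1) powr (1 - s)) = (\<Sum>n. zeta_term (n + M) s)"
    by (simp only: sum_zeta_term) simp
  also have "norm \<dots> \<le> (\<Sum>n. norm s * norm (s - 1) * real (Suc (n + M)) powr (-1 - Re s))"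
  proof (rule norm_suminf_le)
    fix n show "norm (zeta_term (n + M) s) \<le> norm s * norm (s - 1) * real (Suc (n + M)) powr (-1 - Re s)"
      using s by (intro norm_zeta_term_le) auto
    show "summable (\<lambda>n. norm s * norm (s - 1) * real (Suc (n + M)) powr (-1 - Re s))"
      using summable_ignore_initial_segment[OF summable_powr_Suc[OF s], of M] by (intro summable_mult) simp
  qed
  also have "\<dots> = norm s * norm (s - 1) * (\<Sum>n. real (Suc (n + M)) powr (-1 - Re s))"
    using summable_ignore_initial_segment[OF summable_powr_Suc[OF s], of M] by (intro suminf_mult) simp
  also have "\<dots> \<le> norm s * norm (s - 1) * (real M powr (- Re s) / Re s)"
    by (intro mult_left_mono suminf_powr_tail_le s M) auto
  finally show ?thesis .
qed

text \<open>The series converges uniformly on the disc of radius Re x / 2 around x, where Re s stays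
  at least Re x / 2.\<close>

lemma holomorphic_zeta1: "zeta1 holomorphic_on {s. Re s > 0}"
proof (rule holomorphic_uniform_sequence)
  show "open {s. Re s > 0}" by (simp add: open_halfspace_Re_gt)
  show "(\<lambda>s. s + (\<Sum>n<N. zeta_term n s)) holomorphic_on {s. Re s > 0}" for N
    unfolding zeta_term_def by (intro holomorphic_intros)
  fix x assume x: "x \<in> {s. Re s > 0}"
  define d where "d = Re x / 2"
  have d: "d > 0" using x by (simp add: d_def)
  have Re: "Re s \<ge> d" if "s \<in> cball x d" for s
    using that abs_Re_le_cmod[of "x - s"] by (simp add: d_def dist_norm)
  define C where "C = (norm x + d) * (norm x + d + 1)"
  have "uniform_limit (cball x d) (\<lambda>N s. \<Sum>n<N. zeta_term n s) (\<lambda>s. \<Sum>n. zeta_term n s) sequentially"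
  proof (rule Weierstrass_m_test)
    show "summable (\<lambda>n. C * real (Suc n) powr (-1 - d))" by (intro summable_mult summable_powr_Suc d)
    fix n s assume s: "s \<in> cball x d"
    have "norm s \<le> norm x + d"
      using s norm_triangle_ineq2[of s x] by (simp add: dist_norm norm_minus_commute)
    moreover from this have "norm (s - 1) \<le> norm x + d + 1"
      using norm_triangle_ineq4[of s 1] by simp
    moreover have "real (Suc n) powr (-1 - Re s) \<le> real (Suc n) powr (-1 - d)"
      using Re[OF s] by (intro powr_mono) auto
    ultimately have "norm s * norm (s - 1) * real (Suc n) powr (-1 - Re s) \<le> C * real (Suc n) powr (-1 - d)"
      unfolding C_def using d by (intro mult_mono) auto
    thus "norm (zeta_term n s) \<le> C * real (Suc n) powr (-1 - d)"
      using norm_zeta_term_le[of s n] Re[OF s] d by simp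
  qed
  hence "uniform_limit (cball x d) (\<lambda>N s. s + (\<Sum>n<N. zeta_term n s)) zeta1 sequentially"
    unfolding zeta1_def[abs_def] by (intro uniform_limit_intros)
  moreover have "cball x d \<subseteq> {s. Re s > 0}" using Re d by force
  ultimately show "\<exists>d>0. cball x d \<subseteq> {s. Re s > 0} \<and>
      uniform_limit (cball x d) (\<lambda>N s. s + (\<Sum>n<N. zeta_term n s)) zeta1 sequentially"
    using d by blast
qed

lemma zeta1_1: "zeta1 1 = 1"
proof -
  have "zeta_term n 1 = 0" for n
  proof -
    have "(of_nat (n + 2) :: complex) \<noteq> 0" "(of_nat (n + 1) :: complex) \<noteq> 0"
      unfolding of_nat_eq_0_iff by simp_all
    thus ?thesis by (simp add: zeta_term_def)
  qed
  thus ?thesis by (simp add: zeta1_def)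
qed

section \<open>Euler products in the half plane Re s > 1\<close>

definition dsum :: "(nat \<Rightarrow> real) \<Rightarrow> nat set \<Rightarrow> complex \<Rightarrow> complex" where
  "dsum a D s = (\<Sum>\<^sub>\<infinity>n | free_of D n. of_real (a n) * of_nat n powr (-s))"

lemma abs_summable_dirichlet:
  assumes "Re s > 1" "\<And>n. \<bar>a n\<bar> \<le> (1::real)"
  shows "(\<lambda>n. norm (of_real (a n) * of_nat n powr (-s) :: complex)) summable_on A"
proof -
  have "summable (\<lambda>n. norm (real n powr (- Re s)))"
    using assms by (simp add: summable_real_powr_iff)
  hence "(\<lambda>n. real n powr (- Re s)) summable_on UNIV" by (rule norm_summable_imp_summable_on)
  hence "(\<lambda>n. real n powr (- Re s)) summable_on A" by (rule summable_on_subset_banach) auto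
  thus ?thesis
  proof (rule summable_on_comparison_test)
    fix n assume "n \<in> A"
    have "\<bar>a n\<bar> * real n powr (- Re s) \<le> 1 * real n powr (- Re s)"
      by (intro mult_right_mono assms) auto
    thus "norm (of_real (a n) * of_nat n powr (-s)) \<le> real n powr (- Re s)"
      by (simp add: norm_mult norm_of_nat_powr)
  qed simp
qed

lemmas summable_dirichlet = abs_summable_summable[OF abs_summable_dirichlet]

lemma norm_infsum_dirichlet_tail:
  assumes "Re s > 1" "\<And>n. \<bar>a n\<bar> \<le> (1::real)" "N > 0" "A \<subseteq> {N<..}"
  shows "norm (\<Sum>\<^sub>\<infinity>n\<in>A. of_real (a n) * of_nat n powr (-s)) \<le> real N powr (1 - Re s) / (Re s - 1)"
proof -
  have "norm (\<Sum>\<^sub>\<infinity>n\<in>A. of_real (a n) * of_nat n powr (-s)) \<le>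
        (\<Sum>\<^sub>\<infinity>n\<in>A. norm (of_real (a n) * of_nat n powr (-s)))"
    by (intro norm_infsum_bound abs_summable_dirichlet assms)
  also have "\<dots> \<le> real N powr (1 - Re s) / (Re s - 1)"
  proof (rule infsum_le_finite_sums)
    show "(\<lambda>n. norm (of_real (a n) * of_nat n powr (-s) :: complex)) summable_on A"
      by (intro abs_summable_dirichlet assms)
    fix F assume F: "finite F" "F \<subseteq> A"
    obtain M where M: "\<And>n. n \<in> F \<Longrightarrow> n \<le> M" using F(1) by (meson finite_nat_set_iff_bounded_le)
    have "(\<Sum>n\<in>F. norm (of_real (a n) * of_nat n powr (-s))) \<le> (\<Sum>n\<in>F. 1 * real n powr (-1 - (Re s - 1)))"
      unfolding norm_mult norm_of_nat_powr by (intro sum_mono mult_mono) (use assms in auto)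
    also have "\<dots> \<le> (\<Sum>n=N+1..max N M. 1 * real n powr (-1 - (Re s - 1)))"
      using F assms(4) M by (intro sum_mono2) (fastforce simp: max_def)+
    also have "\<dots> \<le> (real N powr (-(Re s - 1)) - real (max N M) powr (-(Re s - 1))) / (Re s - 1)"
      using sum_powr_tail_le[of N "max N M" "Re s - 1"] assms by simp
    also have "\<dots> \<le> real N powr (1 - Re s) / (Re s - 1)"
      using assms by (intro divide_right_mono) auto
    finally show "(\<Sum>n\<in>F. norm (of_real (a n) * of_nat n powr (-s))) \<le> real N powr (1 - Re s) / (Re s - 1)" .
  qed
  finally show ?thesis .
qed

text \<open>Apart from 1, a number free of all primes up to N exceeds N, so what remains is a tail
  of an absolutely convergent series. This limit stands in for the infinite Euler product.\<close>

lemma dsum_primes_upto_tendsto: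
  assumes s: "Re s > 1" and a: "\<And>n. \<bar>a n\<bar> \<le> (1::real)" "a 1 = 1"
  shows "(\<lambda>N. dsum a (primes_upto (real N)) s) \<longlonglongrightarrow> 1"
proof -
  have bound: "norm (dsum a (primes_upto (real N)) s - 1) \<le> real N powr (1 - Re s) / (Re s - 1)" if N: "N > 0" for N
  proof -
    let ?D = "primes_upto (real N)"
    have P: "\<forall>p\<in>?D. prime p" by (simp add: primes_upto_def)
    have "{n. free_of ?D n} = {1} \<union> {n. free_of ?D n \<and> n \<noteq> 1}" using P by auto
    hence "dsum a ?D s = (\<Sum>\<^sub>\<infinity>n\<in>{1} \<union> {n. free_of ?D n \<and> n \<noteq> 1}. of_real (a n) * of_nat n powr (-s))"
      by (simp add: dsum_def)
    also have "\<dots> = (\<Sum>\<^sub>\<infinity>n\<in>{1}. of_real (a n) * of_nat n powr (-s)) +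
       (\<Sum>\<^sub>\<infinity>n\<in>{n. free_of ?D n \<and> n \<noteq> 1}. of_real (a n) * of_nat n powr (-s))"
      by (intro infsum_Un_disjoint summable_dirichlet s a) auto
    also have "(\<Sum>\<^sub>\<infinity>n\<in>{1}. of_real (a n) * of_nat n powr (-s)) = 1" using a by simp
    finally have "dsum a ?D s - 1 = (\<Sum>\<^sub>\<infinity>n\<in>{n. free_of ?D n \<and> n \<noteq> 1}. of_real (a n) * of_nat n powr (-s))"
      by simp
    moreover have "{n. free_of ?D n \<and> n \<noteq> 1} \<subseteq> {N<..}"
    proof
      fix n assume "n \<in> {n. free_of ?D n \<and> n \<noteq> 1}"
      hence n: "free_of ?D n" "n \<noteq> 1" by auto
      obtain p where p: "prime p" "p dvd n" using prime_factor_nat[OF n(2)] by blast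
      hence "p \<notin> ?D" using n by (auto simp: free_of_def)
      hence "p > N" using p by (auto simp: primes_upto_def)
      thus "n \<in> {N<..}" using dvd_imp_le[OF p(2)] n by (auto simp: free_of_def)
    qed
    ultimately show ?thesis using norm_infsum_dirichlet_tail[OF s a(1) N] by simp
  qed
  have "(\<lambda>N. real N powr (1 - Re s) / (Re s - 1)) \<longlonglongrightarrow> 0"
    using s by (intro tendsto_divide_zero tendsto_neg_powr filterlim_real_sequentially) auto
  hence "(\<lambda>N. dsum a (primes_upto (real N)) s - 1) \<longlonglongrightarrow> 0"
    by (rule Lim_null_comparison[rotated])
       (use bound in \<open>auto simp: eventually_at_top_linorder intro!: exI[of _ 1]\<close>)
  thus ?thesis by (simp add: LIM_zero_iff)
qed

lemma infsum_multiples: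
  fixes f :: "nat \<Rightarrow> complex"
  assumes q: "prime q" "q \<notin> D" "\<forall>p\<in>D. prime p"
    and sm: "\<And>A. f summable_on A"
  shows "(\<Sum>\<^sub>\<infinity>n | free_of D n. f n) = (\<Sum>\<^sub>\<infinity>n | free_of (insert q D) n. f n) + (\<Sum>\<^sub>\<infinity>n | free_of D n. f (q * n))"
proof -
  have q0: "q > 0" using q(1) by (simp add: prime_gt_0_nat)
  have "{n. free_of D n} = {n. free_of (insert q D) n} \<union> (*) q ` {n. free_of D n}"
    using free_of_mult[OF q] by (auto simp: free_of_insert elim!: dvdE)
  hence "(\<Sum>\<^sub>\<infinity>n | free_of D n. f n) = (\<Sum>\<^sub>\<infinity>n\<in>{n. free_of (insert q D) n} \<union> (*) q ` {n. free_of D n}. f n)"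
    by simp
  also have "\<dots> = (\<Sum>\<^sub>\<infinity>n | free_of (insert q D) n. f n) + (\<Sum>\<^sub>\<infinity>n\<in>(*) q ` {n. free_of D n}. f n)"
    by (intro infsum_Un_disjoint sm) (auto simp: free_of_insert)
  also have "(\<Sum>\<^sub>\<infinity>n\<in>(*) q ` {n. free_of D n}. f n) = (\<Sum>\<^sub>\<infinity>n | free_of D n. f (q * n))"
    using q0 by (subst infsum_reindex) (auto simp: inj_on_def o_def)
  finally show ?thesis .
qed

lemma of_nat_mult_powr: "(of_nat (m * n) :: complex) powr s = of_nat m powr s * of_nat n powr s"
  by (simp add: powr_times_real)

lemma dsum_1_insert:
  assumes q: "prime q" "q \<notin> D" "\<forall>p\<in>D. prime p" and s: "Re s > 1"
  shows "dsum (\<lambda>_. 1) (insert q D) s = (1 - of_nat q powr (-s)) * dsum (\<lambda>_. 1) D s"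
proof -
  let ?f = "\<lambda>n. of_real 1 * (of_nat n :: complex) powr (-s)"
  have "dsum (\<lambda>_. 1) D s = dsum (\<lambda>_. 1) (insert q D) s + (\<Sum>\<^sub>\<infinity>n | free_of D n. ?f (q * n))"
    unfolding dsum_def using summable_dirichlet[OF s, of "\<lambda>_. 1"] by (intro infsum_multiples q) auto
  also have "(\<Sum>\<^sub>\<infinity>n | free_of D n. ?f (q * n)) = (\<Sum>\<^sub>\<infinity>n | free_of D n. of_nat q powr (-s) * ?f n)"
    by (simp add: of_nat_mult_powr del: of_nat_mult)
  also have "\<dots> = of_nat q powr (-s) * dsum (\<lambda>_. 1) D s"
    unfolding dsum_def by (rule infsum_cmult_right')
  finally show ?thesis by (simp add: algebra_simps)
qed

text \<open>In contrast to constant coefficients, a multiple q n with q dividing n carries mu = 0;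
  therefore the factor 1 - q^(-s) multiplies the sifted series and not the unsifted one.\<close>

lemma dsum_mu_insert:
  assumes q: "prime q" "q \<notin> D" "\<forall>p\<in>D. prime p" and s: "Re s > 1"
  shows "dsum mu D s = (1 - of_nat q powr (-s)) * dsum mu (insert q D) s"
proof -
  let ?f = "\<lambda>n. of_real (mu n) * (of_nat n :: complex) powr (-s)"
  have "dsum mu D s = dsum mu (insert q D) s + (\<Sum>\<^sub>\<infinity>n | free_of D n. ?f (q * n))"
    unfolding dsum_def using summable_dirichlet[OF s, of mu] abs_mu_le by (intro infsum_multiples q) auto
  also have "(\<Sum>\<^sub>\<infinity>n | free_of D n. ?f (q * n)) = (\<Sum>\<^sub>\<infinity>n | free_of (insert q D) n. (- (of_nat q powr (-s))) * ?f n)"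
    using q by (intro infsum_cong_neutral)
       (auto simp: free_of_insert moebius_mult_dvd moebius_mult_prime free_of_pos of_nat_mult_powr simp del: of_nat_mult)
  also have "\<dots> = (- (of_nat q powr (-s))) * dsum mu (insert q D) s"
    unfolding dsum_def by (rule infsum_cmult_right')
  finally show ?thesis by (simp add: algebra_simps)
qed

lemma dsum_1_prod:
  assumes "finite D" "\<forall>p\<in>D. prime p" and s: "Re s > 1"
  shows "dsum (\<lambda>_. 1) D s = (\<Prod>q\<in>D. 1 - of_nat q powr (-s)) * dsum (\<lambda>_. 1) {} s"
  using assms(1,2) by (induction D rule: finite_induct) (simp_all add: dsum_1_insert s)

lemma dsum_mu_prod:
  assumes "finite D" "\<forall>p\<in>D. prime p" and s: "Re s > 1"
  shows "dsum mu {} s = (\<Prod>q\<in>D. 1 - of_nat q powr (-s)) * dsum mu D s"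
  using assms(1,2) by (induction D rule: finite_induct) (simp_all add: dsum_mu_insert s)

text \<open>The Euler factors of the two series are reciprocal, so sifting by the primes up to N
  leaves the product unchanged, while each sifted series tends to 1.\<close>

lemma dsum_mu_inverse:
  assumes s: "Re s > 1"
  shows "dsum (\<lambda>_. 1) {} s * dsum mu {} s = 1"
proof -
  have "dsum (\<lambda>_. 1) (primes_upto (real N)) s * dsum mu (primes_upto (real N)) s
      = dsum (\<lambda>_. 1) {} s * dsum mu {} s" for N
  proof -
    have "\<forall>p\<in>primes_upto (real N). prime p" by (simp add: primes_upto_def)
    thus ?thesis
      using dsum_1_prod[of "primes_upto (real N)" s] dsum_mu_prod[of "primes_upto (real N)" s] s by simp
  qed
  moreover have "(\<lambda>N. dsum (\<lambda>_. 1) (primes_upto (real N)) s * dsum mu (primes_upto (real N)) s) \<longlonglongrightarrow> 1 * 1"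
    using s abs_mu_le by (intro tendsto_mult dsum_primes_upto_tendsto) auto
  ultimately show ?thesis by (simp add: LIMSEQ_const_iff)
qed

lemma dsum_sums:
  assumes s: "Re s > 1" and a: "\<And>n. \<bar>a n\<bar> \<le> 1"
  shows "(\<lambda>n. of_real (a (Suc n)) * of_nat (Suc n) powr (-s)) sums dsum a {} s"
proof -
  have "dsum a {} s = (\<Sum>\<^sub>\<infinity>n\<in>UNIV. of_real (a n) * of_nat n powr (-s))"
    unfolding dsum_def by (intro infsum_cong_neutral) (auto simp: free_of_def)
  hence "((\<lambda>n. of_real (a n) * of_nat n powr (-s)) has_sum dsum a {} s) UNIV"
    using summable_dirichlet[OF s a] by (simp add: has_sum_infsum)
  hence "(\<lambda>n. of_real (a n) * of_nat n powr (-s)) sums dsum a {} s" by (rule has_sum_imp_sums)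
  thus ?thesis by (subst sums_Suc_iff) simp
qed

lemma zeta1_eq_dsum:
  assumes s: "Re s > 1"
  shows "zeta1 s = (s - 1) * dsum (\<lambda>_. 1) {} s"
proof -
  have "(\<lambda>n. of_nat (Suc n) powr (-s)) sums dsum (\<lambda>_. 1) {} s" using dsum_sums[OF s, of "\<lambda>_. 1"] by simp
  hence "(\<lambda>M. \<Sum>n<M+1. of_nat (Suc n) powr (-s)) \<longlonglongrightarrow> dsum (\<lambda>_. 1) {} s"
    unfolding sums_def by (subst LIMSEQ_ignore_initial_segment) auto
  also have "(\<lambda>M. \<Sum>n<M+1. of_nat (Suc n) powr (-s)) = (\<lambda>M. \<Sum>n=1..M+1. of_nat n powr (-s))"
    by (intro ext sum.reindex_bij_witness[of _ "\<lambda>n. n - 1" Suc]) auto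
  finally have l1: "(\<lambda>M. \<Sum>n=1..M+1. of_nat n powr (-s)) \<longlonglongrightarrow> dsum (\<lambda>_. 1) {} s" .
  have "(\<lambda>M. real M powr (1 - Re s)) \<longlonglongrightarrow> 0"
    using s by (intro tendsto_neg_powr filterlim_real_sequentially) auto
  hence "(\<lambda>M. real (M + 1) powr (1 - Re s)) \<longlonglongrightarrow> 0" by (rule LIMSEQ_ignore_initial_segment)
  hence "(\<lambda>M. norm ((of_nat (M + 1) :: complex) powr (1 - s))) \<longlonglongrightarrow> 0"
    by (simp only: norm_of_nat_powr) simp
  hence l2: "(\<lambda>M. (of_nat (M + 1) :: complex) powr (1 - s)) \<longlonglongrightarrow> 0" by (rule tendsto_norm_zero_cancel)
  have "(\<lambda>M. s + (\<Sum>n<M. zeta_term n s)) \<longlonglongrightarrow> (s - 1) * dsum (\<lambda>_. 1) {} s + 0"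
    unfolding sum_zeta_term by (intro tendsto_intros l1 l2)
  moreover have "(\<lambda>M. s + (\<Sum>n<M. zeta_term n s)) \<longlonglongrightarrow> zeta1 s"
    unfolding zeta1_def using summable_norm_cancel[OF summable_zeta_term[of s]] s
    by (intro tendsto_intros summable_LIMSEQ) auto
  ultimately show ?thesis using LIMSEQ_unique by fastforce
qed

lemma zeta1_nonzero:
  assumes "Re s > 1"
  shows "zeta1 s \<noteq> 0"
  using dsum_mu_inverse[OF assms] assms by (auto simp: zeta1_eq_dsum)

section \<open>The 3-4-1 inequality\<close>

lemma ln_one_minus_le:
  fixes r :: real
  assumes "0 \<le> r" "r < 1"
  shows "ln (1 - r) \<le> - r - r\<^sup>2 / 2"
proof -
  have "- 0 - 0\<^sup>2 / 2 - ln (1 - 0) \<le> - r - r\<^sup>2 / 2 - ln (1 - r)"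
  proof (rule DERIV_nonneg_imp_nondecreasing[OF assms(1)])
    fix x assume x: "0 \<le> x" "x \<le> r"
    have "((\<lambda>x. - x - x\<^sup>2 / 2 - ln (1 - x)) has_real_derivative (- 1 - x + 1 / (1 - x))) (at x)"
      using x assms by (auto intro!: derivative_eq_intros simp: field_simps)
    moreover have "- 1 - x + 1 / (1 - x) = x\<^sup>2 / (1 - x)" using x assms by (simp add: field_simps power2_eq_square)
    hence "- 1 - x + 1 / (1 - x) \<ge> 0" using x assms by simp
    ultimately show "\<exists>y. ((\<lambda>x. - x - x\<^sup>2 / 2 - ln (1 - x)) has_real_derivative y) (at x) \<and> 0 \<le> y" by blast
  qed
  thus ?thesis by simp
qed

text \<open>The inequality for a single Euler factor, in terms of squared norms A and B. With c = Re
  w, 5 T - (4 A + B) is the classical square 4 r (1 + c)^2. The inequality of the means then gives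
  A^4 B \<le> T^5, and (1 - r)^6 T^5 \<le> 1 follows from exponential bounds.\<close>

lemma mertens_341:
  fixes w :: complex and r :: real
  assumes w: "norm w = 1" and r: "0 \<le> r" "r < 1"
  shows "norm (1 - complex_of_real r) ^ 3 * norm (1 - of_real r * w) ^ 4 * norm (1 - of_real r * w\<^sup>2) \<le> (1 :: real)"
proof -
  define c where "c = Re w"
  define A where "A = norm (1 - of_real r * w) ^ 2"
  define B where "B = norm (1 - of_real r * w\<^sup>2) ^ 2"
  define T where "T = 1 + 6/5 * r + r\<^sup>2"
  have cw: "c\<^sup>2 + (Im w)\<^sup>2 = 1" using w by (simp add: c_def cmod_power2[symmetric])
  have A: "A = 1 - 2 * r * c + r\<^sup>2"
  proof -
    have "A = (1 - r * c)\<^sup>2 + (r * Im w)\<^sup>2" by (simp add: A_def cmod_power2 c_def)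
    also have "\<dots> = 1 - 2 * r * c + r\<^sup>2 * (c\<^sup>2 + (Im w)\<^sup>2)" by (simp add: power2_eq_square algebra_simps)
    finally show ?thesis by (simp add: cw)
  qed
  have B: "B = 1 - 2 * r * (2 * c\<^sup>2 - 1) + r\<^sup>2"
  proof -
    have Re2: "Re (w\<^sup>2) = 2 * c\<^sup>2 - 1" using cw by (simp add: power2_eq_square c_def)
    have n2: "(Re (w\<^sup>2))\<^sup>2 + (Im (w\<^sup>2))\<^sup>2 = 1" using w by (simp add: cmod_power2[symmetric] norm_power)
    have "B = (1 - r * Re (w\<^sup>2))\<^sup>2 + (r * Im (w\<^sup>2))\<^sup>2" unfolding B_def cmod_power2 by simp
    also have "\<dots> = 1 - 2 * r * Re (w\<^sup>2) + r\<^sup>2 * ((Re (w\<^sup>2))\<^sup>2 + (Im (w\<^sup>2))\<^sup>2)"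
      by (simp only: power2_eq_square) (simp add: algebra_simps)
    also have "\<dots> = 1 - 2 * r * Re (w\<^sup>2) + r\<^sup>2 * 1" by (simp only: n2)
    finally show ?thesis by (simp add: Re2)
  qed
  have "5 * T - (4 * A + B) = 4 * r * (c + 1)\<^sup>2" by (simp add: T_def A B power2_eq_square algebra_simps)
  hence "B \<le> 5 * T - 4 * A" using r by (smt (verit) mult_nonneg_nonneg zero_le_power2)
  hence "A ^ 4 * B \<le> A ^ 4 * (5 * T - 4 * A)" by (intro mult_left_mono) auto
  also have "\<dots> \<le> T ^ 5"
  proof -
    \<comment> \<open>A factorisation that proves the weighted inequality of the means: both factors
      are visibly nonnegative.\<close>
    have "T ^ 5 - A ^ 4 * (5 * T - 4 * A) = (T - A)\<^sup>2 * (T ^ 3 + 2 * T\<^sup>2 * A + 3 * T * A\<^sup>2 + 4 * A ^ 3)"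
      by (simp add: eval_nat_numeral algebra_simps)
    moreover have "T \<ge> 0" "A \<ge> 0" using r by (auto simp: T_def A_def)
    ultimately show ?thesis by (smt (verit) mult_nonneg_nonneg zero_le_power zero_le_power2)
  qed
  finally have AB: "A ^ 4 * B \<le> T ^ 5" .
  \<comment> \<open>The exponent is a fifth of 6 r + 3 r^2, as dictated by (1 - r)^6 \<le> exp (- 6
    r - 3 r^2).\<close>
  have "T \<le> exp (6/5 * r + 3/5 * r\<^sup>2)"
  proof -
    define y where "y = 6/5 * r + 3/5 * r\<^sup>2"
    have "1 + y + y\<^sup>2 / 2 \<le> exp y" using r by (intro exp_lower_Taylor_quadratic) (auto simp: y_def)
    moreover have "y\<^sup>2 \<ge> (6/5 * r)\<^sup>2" using r by (intro power_mono) (auto simp: y_def)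
    moreover have "(6/5 * r)\<^sup>2 \<ge> 4/5 * r\<^sup>2" using zero_le_power2[of r] unfolding power_mult_distrib
      by (intro mult_right_mono) (auto simp: power2_eq_square)
    ultimately show ?thesis unfolding T_def y_def[symmetric] by (simp add: y_def)
  qed
  hence "T ^ 5 \<le> exp (6/5 * r + 3/5 * r\<^sup>2) ^ 5" using r by (intro power_mono) (auto simp: T_def)
  also have "\<dots> = exp (6 * r + 3 * r\<^sup>2)" by (simp add: exp_of_nat_mult[symmetric] algebra_simps)
  finally have T5: "T ^ 5 \<le> exp (6 * r + 3 * r\<^sup>2)" .
  have "1 - r \<le> exp (- r - r\<^sup>2 / 2)" using ln_one_minus_le[OF r] r by (metis diff_gt_0_iff_gt exp_le_cancel_iff exp_ln)
  hence "(1 - r) ^ 6 \<le> exp (- r - r\<^sup>2 / 2) ^ 6" using r by (intro power_mono) auto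
  also have "\<dots> = exp (- (6 * r + 3 * r\<^sup>2))" by (simp add: exp_of_nat_mult[symmetric] algebra_simps)
  finally have "(1 - r) ^ 6 * T ^ 5 \<le> exp (- (6 * r + 3 * r\<^sup>2)) * exp (6 * r + 3 * r\<^sup>2)"
    using T5 r by (intro mult_mono) (auto simp: T_def)
  also have "\<dots> = 1" by (simp only: exp_add[symmetric]) simp
  finally have *: "(1 - r) ^ 6 * T ^ 5 \<le> 1" .
  have n1: "norm (1 - complex_of_real r) = 1 - r"
    using r by (metis abs_of_pos diff_gt_0_iff_gt norm_of_real of_real_1 of_real_diff)
  have "(norm (1 - complex_of_real r) ^ 3 * norm (1 - of_real r * w) ^ 4 * norm (1 - of_real r * w\<^sup>2))\<^sup>2 = (1 - r) ^ 6 * (A ^ 4 * B)"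
    unfolding n1 A_def B_def by (simp add: power_mult_distrib flip: power_mult)
  also have "\<dots> \<le> (1 - r) ^ 6 * T ^ 5" using AB r by (intro mult_left_mono) auto
  also have "\<dots> \<le> 1\<^sup>2" using * by simp
  finally show ?thesis by (rule power2_le_imp_le) simp
qed

text \<open>The same product formed with the sifted series tends to 1, and it is the full product
  times local factors that are at most 1. So the full product cannot lie below 1.\<close>

lemma zeta_341:
  fixes x t :: real
  assumes x: "x > 1"
  shows "norm (dsum (\<lambda>_. 1) {} (of_real x)) ^ 3 * norm (dsum (\<lambda>_. 1) {} (Complex x t)) ^ 4
         * norm (dsum (\<lambda>_. 1) {} (Complex x (2 * t))) \<ge> 1"
proof -
  let ?z = "dsum (\<lambda>_. 1)"
  let ?L = "norm (?z {} (of_real x)) ^ 3 * norm (?z {} (Complex x t)) ^ 4 * norm (?z {} (Complex x (2 * t)))"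
  let ?P = "\<lambda>N. primes_upto (real N)"
  have "(\<lambda>N. norm (?z (?P N) (of_real x)) ^ 3 * norm (?z (?P N) (Complex x t)) ^ 4 * norm (?z (?P N) (Complex x (2 * t))))
      \<longlonglongrightarrow> norm (1::complex) ^ 3 * norm (1::complex) ^ 4 * norm (1::complex)"
    using x by (intro tendsto_intros dsum_primes_upto_tendsto) auto
  moreover have "norm (?z (?P N) (of_real x)) ^ 3 * norm (?z (?P N) (Complex x t)) ^ 4 * norm (?z (?P N) (Complex x (2 * t)))
      \<le> ?L" for N
  proof -
    let ?e = "\<lambda>s q. norm (1 - of_nat q powr (-s) :: complex)"
    have P: "\<forall>p\<in>?P N. prime p" by (simp add: primes_upto_def)
    have z: "norm (?z (?P N) s) = (\<Prod>q\<in>?P N. ?e s q) * norm (?z {} s)" if "Re s > 1" for s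
      using dsum_1_prod[OF _ P that] by (simp add: norm_mult prod_norm)
    have "norm (?z (?P N) (of_real x)) ^ 3 * norm (?z (?P N) (Complex x t)) ^ 4 * norm (?z (?P N) (Complex x (2 * t)))
      = ?L * (\<Prod>q\<in>?P N. ?e (of_real x) q ^ 3 * ?e (Complex x t) q ^ 4 * ?e (Complex x (2 * t)) q)"
      using x by (simp add: z prod.distrib prod_power_distrib power_mult_distrib mult_ac)
    also have "\<dots> \<le> ?L * 1"
    proof (intro mult_left_mono prod_le_1)
      fix q assume "q \<in> ?P N"
      hence q: "q \<ge> 2" by (auto simp: primes_upto_def prime_ge_2_nat)
      define r where "r = real q powr (-x)"
      define w where "w = (of_nat q :: complex) powr (- \<i> * of_real t)"
      have "real q powr (-x) < 1" using q x by (intro powr_less_one) auto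
      hence r: "0 \<le> r" "r < 1" by (auto simp: r_def)
      have w: "norm w = 1" using q unfolding w_def norm_of_nat_powr by simp
      have e1: "(of_nat q :: complex) powr (- of_real x) = of_real r"
        unfolding r_def using powr_of_real[of "real q" "-x"] by simp
      have e2: "(of_nat q :: complex) powr (- Complex x t) = of_real r * w"
        unfolding e1[symmetric] w_def powr_add[symmetric] by (intro arg_cong[of _ _ "\<lambda>z. of_nat q powr z"]) (simp add: complex_eq_iff)
      have "w\<^sup>2 = (of_nat q :: complex) powr (- \<i> * of_real t + - \<i> * of_real t)"
        unfolding w_def powr_add power2_eq_square ..
      hence e3: "(of_nat q :: complex) powr (- Complex x (2 * t)) = of_real r * w\<^sup>2"
        unfolding e1[symmetric] by (simp only: powr_add[symmetric])
          (intro arg_cong[of _ _ "\<lambda>z. of_nat q powr z"], simp add: complex_eq_iff)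
      show "0 \<le> ?e (of_real x) q ^ 3 * ?e (Complex x t) q ^ 4 * ?e (Complex x (2 * t)) q \<and>
            ?e (of_real x) q ^ 3 * ?e (Complex x t) q ^ 4 * ?e (Complex x (2 * t)) q \<le> 1"
        unfolding e1 e2 e3 using mertens_341[OF w r] by simp
    qed auto
    finally show ?thesis by simp
  qed
  ultimately have "norm (1::complex) ^ 3 * norm (1::complex) ^ 4 * norm (1::complex) \<le> ?L"
    by (intro LIMSEQ_le_const2) auto
  thus ?thesis by simp
qed

section \<open>Upper and lower bounds for zeta near Re s = 1\<close>

lemma sum_inverse_le:
  assumes "N > 0"
  shows "(\<Sum>n=1..N. 1 / real n) \<le> 1 + ln (real N)"
proof -
  have "harm N - ln (real N) \<le> (1::real)"
  proof -
    have "harm (Suc (N - 1)) - ln (real (Suc (N - 1))) \<le> harm (Suc 0) - ln (real (Suc 0))"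
      using decseq_harm_diff_ln by (rule decseqD) simp
    thus ?thesis using assms by (simp add: harm_def)
  qed
  thus ?thesis by (simp add: harm_def divide_inverse)
qed

text \<open>R^(1 / log R) = e: moving left of Re s = 1 by 1 / log R enlarges n^(-s) with n \<le> R^2
  by at most the factor e^2.\<close>

lemma powr_inverse_ln_le:
  assumes "R > 1" "0 < x" "x \<le> R\<^sup>2" "b \<le> 1 / ln R" "0 \<le> (b::real) \<or> x \<ge> 1"
  shows "x powr b \<le> exp 2"
proof -
  have l: "ln R > 0" using assms by simp
  have lx: "ln x \<le> 2 * ln R"
    using assms ln_mono[of x "R\<^sup>2"] by (simp add: ln_realpow)
  have "b * ln x \<le> 2"
  proof (cases "b \<ge> 0")
    case True
    have "b * ln x \<le> b * (2 * ln R)" using lx True by (rule mult_left_mono)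
    also have "\<dots> \<le> 1 / ln R * (2 * ln R)" using assms l by (intro mult_right_mono) auto
    finally show ?thesis using l by simp
  next
    case False
    hence "b * ln x \<le> 0" using assms by (intro mult_nonpos_nonneg) auto
    thus ?thesis by simp
  qed
  thus ?thesis using assms by (simp add: powr_def)
qed

text \<open>The truncated formula with M about R. The distance c0 from 1 keeps the pole away, and
  the height 3 R leaves room for the ordinate 2 t of the 3-4-1 inequality and for small discs around
  points of height up to R.\<close>

lemma zeta_upper_bound:
  assumes c0: "c0 > 0"
  shows "\<exists>C>0. \<forall>R\<ge>8. \<forall>s. 1 - 1 / ln R \<le> Re s \<longrightarrow> Re s \<le> 2 \<longrightarrow> \<bar>Im s\<bar> \<le> 3 * R \<longrightarrow> c0 \<le> norm (s - 1) \<longrightarrow>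
           norm (zeta1 s / (s - 1)) \<le> C * ln R"
proof (intro exI conjI allI impI)
  define C where "C = exp 2 * (11 + 1 / c0)"
  show "exp 2 * (11 + 1 / c0) > 0" using c0 by (simp add: add_pos_pos)
  fix R :: real and s :: complex
  assume R: "R \<ge> 8" and s: "1 - 1 / ln R \<le> Re s" "Re s \<le> 2" "\<bar>Im s\<bar> \<le> 3 * R" "c0 \<le> norm (s - 1)"
  have lnR: "ln R \<ge> 2"
  proof -
    have "3 * ln 2 = ln ((2::real) ^ 3)" by (subst ln_realpow) auto
    also have "\<dots> \<le> ln R" using R by (subst ln_le_cancel_iff) auto
    finally show ?thesis using ln2_ge_two_thirds by simp
  qed
  define M where "M = nat \<lceil>R\<rceil>"
  have "real M = of_int \<lceil>R\<rceil>" using R by (simp add: M_def)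
  hence M: "real M \<ge> R" "real M < R + 1" using ceiling_correct[of R] by linarith+
  have M0: "M > 0" using M R by auto
  have RR: "real M + 1 \<le> R\<^sup>2"
  proof -
    have "real M + 1 \<le> R + 2" using M by simp
    also have "\<dots> \<le> 2 * R" using R by simp
    also have "\<dots> \<le> R * R" using R by (intro mult_right_mono) auto
    finally show ?thesis by (simp add: power2_eq_square)
  qed
  have sig: "Re s \<ge> 1 / 2"
  proof -
    have "1 / ln R \<le> 1 / 2" using lnR by (intro divide_left_mono) auto
    thus ?thesis using s by linarith
  qed
  have pw: "x powr (- Re s) \<le> exp 2 / x" if "1 \<le> x" "x \<le> R\<^sup>2" for x
  proof -
    have "x powr (- Re s) = x powr (1 - Re s) / x"
      using that by (simp add: powr_diff powr_minus field_simps)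
    also have "\<dots> \<le> exp 2 / x"
      using that s R by (intro divide_right_mono powr_inverse_ln_le[of R]) auto
    finally show ?thesis .
  qed
  let ?S = "\<Sum>n=1..M+1. (of_nat n :: complex) powr (-s)"
  have S: "norm ?S \<le> 3 * exp 2 * ln R"
  proof -
    have "norm ?S \<le> (\<Sum>n=1..M+1. norm ((of_nat n :: complex) powr (-s)))" by (rule norm_sum)
    also have "\<dots> \<le> (\<Sum>n=1..M+1. exp 2 * (1 / real n))"
    proof (intro sum_mono)
      fix n assume n: "n \<in> {1..M+1}"
      hence "real n \<le> R\<^sup>2" using RR by auto
      thus "norm ((of_nat n :: complex) powr (-s)) \<le> exp 2 * (1 / real n)"
        unfolding norm_of_nat_powr using n pw[of "real n"] by simp
    qed
    also have "\<dots> = exp 2 * (\<Sum>n=1..M+1. 1 / real n)" by (simp only: sum_distrib_left)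
    also have "\<dots> \<le> exp 2 * (1 + ln (real (M + 1)))" by (intro mult_left_mono sum_inverse_le) auto
    also have "ln (real (M + 1)) \<le> 2 * ln R"
      using RR R ln_mono[of "real (M + 1)" "R\<^sup>2"] by (simp add: ln_realpow)
    also have "1 + 2 * ln R \<le> 3 * ln R" using lnR by simp
    finally show ?thesis by (simp add: mult_ac)
  qed
  have P: "norm ((of_nat (M + 1) :: complex) powr (1 - s)) \<le> exp 2"
    unfolding norm_of_nat_powr using RR R s by (intro powr_inverse_ln_le[of R]) auto
  let ?T = "zeta1 s - ((s - 1) * ?S + of_nat (M + 1) powr (1 - s))"
  have ns: "norm s \<le> 4 * R"
    using cmod_le[of s] s sig R by linarith
  have T: "norm ?T \<le> norm (s - 1) * (8 * exp 2)"
  proof -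
    have "norm ?T \<le> norm s * norm (s - 1) * (real M powr (- Re s) / Re s)"
      using sig M0 by (intro zeta1_approx) auto
    also have "\<dots> \<le> (4 * R) * norm (s - 1) * ((exp 2 / R) / (1 / 2))"
    proof (intro mult_mono frac_le)
      have "real M powr (- Re s) \<le> exp 2 / real M" using M R RR by (intro pw) auto
      also have "\<dots> \<le> exp 2 / R" using M R by (intro divide_left_mono) auto
      finally show "real M powr (- Re s) \<le> exp 2 / R" .
    qed (use ns sig R in auto)
    finally show ?thesis using R by (simp add: field_simps)
  qed
  have n0: "norm (s - 1) > 0" using s c0 by linarith
  have "norm (zeta1 s / (s - 1)) = norm (?S + of_nat (M + 1) powr (1 - s) / (s - 1) + ?T / (s - 1))"
  proof -
    have "a + b / d + c / d = (d * a + b + c) / d" if "d \<noteq> 0" for a b c d :: complex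
      using that by (simp add: add_divide_distrib)
    thus ?thesis using n0 by simp
  qed
  also have "\<dots> \<le> norm ?S + norm ((of_nat (M + 1) :: complex) powr (1 - s)) / norm (s - 1) + norm ?T / norm (s - 1)"
    unfolding norm_divide[symmetric] by (intro norm_triangle_le add_mono order_refl norm_triangle_ineq)
  also have "\<dots> \<le> 3 * exp 2 * ln R + exp 2 / c0 + 8 * exp 2"
    using n0 T c0 s by (intro add_mono S frac_le P) (auto simp: divide_le_eq mult_ac)
  also have "\<dots> \<le> 3 * exp 2 * ln R + exp 2 / c0 * ln R + 8 * exp 2 * ln R"
  proof (intro add_mono order_refl)
    show "exp 2 / c0 \<le> exp 2 / c0 * ln R"
      using mult_left_mono[of 1 "ln R" "exp 2 / c0"] lnR c0 by simp
    show "8 * exp 2 \<le> 8 * exp 2 * ln R"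
      using mult_left_mono[of 1 "ln R" "8 * exp 2"] lnR by simp
  qed
  also have "\<dots> = exp 2 * (11 + 1 / c0) * ln R" by (simp add: algebra_simps)
  finally show "norm (zeta1 s / (s - 1)) \<le> exp 2 * (11 + 1 / c0) * ln R" .
qed

text \<open>The classical argument with explicit exponents; l = log R and f is zeta. At abscissa 1 +
  d the 3-4-1 inequality gives norm f ^ 4 \<ge> d^3 / (8 C l), and for d = \<kappa>^4 / l^9 this
  yields norm f \<ge> \<kappa>^3 \<eta> / l^7. Moving left by at most 2 d loses at most 2 C l^2
  times 2 d, again of order l^(-7), and small \<kappa> makes the loss half of the gain. So 7 is (3 *
  9 + 1) / 4, and 9 is 7 + 2.\<close>

lemma zeta1_lower_bound:
  "\<exists>c k R0. c > 0 \<and> c \<le> 1 \<and> k > 0 \<and> R0 \<ge> 8 \<and> (\<forall>R\<ge>R0. \<forall>s. 1 - c / ln R ^ 9 \<le> Re s \<longrightarrow> Re s \<le> 1 \<longrightarrow> \<bar>Im s\<bar> \<le> R \<longrightarrow>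
      norm (zeta1 s) \<ge> k / ln R ^ 7)"
proof -
  have "isCont zeta1 1"
    using holomorphic_zeta1 by (auto simp: holomorphic_on_imp_continuous_on continuous_on_eq_continuous_at[OF open_halfspace_Re_gt]
       dest!: holomorphic_on_imp_continuous_on)
  then obtain c1 where c1: "c1 > 0" "\<And>s. norm (s - 1) < c1 \<Longrightarrow> norm (zeta1 s - 1) < 1 / 2"
    using zeta1_1 unfolding continuous_at_eps_delta dist_norm by (metis half_gt_zero zero_less_one)
  define c0 where "c0 = c1 / 2"
  have c0: "c0 > 0" using c1 by (simp add: c0_def)
  obtain C where C: "C > 0" "\<And>R s. R \<ge> 8 \<Longrightarrow> 1 - 1 / ln R \<le> Re s \<Longrightarrow> Re s \<le> 2 \<Longrightarrow> \<bar>Im s\<bar> \<le> 3 * R \<Longrightarrow>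
      c0 / 2 \<le> norm (s - 1) \<Longrightarrow> norm (zeta1 s / (s - 1)) \<le> C * ln R"
    using zeta_upper_bound[of "c0 / 2"] c0 by auto
  \<comment> \<open>\<open>\<eta>\<close> ensures \<eta>^4 \<le> 1 / (8 C), absorbing the constant
    of the 3-4-1 bound; \<open>\<kappa>\<close> ensures 4 C \<kappa> \<le> \<eta> / 2, so that the
    loss along the segment is half of the main term.\<close>
  define \<eta> where "\<eta> = 1 / (8 * C + 1)"
  define \<kappa> where "\<kappa> = min 1 (\<eta> / (8 * C))"
  have \<eta>: "\<eta> > 0" "\<eta> \<le> 1" "\<eta> \<le> 1 / (8 * C)" using C(1) by (auto simp: \<eta>_def field_simps)
  have \<kappa>: "\<kappa> > 0" "\<kappa> \<le> 1" "\<kappa> \<le> \<eta> / (8 * C)" using C(1) \<eta> by (auto simp: \<kappa>_def)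
  define k where "k = min (1 / 2) (\<kappa> ^ 3 * \<eta> / 2 * c0)"
  have k: "k > 0" using \<kappa> \<eta> c0 by (auto simp: k_def)
  define R0 where "R0 = max 8 (exp (2 / c0 + 2))"
  have R0: "R0 \<ge> 8" by (simp add: R0_def)
  have main: "norm (zeta1 s) \<ge> k / ln R ^ 7"
    if R: "R \<ge> R0" and s: "1 - \<kappa> ^ 4 / ln R ^ 9 \<le> Re s" "Re s \<le> 1" "\<bar>Im s\<bar> \<le> R" for R s
  proof -
    have R8: "R \<ge> 8" using R R0 by simp
    define l where "l = ln R"
    have "2 / c0 + 2 \<le> l"
      unfolding l_def using R by (subst ln_ge_iff) (auto simp: R0_def)
    moreover have "2 / c0 > 0" using c0 by simp
    ultimately have l: "l \<ge> 2" "2 / c0 \<le> l" by linarith+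
    define d where "d = \<kappa> ^ 4 / l ^ 9"
    have d0: "d > 0" using \<kappa> l by (simp add: d_def)
    have dl: "d \<le> 1 / (2 * l)"
    proof -
      have "\<kappa> ^ 4 \<le> 1" using \<kappa> by (simp add: power_le_one)
      moreover have "2 * l \<le> l ^ 9"
      proof -
        have "2 * l \<le> l ^ 8 * l"
        proof (intro mult_right_mono)
          have "l ^ 1 \<le> l ^ 8" using l by (intro power_increasing) auto
          thus "2 \<le> l ^ 8" using l by simp
        qed (use l in auto)
        thus ?thesis by (simp add: eval_nat_numeral mult_ac)
      qed
      ultimately show ?thesis unfolding d_def using l \<kappa> by (intro frac_le) auto
    qed
    have lc: "1 / (2 * l) \<le> c0 / 4"
      using l c0 by (simp add: field_simps)
    have "1 / (2 * l) \<le> 1 / 4" using l by (simp add: field_simps)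
    hence d1: "d \<le> 1 / 4" using dl by linarith
    have dc: "d < c1" using dl lc c0 by (simp add: c0_def)
    have l7: "1 \<le> l ^ 7" using l by (intro one_le_power) auto
    show ?thesis
    \<comment> \<open>Close to 1, \<open>zeta1\<close> is near its value 1 there. Away from it the
      ordinate is at least c0 in absolute value, and the upper bound for f applies.\<close>
    proof (cases "norm (s - 1) < c1")
      case True
      hence "norm (zeta1 s - 1) < 1 / 2" by (rule c1)
      hence "norm (zeta1 s) \<ge> 1 / 2" using norm_triangle_ineq2[of 1 "1 - zeta1 s"] by (simp add: norm_minus_commute)
      moreover have "k / l ^ 7 \<le> (1 / 2) / 1" using l7 k by (intro frac_le) (auto simp: k_def)
      ultimately show ?thesis unfolding l_def by linarith
    next
      case False
      define t where "t = Im s"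
      have sd: "Re s \<ge> 1 - d" using s by (simp add: d_def l_def)
      have t: "\<bar>t\<bar> \<ge> c0" "\<bar>t\<bar> \<le> R"
      proof -
        have "norm (s - 1) \<le> \<bar>Re s - 1\<bar> + \<bar>t\<bar>" using cmod_le[of "s - 1"] by (simp add: t_def)
        moreover have "\<bar>Re s - 1\<bar> \<le> c0 / 4" using sd s dl lc by linarith
        ultimately show "\<bar>t\<bar> \<ge> c0" using False c0 by (simp add: c0_def)
        show "\<bar>t\<bar> \<le> R" using s by (simp add: t_def)
      qed
      define f where "f = (\<lambda>s. zeta1 s / (s - 1))"
      define r where "r = 1 / (2 * l)"
      have r: "r > 0" "r \<le> 1/4" "r \<le> c0 / 4" using l lc by (auto simp: r_def field_simps)
      have 2: "2 * r = 1 / ln R" by (simp add: r_def l_def)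
      have holf: "f holomorphic_on {w. Re w > 0} - {1}"
        unfolding f_def by (intro holomorphic_intros holomorphic_on_subset[OF holomorphic_zeta1]) auto
      have near: "1 - 1 / ln R \<le> Re w \<and> Re w \<le> 2 \<and> \<bar>Im w\<bar> \<le> 3 * R \<and> c0 / 2 \<le> norm (w - 1)"
        if w: "norm (z - w) \<le> r" and z: "Im z = t" "1 - d \<le> Re z" "Re z \<le> 1 + d" for w z
      proof -
        have re: "\<bar>Re z - Re w\<bar> \<le> r" and im: "\<bar>t - Im w\<bar> \<le> r"
          using abs_Re_le_cmod[of "z - w"] abs_Im_le_cmod[of "z - w"] w z by auto
        have "c0 / 2 \<le> \<bar>Im w\<bar>" using im t r c0 by linarith
        also have "\<dots> \<le> norm (w - 1)" using abs_Im_le_cmod[of "w - 1"] by simp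
        finally have "c0 / 2 \<le> norm (w - 1)" .
        moreover have "1 - 1 / ln R \<le> Re w" using re z dl 2 by (simp add: r_def[symmetric])
        moreover have "Re w \<le> 2" using re z d1 r by linarith
        moreover have "\<bar>Im w\<bar> \<le> 3 * R" using im t r R8 by linarith
        ultimately show ?thesis by blast
      qed
      have near_dom: "w \<in> {w. Re w > 0} - {1}"
        if w: "norm (z - w) \<le> r" and z: "Im z = t" "1 - d \<le> Re z" "Re z \<le> 1 + d" for w z
      proof -
        have "Re w \<ge> 1 - 2 * r" "c0 / 2 \<le> norm (w - 1)" using near[OF w z] 2 by auto
        thus ?thesis using r c0 by auto
      qed
      have fb: "norm (f w) \<le> C * l" if w: "norm (z - w) \<le> r" and z: "Im z = t" "1 - d \<le> Re z" "Re z \<le> 1 + d" for w z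
        unfolding f_def l_def using near[OF w z] R8 by (intro C(2)) auto
      have deriv: "norm (deriv f z) \<le> 2 * C * l\<^sup>2" if z: "Im z = t" "1 - d \<le> Re z" "Re z \<le> 1 + d" for z
      proof -
        have sub: "cball z r \<subseteq> {w. Re w > 0} - {1}"
        proof
          fix w assume "w \<in> cball z r"
          thus "w \<in> {w. Re w > 0} - {1}" using near_dom[of z w] z by (simp add: dist_norm)
        qed
        have "norm ((deriv ^^ 1) f z) \<le> fact 1 * (C * l) / r ^ 1"
        proof (rule Cauchy_inequality)
          show "f holomorphic_on ball z r"
            using sub ball_subset_cball by (intro holomorphic_on_subset[OF holf]) blast
          show "continuous_on (cball z r) f"
            using sub by (intro holomorphic_on_imp_continuous_on holomorphic_on_subset[OF holf])
          show "norm (f x) \<le> C * l" if "norm (z - x) = r" for x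
            using fb[OF _ z, of x] that by simp
        qed (use r in auto)
        also have "\<dots> = 2 * C * l\<^sup>2" using l by (simp add: r_def power2_eq_square)
        finally show ?thesis by simp
      qed
      define x1 where "x1 = Complex (1 + d) t"
      have seg: "Im z = t \<and> 1 - d \<le> Re z \<and> Re z \<le> 1 + d" if zs: "z \<in> closed_segment s x1" for z
      proof -
        obtain u where u: "0 \<le> u" "u \<le> 1" "z = (1 - u) *\<^sub>R s + u *\<^sub>R x1" using zs by (auto simp: in_segment)
        have im: "Im z = t" by (simp add: u(3) x1_def t_def algebra_simps)
        have re: "Re z = (1 - u) * Re s + u * (1 + d)" by (simp add: u(3) x1_def)
        have "(1 - u) * (1 - d) + u * (1 - d) \<le> Re z" unfolding re using u sd d0
          by (intro add_mono mult_left_mono) auto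
        moreover have "Re z \<le> (1 - u) * (1 + d) + u * (1 + d)" unfolding re using u s d0
          by (intro add_mono mult_left_mono) auto
        ultimately show ?thesis using im by (simp add: algebra_simps)
      qed
      have opn: "open ({w. Re w > 0} - {1})" by (intro open_Diff open_halfspace_Re_gt) auto
      have "norm (f s - f x1) \<le> 2 * C * l\<^sup>2 * norm (s - x1)"
      proof (rule field_differentiable_bound[of "closed_segment s x1" f "deriv f"])
        fix z assume z: "z \<in> closed_segment s x1"
        have "z \<in> {w. Re w > 0} - {1}" using near_dom[of z z] seg[OF z] r by simp
        hence "f field_differentiable at z"
          using holf opn by (auto simp: holomorphic_on_open field_differentiable_def)
        thus "(f has_field_derivative deriv f z) (at z within closed_segment s x1)"
          by (rule has_field_derivative_at_within[OF field_differentiable_derivI])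
        show "norm (deriv f z) \<le> 2 * C * l\<^sup>2" using seg[OF z] by (intro deriv) auto
      qed auto
      also have "norm (s - x1) \<le> 2 * d"
      proof -
        have "s - x1 = of_real (Re s - (1 + d))" by (simp add: complex_eq_iff x1_def t_def)
        hence "norm (s - x1) = \<bar>Re s - (1 + d)\<bar>" by (simp only: norm_of_real)
        thus ?thesis using sd s by linarith
      qed
      also have "2 * C * l\<^sup>2 * (2 * d) = 4 * C * \<kappa> * \<kappa> ^ 3 / l ^ 7"
        using l by (simp add: d_def field_simps eval_nat_numeral)
      also have "\<dots> \<le> (\<eta> / 2) * \<kappa> ^ 3 / l ^ 7"
      proof -
        have "4 * C * \<kappa> \<le> \<eta> / 2" using \<kappa>(3) C(1) by (simp add: field_simps)
        thus ?thesis using \<kappa> l by (intro divide_right_mono mult_right_mono) auto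
      qed
      finally have diff: "norm (f s - f x1) \<le> \<kappa> ^ 3 * \<eta> / 2 / l ^ 7"
        using C(1) l by (simp add: mult_left_mono mult_ac)

      have e: "dsum (\<lambda>_. 1) {} z = f z" if "Re z > 1" for z
        using zeta1_eq_dsum[OF that] that by (auto simp: f_def)
      have "1 \<le> norm (f (of_real (1 + d))) ^ 3 * norm (f x1) ^ 4 * norm (f (Complex (1 + d) (2 * t)))"
        using zeta_341[of "1 + d" t] d0 by (simp add: e x1_def)
      also have "\<dots> \<le> (2 / d) ^ 3 * norm (f x1) ^ 4 * (C * l)"
      proof (intro mult_mono power_mono)
        have "norm (zeta1 (of_real (1 + d)) - 1) < 1 / 2" using dc d0 by (intro c1) simp
        hence "norm (zeta1 (of_real (1 + d))) \<le> 2"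
          using norm_triangle_ineq2[of "zeta1 (of_real (1 + d))" 1] by simp
        thus "norm (f (of_real (1 + d))) \<le> 2 / d"
          using d0 by (simp add: f_def norm_divide divide_right_mono)
        have "c0 / 2 \<le> \<bar>2 * t\<bar>" using t c0 by linarith
        also have "\<dots> \<le> norm (Complex (1 + d) (2 * t) - 1)"
          using abs_Im_le_cmod[of "Complex (1 + d) (2 * t) - 1"] by simp
        finally show "norm (f (Complex (1 + d) (2 * t))) \<le> C * l"
          unfolding f_def l_def using d0 d1 t R8 l 2 r by (intro C(2)) auto
      qed (use d0 C(1) l in auto)
      also have "\<dots> = norm (f x1) ^ 4 * (8 * C * l / d ^ 3)"
        by (simp add: field_simps eval_nat_numeral)
      finally have "d ^ 3 / (8 * C * l) \<le> norm (f x1) ^ 4"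
        using C(1) l d0 by (simp add: field_simps)
      moreover have "(\<kappa> ^ 3 * \<eta> / l ^ 7) ^ 4 \<le> d ^ 3 / (8 * C * l)"
      proof -
        have "\<eta> ^ 4 \<le> \<eta> ^ 1" using \<eta> by (intro power_decreasing) auto
        also have "\<dots> \<le> 1 / (8 * C)" using \<eta> by simp
        finally have "\<eta> ^ 4 \<le> 1 / (8 * C)" .
        hence "d ^ 3 / l * \<eta> ^ 4 \<le> d ^ 3 / l * (1 / (8 * C))"
          using d0 l by (intro mult_left_mono) auto
        moreover have "(\<kappa> ^ 3 * \<eta> / l ^ 7) ^ 4 = d ^ 3 / l * \<eta> ^ 4"
        proof -
          have "l ^ Suc 27 = l * l ^ 27" by (rule power_Suc)
          hence "l ^ 28 = l * l ^ 27" by simp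
          thus ?thesis
            using l by (simp add: d_def power_mult_distrib power_divide field_simps flip: power_mult power_add power_Suc2)
        qed
        ultimately show ?thesis by (simp add: mult_ac)
      qed
      ultimately have "(\<kappa> ^ 3 * \<eta> / l ^ 7) ^ 4 \<le> norm (f x1) ^ 4" by simp
      hence "\<kappa> ^ 3 * \<eta> / l ^ 7 \<le> norm (f x1)" using power_le_imp_le_base[of "\<kappa> ^ 3 * \<eta> / l ^ 7" 3] by simp
      hence "\<kappa> ^ 3 * \<eta> / 2 / l ^ 7 \<le> norm (f s)"
      proof -
        assume *: "\<kappa> ^ 3 * \<eta> / l ^ 7 \<le> norm (f x1)"
        define X where "X = \<kappa> ^ 3 * \<eta> / l ^ 7"
        have eq: "\<kappa> ^ 3 * \<eta> / 2 / l ^ 7 = X / 2" by (simp add: X_def)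
        have "norm (f x1) - norm (f s) \<le> X / 2"
          using norm_triangle_ineq2[of "f x1" "f s"] diff unfolding norm_minus_commute[of "f x1"] eq by linarith
        thus ?thesis using * unfolding eq X_def[symmetric] by linarith
      qed
      moreover have "norm (zeta1 s) = norm (f s) * norm (s - 1)"
      proof -
        have "s \<noteq> 1" using False c1(1) by auto
        thus ?thesis by (simp add: f_def norm_divide)
      qed
      moreover have "norm (s - 1) \<ge> c0" using False c1 by (simp add: c0_def)
      ultimately have "norm (zeta1 s) \<ge> (\<kappa> ^ 3 * \<eta> / 2 / l ^ 7) * c0"
        using c0 by (simp only:) (intro mult_mono; simp)
      moreover have "k / l ^ 7 \<le> (\<kappa> ^ 3 * \<eta> / 2 / l ^ 7) * c0"
        using l by (simp add: k_def field_simps min_def)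
      ultimately show ?thesis unfolding l_def by linarith
    qed
  qed
  have "\<kappa> ^ 4 > 0" "\<kappa> ^ 4 \<le> 1" using \<kappa> by (auto simp: power_le_one)
  thus ?thesis using main k R0 by blast
qed

text \<open>Newman's bound with G(z) = 1 / \<open>zeta1 (1 + z)\<close>, since the Dirichlet series
  of mu at 1 + z is z G(z). For R = (log N)^A the zero-free width is of order (log log N)^(-9), so
  N^(-d) beats every power of log N and all error terms are O(1/R).\<close>

lemma msum_log_decay_eventually:
  assumes A: "A > (0::real)"
  shows "\<exists>C>0. \<forall>\<^sub>F N in sequentially. \<bar>msum {} (real N)\<bar> \<le> C * ln (real N) powr (-A)"
proof -
  obtain c k R0 where ck: "c > 0" "c \<le> 1" "k > 0" "R0 \<ge> 8"
    and low: "\<And>R s. R \<ge> R0 \<Longrightarrow> 1 - c / ln R ^ 9 \<le> Re s \<Longrightarrow> Re s \<le> 1 \<Longrightarrow> \<bar>Im s\<bar> \<le> R \<Longrightarrow> norm (zeta1 s) \<ge> k / ln R ^ 7"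
    using zeta1_lower_bound by blast
  define R where "R = (\<lambda>N::nat. ln (real N) powr A)"
  define d where "d = (\<lambda>N. c / ln (R N) ^ 9)"
  define B where "B = (\<lambda>N. ln (R N) ^ 7 / k)"
  have Rinf: "filterlim R at_top sequentially" unfolding R_def using A by real_asymp
  have "\<forall>\<^sub>F N in sequentially. R N \<ge> max R0 (exp 2)" using Rinf unfolding filterlim_at_top by blast
  moreover have "\<forall>\<^sub>F N in sequentially. 1 / real N \<le> 1 / R N"
    unfolding R_def using A by real_asymp
  moreover have "\<forall>\<^sub>F N in sequentially. B N * R N * real N powr (- d N) \<le> 1 / R N"
    unfolding R_def B_def d_def using A ck by real_asymp
  moreover have "\<forall>\<^sub>F N in sequentially. N > (1::nat)" by (rule eventually_gt_at_top)
  ultimately have "\<forall>\<^sub>F N in sequentially. \<bar>msum {} (real N)\<bar> \<le> (4 + 1 / k) * ln (real N) powr (-A)"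
  proof eventually_elim
    case (elim N)
    have lR: "ln (R N) \<ge> 2" using elim(1) by (subst ln_ge_iff) (auto intro: less_le_trans[OF exp_gt_zero])
    have R0: "R N \<ge> R0" "R N \<ge> 8" using elim(1) ck by auto
    have p9: "ln (R N) ^ 9 \<ge> 2"
    proof -
      have "ln (R N) ^ 1 \<le> ln (R N) ^ 9" using lR by (intro power_increasing) auto
      thus ?thesis using lR by simp
    qed
    have d: "0 < d N" "d N \<le> 1/2"
    proof -
      show "0 < d N" using ck lR by (simp add: d_def)
      have "c / ln (R N) ^ 9 \<le> 1 / 2" using ck p9 by (intro frac_le) auto
      thus "d N \<le> 1/2" by (simp add: d_def)
    qed
    have nz: "zeta1 (1 + z) \<noteq> 0" if "Re z \<ge> - d N" "\<bar>Im z\<bar> \<le> R N" for z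
    proof (cases "Re z > 0")
      case True
      thus ?thesis by (intro zeta1_nonzero) simp
    next
      case False
      hence "norm (zeta1 (1 + z)) \<ge> k / ln (R N) ^ 7"
        using that R0 by (intro low) (auto simp: d_def)
      moreover have "k / ln (R N) ^ 7 > 0" using ck lR by simp
      ultimately show ?thesis by auto
    qed
    have "norm (\<Sum>n=1..N. complex_of_real (mu n) / of_nat n) \<le> 2 / R N + 1 / real N + B N * R N * real N powr (- d N) + B N * (d N)\<^sup>2 / R N"
    proof (rule newman_bound[where G = "\<lambda>z. 1 / zeta1 (1 + z)"])
      show "norm (complex_of_real (mu n)) \<le> 1" for n using abs_mu_le[of n] by simp
      show "(\<lambda>z. 1 / zeta1 (1 + z)) holomorphic_on {z. - d N \<le> Re z \<and> \<bar>Im z\<bar> \<le> R N}"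
        using nz d by (intro holomorphic_intros holomorphic_on_compose_gen[OF _ holomorphic_zeta1, unfolded o_def]) auto
      show "(\<lambda>n. complex_of_real (mu (Suc n)) * of_nat (Suc n) powr (- (1 + z))) sums (z * (1 / zeta1 (1 + z)))"
        if "0 < Re z" for z
      proof -
        have "dsum mu {} (1 + z) = z * (1 / zeta1 (1 + z))"
          using dsum_mu_inverse[of "1 + z"] zeta1_eq_dsum[of "1 + z"] zeta1_nonzero[of "1 + z"] that
          by (auto simp: field_simps)
        thus ?thesis using dsum_sums[of "1 + z" mu] abs_mu_le that by simp
      qed
      show "norm (1 / zeta1 (1 + z)) \<le> B N" if "- d N \<le> Re z" "Re z \<le> 0" "\<bar>Im z\<bar> \<le> R N" for z
      proof -
        have "norm (zeta1 (1 + z)) \<ge> k / ln (R N) ^ 7"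
          using that R0 by (intro low) (auto simp: d_def)
        moreover have "k / ln (R N) ^ 7 > 0" using ck lR by simp
        ultimately have "1 / norm (zeta1 (1 + z)) \<le> 1 / (k / ln (R N) ^ 7)" by (intro divide_left_mono mult_pos_pos) linarith+
        thus ?thesis by (simp add: B_def norm_divide)
      qed
    qed (use elim R0 d lR ck in \<open>auto simp: B_def\<close>)
    also have "(\<Sum>n=1..N. complex_of_real (mu n) / of_nat n) = of_real (\<Sum>n=1..N. mu n / real n)" by simp
    also have "(\<Sum>n=1..N. mu n / real n) = msum {} (real N)"
      unfolding msum_def by (intro sum.cong) (auto simp: free_of_def)
    also have "norm (of_real (msum {} (real N)) :: complex) = \<bar>msum {} (real N)\<bar>" by simp
    also have "B N * (d N)\<^sup>2 / R N \<le> (1 / k) / R N"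
    proof (intro divide_right_mono)
      have "B N * (d N)\<^sup>2 = (c\<^sup>2 / k) / ln (R N) ^ 11"
        using lR by (simp add: B_def d_def field_simps eval_nat_numeral)
      also have "\<dots> \<le> (1 / k) / 1"
      proof (rule frac_le)
        show "c\<^sup>2 / k \<le> 1 / k" using ck by (intro divide_right_mono) (auto simp: power_le_one)
        show "1 \<le> ln (R N) ^ 11" using lR by (intro one_le_power) auto
      qed (use ck in auto)
      finally show "B N * (d N)\<^sup>2 \<le> 1 / k" by simp
    qed (use R0 in auto)
    finally have "\<bar>msum {} (real N)\<bar> \<le> 2 / R N + 1 / R N + 1 / R N + (1 / k) / R N"
      using elim(2,3) by linarith
    also have "\<dots> = (4 + 1 / k) * (1 / R N)" unfolding distrib_right by simp
    also have "1 / R N = ln (real N) powr (-A)" by (simp add: R_def powr_minus field_simps)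
    finally show ?case .
  qed
  moreover have "4 + 1 / k > 0" using ck by (simp add: add_pos_pos)
  ultimately show ?thesis by blast
qed

lemma msum_floor: "msum D u = msum D (real (nat \<lfloor>u\<rfloor>))"
proof (cases "u \<ge> 0")
  case True
  hence "real n \<le> u \<longleftrightarrow> real n \<le> real (nat \<lfloor>u\<rfloor>)" for n
    by (subst of_nat_le_iff) (simp add: le_nat_iff le_floor_iff)
  thus ?thesis unfolding msum_def by (intro sum.cong) auto
next
  case False
  thus ?thesis by (simp add: msum_eq_0)
qed

text \<open>From large integers to all u \<ge> 2: rounding down costs 2^A because the logarithm of
  the integer part is at least half of log u, and bounded u are covered by the trivial bound
  1.\<close>

lemma msum_log_decay:
  assumes A: "A > (0::real)"
  shows "\<exists>C>0. \<forall>u\<ge>2. \<bar>msum {} u\<bar> \<le> C * ln u powr (-A)"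
proof -
  obtain C N0 where C: "C > 0" "\<And>N. N \<ge> N0 \<Longrightarrow> \<bar>msum {} (real N)\<bar> \<le> C * ln (real N) powr (-A)"
    using msum_log_decay_eventually[OF A] by (auto simp: eventually_at_top_linorder)
  define U where "U = max 4 (real N0 + 1)"
  define C' where "C' = max (C * 2 powr A) (ln U powr A)"
  have "\<bar>msum {} u\<bar> \<le> C' * ln u powr (-A)" if u: "u \<ge> 2" for u
  proof (cases "u \<ge> U")
    case True
    define N where "N = nat \<lfloor>u\<rfloor>"
    have u4: "u \<ge> 4" "u \<ge> real N0 + 1" using True by (auto simp: U_def)
    have N: "real N \<le> u" "real N > u - 1" using u by (auto simp: N_def)
    have "N \<ge> N0" using N u4 by linarith
    hence "\<bar>msum {} u\<bar> \<le> C * ln (real N) powr (-A)" using C(2)[of N] msum_floor[of "{}" u] by (simp add: N_def)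
    also have "ln (real N) powr (-A) \<le> (ln u / 2) powr (-A)"
    proof (rule powr_mono2')
      have "sqrt u \<le> u / 2"
      proof (rule real_le_lsqrt)
        have "4 * u \<le> u * u" using u4 by (intro mult_right_mono) auto
        thus "u \<le> (u / 2)\<^sup>2" by (simp add: power2_eq_square)
      qed (use u4 in auto)
      hence "sqrt u \<le> real N" using N u4 by linarith
      moreover have "real N > 0" using N u4 by linarith
      ultimately have "ln (sqrt u) \<le> ln (real N)" using u4 by (subst ln_le_cancel_iff) auto
      thus "ln u / 2 \<le> ln (real N)" using u4 by (simp add: ln_sqrt)
    qed (use A u4 in auto)
    also have "(ln u / 2) powr (-A) = 2 powr A * ln u powr (-A)"
      using u4 by (simp add: powr_divide powr_minus field_simps)
    also have "C * (2 powr A * ln u powr (-A)) \<le> C' * ln u powr (-A)"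
      unfolding mult.assoc[symmetric] by (intro mult_right_mono) (auto simp: C'_def)
    finally show ?thesis using C(1) by (simp add: mult_left_mono)
  next
    case False
    have "1 = ln u powr A * ln u powr (-A)" using u by (simp add: powr_minus)
    also have "\<dots> \<le> ln U powr A * ln u powr (-A)"
      using u False A by (intro mult_right_mono powr_mono2) auto
    also have "\<dots> \<le> C' * ln u powr (-A)" by (intro mult_right_mono) (auto simp: C'_def)
    finally show ?thesis using abs_msum_le_1[of "{}" u] by simp
  qed
  moreover have "C' > 0"
  proof -
    have "C * 2 powr A > 0" using C(1) by simp
    thus ?thesis unfolding C'_def by (simp add: less_max_iff_disj)
  qed
  ultimately show ?thesis by blast
qed

section \<open>Sums weighted by the number of prime factors\<close>

text \<open>The shift c counts the prime factors already split off: each removal of a smallest prime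
  raises it by one, so c runs through 0, 1, 2.\<close>

definition V :: "nat \<Rightarrow> nat set \<Rightarrow> real \<Rightarrow> real" where
  "V c D y = (\<Sum>m | free_of D m \<and> real m \<le> y. mu m / real m * (real (omega m) + real c)\<^sup>2)"

definition U1 :: "nat set \<Rightarrow> real \<Rightarrow> real" where
  "U1 D y = (\<Sum>m | free_of D m \<and> real m \<le> y. mu m / real m * real (omega m))"

text \<open>The falling factorial counts ordered pairs of distinct primes dividing m. Truncated
  subtraction is harmless because of the factor omega(m).\<close>

definition U2 :: "nat set \<Rightarrow> real \<Rightarrow> real" where
  "U2 D y = (\<Sum>m | free_of D m \<and> real m \<le> y. mu m / real m * (real (omega m) * real (omega m - 1)))"

lemma V_eq: "V c D y = U2 D y + (2 * real c + 1) * U1 D y + (real c)\<^sup>2 * msum D y"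
proof -
  have e: "(real w + real c)\<^sup>2 = real w * real (w - 1) + (2 * real c + 1) * real w + (real c)\<^sup>2" for w
    by (cases w) (auto simp: power2_eq_square algebra_simps)
  have g: "k * (a + b * w + d) = k * a + b * (k * w) + d * k" for k a b w d :: real
    by (simp add: algebra_simps)
  show ?thesis
    unfolding V_def U2_def U1_def msum_def sum_distrib_left sum.distrib[symmetric] e
    by (intro sum.cong refl g)
qed

lemma U1_eq:
  assumes "\<forall>p\<in>D. prime p"
  shows "U1 D y = - (\<Sum>q\<in>primes_upto y - D. 1 / real q * msum (insert q D) (y / real q))"
  using sum_mu_omega[OF assms, where g = "\<lambda>_. 1" and y = y] by (simp add: U1_def msum_def)

lemma U2_eq:
  assumes "\<forall>p\<in>D. prime p"
  shows "U2 D y = - (\<Sum>q\<in>primes_upto y - D. 1 / real q * U1 (insert q D) (y / real q))"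
  using sum_mu_omega[OF assms, where g = real and y = y] by (simp add: U2_def U1_def)

definition prime_inv :: "real \<Rightarrow> real \<Rightarrow> real" where
  "prime_inv a b = (\<Sum>q\<in>primes_upto b - primes_upto a. 1 / real q)"

abbreviation prime_inv_sum :: "real \<Rightarrow> real" where
  "prime_inv_sum x \<equiv> (\<Sum>q\<in>primes_upto x. 1 / real q)"

text \<open>Rounding the end points to integers costs O(1 / log a): the ratio of a to its integer
  part is at most 2, and the logarithm of the latter is at least half of log a.\<close>

lemma prime_inv_bound:
  "\<exists>C>0. \<forall>a\<ge>2. \<forall>b\<ge>a. prime_inv a b \<le> ln (ln b / ln a) + C / ln a"
proof -
  obtain C where C: "C > 0" "\<And>M N. 2 \<le> M \<Longrightarrow> M \<le> N \<Longrightarrow>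
    (\<Sum>q\<in>{q\<in>{M<..N}. prime q}. 1 / real q) \<le> ln (ln (real N) / ln (real M)) + C / ln (real M)"
    using sum_inverse_primes_le_nat by blast
  have "prime_inv a b \<le> ln (ln b / ln a) + 2 * (C + 1) / ln a" if ab: "2 \<le> a" "a \<le> b" for a b
  proof -
    define M N where "M = nat \<lfloor>a\<rfloor>" and "N = nat \<lfloor>b\<rfloor>"
    have M: "2 \<le> M" "real M \<le> a" "a < real M + 1" using ab by (auto simp: M_def le_nat_iff le_floor_iff)
    have N: "M \<le> N" "real N \<le> b" using ab by (auto simp: M_def N_def intro!: nat_mono floor_mono)
    have "prime_inv a b = (\<Sum>q\<in>{q\<in>{M<..N}. prime q}. 1 / real q)"
      unfolding prime_inv_def using ab
      by (intro sum.cong) (auto simp: primes_upto_def M_def N_def le_nat_iff le_floor_iff nat_less_iff floor_less_iff)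
    also have "\<dots> \<le> ln (ln (real N) / ln (real M)) + C / ln (real M)" using M N by (intro C)
    also have "ln (ln (real N) / ln (real M)) \<le> ln (ln b / ln a) + 1 / ln (real M)"
    proof -
      have l: "ln (real M) > 0" "ln a > 0" "ln b > 0" "ln (real N) > 0" using M N ab by auto
      have "ln (ln (real N) / ln (real M)) = ln (ln (real N)) - ln (ln (real M))" using l by (simp add: ln_div)
      also have "\<dots> \<le> ln (ln b) - ln (ln (real M))" using l M N by (intro diff_right_mono) auto
      also have "\<dots> = ln (ln b / ln a) + ln (ln a / ln (real M))" using l by (simp add: ln_div)
      also have "ln (ln a / ln (real M)) \<le> ln a / ln (real M) - 1" using l by (intro ln_le_minus_one) auto
      also have "\<dots> = (ln a - ln (real M)) / ln (real M)" using l by (simp add: field_simps)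
      also have "ln a - ln (real M) = ln (a / real M)" using M ab by (simp add: ln_div)
      also have "ln (a / real M) \<le> a / real M - 1" using M ab by (intro ln_le_minus_one) auto
      also have "\<dots> \<le> 1" using M by (simp add: field_simps)
      finally show ?thesis using l by (simp add: divide_right_mono)
    qed
    also have "ln (ln b / ln a) + 1 / ln (real M) + C / ln (real M) = ln (ln b / ln a) + (C + 1) / ln (real M)"
      by (simp add: add_divide_distrib)
    also have "(C + 1) / ln (real M) \<le> (C + 1) / (ln a / 2)"
    proof (intro divide_left_mono)
      have "a \<le> real M + 1" using M by simp
      also have "\<dots> \<le> 2 * real M" using M by simp
      also have "\<dots> \<le> real M * real M" using M by (intro mult_right_mono) auto
      finally have "ln a \<le> ln (real M * real M)" using ab M by (intro ln_mono) auto
      also have "\<dots> = 2 * ln (real M)" using M by (simp add: ln_mult)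
      finally show "ln a / 2 \<le> ln (real M)" by simp
    qed (use C M ab in auto)
    also have "(C + 1) / (ln a / 2) = 2 * (C + 1) / ln a" by (simp add: field_simps)
    finally show ?thesis by simp
  qed
  moreover have "2 * (C + 1) > 0" using C by simp
  ultimately show ?thesis by blast
qed

text \<open>The inequality log y \<le> y - 1 at y = log b / log a; a good bound when the ratio b/a
  is small compared with a.\<close>

lemma prime_inv_short:
  "\<exists>C>0. \<forall>a\<ge>2. \<forall>b\<ge>a. prime_inv a b \<le> (ln (b / a) + C) / ln a"
proof -
  obtain C where C: "C > 0" "\<And>a b. 2 \<le> a \<Longrightarrow> a \<le> b \<Longrightarrow> prime_inv a b \<le> ln (ln b / ln a) + C / ln a"
    using prime_inv_bound by blast
  have "prime_inv a b \<le> (ln (b / a) + C) / ln a" if ab: "2 \<le> a" "a \<le> b" for a b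
  proof -
    have l: "ln a > 0" "ln b > 0" using ab by auto
    have "prime_inv a b \<le> ln (ln b / ln a) + C / ln a" by (rule C(2)[OF ab])
    also have "ln (ln b / ln a) \<le> ln b / ln a - 1" using l by (intro ln_le_minus_one) auto
    also have "ln b / ln a - 1 + C / ln a = (ln (b / a) + C) / ln a"
      using l ab by (simp add: ln_div field_simps)
    finally show ?thesis by simp
  qed
  thus ?thesis using C(1) by blast
qed

lemma prime_inv_sum_bound:
  "\<exists>C>0. \<forall>x\<ge>3. prime_inv_sum x \<le> ln (ln x) + C"
proof -
  obtain C where C: "C > 0" "\<And>a b. 2 \<le> a \<Longrightarrow> a \<le> b \<Longrightarrow> prime_inv a b \<le> ln (ln b / ln a) + C / ln a"
    using prime_inv_bound by blast
  define C' where "C' = C / ln 2 + \<bar>ln (ln 2)\<bar> + 1"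
  have "prime_inv_sum x \<le> ln (ln x) + C'" if x: "x \<ge> 3" for x
  proof -
    have p2: "primes_upto 2 = {2}" by (auto simp: primes_upto_def dest: prime_ge_2_nat)
    have sub: "primes_upto 2 \<subseteq> primes_upto x" using x by (auto simp: primes_upto_def)
    have "prime_inv_sum x = prime_inv 2 x + prime_inv_sum 2"
      unfolding prime_inv_def using sum.subset_diff[OF sub finite_primes_upto, of "\<lambda>q. 1 / real q"] by simp
    also have "prime_inv_sum 2 = 1 / 2" by (simp add: p2)
    also have "prime_inv 2 x \<le> ln (ln x / ln 2) + C / ln 2" using x by (intro C) auto
    also have "ln (ln x / ln 2) = ln (ln x) - ln (ln 2)" using x by (simp add: ln_div)
    finally show ?thesis by (simp add: C'_def)
  qed
  moreover have "C' > 0" using C by (simp add: C'_def add_pos_pos add_nonneg_pos)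
  ultimately show ?thesis by blast
qed

lemma prime_inv_sum_mono: "x \<le> y \<Longrightarrow> prime_inv_sum x \<le> prime_inv_sum y"
  by (intro sum_mono2) (auto simp: primes_upto_def)

lemma prime_inv_sum_nonneg: "prime_inv_sum x \<ge> 0"
  by (intro sum_nonneg) auto

text \<open>After expansion over primes q, or pairs q and r, the inner sum has length y/q or y/(q
  r). At lengths of at least W it is at most \<tau>. Below W only the bound 1 is available, but then
  q or q r lies within a factor W of y, and the reciprocals of such primes sum to O(log W / log
  y).\<close>

lemma U_bounds:
  "\<exists>C>0. \<forall>D y W \<tau>. (\<forall>p\<in>D. prime p) \<longrightarrow> y \<ge> 16 \<longrightarrow> W \<ge> 1 \<longrightarrow> ln W \<le> ln y / 4 \<longrightarrow> \<tau> \<ge> 0 \<longrightarrow>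
     (\<forall>q r u. prime q \<longrightarrow> prime r \<longrightarrow> W \<le> u \<longrightarrow> u \<le> y \<longrightarrow> \<bar>msum (insert q (insert r D)) u\<bar> \<le> \<tau>) \<longrightarrow>
     \<bar>U1 D y\<bar> \<le> \<tau> * prime_inv_sum y + 4 * (ln W + C) / ln y \<and>
     \<bar>U2 D y\<bar> \<le> \<tau> * (prime_inv_sum y)\<^sup>2 + 8 * prime_inv_sum y * (ln W + C) / ln y"
proof -
  obtain C where C: "C > 0" "\<And>a b. 2 \<le> a \<Longrightarrow> a \<le> b \<Longrightarrow> prime_inv a b \<le> (ln (b / a) + C) / ln a"
    using prime_inv_short by blast
  have main: "\<bar>U1 D y\<bar> \<le> \<tau> * prime_inv_sum y + 4 * (ln W + C) / ln y \<and>
     \<bar>U2 D y\<bar> \<le> \<tau> * (prime_inv_sum y)\<^sup>2 + 8 * prime_inv_sum y * (ln W + C) / ln y"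
    if D: "\<forall>p\<in>D. prime p" and y: "y \<ge> 16" and W: "W \<ge> 1" "ln W \<le> ln y / 4" and tau: "\<tau> \<ge> 0"
      and H: "\<And>q r u. prime q \<Longrightarrow> prime r \<Longrightarrow> W \<le> u \<Longrightarrow> u \<le> y \<Longrightarrow> \<bar>msum (insert q (insert r D)) u\<bar> \<le> \<tau>"
    for D y W \<tau>
  proof -
    let ?P = "primes_upto y"
    let ?s = "prime_inv_sum y"
    have lny: "ln y > 0" using y by simp
    have lnW: "ln W \<ge> 0" using W by simp
    have sq: "sqrt y / W \<ge> y powr (1/4)"
    proof -
      have "ln W + ln (y powr (1/4)) \<le> ln y / 2" using W y by (simp add: ln_powr)
      hence "ln (W * y powr (1/4)) \<le> ln (sqrt y)" using W y by (simp add: ln_mult ln_sqrt)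
      hence "W * y powr (1/4) \<le> sqrt y" using W y by (subst (asm) ln_le_cancel_iff) auto
      thus ?thesis using W by (simp add: field_simps)
    qed
    have y4: "y powr (1/4) \<ge> 2"
    proof -
      have "(2::real) = 16 powr (1/4)" using powr_powr[of 2 4 "1/4"] by (simp add: powr_numeral)
      also have "\<dots> \<le> y powr (1/4)" using y by (intro powr_mono2) auto
      finally show ?thesis .
    qed
    \<comment> \<open>The hypotheses on W and y keep v/W at least y^(1/4) \<ge> 2, so the logarithm
      in the denominator is at least a quarter of log y.\<close>
    have short: "prime_inv (v / W) v \<le> 4 * (ln W + C) / ln y" if v: "v \<ge> sqrt y" for v
    proof -
      have v1: "v / W \<ge> y powr (1/4)" using sq v W by (meson divide_right_mono order_trans zero_le_one)
      have v0: "v > 0" using v y by (smt (verit) real_sqrt_gt_zero)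
      have "prime_inv (v / W) v \<le> (ln (v / (v / W)) + C) / ln (v / W)"
        using v1 y4 W v0 by (intro C(2)) (auto simp: divide_le_eq mult_le_cancel_left1)
      also have "v / (v / W) = W" using v0 by simp
      also have "(ln W + C) / ln (v / W) \<le> (ln W + C) / (ln y / 4)"
      proof (intro divide_left_mono)
        have "ln (y powr (1/4)) \<le> ln (v / W)" using v1 y by (intro ln_mono) auto
        thus "ln y / 4 \<le> ln (v / W)" using y by (simp add: ln_powr)
        thus "0 < ln (v / W) * (ln y / 4)" using lny by (intro mult_pos_pos) auto
      qed (use lnW C in auto)
      also have "\<dots> = 4 * (ln W + C) / ln y" by (simp add: field_simps)
      finally show ?thesis .
    qed
    have H1: "\<bar>msum (insert q (insert r D)) u\<bar> \<le> \<tau> + (if u < W then 1 else 0)" if "prime q" "prime r" "u \<le> y" for q r u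
      using H[of q r u] abs_msum_le_1[of "insert q (insert r D)" u] D that tau by auto
    have dl: "y / real q \<le> y" if "prime q" for q
      using y prime_gt_0_nat[OF that] by (simp add: divide_le_eq mult_le_cancel_left1)
    have b1: "\<bar>U1 D y\<bar> \<le> \<tau> * ?s + 4 * (ln W + C) / ln y"
    proof -
      have "\<bar>U1 D y\<bar> \<le> (\<Sum>q\<in>?P - D. \<bar>1 / real q * msum (insert q D) (y / real q)\<bar>)"
        unfolding U1_eq[OF D] abs_minus_cancel by (rule sum_abs)
      also have "\<dots> \<le> (\<Sum>q\<in>?P - D. 1 / real q * (\<tau> + (if y / real q < W then 1 else 0)))"
      proof (intro sum_mono)
        fix q assume "q \<in> ?P - D"
        hence q: "prime q" by (simp add: primes_upto_def)
        show "\<bar>1 / real q * msum (insert q D) (y / real q)\<bar> \<le> 1 / real q * (\<tau> + (if y / real q < W then 1 else 0))"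
          unfolding abs_mult using H1[OF q q dl[OF q]] by (intro mult_mono) auto
      qed
      also have "\<dots> \<le> (\<Sum>q\<in>?P. 1 / real q * (\<tau> + (if y / real q < W then 1 else 0)))"
        using tau by (intro sum_mono2) auto
      also have "\<dots> = \<tau> * ?s + (\<Sum>q\<in>?P. if y / real q < W then 1 / real q else 0)"
        unfolding sum_distrib_left sum.distrib[symmetric] by (intro sum.cong) (auto simp: add_divide_distrib)
      also have "(\<Sum>q\<in>?P. if y / real q < W then 1 / real q else 0) = prime_inv (y / W) y"
        unfolding prime_inv_def using W
        by (intro sum.mono_neutral_cong_right) (auto simp: primes_upto_def field_simps prime_gt_0_nat)
      also have "\<dots> \<le> 4 * (ln W + C) / ln y"
        using y by (intro short) (auto intro!: real_le_lsqrt simp: power2_eq_square)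
      finally show ?thesis by simp
    qed
    let ?T = "\<lambda>q r. if y / W < real q * real r \<and> real q * real r \<le> y then 1 / (real q * real r) else 0"
    have "\<bar>U2 D y\<bar> \<le> (\<Sum>q\<in>?P - D. \<bar>1 / real q * U1 (insert q D) (y / real q)\<bar>)"
      unfolding U2_eq[OF D] abs_minus_cancel by (rule sum_abs)
    also have "\<dots> \<le> (\<Sum>q\<in>?P - D. \<Sum>r\<in>?P. \<tau> * (1 / real q * (1 / real r)) + ?T q r)"
    proof (intro sum_mono)
      fix q assume "q \<in> ?P - D"
      hence q: "prime q" "q > 0" by (auto simp: primes_upto_def prime_gt_0_nat)
      have Dq: "\<forall>p\<in>insert q D. prime p" using D q by auto
      have sub: "primes_upto (y / real q) \<subseteq> ?P" using dl[OF q(1)] by (auto simp: primes_upto_def)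
      have "\<bar>1 / real q * U1 (insert q D) (y / real q)\<bar> = 1 / real q * \<bar>U1 (insert q D) (y / real q)\<bar>" by (simp add: abs_mult)
      also have "\<dots> \<le> 1 / real q * (\<Sum>r\<in>primes_upto (y / real q) - insert q D. \<bar>1 / real r * msum (insert r (insert q D)) (y / real q / real r)\<bar>)"
        unfolding U1_eq[OF Dq] abs_minus_cancel by (intro mult_left_mono sum_abs) auto
      also have "\<dots> \<le> 1 / real q * (\<Sum>r\<in>primes_upto (y / real q) - insert q D. 1 / real r * (\<tau> + (if y / real q / real r < W then 1 else 0)))"
      proof (intro mult_left_mono sum_mono)
        fix r assume "r \<in> primes_upto (y / real q) - insert q D"
        hence r: "prime r" "r > 0" by (auto simp: primes_upto_def prime_gt_0_nat)
        have "y / real q / real r \<le> y / real q"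
          using y q r by (simp add: divide_le_eq mult_le_cancel_left1)
        hence "y / real q / real r \<le> y" using dl[OF q(1)] by linarith
        thus "\<bar>1 / real r * msum (insert r (insert q D)) (y / real q / real r)\<bar> \<le> 1 / real r * (\<tau> + (if y / real q / real r < W then 1 else 0))"
          unfolding abs_mult using H1[OF r(1) q(1)] by (intro mult_mono) auto
      qed auto
      also have "\<dots> = (\<Sum>r\<in>primes_upto (y / real q) - insert q D. \<tau> * (1 / real q * (1 / real r)) + ?T q r)"
        unfolding sum_distrib_left
      proof (intro sum.cong refl)
        fix r assume r: "r \<in> primes_upto (y / real q) - insert q D"
        hence "r > 0" by (auto simp: primes_upto_def prime_gt_0_nat)
        moreover have "real q * real r \<le> y" using r q by (auto simp: primes_upto_def field_simps)
        ultimately show "1 / real q * (1 / real r * (\<tau> + (if y / real q / real r < W then 1 else 0))) = \<tau> * (1 / real q * (1 / real r)) + ?T q r"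
          using q W by (auto simp: field_simps)
      qed
      also have "\<dots> \<le> (\<Sum>r\<in>?P. \<tau> * (1 / real q * (1 / real r)) + ?T q r)"
        using sub tau by (intro sum_mono2) auto
      finally show "\<bar>1 / real q * U1 (insert q D) (y / real q)\<bar> \<le> \<dots>" .
    qed
    also have "\<dots> \<le> (\<Sum>q\<in>?P. \<Sum>r\<in>?P. \<tau> * (1 / real q * (1 / real r)) + ?T q r)"
      using tau by (intro sum_mono2 sum_nonneg) auto
    also have "\<dots> = \<tau> * ?s\<^sup>2 + (\<Sum>q\<in>?P. \<Sum>r\<in>?P. ?T q r)"
    proof -
      have "?s\<^sup>2 = (\<Sum>q\<in>?P. \<Sum>r\<in>?P. 1 / real q * (1 / real r))" by (simp only: power2_eq_square sum_product)
      hence "\<tau> * ?s\<^sup>2 = (\<Sum>q\<in>?P. \<Sum>r\<in>?P. \<tau> * (1 / real q * (1 / real r)))" by (simp only: sum_distrib_left)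
      thus ?thesis by (simp only: sum.distrib)
    qed
    \<comment> \<open>One of q, r is at most sqrt y. Fixing that one, say q, leaves the other in the
      short interval from y/(q W) to y/q, with y/q \<ge> sqrt y. Symmetry gives the factor
      2.\<close>
    also have "(\<Sum>q\<in>?P. \<Sum>r\<in>?P. ?T q r) \<le> (\<Sum>q\<in>?P. \<Sum>r\<in>?P. (if real q \<le> sqrt y then ?T q r else 0) + (if real r \<le> sqrt y then ?T q r else 0))"
    proof (intro sum_mono)
      fix q r
      have "real q \<le> sqrt y \<or> real r \<le> sqrt y" if "real q * real r \<le> y"
      proof (rule ccontr)
        assume "\<not> (real q \<le> sqrt y \<or> real r \<le> sqrt y)"
        hence "sqrt y * sqrt y < real q * real r" using y by (intro mult_strict_mono') auto
        thus False using that y by simp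
      qed
      thus "?T q r \<le> (if real q \<le> sqrt y then ?T q r else 0) + (if real r \<le> sqrt y then ?T q r else 0)" by auto
    qed
    also have "\<dots> = 2 * (\<Sum>q\<in>?P. \<Sum>r\<in>?P. if real q \<le> sqrt y then ?T q r else 0)"
    proof -
      have "(\<Sum>q\<in>?P. \<Sum>r\<in>?P. if real r \<le> sqrt y then ?T q r else 0) = (\<Sum>r\<in>?P. \<Sum>q\<in>?P. if real r \<le> sqrt y then ?T r q else 0)"
        by (subst sum.swap) (simp only: mult.commute)
      thus ?thesis by (simp only: sum.distrib)
    qed
    also have "(\<Sum>q\<in>?P. \<Sum>r\<in>?P. if real q \<le> sqrt y then ?T q r else 0) \<le> (\<Sum>q\<in>?P. 1 / real q * (4 * (ln W + C) / ln y))"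
    proof (intro sum_mono)
      fix q assume "q \<in> ?P"
      hence q: "prime q" "q > 0" by (auto simp: primes_upto_def prime_gt_0_nat)
      show "(\<Sum>r\<in>?P. if real q \<le> sqrt y then ?T q r else 0) \<le> 1 / real q * (4 * (ln W + C) / ln y)"
      proof (cases "real q \<le> sqrt y")
        case True
        have v: "y / real q \<ge> sqrt y"
        proof -
          have "sqrt y * real q \<le> sqrt y * sqrt y" using True y by (intro mult_left_mono) auto
          thus ?thesis using q y by (simp add: field_simps)
        qed
        have "(\<Sum>r\<in>?P. ?T q r) = (\<Sum>r\<in>primes_upto (y / real q) - primes_upto (y / real q / W). 1 / real q * (1 / real r))"
        proof (rule sum.mono_neutral_cong_right)
          have "primes_upto (y / real q) \<subseteq> ?P" using dl[OF q(1)] by (auto simp: primes_upto_def)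
          thus "primes_upto (y / real q) - primes_upto (y / real q / W) \<subseteq> ?P" by blast
        qed (use q W in \<open>auto simp: primes_upto_def field_simps\<close>)
        also have "\<dots> = 1 / real q * prime_inv (y / real q / W) (y / real q)"
          by (simp only: prime_inv_def sum_distrib_left)
        also have "\<dots> \<le> 1 / real q * (4 * (ln W + C) / ln y)" by (intro mult_left_mono short v) auto
        finally show ?thesis using True by simp
      next
        case False
        have "0 \<le> 1 / real q * (4 * (ln W + C) / ln y)"
          using lnW lny C(1) by (intro mult_nonneg_nonneg divide_nonneg_nonneg) auto
        thus ?thesis using False by simp
      qed
    qed
    also have "\<dots> = ?s * (4 * (ln W + C) / ln y)" by (simp only: sum_distrib_right)
    finally have "\<bar>U2 D y\<bar> \<le> \<tau> * ?s\<^sup>2 + 2 * (?s * (4 * (ln W + C) / ln y))" by simp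
    moreover have "2 * (?s * (4 * (ln W + C) / ln y)) = 8 * ?s * (ln W + C) / ln y" by (simp add: field_simps)
    ultimately show ?thesis using b1 by linarith
  qed
  show ?thesis
    by (rule exI[of _ C]) (use main C(1) in blast)
qed

text \<open>Every prime has p^(e-1) \<le> 5/6, so each factor is at most 6; this bounds the two
  extra primes, which may exceed z, by 36. For p \<le> z moreover p^e \<le> exp (1/2) \<le> 1.65,
  and the factor is at most 1 + 6 * 1.65 / p \<le> exp (10/p).\<close>

lemma prod_smooth_bound:
  assumes e: "0 \<le> e" "e \<le> 1/8" and z: "z \<ge> 1" "e * ln z \<le> 1/2" and qr: "prime q" "prime r"
  shows "(\<Prod>p\<in>insert q (insert r (primes_upto z)). 1 / (1 - real p powr (e - 1))) \<le> 36 * exp (10 * prime_inv_sum z)"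
proof -
  have exph: "exp (1/2) \<le> (1.65 :: real)"
  proof -
    have "exp (1/2) ^ 2 = exp (1::real)" by (simp add: exp_of_nat_mult[symmetric])
    also have "\<dots> \<le> 2.72" using e_less_272 by simp
    also have "\<dots> \<le> 1.65 ^ 2" by (simp add: power2_eq_square)
    finally show ?thesis by (rule power2_le_imp_le) simp
  qed
  have fv: "real p powr (e - 1) \<le> 5 / 6" if p: "prime p" for p
  proof -
    have p2: "real p \<ge> 2" using prime_ge_2_nat[OF p] by simp
    have "real p powr (e - 1) \<le> 2 powr (e - 1)" using p2 e by (intro powr_mono2') auto
    also have "\<dots> \<le> 2 powr (- (1/2))" using e by (intro powr_mono) auto
    also have "\<dots> = 1 / sqrt 2" by (simp add: powr_minus powr_half_sqrt field_simps)
    also have "\<dots> \<le> 5 / 6" using real_le_rsqrt[of "6/5" 2] by (simp add: field_simps power2_eq_square)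
    finally show ?thesis .
  qed
  have f1: "1 / (1 - real p powr (e - 1)) \<ge> 1" "1 / (1 - real p powr (e - 1)) \<le> 6" if p: "prime p" for p
  proof -
    have "real p powr (e - 1) > 0" using prime_gt_0_nat[OF p] by simp
    with fv[OF p] show "1 / (1 - real p powr (e - 1)) \<ge> 1" "1 / (1 - real p powr (e - 1)) \<le> 6"
      by (auto simp: field_simps)
  qed
  have f2: "1 / (1 - real p powr (e - 1)) \<le> exp (10 * (1 / real p))" if p: "p \<in> primes_upto z" for p
  proof -
    have pp: "prime p" "real p \<le> z" using p by (auto simp: primes_upto_def)
    have p2: "real p \<ge> 2" using prime_ge_2_nat[OF pp(1)] by simp
    define v where "v = real p powr (e - 1)"
    have v0: "v > 0" using p2 by (simp add: v_def)
    have v1: "1 / (1 - v) \<le> 6" "1 / (1 - v) \<ge> 1" using f1[OF pp(1)] by (auto simp: v_def)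
    have v56: "v \<le> 5/6" using fv[OF pp(1)] by (simp add: v_def)
    have "real p powr e = exp (e * ln (real p))" using p2 by (simp add: powr_def)
    also have "\<dots> \<le> exp (1/2)"
    proof -
      have "e * ln (real p) \<le> e * ln z" using e pp p2 by (intro mult_left_mono) auto
      thus ?thesis using z by simp
    qed
    finally have "real p powr e \<le> 1.65" using exph by linarith
    hence "real p powr e / real p \<le> 1.65 / real p" by (intro divide_right_mono) auto
    hence "v \<le> 1.65 / real p" using p2 by (simp add: v_def powr_diff)
    have "1 / (1 - v) = 1 + v * (1 / (1 - v))" using v56 by (simp add: field_simps)
    also have "\<dots> \<le> 1 + v * 6" using v0 v1 by (intro add_left_mono mult_left_mono) auto
    also have "\<dots> \<le> 1 + 10 * (1 / real p)" using \<open>v \<le> 1.65 / real p\<close> p2 by (simp add: field_simps)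
    also have "\<dots> \<le> exp (10 * (1 / real p))" by (rule exp_ge_add_one_self)
    finally show ?thesis by (simp add: v_def)
  qed
  let ?f = "\<lambda>p. 1 / (1 - real p powr (e - 1))"
  have f0: "?f p \<ge> 0" if "prime p" for p using f1(1)[OF that] by linarith
  have nn: "prod ?f S \<ge> 0" if "\<forall>x\<in>S. prime x" for S
    using that f0 by (intro prod_nonneg) blast
  have pr: "prod ?f (insert p S) \<le> 6 * prod ?f S" if "finite S" "prime p" "\<forall>x\<in>S. prime x" for p S
  proof (cases "p \<in> S")
    case True
    thus ?thesis using nn[OF that(3)] by (simp add: insert_absorb)
  next
    case False
    thus ?thesis using that nn[OF that(3)] mult_right_mono[OF f1(2)[OF that(2)], of "prod ?f S"]
      by (simp only: prod.insert) simp
  qed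
  have pz: "\<forall>x\<in>primes_upto z. prime x" by (simp add: primes_upto_def)
  have "prod ?f (insert q (insert r (primes_upto z))) \<le> 6 * prod ?f (insert r (primes_upto z))"
    using pz qr by (intro pr) auto
  also have "prod ?f (insert r (primes_upto z)) \<le> 6 * prod ?f (primes_upto z)"
    using pz qr by (intro pr) auto
  also have "prod ?f (primes_upto z) \<le> (\<Prod>p\<in>primes_upto z. exp (10 * (1 / real p)))"
    using f0 f2 pz by (intro prod_mono conjI) blast+
  also have "\<dots> = exp (10 * prime_inv_sum z)"
    by (simp only: exp_sum[OF finite_primes_upto, symmetric] sum_distrib_left)
  finally show ?thesis by simp
qed

text \<open>Origin of the exponents, with L = log log x, Y = max (log z) (sqrt (log x)), e = 1/(2Y).
  A bound K t^(-e) for the unsifted sum is obtained in two ranges. For t \<ge> sqrt u, log t \<ge>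
  sqrt (log x), so decay with exponent 22 gives (log x)^(-11). For t < sqrt u, log u \<ge> 44 L Y
  gives u^(e/2) \<ge> exp (11 L), so the trivial bound 1 suffices. Sifting by
  \<open>msum_decay\<close> loses (log x)^10 up to a constant, leaving 1 / log x.\<close>

lemma msum_sifted_small:
  "\<exists>C>0. \<forall>\<^sub>F x in at_top. \<forall>z u q r. 1 \<le> z \<longrightarrow> z \<le> x \<longrightarrow> prime q \<longrightarrow> prime r \<longrightarrow>
     exp (44 * ln (ln x) * max (ln z) (sqrt (ln x))) \<le> u \<longrightarrow> u \<le> x \<longrightarrow>
     \<bar>msum (insert q (insert r (primes_upto z))) u\<bar> \<le> C / ln x"
proof -
  obtain CA where CA: "CA > 0" "\<And>u. u \<ge> 2 \<Longrightarrow> \<bar>msum {} u\<bar> \<le> CA * ln u powr (-22)"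
    using msum_log_decay[of 22] by auto
  obtain C' where C': "C' > 0" "\<And>x. x \<ge> 3 \<Longrightarrow> prime_inv_sum x \<le> ln (ln x) + C'"
    using prime_inv_sum_bound by blast
  define C1 where "C1 = max 1 CA"
  define C where "C = C1 * (36 * exp (10 * C'))"
  have "\<forall>\<^sub>F x::real in at_top. ln x \<ge> 16" by real_asymp
  moreover have "\<forall>\<^sub>F x::real in at_top. ln (ln x) \<ge> 1" by real_asymp
  moreover have "\<forall>\<^sub>F x::real in at_top. x \<ge> 3" by (rule eventually_ge_at_top)
  ultimately have "\<forall>\<^sub>F x in at_top. \<forall>z u q r. 1 \<le> z \<longrightarrow> z \<le> x \<longrightarrow> prime q \<longrightarrow> prime r \<longrightarrow>
     exp (44 * ln (ln x) * max (ln z) (sqrt (ln x))) \<le> u \<longrightarrow> u \<le> x \<longrightarrow>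
     \<bar>msum (insert q (insert r (primes_upto z))) u\<bar> \<le> C / ln x"
  proof eventually_elim
    case (elim x)
    show ?case
    proof (intro allI impI)
      fix z u :: real and q r :: nat
      assume z: "1 \<le> z" "z \<le> x" and qr: "prime q" "prime r"
        and u: "exp (44 * ln (ln x) * max (ln z) (sqrt (ln x))) \<le> u" "u \<le> x"
      define L where "L = ln (ln x)"
      define Y where "Y = max (ln z) (sqrt (ln x))"
      define e where "e = 1 / (2 * Y)"
      define D where "D = insert q (insert r (primes_upto z))"
      define K where "K = u powr e * (C1 * ln x powr (-11))"
      have L1: "L \<ge> 1" using elim by (simp add: L_def)
      have s4: "sqrt (ln x) \<ge> 4" using elim by (intro real_le_rsqrt) auto
      have Y4: "Y \<ge> 4" "Y \<ge> sqrt (ln x)" "Y \<ge> ln z" using s4 by (auto simp: Y_def)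
      have u0: "u > 0" using u(1) by (meson exp_gt_zero less_le_trans)
      have lnu: "ln u \<ge> 44 * L * Y" using u(1) u0 by (simp add: L_def Y_def ln_ge_iff)
      have LY: "L * Y \<ge> 4" using mult_mono[of 1 L 4 Y] L1 Y4 by simp
      have u1: "u > 1"
      proof (rule ccontr)
        assume "\<not> u > 1"
        hence "ln u \<le> 0" using u0 by simp
        moreover have "44 * L * Y = 44 * (L * Y)" by simp
        ultimately show False using lnu LY by linarith
      qed
      have e: "e > 0" "e \<le> 1/8" using Y4 by (auto simp: e_def field_simps)
      have ez: "e * ln z \<le> 1/2" using Y4 by (simp add: e_def field_simps)
      have D: "finite D" "\<forall>p\<in>D. prime p" using qr by (auto simp: D_def primes_upto_def)
      have K0: "K \<ge> 0" by (simp add: K_def C1_def)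
      have hyp: "\<bar>msum {} t\<bar> \<le> K * t powr (-e)" if t: "t \<le> u" "t \<ge> 1" for t
      proof (cases "t \<ge> sqrt u")
        case True
        have lt: "ln t \<ge> sqrt (ln x)"
        proof -
          have "ln (sqrt u) \<le> ln t" using True u0 t by (intro ln_mono) auto
          hence "ln t \<ge> 22 * (L * Y)" using lnu u0 by (simp add: ln_sqrt)
          moreover have "L * Y \<ge> 1 * Y" using L1 Y4 by (intro mult_right_mono) auto
          ultimately show ?thesis using Y4 by linarith
        qed
        have t2: "t \<ge> 2"
        proof (rule ccontr)
          assume "\<not> t \<ge> 2"
          hence "ln t \<le> ln 2" using t by simp
          thus False using lt s4 ln_2_less_1 by linarith
        qed
        have "\<bar>msum {} t\<bar> \<le> CA * ln t powr (-22)" by (rule CA(2)[OF t2])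
        also have "\<dots> \<le> C1 * sqrt (ln x) powr (-22)"
          using lt s4 elim by (intro mult_mono powr_mono2') (auto simp: C1_def)
        also have "sqrt (ln x) powr (-22) = ln x powr (-11)"
          using elim by (simp add: powr_half_sqrt[symmetric] powr_powr)
        also have "C1 * ln x powr (-11) \<le> (u powr e * t powr (-e)) * (C1 * ln x powr (-11))"
        proof -
          have "t powr e \<le> u powr e" using t e by (intro powr_mono2) auto
          hence "1 \<le> u powr e * t powr (-e)" using t by (simp add: powr_minus field_simps)
          thus ?thesis using mult_right_mono[of 1 "u powr e * t powr (-e)" "C1 * ln x powr (-11)"] by (simp add: C1_def)
        qed
        also have "\<dots> = K * t powr (-e)" by (simp add: K_def mult_ac)
        finally show ?thesis .
      next
        case False
        have "\<bar>msum {} t\<bar> \<le> 1" by (rule abs_msum_le_1) auto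
        also have "1 = exp (11 * L) * ln x powr (-11)" using elim by (simp add: L_def powr_def exp_add[symmetric])
        also have "\<dots> \<le> (u powr e * t powr (-e)) * (C1 * ln x powr (-11))"
        proof (intro mult_mono)
          have "11 * L \<le> e / 2 * ln u"
          proof -
            have "e / 2 * (44 * L * Y) \<le> e / 2 * ln u" using lnu e by (intro mult_left_mono) auto
            moreover have "e / 2 * (44 * L * Y) = 11 * L" using Y4 by (simp add: e_def)
            ultimately show ?thesis by linarith
          qed
          hence "exp (11 * L) \<le> u powr (e / 2)" using u0 by (simp add: powr_def)
          also have "\<dots> = u powr e * sqrt u powr (-e)"
            using u0 by (simp add: powr_half_sqrt[symmetric] powr_powr powr_add[symmetric])
          also have "\<dots> \<le> u powr e * t powr (-e)"
            using False t e by (intro mult_left_mono powr_mono2') auto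
          finally show "exp (11 * L) \<le> u powr e * t powr (-e)" .
          show "ln x powr (-11) \<le> C1 * ln x powr (-11)"
            using mult_right_mono[of 1 C1 "ln x powr (-11)"] by (simp add: C1_def)
        qed auto
        also have "\<dots> = K * t powr (-e)" by (simp add: K_def mult_ac)
        finally show ?thesis .
      qed
      have "\<bar>msum D u\<bar> \<le> K * u powr (-e) * (\<Prod>p\<in>D. 1 / (1 - real p powr (e - 1)))"
        using e u1 by (intro msum_decay[where U = u] D hyp K0) auto
      also have "K * u powr (-e) = C1 * ln x powr (-11)"
        using u0 by (simp add: K_def powr_minus)
      also have "(\<Prod>p\<in>D. 1 / (1 - real p powr (e - 1))) \<le> 36 * exp (10 * prime_inv_sum z)"
        unfolding D_def using e z ez qr by (intro prod_smooth_bound) auto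
      also have "exp (10 * prime_inv_sum z) \<le> exp (10 * (L + C'))"
        using order_trans[OF prime_inv_sum_mono[OF z(2)] C'(2)[of x]] elim by (simp add: L_def)
      also have "exp (10 * (L + C')) = ln x ^ 10 * exp (10 * C')"
        using elim by (simp add: L_def exp_add distrib_left exp_of_nat_mult[of 10, simplified])
      also have "C1 * ln x powr (-11) * (36 * (ln x ^ 10 * exp (10 * C'))) = C * (ln x powr (-11) * ln x ^ 10)"
        by (simp add: C_def)
      also have "ln x powr (-11) * ln x ^ 10 = 1 / ln x"
      proof -
        have "ln x ^ 11 = ln x * ln x ^ 10" by (simp flip: power_Suc)
        thus ?thesis using elim by (simp add: powr_minus field_simps)
      qed
      finally show "\<bar>msum (insert q (insert r (primes_upto z))) u\<bar> \<le> C / ln x"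
        by (simp add: D_def C1_def mult_left_mono)
    qed
  qed
  moreover have "C > 0" by (simp add: C_def C1_def)
  ultimately show ?thesis by blast
qed

text \<open>\<open>U_bounds\<close> with W = exp (44 L Y) and \<tau> = O(1 / log x). The condition
  on log z keeps log W below log x / 8, hence below a quarter of log y. The dominant term is log W /
  log y times the sum of reciprocal primes, of order L^2 Y / log x.\<close>

lemma V_bound:
  "\<exists>C>0. \<forall>\<^sub>F x in at_top. \<forall>c y z. c \<le> 2 \<longrightarrow> sqrt x \<le> y \<longrightarrow> y \<le> x \<longrightarrow> 1 \<le> z \<longrightarrow> ln z \<le> ln x powr (3/4) \<longrightarrow>
     \<bar>V c (primes_upto z) y\<bar> \<le> C * ln (ln x) ^ 2 * max (ln z) (sqrt (ln x)) / ln x"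
proof -
  obtain C1 where C1: "C1 > 0" "\<forall>\<^sub>F x in at_top. \<forall>z u q r. 1 \<le> z \<longrightarrow> z \<le> x \<longrightarrow> prime q \<longrightarrow> prime r \<longrightarrow>
     exp (44 * ln (ln x) * max (ln z) (sqrt (ln x))) \<le> u \<longrightarrow> u \<le> x \<longrightarrow>
     \<bar>msum (insert q (insert r (primes_upto z))) u\<bar> \<le> C1 / ln x"
    using msum_sifted_small by blast
  obtain C' where C': "C' > 0" "\<And>x. x \<ge> 3 \<Longrightarrow> prime_inv_sum x \<le> ln (ln x) + C'"
    using prime_inv_sum_bound by blast
  obtain C0 where C0: "C0 > 0" and U: "\<And>D y W \<tau>. (\<forall>p\<in>D. prime p) \<Longrightarrow> y \<ge> 16 \<Longrightarrow> W \<ge> 1 \<Longrightarrow> ln W \<le> ln y / 4 \<Longrightarrow> \<tau> \<ge> 0 \<Longrightarrow>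
     (\<And>q r u. prime q \<Longrightarrow> prime r \<Longrightarrow> W \<le> u \<Longrightarrow> u \<le> y \<Longrightarrow> \<bar>msum (insert q (insert r D)) u\<bar> \<le> \<tau>) \<Longrightarrow>
     \<bar>U1 D y\<bar> \<le> \<tau> * prime_inv_sum y + 4 * (ln W + C0) / ln y \<and>
     \<bar>U2 D y\<bar> \<le> \<tau> * (prime_inv_sum y)\<^sup>2 + 8 * prime_inv_sum y * (ln W + C0) / ln y"
    using U_bounds by metis
  define C where "C = (4 * C1 + 32 * (44 + C0)) + 5 * (2 * C1 + 8 * (44 + C0)) + 8 * C1"
  have "\<forall>\<^sub>F x::real in at_top. 44 * ln (ln x) * ln x powr (3/4) \<le> ln x / 8" by real_asymp
  moreover have "\<forall>\<^sub>F x::real in at_top. sqrt (ln x) \<le> ln x powr (3/4)" by real_asymp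
  moreover have "\<forall>\<^sub>F x::real in at_top. ln x powr (3/4) \<le> ln x" by real_asymp
  moreover have "\<forall>\<^sub>F x::real in at_top. ln (ln x) \<ge> 1 + C'" by real_asymp
  moreover have "\<forall>\<^sub>F x::real in at_top. sqrt x \<ge> 32" by real_asymp
  moreover have "\<forall>\<^sub>F x::real in at_top. ln x \<ge> 16" by real_asymp
  ultimately have "\<forall>\<^sub>F x in at_top. \<forall>c y z. c \<le> 2 \<longrightarrow> sqrt x \<le> y \<longrightarrow> y \<le> x \<longrightarrow> 1 \<le> z \<longrightarrow> ln z \<le> ln x powr (3/4) \<longrightarrow>
     \<bar>V c (primes_upto z) y\<bar> \<le> C * ln (ln x) ^ 2 * max (ln z) (sqrt (ln x)) / ln x"
    using C1(2)
  proof eventually_elim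
    case (elim x)
    show ?case
    proof (intro allI impI)
      fix c :: nat and y z :: real
      assume c: "c \<le> 2" and y: "sqrt x \<le> y" "y \<le> x" and z: "1 \<le> z" "ln z \<le> ln x powr (3/4)"
      define L where "L = ln (ln x)"
      define Y where "Y = max (ln z) (sqrt (ln x))"
      define W where "W = exp (44 * L * Y)"
      define D where "D = primes_upto z"
      define \<tau> where "\<tau> = C1 / ln x"
      have x0: "x > 0" using elim(5) real_sqrt_gt_0_iff[of x] by linarith
      have L1: "L \<ge> 1" "L \<ge> C'" "C' > 0" using elim(4) C'(1) by (auto simp: L_def)
      have Y1: "Y \<ge> 1"
      proof -
        have "sqrt (ln x) \<ge> 1" using elim(6) by simp
        thus ?thesis by (simp add: Y_def le_max_iff_disj)
      qed
      have zx: "z \<le> x"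
      proof -
        have "ln z \<le> ln x" using z elim(3) by linarith
        thus ?thesis using z x0 by simp
      qed
      have lnW: "ln W = 44 * L * Y" "ln W \<le> ln x / 8"
      proof -
        show "ln W = 44 * L * Y" by (simp add: W_def)
        have "44 * L * Y \<le> 44 * L * ln x powr (3/4)"
          using z elim(2) L1 by (intro mult_left_mono) (auto simp: Y_def)
        thus "ln W \<le> ln x / 8" using elim(1) by (simp add: W_def L_def)
      qed
      have W1: "W \<ge> 1" using L1 Y1 by (simp add: W_def)
      have lny: "ln y \<ge> ln x / 2"
      proof -
        have "ln (sqrt x) \<le> ln y" using y x0 by (intro ln_mono) auto
        thus ?thesis using x0 by (simp add: ln_sqrt)
      qed
      have y16: "y \<ge> 32" using y elim(5) by linarith
      have tau0: "\<tau> \<ge> 0" using C1(1) elim(6) by (simp add: \<tau>_def)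
      have Dp: "\<forall>p\<in>D. prime p" by (simp add: D_def primes_upto_def)
      have H: "\<bar>msum (insert q (insert r D)) u\<bar> \<le> \<tau>" if "prime q" "prime r" "W \<le> u" "u \<le> x" for q r u
        using elim(7) z(1) zx that unfolding D_def \<tau>_def W_def L_def Y_def by blast
      have UU: "\<bar>U1 D y\<bar> \<le> \<tau> * prime_inv_sum y + 4 * (ln W + C0) / ln y \<and>
         \<bar>U2 D y\<bar> \<le> \<tau> * (prime_inv_sum y)\<^sup>2 + 8 * prime_inv_sum y * (ln W + C0) / ln y"
        using y16 W1 lnW lny tau0 y by (intro U Dp H) auto
      define s where "s = prime_inv_sum y"
      have s: "0 \<le> s" "s \<le> 2 * L"
      proof -
        have "s \<le> prime_inv_sum x" unfolding s_def by (intro prime_inv_sum_mono y)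
        also have "\<dots> \<le> L + C'" unfolding L_def using y y16 by (intro C') auto
        finally show "s \<le> 2 * L" using L1 by simp
        show "0 \<le> s" unfolding s_def by (rule prime_inv_sum_nonneg)
      qed
      have lx: "ln x > 0" using elim(6) by simp
      have LLY: "1 \<le> L\<^sup>2 * Y" "L \<le> L\<^sup>2 * Y" "L\<^sup>2 \<le> L\<^sup>2 * Y"
      proof -
        have a: "L * 1 \<le> L * L" using L1 by (intro mult_left_mono) auto
        have b: "L\<^sup>2 * 1 \<le> L\<^sup>2 * Y" using Y1 by (intro mult_left_mono) auto
        show "L\<^sup>2 \<le> L\<^sup>2 * Y" using b by simp
        thus "L \<le> L\<^sup>2 * Y" using a by (simp add: power2_eq_square)
        thus "1 \<le> L\<^sup>2 * Y" using L1 by linarith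
      qed
      have w: "(ln W + C0) / ln y \<le> 2 * (44 + C0) * (L * Y) / ln x"
      proof -
        have "C0 * 1 \<le> C0 * (L * Y)" using C0 L1 Y1 mult_mono[of 1 L 1 Y] by (intro mult_left_mono) auto
        hence "ln W + C0 \<le> (44 + C0) * (L * Y)" by (simp add: lnW algebra_simps)
        hence "(ln W + C0) / ln y \<le> (44 + C0) * (L * Y) / (ln x / 2)"
          using C0 L1 Y1 lny lx by (intro frac_le) auto
        thus ?thesis by (simp add: algebra_simps)
      qed
      have LY: "L * Y \<le> L\<^sup>2 * Y" using L1 Y1 unfolding power2_eq_square mult.assoc
        by (intro mult_left_mono) (auto simp: mult_le_cancel_right1)
      have u1: "\<bar>U1 D y\<bar> \<le> (2 * C1 + 8 * (44 + C0)) * (L\<^sup>2 * Y) / ln x"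
      proof -
        have "\<tau> * s \<le> \<tau> * (2 * (L\<^sup>2 * Y))" using s LLY tau0 by (intro mult_left_mono) auto
        moreover have "4 * ((ln W + C0) / ln y) \<le> 4 * (2 * (44 + C0) * (L\<^sup>2 * Y) / ln x)"
          using C0 lx LY by (intro mult_left_mono order_trans[OF w] divide_right_mono) auto
        ultimately have "\<bar>U1 D y\<bar> \<le> \<tau> * (2 * (L\<^sup>2 * Y)) + 4 * (2 * (44 + C0) * (L\<^sup>2 * Y) / ln x)"
          using UU unfolding s_def by linarith
        also have "\<dots> = (2 * C1 + 8 * (44 + C0)) * (L\<^sup>2 * Y) / ln x" by (simp add: \<tau>_def add_divide_distrib algebra_simps)
        finally show ?thesis .
      qed
      have u2: "\<bar>U2 D y\<bar> \<le> (4 * C1 + 32 * (44 + C0)) * (L\<^sup>2 * Y) / ln x"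
      proof -
        have "s\<^sup>2 \<le> (2 * L)\<^sup>2" using s by (intro power_mono) auto
        also have "\<dots> \<le> 4 * (L\<^sup>2 * Y)" using LLY by (simp add: power_mult_distrib)
        finally have "\<tau> * s\<^sup>2 \<le> \<tau> * (4 * (L\<^sup>2 * Y))" using tau0 by (intro mult_left_mono) auto
        moreover have "8 * s * ((ln W + C0) / ln y) \<le> 8 * (2 * L) * (2 * (44 + C0) * (L * Y) / ln x)"
          using s w W1 C0 lny lx L1 Y1 by (intro mult_mono) auto
        ultimately have "\<bar>U2 D y\<bar> \<le> \<tau> * (4 * (L\<^sup>2 * Y)) + 8 * (2 * L) * (2 * (44 + C0) * (L * Y) / ln x)"
          using UU unfolding s_def by (simp add: mult.assoc)
        also have "\<dots> = (4 * C1 + 32 * (44 + C0)) * (L\<^sup>2 * Y) / ln x" by (simp add: \<tau>_def add_divide_distrib algebra_simps power2_eq_square)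
        finally show ?thesis .
      qed
      \<comment> \<open>The bound \<open>H\<close> speaks only of sets with inserted primes, so it
        is applied with the prime 2. If 2 is not already in \<open>D\<close>, the sum over
        \<open>D\<close> is recovered through \<open>msum_insert\<close> from the lengths y and
        y/2.\<close>
      have u0: "\<bar>msum D y\<bar> \<le> 2 * \<tau>"
      proof -
        have Wy: "W \<le> y / 2"
        proof -
          have "ln W \<le> ln (sqrt x / 2)"
          proof -
            have "ln (2::real) \<le> 1" using ln_2_less_1 by simp
            thus ?thesis using lnW(2) x0 elim(6) by (simp add: ln_div ln_sqrt)
          qed
          hence "W \<le> sqrt x / 2" using W1 x0 by (subst (asm) ln_le_cancel_iff) auto
          thus ?thesis using y by simp
        qed
        have t2: "prime (2::nat)" by (rule two_is_prime_nat)
        have m1: "\<bar>msum (insert 2 D) y\<bar> \<le> \<tau>" "\<bar>msum (insert 2 D) (y / 2)\<bar> \<le> \<tau>"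
          using H[OF t2 t2, of y] H[OF t2 t2, of "y / 2"] Wy y y16 by auto
        show ?thesis
        proof (cases "2 \<in> D")
          case True
          thus ?thesis using m1(1) tau0 by (simp add: insert_absorb)
        next
          case False
          have "msum D y = msum (insert 2 D) y - msum (insert 2 D) (y / 2) / 2"
            using msum_insert[OF t2 False Dp, of y] by simp
          thus ?thesis using m1 tau0 by linarith
        qed
      qed
      have "\<bar>V c D y\<bar> \<le> \<bar>U2 D y\<bar> + (2 * real c + 1) * \<bar>U1 D y\<bar> + (real c)\<^sup>2 * \<bar>msum D y\<bar>"
        unfolding V_eq by (intro order_trans[OF abs_triangle_ineq] add_mono) (auto simp: abs_mult)
      also have "\<dots> \<le> (4 * C1 + 32 * (44 + C0)) * (L\<^sup>2 * Y) / ln x + 5 * ((2 * C1 + 8 * (44 + C0)) * (L\<^sup>2 * Y) / ln x) + 4 * (2 * \<tau>)"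
      proof (intro add_mono u2 mult_mono u1 u0)
        have "real c \<le> 2" using c by simp
        thus "2 * real c + 1 \<le> 5" by simp
        show "(real c)\<^sup>2 \<le> 4" using power_mono[of "real c" 2 2] c by simp
      qed auto
      also have "4 * (2 * \<tau>) \<le> 8 * C1 * (L\<^sup>2 * Y) / ln x"
        using mult_left_mono[OF LLY(1), of "8 * C1 / ln x"] C1(1) lx by (simp add: \<tau>_def)
      also have "(4 * C1 + 32 * (44 + C0)) * (L\<^sup>2 * Y) / ln x + 5 * ((2 * C1 + 8 * (44 + C0)) * (L\<^sup>2 * Y) / ln x) + 8 * C1 * (L\<^sup>2 * Y) / ln x
         = C * L\<^sup>2 * Y / ln x" by (simp add: C_def add_divide_distrib algebra_simps)
      finally show "\<bar>V c (primes_upto z) y\<bar> \<le> C * ln (ln x) ^ 2 * max (ln z) (sqrt (ln x)) / ln x"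
        by (simp add: D_def L_def Y_def)
    qed
  qed
  moreover have "C > 0" using C1(1) C0 by (simp add: C_def)
  ultimately show ?thesis by blast
qed

section \<open>Sieve bounds\<close>

text \<open>Majorant by an Euler product over the primes in \<open>primes_upto M - D\<close>, taken
  out one at a time with a factor 1 + w/q \<le> exp (w/q) each. The length M/q is enlarged to M
  again, so M stays fixed during the induction.\<close>

lemma sum_weight_inverse_le:
  fixes w :: real
  assumes w: "w \<ge> 0"
  shows "\<forall>p\<in>D. prime p \<Longrightarrow> (\<Sum>m | free_of D m \<and> real m \<le> M. (mu m)\<^sup>2 * w ^ omega m / real m)
      \<le> exp (w * (\<Sum>q\<in>primes_upto M - D. 1 / real q))"
proof (induction "card (primes_upto M - D)" arbitrary: D)
  case 0
  hence sub: "primes_upto M \<subseteq> D" by simp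
  have "{m. free_of D m \<and> real m \<le> M} \<subseteq> {1}"
  proof
    fix m assume m: "m \<in> {m. free_of D m \<and> real m \<le> M}"
    show "m \<in> {1}"
    proof (rule ccontr)
      assume "m \<notin> {1}"
      then obtain p where p: "prime p" "p dvd m" using prime_factor_nat[of m] by auto
      have "p \<le> m" using p m by (auto simp: free_of_def intro: dvd_imp_le)
      hence "p \<in> D" using p m sub by (auto simp: primes_upto_def)
      thus False using m p by (auto simp: free_of_def)
    qed
  qed
  hence "(\<Sum>m | free_of D m \<and> real m \<le> M. (mu m)\<^sup>2 * w ^ omega m / real m) \<le> (\<Sum>m\<in>{1::nat}. (mu m)\<^sup>2 * w ^ omega m / real m)"
    using w by (intro sum_mono2) auto
  also have "\<dots> = 1" by simp
  also have "\<dots> \<le> exp (w * (\<Sum>q\<in>primes_upto M - D. 1 / real q))"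
    using w by (simp add: sum_nonneg)
  finally show ?case .
next
  case (Suc n)
  hence "primes_upto M - D \<noteq> {}" by (metis card.empty nat.simps(3))
  then obtain q where q: "q \<in> primes_upto M" "q \<notin> D" by blast
  hence qp: "prime q" "q > 0" by (auto simp: primes_upto_def prime_gt_0_nat)
  let ?S = "\<lambda>D M. \<Sum>m | free_of D m \<and> real m \<le> M. (mu m)\<^sup>2 * w ^ omega m / real m"
  have eq: "primes_upto M - D = insert q (primes_upto M - insert q D)" using q by auto
  have "card (primes_upto M - insert q D) = n"
  proof -
    have "card (primes_upto M - D) = Suc (card (primes_upto M - insert q D))"
      unfolding eq by (rule card_insert_disjoint) auto
    thus ?thesis using Suc.hyps(2) by simp
  qed
  hence IH: "?S (insert q D) M \<le> exp (w * (\<Sum>q\<in>primes_upto M - insert q D. 1 / real q))"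
    using Suc.hyps(1)[of "insert q D"] Suc.prems qp by auto
  \<comment> \<open>mu(m)^2 is written as mu(m) times mu(m), so that \<open>sum_mu_multiples\<close>
    applies with one of the factors inside its function f.\<close>
  have "?S D M = (\<Sum>m | free_of D m \<and> real m \<le> M. (if q dvd m then 0 else (mu m)\<^sup>2 * w ^ omega m / real m))
      + (\<Sum>m | free_of D m \<and> real m \<le> M. (if q dvd m then mu m * (mu m * w ^ omega m / real m) else 0))"
    unfolding sum.distrib[symmetric] by (intro sum.cong) (auto simp: power2_eq_square)
  also have "(\<Sum>m | free_of D m \<and> real m \<le> M. (if q dvd m then 0 else (mu m)\<^sup>2 * w ^ omega m / real m)) = ?S (insert q D) M"
    by (intro sum.mono_neutral_cong_right) (auto simp: free_of_insert)
  also have "(\<Sum>m | free_of D m \<and> real m \<le> M. (if q dvd m then mu m * (mu m * w ^ omega m / real m) else 0))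
     = - (\<Sum>m | free_of (insert q D) m \<and> real m \<le> M / real q. mu m * (mu (q * m) * w ^ omega (q * m) / real (q * m)))"
    by (rule sum_mu_multiples[OF qp(1) q(2) Suc.prems])
  also have "\<dots> = w / real q * ?S (insert q D) (M / real q)"
    unfolding sum_negf[symmetric] sum_distrib_left
    using qp by (intro sum.cong) (auto simp: free_of_insert free_of_pos moebius_mult_prime omega_mult_prime power2_eq_square)
  also have "?S (insert q D) (M / real q) \<le> ?S (insert q D) M"
  proof (cases "M \<ge> 0")
    case True
    hence "M / real q \<le> M" using qp by (simp add: divide_le_eq mult_le_cancel_left1)
    thus ?thesis using w by (intro sum_mono2) auto
  next
    case False
    hence "{m. free_of (insert q D) m \<and> real m \<le> M / real q} = {}"
      using qp by (auto simp: pos_le_divide_eq) (smt (verit) mult_nonneg_nonneg of_nat_0_le_iff)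
    thus ?thesis using w by (simp only:) (simp add: sum_nonneg)
  qed
  also have "?S (insert q D) M + w / real q * ?S (insert q D) M = (1 + w / real q) * ?S (insert q D) M"
    by (simp add: algebra_simps)
  also have "\<dots> \<le> exp (w / real q) * exp (w * (\<Sum>q\<in>primes_upto M - insert q D. 1 / real q))"
    using w IH by (intro mult_mono exp_ge_add_one_self sum_nonneg) auto
  also have "\<dots> = exp (w * (\<Sum>q\<in>primes_upto M - D. 1 / real q))"
    unfolding exp_add[symmetric] eq by (subst sum.insert) (auto simp: algebra_simps)
  finally show ?case using w by (simp add: mult_left_mono divide_right_mono)
qed

text \<open>Expand log n as the sum of Lambda(d) over d | n. If n = d k contributes, then d is a
  prime not dividing k, so F(d k) \<le> 2 F(k), and Chebyshev's bound for Lambda up to N/k gives the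
  constant 12. The complement log (N/n) \<le> N/n adds 1.\<close>

lemma sum_weight_count_le:
  fixes w :: real
  assumes w: "1 \<le> w" "w \<le> 2" and D: "\<forall>p\<in>D. prime p" and N: "N > 0"
  shows "ln (real N) * (\<Sum>m | free_of D m \<and> real m \<le> real N. (mu m)\<^sup>2 * w ^ omega m)
     \<le> 13 * real N * (\<Sum>m | free_of D m \<and> real m \<le> real N. (mu m)\<^sup>2 * w ^ omega m / real m)"
proof -
  define F where "F = (\<lambda>m. if free_of D m then (mu m)\<^sup>2 * w ^ omega m else 0)"
  have F0: "F m \<ge> 0" for m using w by (simp add: F_def)
  have e1: "(\<Sum>m | free_of D m \<and> real m \<le> real N. (mu m)\<^sup>2 * w ^ omega m) = (\<Sum>m=1..N. F m)"
    by (intro sum.mono_neutral_cong_left) (auto simp: F_def free_of_def)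
  have e2: "(\<Sum>m | free_of D m \<and> real m \<le> real N. (mu m)\<^sup>2 * w ^ omega m / real m) = (\<Sum>m=1..N. F m / real m)"
    by (intro sum.mono_neutral_cong_left) (auto simp: F_def free_of_def)
  have key: "F (d * k) * mang d \<le> 2 * F k * mang d" if "d > 0" "k > 0" for d k
  proof (cases "primepow d \<and> free_of D (d * k) \<and> mu (d * k) \<noteq> 0")
    case False
    hence "mang d = 0 \<or> F (d * k) = 0" by (auto simp: F_def mangoldt_def)
    thus ?thesis using F0[of k] mangoldt_nonneg[of d] by auto
  next
    case True
    then obtain p i where p: "prime p" "i > 0" "d = p ^ i" by (auto simp: primepow_def)
    obtain i' where i': "i = Suc i'" using p(2) gr0_conv_Suc by blast
    have dk: "d * k = p * (p ^ i' * k)" by (simp add: p i')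
    have np: "\<not> p dvd p ^ i' * k" using True moebius_mult_dvd[OF p(1), of "p ^ i' * k"] unfolding dk by auto
    have "i' = 0" using np by (cases i') (auto simp: mult.assoc)
    moreover have "\<not> p dvd k" using np by auto
    ultimately have "i' = 0" "\<not> p dvd k" by auto
    hence d: "d = p" by (simp add: p i')
    have "free_of D k" using True by (auto simp: free_of_def)
    hence "F (d * k) = w * F k" using True \<open>\<not> p dvd k\<close> p(1) that
      by (simp add: F_def d moebius_mult_prime omega_mult_prime)
    also have "\<dots> \<le> 2 * F k" using w F0 by (intro mult_right_mono) auto
    finally show ?thesis by (intro mult_right_mono mangoldt_nonneg)
  qed
  have "(\<Sum>n=1..N. F n * ln (real n)) = (\<Sum>n=1..N. \<Sum>k | k dvd n. F (k * (n div k)) * mang (n div k))"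
  proof (intro sum.cong refl)
    fix n assume n: "n \<in> {1..N}"
    have "(\<Sum>k | k dvd n. F (k * (n div k)) * mang (n div k)) = (\<Sum>k | k dvd n. F n * mang (n div k))"
      by (intro sum.cong) auto
    also have "\<dots> = (\<Sum>d | d dvd n. F n * mang d)"
      using n by (intro sum.reindex_bij_witness[of _ "\<lambda>d. n div d" "\<lambda>d. n div d"]) (auto elim!: dvdE)
    also have "\<dots> = F n * (\<Sum>d | d dvd n. mang d)" by (simp only: sum_distrib_left)
    also have "(\<Sum>d | d dvd n. mang d) = ln (real n)" using n by (subst mangoldt_sum) auto
    finally show "F n * ln (real n) = (\<Sum>k | k dvd n. F (k * (n div k)) * mang (n div k))" by simp
  qed
  also have "\<dots> = (\<Sum>k=1..N. \<Sum>d=1..N div k. F (k * d) * mang d)"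
    using sum_dvd_swap[of "\<lambda>k d. F (k * d) * mang d" N] .
  also have "\<dots> \<le> (\<Sum>k=1..N. \<Sum>d=1..N div k. 2 * F k * mang d)"
  proof (intro sum_mono)
    fix k d assume "k \<in> {1..N}" "d \<in> {1..N div k}"
    thus "F (k * d) * mang d \<le> 2 * F k * mang d" using key[of d k] by (simp only: mult.commute[of k d]) auto
  qed
  also have "\<dots> = (\<Sum>k=1..N. 2 * F k * psi (N div k))"
    by (simp only: psi_def sum_distrib_left)
  also have "\<dots> \<le> (\<Sum>k=1..N. 2 * F k * (6 * (real N / real k)))"
  proof (intro sum_mono mult_left_mono)
    fix k
    have "psi (N div k) \<le> 6 * real (N div k)" by (rule psi_le)
    also have "real (N div k) \<le> real N / real k" using floor_divide_of_nat_eq[of N k, where ?'a = real] by linarith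
    finally show "psi (N div k) \<le> 6 * (real N / real k)" by simp
  qed (use F0 in auto)
  also have "\<dots> = 12 * real N * (\<Sum>k=1..N. F k / real k)"
    by (simp add: sum_distrib_left algebra_simps)
  finally have a: "(\<Sum>n=1..N. F n * ln (real n)) \<le> 12 * real N * (\<Sum>k=1..N. F k / real k)" .
  have "(\<Sum>n=1..N. F n * ln (real N / real n)) \<le> (\<Sum>n=1..N. F n * (real N / real n))"
  proof (intro sum_mono mult_left_mono F0)
    fix n assume "n \<in> {1..N}"
    thus "ln (real N / real n) \<le> real N / real n" by (intro less_imp_le ln_less_self) auto
  qed
  also have "\<dots> = real N * (\<Sum>k=1..N. F k / real k)" by (simp add: sum_distrib_left algebra_simps)
  finally have b: "(\<Sum>n=1..N. F n * ln (real N / real n)) \<le> real N * (\<Sum>k=1..N. F k / real k)" .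
  have "ln (real N) * (\<Sum>n=1..N. F n) = (\<Sum>n=1..N. F n * ln (real n)) + (\<Sum>n=1..N. F n * ln (real N / real n))"
    unfolding sum_distrib_left sum.distrib[symmetric]
    using N by (intro sum.cong) (auto simp: ln_div algebra_simps)
  thus ?thesis unfolding e1 e2 using a b by linarith
qed

text \<open>With \<open>L = ln (ln x)\<close>, the weight \<open>(1 + 1/L)^\<omega>\<close> costs only a bounded factor in the sieve bounds since the sum of the reciprocals of the primes up to \<open>x\<close> is \<open>L + O(1)\<close>.\<close>

lemma square_le_weight:
  fixes L :: real
  assumes "L \<ge> 1"
  shows "(real w + 1)\<^sup>2 \<le> 4 * L\<^sup>2 * (1 + 1 / L) ^ w"
proof -
  \<comment> \<open>The first three terms of the binomial expansion; the quadratic one is what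
    dominates (w + 1)^2 for large w.\<close>
  have "1 + real w / L + real w * (real w - 1) / (2 * L\<^sup>2) \<le> (1 + 1 / L) ^ w"
  proof (induction w)
    case (Suc w)
    have "1 + real (Suc w) / L + real (Suc w) * (real (Suc w) - 1) / (2 * L\<^sup>2)
       \<le> (1 + 1 / L) * (1 + real w / L + real w * (real w - 1) / (2 * L\<^sup>2))"
    proof -
      have "(1 + 1 / L) * (1 + real w / L + real w * (real w - 1) / (2 * L\<^sup>2)) -
        (1 + real (Suc w) / L + real (Suc w) * (real (Suc w) - 1) / (2 * L\<^sup>2)) = real w * (real w - 1) / (2 * L ^ 3)"
        using assms by (simp add: field_simps power2_eq_square power3_eq_cube)
      moreover have "real w * (real w - 1) / (2 * L ^ 3) \<ge> 0"
        using assms by (cases w) (auto intro!: divide_nonneg_nonneg mult_nonneg_nonneg)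
      ultimately show ?thesis by linarith
    qed
    also have "\<dots> \<le> (1 + 1 / L) * (1 + 1 / L) ^ w" using Suc assms by (intro mult_left_mono) auto
    finally show ?case by simp
  qed simp
  hence "4 * L\<^sup>2 * (1 + real w / L + real w * (real w - 1) / (2 * L\<^sup>2)) \<le> 4 * L\<^sup>2 * (1 + 1 / L) ^ w"
    by (intro mult_left_mono) auto
  also have "4 * L\<^sup>2 * (1 + real w / L + real w * (real w - 1) / (2 * L\<^sup>2)) = 4 * L\<^sup>2 + 4 * L * real w + 2 * real w * (real w - 1)"
    using assms by (simp add: field_simps power2_eq_square)
  finally have *: "4 * L\<^sup>2 + 4 * L * real w + 2 * real w * (real w - 1) \<le> 4 * L\<^sup>2 * (1 + 1 / L) ^ w" .
  have "L\<^sup>2 \<ge> 1" using assms by (simp add: one_le_power)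
  moreover have "L * real w \<ge> 1 * real w" using assms by (intro mult_right_mono) auto
  moreover have "real w * real w \<ge> 0" by simp
  moreover have "4 * L\<^sup>2 + 4 * L * real w + 2 * real w * (real w - 1) - (real w + 1)\<^sup>2
      = 4 * (L\<^sup>2 - 1) + 3 + 4 * (L * real w - 1 * real w) + real w * real w"
    by (simp add: power2_eq_square algebra_simps)
  ultimately have "0 \<le> 4 * L\<^sup>2 + 4 * L * real w + 2 * real w * (real w - 1) - (real w + 1)\<^sup>2"
    by (simp only:) (intro add_nonneg_nonneg; simp)
  thus ?thesis using * by linarith
qed

text \<open>The first sum is at most exp (w A) with A = log (log M / log P) + O(1), apart from the
  factor 4 L^2 of \<open>square_le_weight\<close>. The second follows by
  \<open>sum_weight_count_le\<close>, which saves a factor log M.\<close>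

lemma sifted_weight_bounds:
  "\<exists>C>0. \<forall>\<^sub>F x in at_top. \<forall>P M. 2 \<le> P \<longrightarrow> P \<le> M \<longrightarrow> M \<le> x \<longrightarrow>
     (\<Sum>m | free_of (primes_upto P) m \<and> real m \<le> M. (mu m)\<^sup>2 * (real (omega m) + 1)\<^sup>2 / real m)
        \<le> C * ln (ln x) ^ 2 * ln M / ln P \<and>
     (\<Sum>m | free_of (primes_upto P) m \<and> real m \<le> M. (mu m)\<^sup>2 * (real (omega m) + 1)\<^sup>2)
        \<le> C * ln (ln x) ^ 2 * M / ln P"
proof -
  obtain C1 where C1: "C1 > 0" "\<And>a b. 2 \<le> a \<Longrightarrow> a \<le> b \<Longrightarrow> prime_inv a b \<le> ln (ln b / ln a) + C1 / ln a"
    using prime_inv_bound by blast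
  define C2 where "C2 = C1 / ln 2"
  define C3 where "C3 = \<bar>ln (ln 2)\<bar> + C2"
  define C4 where "C4 = 4 * exp (C2 + 1 + C3)"
  define C where "C = 26 * C4"
  have C2: "C2 > 0" using C1 by (simp add: C2_def)
  have C4: "C4 > 0" by (simp add: C4_def)
  have "\<forall>\<^sub>F x::real in at_top. ln (ln x) \<ge> 1" by real_asymp
  moreover have "\<forall>\<^sub>F x::real in at_top. x > 3" by (rule eventually_gt_at_top)
  ultimately have "\<forall>\<^sub>F x in at_top. \<forall>P M. 2 \<le> P \<longrightarrow> P \<le> M \<longrightarrow> M \<le> x \<longrightarrow>
     (\<Sum>m | free_of (primes_upto P) m \<and> real m \<le> M. (mu m)\<^sup>2 * (real (omega m) + 1)\<^sup>2 / real m)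
        \<le> C * ln (ln x) ^ 2 * ln M / ln P \<and>
     (\<Sum>m | free_of (primes_upto P) m \<and> real m \<le> M. (mu m)\<^sup>2 * (real (omega m) + 1)\<^sup>2)
        \<le> C * ln (ln x) ^ 2 * M / ln P"
  proof eventually_elim
    case (elim x)
    show ?case
    proof (intro allI impI)
      fix P M :: real
      assume PM: "2 \<le> P" "P \<le> M" "M \<le> x"
      define L where "L = ln (ln x)"
      define w where "w = 1 + 1 / L"
      let ?D = "primes_upto P"
      let ?A = "{m. free_of ?D m \<and> real m \<le> M}"
      have L1: "L \<ge> 1" using elim by (simp add: L_def)
      have w: "1 \<le> w" "w \<le> 2" using L1 by (auto simp: w_def)
      have lP: "ln P > 0" "ln M > 0" "ln P \<le> ln M" "ln M \<le> ln x" using PM by auto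
      have Dp: "\<forall>p\<in>?D. prime p" by (simp add: primes_upto_def)
      define A where "A = ln (ln M / ln P) + C2"
      have A: "prime_inv P M \<le> A"
      proof -
        have "C1 / ln P \<le> C1 / ln 2" using PM C1 by (intro divide_left_mono) auto
        thus ?thesis using C1(2)[OF PM(1,2)] by (simp add: A_def C2_def)
      qed
      \<comment> \<open>A \<le> L + O(1), so in exp (w A) = exp (A + A/L) the second summand is
        bounded.\<close>
      have AL: "A / L \<le> 1 + C3"
      proof -
        have "ln (ln M / ln P) = ln (ln M) - ln (ln P)" using lP by (simp add: ln_div)
        moreover have "ln (ln M) \<le> L" using lP by (simp add: L_def)
        moreover have "ln (ln 2) \<le> ln (ln P)" using PM by simp
        ultimately have "A \<le> L + C3" by (simp add: A_def C3_def)
        hence "A / L \<le> (L + C3) / L" using L1 by (intro divide_right_mono) auto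
        also have "\<dots> = 1 + C3 / L" using L1 by (simp add: field_simps)
        also have "C3 / L \<le> C3" using L1 C2 by (simp add: C3_def divide_le_eq mult_le_cancel_left1)
        finally show ?thesis by simp
      qed
      have S0: "(\<Sum>m\<in>?A. (mu m)\<^sup>2 * w ^ omega m / real m) \<le> exp (C2 + 1 + C3) * (ln M / ln P)"
      proof -
        have "(\<Sum>m\<in>?A. (mu m)\<^sup>2 * w ^ omega m / real m) \<le> exp (w * prime_inv P M)"
          unfolding prime_inv_def using w by (intro sum_weight_inverse_le Dp) auto
        also have "\<dots> \<le> exp (w * A)" using A w by (simp add: mult_left_mono)
        also have "w * A = A + A / L" by (simp add: w_def algebra_simps)
        also have "exp (A + A / L) \<le> exp (A + (1 + C3))" using AL by simp
        also have "A + (1 + C3) = (C2 + 1 + C3) + ln (ln M / ln P)" by (simp add: A_def)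
        also have "exp \<dots> = exp (C2 + 1 + C3) * (ln M / ln P)" using lP by (simp only: exp_add) simp
        finally show ?thesis .
      qed
      have S1: "(\<Sum>m\<in>?A. (mu m)\<^sup>2 * (real (omega m) + 1)\<^sup>2 / real m) \<le> C4 * L\<^sup>2 * (ln M / ln P)"
      proof -
        have "(\<Sum>m\<in>?A. (mu m)\<^sup>2 * (real (omega m) + 1)\<^sup>2 / real m) \<le> (\<Sum>m\<in>?A. 4 * L\<^sup>2 * ((mu m)\<^sup>2 * w ^ omega m / real m))"
        proof (intro sum_mono)
          fix m
          have "(mu m)\<^sup>2 * (real (omega m) + 1)\<^sup>2 / real m \<le> (mu m)\<^sup>2 * (4 * L\<^sup>2 * w ^ omega m) / real m"
            unfolding w_def by (intro divide_right_mono mult_left_mono square_le_weight L1) auto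
          thus "(mu m)\<^sup>2 * (real (omega m) + 1)\<^sup>2 / real m \<le> 4 * L\<^sup>2 * ((mu m)\<^sup>2 * w ^ omega m / real m)" by (simp add: mult_ac)
        qed
        also have "\<dots> = 4 * L\<^sup>2 * (\<Sum>m\<in>?A. (mu m)\<^sup>2 * w ^ omega m / real m)" by (simp only: sum_distrib_left)
        also have "\<dots> \<le> 4 * L\<^sup>2 * (exp (C2 + 1 + C3) * (ln M / ln P))" by (intro mult_left_mono S0) auto
        finally show ?thesis by (simp add: C4_def mult_ac)
      qed
      have S2: "(\<Sum>m\<in>?A. (mu m)\<^sup>2 * (real (omega m) + 1)\<^sup>2) \<le> 26 * C4 * L\<^sup>2 * M / ln P"
      proof -
        define N where "N = nat \<lfloor>M\<rfloor>"
        have N: "2 \<le> N" "real N \<le> M" "M < real N + 1" using PM by (auto simp: N_def le_nat_iff le_floor_iff)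
        have AN: "?A = {m. free_of ?D m \<and> real m \<le> real N}"
        proof -
          have "real m \<le> M \<longleftrightarrow> real m \<le> real N" for m
          proof
            assume "real m \<le> M"
            hence "real m < real (N + 1)" using N by simp
            thus "real m \<le> real N" by simp
          qed (use N in simp)
          thus ?thesis by simp
        qed
        have lN: "ln (real N) \<ge> ln M / 2"
        proof -
          have "M \<le> 2 * real N" using N by simp
          also have "\<dots> \<le> real N * real N" using N by (intro mult_right_mono) auto
          finally have "ln M \<le> ln (real N * real N)" using PM N by (intro ln_mono) auto
          also have "\<dots> = 2 * ln (real N)" using N by (simp add: ln_mult)
          finally show ?thesis by simp
        qed
        let ?F = "\<Sum>m\<in>?A. (mu m)\<^sup>2 * w ^ omega m"
        have F0: "?F \<ge> 0" using w by (intro sum_nonneg) auto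
        have "ln M / 2 * ?F \<le> ln (real N) * ?F" by (intro mult_right_mono lN F0)
        also have "\<dots> \<le> 13 * real N * (\<Sum>m\<in>?A. (mu m)\<^sup>2 * w ^ omega m / real m)"
          unfolding AN using N by (intro sum_weight_count_le w Dp) auto
        also have "\<dots> \<le> 13 * M * (exp (C2 + 1 + C3) * (ln M / ln P))"
          using N PM w by (intro mult_mono S0 sum_nonneg) auto
        finally have "?F \<le> 26 * M * exp (C2 + 1 + C3) / ln P" using lP by (simp add: field_simps)
        have "(\<Sum>m\<in>?A. (mu m)\<^sup>2 * (real (omega m) + 1)\<^sup>2) \<le> (\<Sum>m\<in>?A. (mu m)\<^sup>2 * (4 * L\<^sup>2 * w ^ omega m))"
          unfolding w_def by (intro sum_mono mult_left_mono square_le_weight L1) auto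
        also have "\<dots> = 4 * L\<^sup>2 * ?F" by (simp add: sum_distrib_left mult_ac)
        also have "\<dots> \<le> 4 * L\<^sup>2 * (26 * M * exp (C2 + 1 + C3) / ln P)"
          using \<open>?F \<le> _\<close> by (intro mult_left_mono) auto
        finally show ?thesis by (simp add: C4_def mult_ac)
      qed
      have "C4 * L\<^sup>2 * (ln M / ln P) \<le> C * L\<^sup>2 * ln M / ln P"
        using C4 lP unfolding C_def times_divide_eq_right
        by (intro divide_right_mono mult_right_mono) auto
      thus "(\<Sum>m\<in>?A. (mu m)\<^sup>2 * (real (omega m) + 1)\<^sup>2 / real m) \<le> C * ln (ln x) ^ 2 * ln M / ln P \<and>
        (\<Sum>m\<in>?A. (mu m)\<^sup>2 * (real (omega m) + 1)\<^sup>2) \<le> C * ln (ln x) ^ 2 * M / ln P"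
        using S1 S2 by (simp add: L_def C_def)
    qed
  qed
  moreover have "C > 0" using C4 by (simp add: C_def)
  ultimately show ?thesis by blast
qed

section \<open>Decomposition along the smallest prime factor\<close>

lemma V_eq_0: "y < 1 \<Longrightarrow> V c D y = 0"
proof -
  assume "y < 1"
  hence "{m. free_of D m \<and> real m \<le> y} = {}" by (auto dest!: free_of_pos)
  thus ?thesis unfolding V_def by (simp only: sum.empty)
qed

text \<open>The cutoff \<open>B\<close> may depend on the smallest prime, which permits two uses:
  constant x for the original sum, and x/p restricted to p > z for those cofactors m whose smallest
  prime factor is at most x/m.\<close>

lemma sum_smallest_prime_factor_V:
  fixes b B :: "nat \<Rightarrow> real"
  assumes B: "\<And>p. B p \<le> x"
  shows "(\<Sum>n | 2 \<le> n \<and> real n \<le> B (smallest_prime_factor n).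
            mu n / real n * (real (omega n) + real c)\<^sup>2 * b (smallest_prime_factor n))
       = - (\<Sum>p\<in>primes_upto x. b p / real p * V (c + 1) (primes_upto (real p)) (B p / real p))"
proof -
  define A where "A = {n. 2 \<le> n \<and> real n \<le> B (smallest_prime_factor n)}"
  define f where "f = (\<lambda>n. (real (omega n) + real c)\<^sup>2 / real n * b (smallest_prime_factor n))"
  have "A \<subseteq> {n. real n \<le> x}" using B by (auto simp: A_def intro: order_trans)
  hence fin: "finite A" by (rule finite_subset) simp
  have set_eq: "{(p, m). prime p \<and> free_of (primes_upto (real p)) m \<and> p * m \<in> A}
      = Sigma (primes_upto x) (\<lambda>p. {m. free_of (primes_upto (real p)) m \<and> real m \<le> B p / real p})"
  proof -
    have "prime p \<and> free_of (primes_upto (real p)) m \<and> p * m \<in> A \<longleftrightarrow>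
      p \<in> primes_upto x \<and> free_of (primes_upto (real p)) m \<and> real m \<le> B p / real p" (is "?l \<longleftrightarrow> ?r") for p m
    proof -
      have *: "2 \<le> p * m \<and> smallest_prime_factor (p * m) = p \<and> p \<le> p * m"
        if "prime p" "free_of (primes_upto (real p)) m"
      proof -
        have "m \<ge> 1" "p \<ge> 2" using that free_of_pos[of _ m] prime_ge_2_nat by fastforce+
        hence "p * 1 \<le> p * m" by (intro mult_le_mono2)
        hence "p \<le> p * m" "2 \<le> p * m" using \<open>p \<ge> 2\<close> by linarith+
        thus ?thesis using smallest_prime_factor_mult[OF that] by simp
      qed
      show ?thesis
      proof
        assume l: ?l
        hence s: "2 \<le> p * m" "smallest_prime_factor (p * m) = p" "p \<le> p * m" using * by auto
        have le: "real (p * m) \<le> B p" using l s by (auto simp: A_def)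
        have "p > 0" using l prime_gt_0_nat by blast
        hence "real m \<le> B p / real p" using le by (simp add: pos_le_divide_eq mult.commute)
        moreover have "real p \<le> x"
        proof -
          have "real p \<le> real (p * m)" using s(3) by (simp only: of_nat_le_iff)
          thus ?thesis using le B[of p] by linarith
        qed
        ultimately show ?r using l by (simp add: primes_upto_def)
      next
        assume r: ?r
        hence p: "prime p" "p > 0" by (auto simp: primes_upto_def prime_gt_0_nat)
        hence s: "2 \<le> p * m" "smallest_prime_factor (p * m) = p" using * r by auto
        have "real (p * m) \<le> B p" using r p by (simp add: pos_le_divide_eq mult.commute)
        thus ?l using p r s by (simp add: A_def)
      qed
    qed
    thus ?thesis by auto
  qed
  have "(\<Sum>n\<in>A. mu n / real n * (real (omega n) + real c)\<^sup>2 * b (smallest_prime_factor n)) = (\<Sum>n\<in>A. mu n * f n)"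
    by (simp add: f_def mult_ac)
  also have "\<dots> = - (\<Sum>(p, m) | prime p \<and> free_of (primes_upto (real p)) m \<and> p * m \<in> A. mu m * f (p * m))"
    by (rule sum_mu_smallest_prime_factor[OF fin]) (simp add: A_def)
  also have "(\<Sum>(p, m) | prime p \<and> free_of (primes_upto (real p)) m \<and> p * m \<in> A. mu m * f (p * m))
     = (\<Sum>p\<in>primes_upto x. \<Sum>m | free_of (primes_upto (real p)) m \<and> real m \<le> B p / real p. mu m * f (p * m))"
    unfolding set_eq by (rule sum.Sigma[symmetric]) auto
  also have "\<dots> = (\<Sum>p\<in>primes_upto x. b p / real p * V (c + 1) (primes_upto (real p)) (B p / real p))"
    unfolding V_def sum_distrib_left
  proof (intro sum.cong refl)
    fix p m assume p: "p \<in> primes_upto x" and m: "m \<in> {m. free_of (primes_upto (real p)) m \<and> real m \<le> B p / real p}"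
    have pp: "prime p" using p by (simp add: primes_upto_def)
    have fm: "free_of (primes_upto (real p)) m" using m by simp
    note s = smallest_prime_factor_mult[OF pp fm]
    have "omega (p * m) = Suc (omega m)" using s pp free_of_pos[OF fm] by (intro omega_mult_prime) auto
    thus "mu m * f (p * m) = b p / real p * (mu m / real m * (real (omega m) + real (c + 1))\<^sup>2)"
      using s(1) by (simp add: f_def add_ac mult_ac)
  qed
  finally show ?thesis unfolding A_def .
qed

lemma free_of_primes_upto_iff:
  assumes "m \<ge> 2"
  shows "free_of (primes_upto z) m \<longleftrightarrow> z < real (smallest_prime_factor m)"
proof -
  note s = smallest_prime_factor_props[OF assms]
  show ?thesis
  proof
    assume "free_of (primes_upto z) m"
    thus "z < real (smallest_prime_factor m)" using s(1,2) by (auto simp: free_of_def primes_upto_def not_le)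
  next
    assume z: "z < real (smallest_prime_factor m)"
    show "free_of (primes_upto z) m" unfolding free_of_def
    proof (intro conjI ballI notI)
      fix p assume "p \<in> primes_upto z" "p dvd m"
      hence "smallest_prime_factor m \<le> p" "real p \<le> z" using s(3) by (auto simp: primes_upto_def)
      thus False using z by linarith
    qed (use assms in auto)
  qed
qed

text \<open>For fixed m the admissible primes satisfy z < p \<le> x/m and lie below the smallest
  prime factor of m, so the sum over p is a difference of two values of \<open>T\<close>. The -1 in
  \<open>t\<close> encodes the strict inequality, and m = 1, which has no smallest prime factor,
  takes the value x/m.\<close>

lemma sum_primes_V_swap:
  fixes a :: "nat \<Rightarrow> real" and x z :: real
  assumes z: "z \<ge> 1"
  defines "T \<equiv> \<lambda>t. \<Sum>p\<in>primes_upto t. a p / real p"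
  defines "t \<equiv> \<lambda>m. if 2 \<le> m \<and> real (smallest_prime_factor m) \<le> x / real m then real (smallest_prime_factor m) - 1 else x / real m"
  shows "(\<Sum>p\<in>primes_upto x - primes_upto z. a p / real p * V c (primes_upto (real p)) (x / real p))
    = (\<Sum>m | free_of (primes_upto z) m \<and> real m \<le> x / z. mu m / real m * (real (omega m) + real c)\<^sup>2 * (T (t m) - T z))"
proof -
  define M where "M = {m. free_of (primes_upto z) m \<and> real m \<le> x / z}"
  define w where "w = (\<lambda>m. mu m / real m * (real (omega m) + real c)\<^sup>2)"
  define R where "R = (\<lambda>p m. free_of (primes_upto (real p)) m \<and> real m \<le> x / real p)"
  have finM: "finite M" by (simp add: M_def)
  have "V c (primes_upto (real p)) (x / real p) = (\<Sum>m\<in>M. if R p m then w m else 0)" if p: "p \<in> primes_upto x - primes_upto z" for p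
  proof -
    have pz: "z < real p" "0 < real p" "0 \<le> x" using p z by (auto simp: primes_upto_def)
    have "{m. R p m} \<subseteq> M"
    proof safe
      fix m assume m: "R p m"
      have "free_of (primes_upto z) m" using m pz by (auto simp: R_def free_of_def primes_upto_def)
      moreover have "x / real p \<le> x / z" using pz z by (intro divide_left_mono) auto
      ultimately show "m \<in> M" using m by (auto simp: R_def M_def)
    qed
    hence "(\<Sum>m | R p m. w m) = (\<Sum>m\<in>M. if R p m then w m else 0)"
      using finM by (intro sum.mono_neutral_cong_left) auto
    thus ?thesis by (simp add: V_def R_def w_def)
  qed
  hence "(\<Sum>p\<in>primes_upto x - primes_upto z. a p / real p * V c (primes_upto (real p)) (x / real p))
    = (\<Sum>p\<in>primes_upto x - primes_upto z. \<Sum>m\<in>M. w m * (if R p m then a p / real p else 0))"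
    unfolding sum_distrib_left by (intro sum.cong refl) (simp add: sum_distrib_left if_distrib mult.commute cong: if_cong)
  also have "\<dots> = (\<Sum>m\<in>M. w m * (\<Sum>p\<in>primes_upto x - primes_upto z. if R p m then a p / real p else 0))"
    unfolding sum_distrib_left by (rule sum.swap)
  also have "\<dots> = (\<Sum>m\<in>M. w m * (T (t m) - T z))"
  proof (intro sum.cong refl arg_cong2[where f = "(*)"])
    fix m assume m: "m \<in> M"
    have m1: "m \<ge> 1" using m free_of_pos[of _ m] by (auto simp: M_def Suc_le_eq)
    have mx: "real m \<le> x / z" "real m * z \<le> x" using m z by (auto simp: M_def pos_le_divide_eq)
    have zx: "z \<le> x / real m" using mx m1 by (simp add: pos_le_divide_eq mult.commute)
    have x0: "x > 0" using mx(2) m1 z mult_pos_pos[of "real m" z] by linarith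
    have Riff: "p \<in> primes_upto x \<and> R p m \<longleftrightarrow> p \<in> primes_upto (t m)" if "p \<notin> primes_upto z" for p
    proof (cases "prime p")
      case True
      have p0: "real p > 0" using True prime_gt_0_nat by auto
      have e1: "real m \<le> x / real p \<longleftrightarrow> real p \<le> x / real m" using p0 m1 by (simp add: pos_le_divide_eq mult.commute)
      have e2: "real p \<le> x / real m \<Longrightarrow> real p \<le> x"
      proof -
        assume "real p \<le> x / real m"
        also have "\<dots> \<le> x / 1" using m1 x0 by (intro divide_left_mono) auto
        finally show ?thesis by simp
      qed
      show ?thesis
      proof (cases "m \<ge> 2")
        case False
        hence "m = 1" using m1 by simp
        thus ?thesis using True p0 by (auto simp: R_def t_def primes_upto_def free_of_def)
      next
        case m2: True
        have f: "free_of (primes_upto (real p)) m \<longleftrightarrow> real p + 1 \<le> real (smallest_prime_factor m)"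
          unfolding free_of_primes_upto_iff[OF m2]
          by (metis of_nat_less_iff of_nat_le_iff Suc_eq_plus1 Suc_le_eq of_nat_1 of_nat_add)
        have f': "free_of (primes_upto (real p)) m" if "real p < real (smallest_prime_factor m)"
          using that free_of_primes_upto_iff[OF m2] by blast
        have Rp: "R p m \<longleftrightarrow> free_of (primes_upto (real p)) m \<and> real p \<le> x / real m" by (simp only: R_def e1)
        have P: "p \<in> primes_upto y \<longleftrightarrow> real p \<le> y" for y using True by (simp add: primes_upto_def)
        show ?thesis
        proof (cases "real (smallest_prime_factor m) \<le> x / real m")
          case True
          hence "t m = real (smallest_prime_factor m) - 1" using m2 by (simp add: t_def)
          thus ?thesis unfolding Rp P f using e2 True by auto
        next
          case False
          hence "t m = x / real m" by (simp add: t_def)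
          thus ?thesis unfolding Rp P using e2 f' False by auto
        qed
      qed
    qed (auto simp: primes_upto_def)
    have sub: "primes_upto z \<subseteq> primes_upto (t m)"
    proof
      fix p assume p: "p \<in> primes_upto z"
      show "p \<in> primes_upto (t m)"
      proof (cases "2 \<le> m \<and> real (smallest_prime_factor m) \<le> x / real m")
        case True
        hence "z < real (smallest_prime_factor m)" using m free_of_primes_upto_iff[of m z] by (auto simp: M_def)
        hence "real p < real (smallest_prime_factor m)" using p by (auto simp: primes_upto_def)
        hence "p < smallest_prime_factor m" by simp
        hence "real (p + 1) \<le> real (smallest_prime_factor m)" by (simp only: of_nat_le_iff)
        thus ?thesis using p True by (auto simp: t_def primes_upto_def)
      next
        case False
        thus ?thesis using p zx by (auto simp: t_def primes_upto_def)
      qed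
    qed
    have "(\<Sum>p\<in>primes_upto x - primes_upto z. if R p m then a p / real p else 0)
        = (\<Sum>p\<in>primes_upto (t m) - primes_upto z. a p / real p)"
      using Riff by (intro sum.mono_neutral_cong_right) auto
    also have "\<dots> = T (t m) - T z"
      unfolding T_def using sub by (intro sum_diff) auto
    finally show "(\<Sum>p\<in>primes_upto x - primes_upto z. if R p m then a p / real p else 0) = T (t m) - T z" .
  qed
  finally show ?thesis by (simp add: w_def M_def)
qed

section \<open>Estimates for the separate ranges of the main sum\<close>

lemma sum_inverse_squares_le:
  assumes "1 \<le> a" "a \<le> b"
  shows "(\<Sum>k=a..b. 1 / (real k)\<^sup>2) \<le> 2 / real a - 1 / real b"
  using assms(2)
proof (induction b rule: dec_induct)
  case base
  have "1 / (real a)\<^sup>2 \<le> 1 / real a" using assms(1) by (simp add: power2_eq_square field_simps)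
  thus ?case by simp
next
  case (step b)
  have b: "real b \<ge> 1" using assms(1) step by simp
  have "(\<Sum>k=a..Suc b. 1 / (real k)\<^sup>2) = (\<Sum>k=a..b. 1 / (real k)\<^sup>2) + 1 / (real b + 1)\<^sup>2"
    using step assms(1) by (simp add: add.commute)
  also have "1 / (real b + 1)\<^sup>2 \<le> 1 / (real b * (real b + 1))"
    using b by (intro divide_left_mono) (auto simp: power2_eq_square intro!: mult_right_mono mult_pos_pos)
  also have "1 / (real b * (real b + 1)) = 1 / real b - 1 / (real b + 1)" using b by (simp add: field_simps)
  finally show ?case using step.IH by (simp add: add.commute)
qed

text \<open>Up to exp (sqrt (log x)) the maximum in \<open>V_bound\<close> is sqrt (log x), so every
  inner sum is O(L^2 / sqrt (log x)) and absolute values may be taken; summing 1/p adds the third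
  L.\<close>

lemma sum_small_primes_V_bound:
  fixes a :: "nat \<Rightarrow> real"
  assumes a: "\<And>p. \<bar>a p\<bar> \<le> H"
  shows "\<exists>C>0. \<forall>\<^sub>F x in at_top. \<bar>\<Sum>p\<in>primes_upto (exp (sqrt (ln x))). a p / real p * V 1 (primes_upto (real p)) (x / real p)\<bar>
           \<le> C * ln (ln x) ^ 3 / sqrt (ln x)"
proof -
  obtain C1 where C1: "C1 > 0" "\<forall>\<^sub>F x in at_top. \<forall>c y z. c \<le> 2 \<longrightarrow> sqrt x \<le> y \<longrightarrow> y \<le> x \<longrightarrow> 1 \<le> z \<longrightarrow> ln z \<le> ln x powr (3/4) \<longrightarrow>
     \<bar>V c (primes_upto z) y\<bar> \<le> C1 * ln (ln x) ^ 2 * max (ln z) (sqrt (ln x)) / ln x"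
    using V_bound by blast
  obtain C' where C': "C' > 0" "\<And>x. x \<ge> 3 \<Longrightarrow> prime_inv_sum x \<le> ln (ln x) + C'"
    using prime_inv_sum_bound by blast
  have H: "H \<ge> 0" using a[of 0] by simp
  define C where "C = (H + 1) * C1 * (1 + C')"
  have "\<forall>\<^sub>F x::real in at_top. exp (sqrt (ln x)) \<le> sqrt x" by real_asymp
  moreover have "\<forall>\<^sub>F x::real in at_top. sqrt (ln x) \<le> ln x powr (3/4)" by real_asymp
  moreover have "\<forall>\<^sub>F x::real in at_top. ln x \<ge> 1" by real_asymp
  moreover have "\<forall>\<^sub>F x::real in at_top. ln (ln x) \<ge> 1" by real_asymp
  moreover have "\<forall>\<^sub>F x::real in at_top. x \<ge> 3" by (rule eventually_ge_at_top)
  ultimately have "\<forall>\<^sub>F x in at_top. \<bar>\<Sum>p\<in>primes_upto (exp (sqrt (ln x))). a p / real p * V 1 (primes_upto (real p)) (x / real p)\<bar>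
           \<le> C * ln (ln x) ^ 3 / sqrt (ln x)"
    using C1(2)
  proof eventually_elim
    case (elim x)
    define L where "L = ln (ln x)"
    define s where "s = sqrt (ln x)"
    define z where "z = exp s"
    have s: "s \<ge> 1" "s * s = ln x" using elim(3) by (auto simp: s_def)
    have L: "L \<ge> 1" using elim(4) by (simp add: L_def)
    define K where "K = (H + 1) * (C1 * L\<^sup>2 / s)"
    have K: "K \<ge> 0" using H C1(1) s by (simp add: K_def)
    have sx: "sqrt x > 0" "sqrt x * sqrt x = x" "sqrt x \<le> x" using elim(5) by (auto intro: real_le_lsqrt simp: power2_eq_square)
    have bound: "\<bar>a p / real p * V 1 (primes_upto (real p)) (x / real p)\<bar> \<le> K * (1 / real p)" if p: "p \<in> primes_upto z" for p
    proof -
      have p1: "real p \<ge> 1" "real p \<le> z" using p by (auto simp: primes_upto_def prime_ge_Suc_0_nat)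
      have lp: "ln (real p) \<le> s"
      proof -
        have "ln (real p) \<le> ln z" using p1 by (intro ln_mono) auto
        thus ?thesis by (simp add: z_def)
      qed
      have "real p \<le> sqrt x" using p1 elim(1) by (simp add: z_def s_def)
      hence "sqrt x * real p \<le> sqrt x * sqrt x" using sx by (intro mult_left_mono) auto
      hence y1: "sqrt x \<le> x / real p" using p1 sx by (simp add: pos_le_divide_eq)
      have y2: "x / real p \<le> x" using p1 elim(5) by (simp add: divide_le_eq mult_le_cancel_left1)
      have "\<bar>V 1 (primes_upto (real p)) (x / real p)\<bar> \<le> C1 * ln (ln x) ^ 2 * max (ln (real p)) (sqrt (ln x)) / ln x"
        using elim(2) elim(6)[rule_format, of 1 "x / real p" "real p"] y1 y2 p1 lp by (simp add: s_def)
      also have "\<dots> = C1 * L\<^sup>2 * s / (s * s)" using lp s by (simp add: L_def s_def max_def)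
      also have "\<dots> = C1 * L\<^sup>2 / s" using s(1) by simp
      finally have v: "\<bar>V 1 (primes_upto (real p)) (x / real p)\<bar> \<le> C1 * L\<^sup>2 / s" .
      have "\<bar>a p / real p * V 1 (primes_upto (real p)) (x / real p)\<bar> = \<bar>a p\<bar> * \<bar>V 1 (primes_upto (real p)) (x / real p)\<bar> / real p"
        by (simp add: abs_mult)
      also have "\<dots> \<le> K / real p" unfolding K_def
        using v a[of p] H by (intro divide_right_mono mult_mono) auto
      finally show ?thesis by simp
    qed
    have "\<bar>\<Sum>p\<in>primes_upto z. a p / real p * V 1 (primes_upto (real p)) (x / real p)\<bar> \<le> (\<Sum>p\<in>primes_upto z. K * (1 / real p))"
      by (rule order_trans[OF sum_abs]) (intro sum_mono bound)
    also have "\<dots> = K * prime_inv_sum z" by (simp only: sum_distrib_left)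
    also have "prime_inv_sum z \<le> (1 + C') * L"
    proof -
      have "z \<le> x" using elim(1) sx by (simp add: z_def s_def)
      hence "prime_inv_sum z \<le> L + C'" using prime_inv_sum_mono[of z x] C'(2)[of x] elim(5) by (simp add: L_def)
      also have "C' \<le> C' * L" using L C'(1) by simp
      finally show ?thesis by (simp add: algebra_simps)
    qed
    also have "K * ((1 + C') * L) = C * L ^ 3 / s" by (simp add: K_def C_def power2_eq_square power3_eq_cube)
    finally show ?case using K by (simp add: mult_left_mono z_def s_def L_def)
  qed
  moreover have "C > 0" using H C1 C' by (simp add: C_def)
  ultimately show ?thesis by blast
qed

lemma abs_V_2_le:
  assumes "y \<le> x"
  shows "\<bar>V 2 D y\<bar> \<le> 4 * (\<Sum>m | free_of D m \<and> real m \<le> x. (mu m)\<^sup>2 * (real (omega m) + 1)\<^sup>2 / real m)"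
proof -
  have "\<bar>V 2 D y\<bar> \<le> (\<Sum>m | free_of D m \<and> real m \<le> y. 4 * ((mu m)\<^sup>2 * (real (omega m) + 1)\<^sup>2 / real m))"
    unfolding V_def
  proof (rule order_trans[OF sum_abs], intro sum_mono)
    fix m
    have m: "\<bar>mu m\<bar> = (mu m)\<^sup>2" by (simp add: moebius_def power_mult[symmetric] flip: power_mult)
    have "(real (omega m) + real 2)\<^sup>2 \<le> 4 * (real (omega m) + 1)\<^sup>2"
      using mult_nonneg_nonneg[of "real (omega m)" "real (omega m)"] by (simp add: power2_eq_square algebra_simps)
    hence "(mu m)\<^sup>2 * (real (omega m) + real 2)\<^sup>2 / real m \<le> (mu m)\<^sup>2 * (4 * (real (omega m) + 1)\<^sup>2) / real m"
      by (intro divide_right_mono mult_left_mono) auto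
    thus "\<bar>mu m / real m * (real (omega m) + real 2)\<^sup>2\<bar> \<le> 4 * ((mu m)\<^sup>2 * (real (omega m) + 1)\<^sup>2 / real m)"
      by (simp add: abs_mult m mult_ac)
  qed
  also have "\<dots> = 4 * (\<Sum>m | free_of D m \<and> real m \<le> y. (mu m)\<^sup>2 * (real (omega m) + 1)\<^sup>2 / real m)"
    by (simp only: sum_distrib_left)
  also have "(\<Sum>m | free_of D m \<and> real m \<le> y. (mu m)\<^sup>2 * (real (omega m) + 1)\<^sup>2 / real m)
      \<le> (\<Sum>m | free_of D m \<and> real m \<le> x. (mu m)\<^sup>2 * (real (omega m) + 1)\<^sup>2 / real m)"
    using assms by (intro sum_mono2) auto
  finally show ?thesis by simp
qed

text \<open>Handles the cofactors m whose smallest prime factor p is at most x/m: splitting p off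
  leaves a sum of length x/p^2 with weight e(p - 1) = O(1 / log p). While log p \<le> (log x)^(3/4),
  this weight cancels the log p in \<open>V_bound\<close>; above, the sieve supplies L^2 log x / log
  p for the sum, without cancellation.\<close>

lemma sum_square_primes_V_bound:
  fixes e :: "real \<Rightarrow> real"
  assumes e: "\<And>t. t \<ge> 2 \<Longrightarrow> \<bar>e t\<bar> \<le> Ce / ln t" and Ce: "Ce > 0"
  shows "\<exists>C>0. \<forall>\<^sub>F x in at_top. \<bar>\<Sum>p\<in>primes_upto x. e (real p - 1) / real p *
            V 2 (primes_upto (real p)) ((if exp (sqrt (ln x)) < real p then x / real p else 0) / real p)\<bar>
           \<le> C * ln (ln x) ^ 3 / sqrt (ln x)"
proof -
  obtain C1 where C1: "C1 > 0" "\<forall>\<^sub>F x in at_top. \<forall>c y z. c \<le> 2 \<longrightarrow> sqrt x \<le> y \<longrightarrow> y \<le> x \<longrightarrow> 1 \<le> z \<longrightarrow> ln z \<le> ln x powr (3/4) \<longrightarrow>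
     \<bar>V c (primes_upto z) y\<bar> \<le> C1 * ln (ln x) ^ 2 * max (ln z) (sqrt (ln x)) / ln x"
    using V_bound by blast
  obtain C2 where C2: "C2 > 0" "\<forall>\<^sub>F x in at_top. \<forall>P M. 2 \<le> P \<longrightarrow> P \<le> M \<longrightarrow> M \<le> x \<longrightarrow>
     (\<Sum>m | free_of (primes_upto P) m \<and> real m \<le> M. (mu m)\<^sup>2 * (real (omega m) + 1)\<^sup>2 / real m)
        \<le> C2 * ln (ln x) ^ 2 * ln M / ln P \<and>
     (\<Sum>m | free_of (primes_upto P) m \<and> real m \<le> M. (mu m)\<^sup>2 * (real (omega m) + 1)\<^sup>2)
        \<le> C2 * ln (ln x) ^ 2 * M / ln P"
    using sifted_weight_bounds by blast
  obtain C' where C': "C' > 0" "\<And>x. x \<ge> 3 \<Longrightarrow> prime_inv_sum x \<le> ln (ln x) + C'"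
    using prime_inv_sum_bound by blast
  define C where "C = (2 * Ce * (C1 + 4 * C2)) * (1 + C')"
  have "\<forall>\<^sub>F x::real in at_top. ln x powr (3/4) \<le> ln x / 4" by real_asymp
  moreover have "\<forall>\<^sub>F x::real in at_top. ln x \<ge> 4" by real_asymp
  moreover have "\<forall>\<^sub>F x::real in at_top. ln (ln x) \<ge> 1" by real_asymp
  moreover have "\<forall>\<^sub>F x::real in at_top. x \<ge> 3" by (rule eventually_ge_at_top)
  ultimately have "\<forall>\<^sub>F x in at_top. \<bar>\<Sum>p\<in>primes_upto x. e (real p - 1) / real p *
            V 2 (primes_upto (real p)) ((if exp (sqrt (ln x)) < real p then x / real p else 0) / real p)\<bar>
           \<le> C * ln (ln x) ^ 3 / sqrt (ln x)"
    using C1(2) C2(2)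
  proof eventually_elim
    case (elim x)
    define L where "L = ln (ln x)"
    define s where "s = sqrt (ln x)"
    define z where "z = exp s"
    have s: "s \<ge> 2" "s * s = ln x" using elim(2) by (auto simp: s_def real_le_rsqrt)
    have L: "L \<ge> 1" using elim(3) by (simp add: L_def)
    define K where "K = 2 * Ce * (C1 + 4 * C2) * (L\<^sup>2 / s)"
    have K: "K \<ge> 0" using Ce C1(1) C2(1) s by (simp add: K_def)
    define v where "v = (\<lambda>p. V 2 (primes_upto (real p)) ((if z < real p then x / real p else 0) / real p))"
    have lx: "ln x > 0" using elim(2) by simp
    have bound: "\<bar>e (real p - 1) / real p * v p\<bar> \<le> K * (1 / real p)" if p: "p \<in> primes_upto x" for p
    proof (cases "z < real p")
      case False
      thus ?thesis using K by (simp add: v_def V_eq_0)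
    next
      case True
      define l where "l = ln (real p)"
      have "z \<ge> 1 + s" by (simp add: z_def)
      hence p3: "real p \<ge> 3" using True s by linarith
      have ls: "l \<ge> s"
      proof -
        have "ln z \<le> ln (real p)" using True by (intro ln_mono) (auto simp: z_def)
        thus ?thesis by (simp add: z_def l_def)
      qed
      have px: "real p \<le> x" using p by (simp add: primes_upto_def)
      have e1: "\<bar>e (real p - 1)\<bar> \<le> 2 * Ce / l"
      proof -
        \<comment> \<open>(p - 1)^2 \<ge> p, so passing from log p to log (p - 1) costs a factor
          2.\<close>
        have "real p * 3 \<le> real p * real p" using p3 by (intro mult_left_mono) auto
        hence "real p \<le> (real p - 1) * (real p - 1)" by (simp add: algebra_simps)
        hence "l \<le> ln ((real p - 1) * (real p - 1))" unfolding l_def using p3 by (intro ln_mono) auto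
        also have "\<dots> = 2 * ln (real p - 1)" using p3 by (simp add: ln_mult)
        finally have "l / 2 \<le> ln (real p - 1)" by simp
        hence "Ce / ln (real p - 1) \<le> Ce / (l / 2)" using ls s Ce by (intro divide_left_mono mult_pos_pos) auto
        thus ?thesis using e[of "real p - 1"] p3 by (simp add: mult.commute)
      qed
      have vp: "v p = V 2 (primes_upto (real p)) (x / real p / real p)" using True by (simp add: v_def)
      have y2: "x / real p / real p \<le> x"
      proof -
        have "x / (real p * real p) \<le> x / 1" using p3 elim(4) mult_mono[of 1 "real p" 1 "real p"]
          by (intro divide_left_mono) auto
        thus ?thesis by simp
      qed
      have main: "\<bar>e (real p - 1)\<bar> * \<bar>v p\<bar> \<le> K"
      \<comment> \<open>The exponent 3/4 is where the bound L^2 log x / l^2, free of cancellation,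
        drops to L^2 / sqrt (log x).\<close>
      proof (cases "l \<le> ln x powr (3/4)")
        case l: True
        have "l \<le> ln x / 4" using l elim(1) by linarith
        hence "exp (l + l) \<le> exp (ln (sqrt x))" using elim(4) by (simp add: ln_sqrt)
        hence pp: "real p * real p \<le> sqrt x" using p3 elim(4) unfolding l_def exp_add by simp
        have "sqrt x * (real p * real p) \<le> sqrt x * sqrt x" using pp elim(4) by (intro mult_left_mono) auto
        hence "sqrt x \<le> x / (real p * real p)" using p3 elim(4) by (simp add: pos_le_divide_eq)
        hence y1: "sqrt x \<le> x / real p / real p" by simp
        have "\<bar>v p\<bar> \<le> C1 * L\<^sup>2 * max l s / ln x"
          unfolding vp L_def l_def s_def using elim(5) y1 y2 p3 l by (simp add: l_def)
        also have "max l s = l" using ls by simp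
        finally have "\<bar>e (real p - 1)\<bar> * \<bar>v p\<bar> \<le> 2 * Ce / l * (C1 * L\<^sup>2 * l / ln x)"
          using e1 Ce ls s by (intro mult_mono) auto
        also have "\<dots> = 2 * Ce * C1 * L\<^sup>2 / (s * s)" using ls s by simp
        also have "\<dots> \<le> 2 * Ce * C1 * L\<^sup>2 / s"
          using s(1) Ce C1(1) by (intro divide_left_mono) (auto simp: mult_le_cancel_left1)
        also have "\<dots> = 2 * Ce * C1 * (L\<^sup>2 / s)" by simp
        also have "\<dots> \<le> K" unfolding K_def using s Ce C1(1) C2(1)
          by (intro mult_right_mono mult_left_mono) auto
        finally show ?thesis .
      next
        case False
        have "ln x powr (3/4) * ln x powr (3/4) \<le> l * l" using False ls s by (intro mult_mono) auto
        also have "ln x powr (3/4) * ln x powr (3/4) = ln x * s"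
          using lx by (simp add: powr_add[symmetric] s_def powr_half_sqrt[symmetric])
             (simp add: powr_add[of "ln x" 1 "1/2", simplified])
        finally have ll: "ln x * s \<le> l * l" .
        have "\<bar>v p\<bar> \<le> 4 * (\<Sum>m | free_of (primes_upto (real p)) m \<and> real m \<le> x. (mu m)\<^sup>2 * (real (omega m) + 1)\<^sup>2 / real m)"
          unfolding vp by (rule abs_V_2_le[OF y2])
        also have "(\<Sum>m | free_of (primes_upto (real p)) m \<and> real m \<le> x. (mu m)\<^sup>2 * (real (omega m) + 1)\<^sup>2 / real m)
           \<le> C2 * L\<^sup>2 * ln x / l"
          using elim(6)[rule_format, of "real p" x] px p3 by (simp add: L_def l_def)
        finally have "\<bar>e (real p - 1)\<bar> * \<bar>v p\<bar> \<le> 2 * Ce / l * (4 * (C2 * L\<^sup>2 * ln x / l))"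
          using e1 Ce ls s by (intro mult_mono) auto
        also have "\<dots> = 2 * Ce * (4 * C2) * L\<^sup>2 * ln x / (l * l)" by simp
        also have "\<dots> \<le> 2 * Ce * (4 * C2) * L\<^sup>2 * ln x / (ln x * s)"
          using ll lx s Ce C2(1) ls by (intro divide_left_mono mult_pos_pos) auto
        also have "\<dots> = 2 * Ce * (4 * C2) * (L\<^sup>2 / s)" using lx by simp
        also have "\<dots> \<le> K" unfolding K_def using s Ce C1(1) C2(1)
          by (intro mult_right_mono mult_left_mono) auto
        finally show ?thesis .
      qed
      have "\<bar>e (real p - 1) / real p * v p\<bar> = \<bar>e (real p - 1)\<bar> * \<bar>v p\<bar> / real p" by (simp add: abs_mult)
      also have "\<dots> \<le> K / real p" by (intro divide_right_mono main) auto
      finally show ?thesis by simp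
    qed
    have "\<bar>\<Sum>p\<in>primes_upto x. e (real p - 1) / real p * v p\<bar> \<le> (\<Sum>p\<in>primes_upto x. K * (1 / real p))"
      by (rule order_trans[OF sum_abs]) (intro sum_mono bound)
    also have "\<dots> = K * prime_inv_sum x" by (simp only: sum_distrib_left)
    also have "\<dots> \<le> K * ((1 + C') * L)"
    proof (intro mult_left_mono K)
      have "prime_inv_sum x \<le> L + C'" using C'(2)[of x] elim(4) by (simp add: L_def)
      also have "C' \<le> C' * L" using L C'(1) by simp
      finally show "prime_inv_sum x \<le> (1 + C') * L" by (simp add: algebra_simps)
    qed
    also have "K * ((1 + C') * L) = C * L ^ 3 / s" by (simp add: K_def C_def power2_eq_square power3_eq_cube)
    finally show ?case unfolding v_def z_def s_def L_def .
  qed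
  moreover have "C > 0" using Ce C1 C2 C' by (simp add: C_def add_pos_pos)
  ultimately show ?thesis by blast
qed

text \<open>Where log (x/m) has integer part k, m is at most x e^(-k) and free of the primes up to
  e^k, so the weighted sieve count is O(L^2 x e^(-k) / k). With 1/m \<le> e^(k+1) / x and the error
  term e = O(1/k), the block contributes O(L^2 / k^2). Summing over k from about sqrt (log x) on
  gives L^2 / sqrt (log x).\<close>

lemma sum_large_cofactor_bound:
  fixes e :: "real \<Rightarrow> real"
  assumes e: "\<And>t. t \<ge> 2 \<Longrightarrow> \<bar>e t\<bar> \<le> Ce / ln t" and Ce: "Ce > 0"
  shows "\<exists>C>0. \<forall>\<^sub>F x in at_top. \<forall>A. finite A \<longrightarrow>
      (\<forall>m\<in>A. 2 \<le> m \<and> x / real m < real (smallest_prime_factor m) \<and> real m \<le> x / exp (sqrt (ln x))) \<longrightarrow>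
      \<bar>\<Sum>m\<in>A. mu m / real m * (real (omega m) + 1)\<^sup>2 * e (x / real m)\<bar> \<le> C * ln (ln x) ^ 2 / sqrt (ln x)"
proof -
  obtain C2 where C2: "C2 > 0" "\<forall>\<^sub>F x in at_top. \<forall>P M. 2 \<le> P \<longrightarrow> P \<le> M \<longrightarrow> M \<le> x \<longrightarrow>
     (\<Sum>m | free_of (primes_upto P) m \<and> real m \<le> M. (mu m)\<^sup>2 * (real (omega m) + 1)\<^sup>2 / real m)
        \<le> C2 * ln (ln x) ^ 2 * ln M / ln P \<and>
     (\<Sum>m | free_of (primes_upto P) m \<and> real m \<le> M. (mu m)\<^sup>2 * (real (omega m) + 1)\<^sup>2)
        \<le> C2 * ln (ln x) ^ 2 * M / ln P"
    using sifted_weight_bounds by blast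
  define C where "C = 4 * (Ce * exp 1 * C2)"
  have "\<forall>\<^sub>F x::real in at_top. sqrt (ln x) + 1 \<le> ln x / 2" by real_asymp
  moreover have "\<forall>\<^sub>F x::real in at_top. ln x \<ge> 4" by real_asymp
  moreover have "\<forall>\<^sub>F x::real in at_top. x \<ge> 3" by (rule eventually_ge_at_top)
  ultimately have "\<forall>\<^sub>F x in at_top. \<forall>A. finite A \<longrightarrow>
      (\<forall>m\<in>A. 2 \<le> m \<and> x / real m < real (smallest_prime_factor m) \<and> real m \<le> x / exp (sqrt (ln x))) \<longrightarrow>
      \<bar>\<Sum>m\<in>A. mu m / real m * (real (omega m) + 1)\<^sup>2 * e (x / real m)\<bar> \<le> C * ln (ln x) ^ 2 / sqrt (ln x)"
    using C2(2)
  proof eventually_elim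
    case (elim x)
    show ?case
    proof (intro allI impI)
      fix A :: "nat set"
      assume fin: "finite A" and A: "\<forall>m\<in>A. 2 \<le> m \<and> x / real m < real (smallest_prime_factor m) \<and> real m \<le> x / exp (sqrt (ln x))"
      define L where "L = ln (ln x)"
      define s where "s = sqrt (ln x)"
      define f where "f = (\<lambda>m. mu m / real m * (real (omega m) + 1)\<^sup>2 * e (x / real m))"
      define g where "g = (\<lambda>m. nat \<lfloor>ln (x / real m)\<rfloor>)"
      define k0 where "k0 = nat \<lfloor>s\<rfloor>"
      define k1 where "k1 = nat \<lfloor>ln x / 2\<rfloor>"
      have x0: "x > 0" using elim(3) by simp
      have s: "s \<ge> 2" using elim(2) by (auto simp: s_def real_le_rsqrt)
      have k0: "k0 \<ge> 1" "real k0 \<ge> s / 2" using s by (auto simp: k0_def le_nat_iff) linarith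
      have k01: "k0 \<le> k1" using elim(1) s unfolding k0_def k1_def s_def by (intro nat_mono floor_mono) auto
      have mA: "g m \<in> {k0..k1}" "real m \<le> x * exp (- real (g m))" "1 / real m \<le> exp (real (g m) + 1) / x"
          "exp (real (g m)) < real (smallest_prime_factor m)" "\<bar>e (x / real m)\<bar> \<le> Ce / real (g m)" if m: "m \<in> A" for m
      proof -
        define l where "l = ln (x / real m)"
        have m': "m \<ge> 2" "x / real m < real (smallest_prime_factor m)" "real m \<le> x / exp s" using A m by (auto simp: s_def)
        have xm: "x / real m > 0" using x0 m' by simp
        have "exp s \<le> x / real m" using m' by (simp add: pos_le_divide_eq mult.commute)
        hence ls: "s \<le> l" using xm by (simp add: l_def ln_ge_iff)
        \<comment> \<open>x/m is less than the smallest prime factor, hence less than m, so k stays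
          at most log x / 2. This keeps the sieving limit e^k below the length x e^(-k), as the
          sieve bound demands.\<close>
        have "smallest_prime_factor m \<le> m" using smallest_prime_factor_props[OF m'(1)] m' by (intro dvd_imp_le) auto
        hence "x / real m < real m" using m' by linarith
        hence "ln (x / real m) < ln (real m)" using xm by (subst ln_less_cancel_iff) auto
        moreover have "ln (x / real m) = ln x - ln (real m)" using x0 m' by (simp add: ln_div)
        ultimately have lx: "l \<le> ln x / 2" by (simp add: l_def)
        have gl: "real (g m) \<le> l" "l < real (g m) + 1" using ls s by (auto simp: g_def l_def)
        show "g m \<in> {k0..k1}" using ls lx unfolding g_def k0_def k1_def l_def[symmetric] by (auto intro!: nat_mono floor_mono)
        hence g1: "real (g m) \<ge> 1" using k0 by simp
        have el: "exp l = x / real m" using xm by (simp add: l_def)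
        have "exp (real (g m)) \<le> x / real m" using gl(1) el[symmetric] by simp
        thus "real m \<le> x * exp (- real (g m))" using m' by (simp add: exp_minus field_simps)
        have "x / real m \<le> exp (real (g m) + 1)" using gl(2) el[symmetric] by simp
        thus "1 / real m \<le> exp (real (g m) + 1) / x" using m' x0 by (simp add: field_simps)
        show "exp (real (g m)) < real (smallest_prime_factor m)" using \<open>exp (real (g m)) \<le> x / real m\<close> m' by linarith
        have "exp l \<ge> 1 + l" by simp
        hence "x / real m \<ge> 2" using ls s el by linarith
        hence "\<bar>e (x / real m)\<bar> \<le> Ce / l" using e[of "x / real m"] by (simp add: l_def)
        also have "\<dots> \<le> Ce / real (g m)" using gl g1 Ce by (intro divide_left_mono mult_pos_pos) auto
        finally show "\<bar>e (x / real m)\<bar> \<le> Ce / real (g m)" .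
      qed
      have block: "(\<Sum>m | m \<in> A \<and> g m = k. \<bar>f m\<bar>) \<le> Ce * exp 1 * C2 * L\<^sup>2 * (1 / (real k)\<^sup>2)" if k: "k \<in> {k0..k1}" for k
      proof -
        define P where "P = exp (real k)"
        define M where "M = x * exp (- real k)"
        have k1': "real k \<ge> 1" using k k0 by simp
        have P2: "P \<ge> 2"
        proof -
          have "P \<ge> 1 + real k" by (simp add: P_def)
          thus ?thesis using k1' by linarith
        qed
        have "real k \<le> ln x / 2"
        proof -
          have "real k \<le> real k1" using k by simp
          also have "\<dots> \<le> ln x / 2" using elim(2) of_int_floor_le[of "ln x / 2"] by (simp add: k1_def)
          finally show ?thesis .
        qed
        hence "exp (real k + real k) \<le> exp (ln x)" by simp
        hence "P * P \<le> x" using x0 unfolding P_def exp_add[symmetric] by simp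
        hence PM: "P \<le> M" by (simp add: M_def P_def exp_minus field_simps)
        have Mx: "M \<le> x" using x0 by (simp add: M_def mult_le_cancel_left1)
        have "(\<Sum>m | m \<in> A \<and> g m = k. \<bar>f m\<bar>) \<le> (\<Sum>m | m \<in> A \<and> g m = k. Ce / real k * (exp (real k + 1) / x) * ((mu m)\<^sup>2 * (real (omega m) + 1)\<^sup>2))"
        proof (intro sum_mono)
          fix m assume "m \<in> {m. m \<in> A \<and> g m = k}"
          hence m: "m \<in> A" "g m = k" by auto
          have mu: "\<bar>mu m\<bar> = (mu m)\<^sup>2" by (simp add: moebius_def flip: power_mult)
          have "\<bar>f m\<bar> = \<bar>e (x / real m)\<bar> * (1 / real m) * ((mu m)\<^sup>2 * (real (omega m) + 1)\<^sup>2)"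
            by (simp add: f_def abs_mult mu)
          also have "\<dots> \<le> Ce / real k * (exp (real k + 1) / x) * ((mu m)\<^sup>2 * (real (omega m) + 1)\<^sup>2)"
            using mA(3,5)[OF m(1)] m(2) x0 Ce by (intro mult_right_mono mult_mono) auto
          finally show "\<bar>f m\<bar> \<le> Ce / real k * (exp (real k + 1) / x) * ((mu m)\<^sup>2 * (real (omega m) + 1)\<^sup>2)" .
        qed
        also have "\<dots> \<le> (\<Sum>m | free_of (primes_upto P) m \<and> real m \<le> M. Ce / real k * (exp (real k + 1) / x) * ((mu m)\<^sup>2 * (real (omega m) + 1)\<^sup>2))"
        proof (intro sum_mono2)
          show "{m \<in> A. g m = k} \<subseteq> {m. free_of (primes_upto P) m \<and> real m \<le> M}"
          proof safe
            fix m assume m: "m \<in> A" "k = g m"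
            show "free_of (primes_upto P) m" using mA(4)[OF m(1)] A m by (subst free_of_primes_upto_iff) (auto simp: P_def)
            show "real m \<le> M" using mA(2)[OF m(1)] m by (simp add: M_def)
          qed
        qed (use Ce x0 in auto)
        also have "\<dots> = Ce / real k * (exp (real k + 1) / x) * (\<Sum>m | free_of (primes_upto P) m \<and> real m \<le> M. (mu m)\<^sup>2 * (real (omega m) + 1)\<^sup>2)"
          by (simp only: sum_distrib_left)
        also have "\<dots> \<le> Ce / real k * (exp (real k + 1) / x) * (C2 * L\<^sup>2 * M / ln P)"
          using elim(4)[rule_format, OF P2 PM Mx] Ce x0 by (intro mult_left_mono) (auto simp: L_def)
        also have "\<dots> = Ce * exp 1 * C2 * L\<^sup>2 * (1 / (real k)\<^sup>2)"
          using x0 k1' by (simp add: M_def P_def exp_add exp_minus power2_eq_square field_simps)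
        finally show ?thesis .
      qed
      have "\<bar>\<Sum>m\<in>A. f m\<bar> \<le> (\<Sum>m\<in>A. \<bar>f m\<bar>)" by (rule sum_abs)
      also have "\<dots> = (\<Sum>k=k0..k1. \<Sum>m | m \<in> A \<and> g m = k. \<bar>f m\<bar>)"
        using mA(1) fin by (intro sum.group[symmetric]) auto
      also have "\<dots> \<le> (\<Sum>k=k0..k1. Ce * exp 1 * C2 * L\<^sup>2 * (1 / (real k)\<^sup>2))"
        by (intro sum_mono block)
      also have "\<dots> = Ce * exp 1 * C2 * L\<^sup>2 * (\<Sum>k=k0..k1. 1 / (real k)\<^sup>2)" by (simp only: sum_distrib_left)
      also have "\<dots> \<le> Ce * exp 1 * C2 * L\<^sup>2 * (4 / s)"
      proof (intro mult_left_mono)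
        have "(\<Sum>k=k0..k1. 1 / (real k)\<^sup>2) \<le> 2 / real k0 - 1 / real k1" by (rule sum_inverse_squares_le[OF k0(1) k01])
        also have "\<dots> \<le> 2 / real k0" by simp
        also have "\<dots> \<le> 2 / (s / 2)" using k0 s by (intro divide_left_mono mult_pos_pos) auto
        finally show "(\<Sum>k=k0..k1. 1 / (real k)\<^sup>2) \<le> 4 / s" by simp
      qed (use Ce C2 in auto)
      also have "\<dots> = C * L\<^sup>2 / s" by (simp add: C_def)
      finally show "\<bar>\<Sum>m\<in>A. mu m / real m * (real (omega m) + 1)\<^sup>2 * e (x / real m)\<bar> \<le> C * ln (ln x) ^ 2 / sqrt (ln x)"
        by (simp add: f_def L_def s_def)
    qed
  qed
  moreover have "C > 0" using Ce C2(1) by (simp add: C_def)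
  ultimately show ?thesis by blast
qed

section \<open>Assembly of the estimates\<close>

lemma restricted_sum_bound:
  assumes l: "l > 0" and jl: "coprime j l"
  shows "\<exists>C>0. \<forall>\<^sub>F x in at_top.
    \<bar>\<Sum>n | 2 \<le> n \<and> real n \<le> x \<and> [smallest_prime_factor n = j] (mod l). mu n / real n * (real (omega n))\<^sup>2\<bar>
      \<le> C * ln (ln x) ^ 3 / sqrt (ln x)"
proof -
  obtain h c Ce where Ce: "Ce > 0" and prog: "\<And>t. t \<ge> 2 \<Longrightarrow>
     \<bar>(\<Sum>p\<in>primes_upto t. ((if [p = j] (mod l) then 1 else 0) - h) / real p) - c\<bar> \<le> Ce / ln t"
    using prime_progression_inverse[OF assms] by blast
  define a where "a = (\<lambda>p. (if [p = j] (mod l) then 1 else 0) - h :: real)"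
  define T where "T = (\<lambda>t. \<Sum>p\<in>primes_upto t. a p / real p)"
  define e where "e = (\<lambda>t. T t - c)"
  have e: "\<bar>e t\<bar> \<le> Ce / ln t" if "t \<ge> 2" for t
    using prog[OF that] by (simp add: e_def T_def a_def)
  have a: "\<bar>a p\<bar> \<le> 1 + \<bar>h\<bar>" for p using abs_triangle_ineq4[of 1 h] by (simp add: a_def)
  obtain C0 where C0: "C0 > 0" "\<forall>\<^sub>F x in at_top. \<forall>c y z. c \<le> 2 \<longrightarrow> sqrt x \<le> y \<longrightarrow> y \<le> x \<longrightarrow> 1 \<le> z \<longrightarrow> ln z \<le> ln x powr (3/4) \<longrightarrow>
     \<bar>V c (primes_upto z) y\<bar> \<le> C0 * ln (ln x) ^ 2 * max (ln z) (sqrt (ln x)) / ln x"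
    using V_bound by blast
  obtain C1 where C1: "C1 > 0" "\<forall>\<^sub>F x in at_top.
      \<bar>\<Sum>p\<in>primes_upto (exp (sqrt (ln x))). a p / real p * V 1 (primes_upto (real p)) (x / real p)\<bar>
           \<le> C1 * ln (ln x) ^ 3 / sqrt (ln x)"
    using sum_small_primes_V_bound[of a, OF a] by blast
  obtain C2 where C2: "C2 > 0" "\<forall>\<^sub>F x in at_top. \<bar>\<Sum>p\<in>primes_upto x. e (real p - 1) / real p *
            V 2 (primes_upto (real p)) ((if exp (sqrt (ln x)) < real p then x / real p else 0) / real p)\<bar>
           \<le> C2 * ln (ln x) ^ 3 / sqrt (ln x)"
    using sum_square_primes_V_bound[of e Ce, OF e Ce] by blast
  obtain C3 where C3: "C3 > 0" "\<forall>\<^sub>F x in at_top. \<forall>A. finite A \<longrightarrow>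
      (\<forall>m\<in>A. 2 \<le> m \<and> x / real m < real (smallest_prime_factor m) \<and> real m \<le> x / exp (sqrt (ln x))) \<longrightarrow>
      \<bar>\<Sum>m\<in>A. mu m / real m * (real (omega m) + 1)\<^sup>2 * e (x / real m)\<bar> \<le> C3 * ln (ln x) ^ 2 / sqrt (ln x)"
    using sum_large_cofactor_bound[of e Ce, OF e Ce] by blast
  define C where "C = \<bar>h\<bar> * C0 + C1 + Ce * C0 + Ce + C2 + C3"
  have "\<forall>\<^sub>F x::real in at_top. exp (sqrt (ln x)) \<le> sqrt x" by real_asymp
  moreover have "\<forall>\<^sub>F x::real in at_top. sqrt (ln x) \<le> ln x powr (3/4)" by real_asymp
  moreover have "\<forall>\<^sub>F x::real in at_top. ln x \<ge> 1" by real_asymp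
  moreover have "\<forall>\<^sub>F x::real in at_top. ln (ln x) \<ge> 1" by real_asymp
  moreover have "\<forall>\<^sub>F x::real in at_top. x \<ge> 3" by (rule eventually_ge_at_top)
  ultimately have "\<forall>\<^sub>F x in at_top.
    \<bar>\<Sum>n | 2 \<le> n \<and> real n \<le> x \<and> [smallest_prime_factor n = j] (mod l). mu n / real n * (real (omega n))\<^sup>2\<bar>
      \<le> C * ln (ln x) ^ 3 / sqrt (ln x)"
    using C0(2) C1(2) C2(2) C3(2)
  proof eventually_elim
    case (elim x)
    define L where "L = ln (ln x)"
    define s where "s = sqrt (ln x)"
    define z where "z = exp s"
    define S where "S = (\<Sum>n | 2 \<le> n \<and> real n \<le> x \<and> [smallest_prime_factor n = j] (mod l). mu n / real n * (real (omega n))\<^sup>2)"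
    define S1 where "S1 = (\<Sum>p\<in>primes_upto z. a p / real p * V 1 (primes_upto (real p)) (x / real p))"
    define B where "B = (\<lambda>p. if z < real p then x / real p else 0)"
    define S2 where "S2 = (\<Sum>p\<in>primes_upto x. e (real p - 1) / real p * V 2 (primes_upto (real p)) (B p / real p))"
    define w where "w = (\<lambda>m. mu m / real m * (real (omega m) + real 1)\<^sup>2)"
    define t where "t = (\<lambda>m. if 2 \<le> m \<and> real (smallest_prime_factor m) \<le> x / real m then real (smallest_prime_factor m) - 1 else x / real m)"
    define M where "M = {m. free_of (primes_upto z) m \<and> real m \<le> x / z}"
    define M1 where "M1 = {m \<in> M. 2 \<le> m \<and> real (smallest_prime_factor m) \<le> x / real m}"
    define M2 where "M2 = {m \<in> M. 2 \<le> m \<and> \<not> real (smallest_prime_factor m) \<le> x / real m}"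
    define S3 where "S3 = (\<Sum>m\<in>M2. mu m / real m * (real (omega m) + 1)\<^sup>2 * e (x / real m))"
    have s: "s \<ge> 1" "s * s = ln x" using elim(3) by (auto simp: s_def)
    have L: "L \<ge> 1" using elim(4) by (simp add: L_def)
    have sx: "sqrt x > 0" "sqrt x * sqrt x = x" using elim(5) by auto
    have sx1: "1 \<le> sqrt x" using elim(5) by simp
    have sxx: "sqrt x \<le> x" using mult_left_mono[OF sx1, of "sqrt x"] sx by simp
    have z: "z \<ge> 1 + s" "z \<le> sqrt x" using elim(1) by (auto simp: z_def s_def)
    have zx: "z \<le> x" using z sxx by linarith
    have fin: "finite M" by (simp add: M_def)
    have total: "(\<Sum>n | 2 \<le> n \<and> real n \<le> x. mu n / real n * (real (omega n))\<^sup>2) = V 0 (primes_upto 1) x"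
    proof -
      have p1: "primes_upto 1 = {}" by (auto simp: primes_upto_def dest: prime_gt_1_nat)
      have sub: "{n. 2 \<le> n \<and> real n \<le> x} \<subseteq> {m. free_of (primes_upto 1) m \<and> real m \<le> x}"
        by (auto simp: free_of_def p1)
      have zero: "mu n / real n * (real (omega n))\<^sup>2 = 0"
        if "n \<in> {m. free_of (primes_upto 1) m \<and> real m \<le> x} - {n. 2 \<le> n \<and> real n \<le> x}" for n
      proof -
        have "n = 1" using that by (auto simp: free_of_def)
        thus ?thesis by simp
      qed
      show ?thesis unfolding V_def of_nat_0 add_0_right
        by (intro sum.mono_neutral_left ballI sub zero) auto
    qed
    \<comment> \<open>Weighting by \<open>a\<close> in place of the indicator changes the sum by h
      times the unrestricted one, which is \<open>V 0\<close> with an empty sifting set.\<close>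
    have "(\<Sum>n | 2 \<le> n \<and> real n \<le> x. mu n / real n * (real (omega n) + real 0)\<^sup>2 * a (smallest_prime_factor n))
       = - (\<Sum>p\<in>primes_upto x. a p / real p * V (0 + 1) (primes_upto (real p)) (x / real p))"
      using sum_smallest_prime_factor_V[of "\<lambda>_. x" x 0 a] by simp
    also have "(\<Sum>n | 2 \<le> n \<and> real n \<le> x. mu n / real n * (real (omega n) + real 0)\<^sup>2 * a (smallest_prime_factor n))
       = (\<Sum>n | 2 \<le> n \<and> real n \<le> x. if [smallest_prime_factor n = j] (mod l) then mu n / real n * (real (omega n))\<^sup>2 else 0)
         - h * (\<Sum>n | 2 \<le> n \<and> real n \<le> x. mu n / real n * (real (omega n))\<^sup>2)"
      unfolding sum_distrib_left sum_subtractf[symmetric] by (intro sum.cong) (auto simp: a_def algebra_simps diff_divide_distrib)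
    also have "(\<Sum>n | 2 \<le> n \<and> real n \<le> x. if [smallest_prime_factor n = j] (mod l) then mu n / real n * (real (omega n))\<^sup>2 else 0) = S"
      unfolding S_def by (intro sum.mono_neutral_cong_right) auto
    also have "(\<Sum>p\<in>primes_upto x. a p / real p * V (0 + 1) (primes_upto (real p)) (x / real p))
       = (\<Sum>p\<in>primes_upto x - primes_upto z. a p / real p * V 1 (primes_upto (real p)) (x / real p)) + S1"
      unfolding S1_def add_0 using zx by (intro sum.subset_diff) (auto simp: primes_upto_def)
    finally have eqS: "S = h * V 0 (primes_upto 1) x
        - (\<Sum>p\<in>primes_upto x - primes_upto z. a p / real p * V 1 (primes_upto (real p)) (x / real p)) - S1"
      unfolding total by linarith
    have "(\<Sum>p\<in>primes_upto x - primes_upto z. a p / real p * V 1 (primes_upto (real p)) (x / real p))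
        = (\<Sum>m\<in>M. w m * (T (t m) - T z))"
      unfolding M_def w_def T_def t_def using z s by (intro sum_primes_V_swap) auto
    \<comment> \<open>The constant c cancels in the difference of two values of \<open>T\<close>, so
      only the errors \<open>e\<close> remain.\<close>
    also have "\<dots> = (\<Sum>m\<in>M. w m * e (t m)) - e z * (\<Sum>m\<in>M. w m)"
      unfolding sum_distrib_left sum_subtractf[symmetric] by (simp add: e_def algebra_simps)
    also have "(\<Sum>m\<in>M. w m) = V 1 (primes_upto z) (x / z)" by (simp add: M_def w_def V_def)
    \<comment> \<open>m = 1 has weight 1 and t = x. The other m are split by whether their smallest
      prime factor is at most x/m.\<close>
    also have "(\<Sum>m\<in>M. w m * e (t m)) = e x + ((\<Sum>m\<in>M1. w m * e (t m)) + (\<Sum>m\<in>M2. w m * e (t m)))"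
    proof -
      have one: "1 \<in> M" using zx z s by (auto simp: M_def primes_upto_def pos_le_divide_eq)
      have "M = insert 1 (M1 \<union> M2)" using one free_of_pos by (force simp: M1_def M2_def M_def)
      moreover have "1 \<notin> M1 \<union> M2" "M1 \<inter> M2 = {}" "finite M1" "finite M2" using fin by (auto simp: M1_def M2_def)
      ultimately have "(\<Sum>m\<in>M. w m * e (t m)) = w 1 * e (t 1) + ((\<Sum>m\<in>M1. w m * e (t m)) + (\<Sum>m\<in>M2. w m * e (t m)))"
        by (simp add: sum.union_disjoint)
      thus ?thesis by (simp add: w_def t_def)
    qed
    also have "(\<Sum>m\<in>M1. w m * e (t m)) = - S2"
    proof -
      \<comment> \<open>If the smallest prime factor q of n exceeds z, then n \<le> x/q already
        implies n \<le> x/z, so all conditions merge into the single cutoff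
        \<open>B\<close>.\<close>
      have M1: "M1 = {n. 2 \<le> n \<and> real n \<le> B (smallest_prime_factor n)}"
      proof -
        have "n \<in> M1 \<longleftrightarrow> real n \<le> B (smallest_prime_factor n)" if n: "2 \<le> n" for n
        proof -
          define q where "q = real (smallest_prime_factor n)"
          have q: "q > 0" using smallest_prime_factor_props(1)[OF n] prime_gt_0_nat by (auto simp: q_def)
          have "x / q \<le> x / z" if "z < q" using that z s elim(5) by (intro divide_left_mono) auto
          moreover have "q \<le> x / real n \<longleftrightarrow> real n \<le> x / q" using n q by (simp add: pos_le_divide_eq mult.commute)
          ultimately show ?thesis using n
            by (auto simp: M1_def M_def B_def free_of_primes_upto_iff q_def[symmetric])
        qed
        thus ?thesis by (auto simp: M1_def)
      qed
      have Bx: "B p \<le> x" for p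
      proof (cases "p = 0")
        case False
        hence "x / real p \<le> x / 1" using elim(5) by (intro divide_left_mono) auto
        thus ?thesis using elim(5) by (simp add: B_def)
      qed (use elim(5) in \<open>simp add: B_def\<close>)
      have "(\<Sum>m\<in>M1. w m * e (t m)) = (\<Sum>n\<in>M1. mu n / real n * (real (omega n) + real 1)\<^sup>2 * e (real (smallest_prime_factor n) - 1))"
        by (intro sum.cong refl) (simp add: M1_def w_def t_def)
      also have "\<dots> = - (\<Sum>p\<in>primes_upto x. e (real p - 1) / real p * V (1 + 1) (primes_upto (real p)) (B p / real p))"
        unfolding M1 by (rule sum_smallest_prime_factor_V) (rule Bx)
      finally show ?thesis by (simp only: S2_def one_add_one)
    qed
    also have "(\<Sum>m\<in>M2. w m * e (t m)) = S3"
      unfolding S3_def by (intro sum.cong refl) (simp add: M2_def w_def t_def)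
    finally have eqS': "S = h * V 0 (primes_upto 1) x - (e x + (- S2 + S3) - e z * V 1 (primes_upto z) (x / z)) - S1"
      using eqS by simp
    have V0: "\<bar>V 0 (primes_upto 1) x\<bar> \<le> C0 * L\<^sup>2 / s"
    proof -
      have "\<bar>V 0 (primes_upto 1) x\<bar> \<le> C0 * ln (ln x) ^ 2 * max (ln 1) (sqrt (ln x)) / ln x"
        using elim(6)[rule_format, of 0 x 1] sxx elim(3) by simp
      also have "\<dots> = C0 * L\<^sup>2 * s / (s * s)" using s by (simp add: L_def s_def)
      also have "\<dots> = C0 * L\<^sup>2 / s" using s(1) by simp
      finally show ?thesis .
    qed
    have V1: "\<bar>V 1 (primes_upto z) (x / z)\<bar> \<le> C0 * L\<^sup>2 / s"
    proof -
      have "sqrt x * z \<le> sqrt x * sqrt x" using z sx by (intro mult_left_mono) auto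
      hence y1: "sqrt x \<le> x / z" using z s sx by (simp add: pos_le_divide_eq)
      have y2: "x / z \<le> x" using z s elim(5) by (simp add: divide_le_eq mult_le_cancel_left1)
      have "\<bar>V 1 (primes_upto z) (x / z)\<bar> \<le> C0 * ln (ln x) ^ 2 * max (ln z) (sqrt (ln x)) / ln x"
        using elim(6)[rule_format, of 1 "x / z" z] y1 y2 z s elim(2) by (simp add: z_def s_def)
      also have "\<dots> = C0 * L\<^sup>2 * s / (s * s)" using s by (simp add: L_def s_def z_def)
      also have "\<dots> = C0 * L\<^sup>2 / s" using s(1) by simp
      finally show ?thesis .
    qed
    have L3: "L\<^sup>2 / s \<le> L ^ 3 / s" "1 / s \<le> L ^ 3 / s"
    proof -
      have "L\<^sup>2 \<le> L ^ 3" using L by (intro power_increasing) auto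
      thus "L\<^sup>2 / s \<le> L ^ 3 / s" using s by (intro divide_right_mono) auto
      have "1 \<le> L ^ 3" using L by (rule one_le_power)
      thus "1 / s \<le> L ^ 3 / s" using s by (intro divide_right_mono) auto
    qed
    have b0: "\<bar>h * V 0 (primes_upto 1) x\<bar> \<le> \<bar>h\<bar> * C0 * (L ^ 3 / s)"
    proof -
      have "\<bar>h * V 0 (primes_upto 1) x\<bar> \<le> \<bar>h\<bar> * (C0 * (L\<^sup>2 / s))" using mult_left_mono[OF V0, of "\<bar>h\<bar>"] by (simp add: abs_mult mult.assoc)
      also have "\<dots> \<le> \<bar>h\<bar> * (C0 * (L ^ 3 / s))" using L3(1) C0(1) by (intro mult_left_mono) auto
      finally show ?thesis by (simp only: mult.assoc)
    qed
    have z2: "z \<ge> 2" using z s by linarith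
    have ez: "\<bar>e z\<bar> \<le> Ce / s" using e[OF z2] by (simp add: z_def)
    have ez1: "\<bar>e z * V 1 (primes_upto z) (x / z)\<bar> \<le> Ce * C0 * (L ^ 3 / s)"
    proof -
      have "Ce / s \<le> Ce" using Ce s by (simp add: divide_le_eq mult_le_cancel_left1)
      hence "\<bar>e z * V 1 (primes_upto z) (x / z)\<bar> \<le> Ce * (C0 * L\<^sup>2 / s)"
        unfolding abs_mult using ez V1 Ce by (intro mult_mono) auto
      also have "\<dots> = Ce * C0 * (L\<^sup>2 / s)" by simp
      also have "\<dots> \<le> Ce * C0 * (L ^ 3 / s)" using L3(1) C0(1) Ce by (intro mult_left_mono) auto
      finally show ?thesis .
    qed
    have ex: "\<bar>e x\<bar> \<le> Ce * (L ^ 3 / s)"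
    proof -
      have "\<bar>e x\<bar> \<le> Ce / (s * s)" using e[of x] elim(5) s by simp
      also have "\<dots> \<le> Ce / s" using s(1) Ce by (intro divide_left_mono) (auto simp: mult_le_cancel_left1)
      also have "\<dots> = Ce * (1 / s)" by simp
      also have "\<dots> \<le> Ce * (L ^ 3 / s)" using L3(2) Ce by (intro mult_left_mono) auto
      finally show ?thesis .
    qed
    have b1: "\<bar>S1\<bar> \<le> C1 * (L ^ 3 / s)" using elim(7) by (simp add: S1_def z_def s_def L_def)
    have b2: "\<bar>S2\<bar> \<le> C2 * (L ^ 3 / s)" using elim(8) by (simp add: S2_def B_def z_def s_def L_def)
    have b3: "\<bar>S3\<bar> \<le> C3 * (L ^ 3 / s)"
    proof -
      have "\<bar>S3\<bar> \<le> C3 * ln (ln x) ^ 2 / sqrt (ln x)" unfolding S3_def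
        using fin by (intro elim(9)[rule_format]) (auto simp: M2_def M_def z_def s_def)
      also have "\<dots> = C3 * (L\<^sup>2 / s)" by (simp add: L_def s_def)
      also have "\<dots> \<le> C3 * (L ^ 3 / s)" using L3(1) C3(1) by (intro mult_left_mono) auto
      finally show ?thesis .
    qed
    have "\<bar>S\<bar> \<le> \<bar>h\<bar> * C0 * (L ^ 3 / s) + C1 * (L ^ 3 / s) + Ce * C0 * (L ^ 3 / s) + Ce * (L ^ 3 / s) + C2 * (L ^ 3 / s) + C3 * (L ^ 3 / s)"
      using b0 ez1 ex b1 b2 b3 unfolding eqS' by linarith
    also have "\<dots> = C * (L ^ 3 / s)" by (simp only: C_def distrib_right)
    finally show ?case by (simp add: S_def L_def s_def)
  qed
  moreover have "C > 0" using C0 C1 C2 C3 Ce by (simp add: C_def add_nonneg_pos)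
  ultimately show ?thesis by blast
qed

theorem theorem4p4:
  fixes j l :: nat
  assumes "1 \<le> j" and "j \<le> l" and "gcd j l = 1"
  shows "(\<lambda>x :: real. \<Sum>n \<in> {n :: nat. 2 \<le> n \<and> real n \<le> x \<and> [smallest_prime_factor n = j] (mod l)}.
              real_of_int (moebius n) * real (omega n) ^ 2 / real n)
           \<in> O[at_top](\<lambda>x. ln (ln x) powr (7 / 2) / sqrt (ln x))
       \<and> (\<lambda>n. if 2 \<le> n \<and> [smallest_prime_factor n = j] (mod l)
              then real_of_int (moebius n) * real (omega n) ^ 2 / real n else 0) sums 0"
proof -
  define S where "S = (\<lambda>x::real. \<Sum>n | 2 \<le> n \<and> real n \<le> x \<and> [smallest_prime_factor n = j] (mod l). mu n * real (omega n) ^ 2 / real n)"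
  obtain C where C: "C > 0" "\<forall>\<^sub>F x in at_top. \<bar>S x\<bar> \<le> C * ln (ln x) ^ 3 / sqrt (ln x)"
    using restricted_sum_bound[of l j] assms by (auto simp: S_def coprime_iff_gcd_eq_1)
  have big: "S \<in> O[at_top](\<lambda>x. ln (ln x) powr (7 / 2) / sqrt (ln x))"
  proof (rule bigoI[where c = C])
    have "\<forall>\<^sub>F x::real in at_top. ln (ln x) \<ge> 1" by real_asymp
    moreover have "\<forall>\<^sub>F x::real in at_top. ln x \<ge> 1" by real_asymp
    ultimately show "\<forall>\<^sub>F x in at_top. norm (S x) \<le> C * norm (ln (ln x) powr (7 / 2) / sqrt (ln x))"
      using C(2)
    proof eventually_elim
      case (elim x)
      \<comment> \<open>The exponent 3 is weakened to 7/2, which is legitimate once log log x \<ge>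
        1.\<close>
      have "ln (ln x) ^ 3 = ln (ln x) powr 3" using elim(1) by (simp add: powr_numeral)
      also have "\<dots> \<le> ln (ln x) powr (7 / 2)" using elim(1) by (intro powr_mono) auto
      finally have "C * (ln (ln x) ^ 3 / sqrt (ln x)) \<le> C * (ln (ln x) powr (7 / 2) / sqrt (ln x))"
        using C(1) elim(2) by (intro mult_left_mono divide_right_mono) auto
      thus ?case using elim by simp
    qed
  qed
  have "((\<lambda>x::real. C * ln (ln x) ^ 3 / sqrt (ln x)) \<longlongrightarrow> 0) at_top" by real_asymp
  hence lim: "(S \<longlongrightarrow> 0) at_top" by (rule Lim_null_comparison[rotated]) (use C(2) in simp)
  define f where "f = (\<lambda>n. if 2 \<le> n \<and> [smallest_prime_factor n = j] (mod l) then mu n * real (omega n) ^ 2 / real n else 0)"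
  \<comment> \<open>The indices 0 and 1 carry the value 0, so the partial sums of the series are the
    values of \<open>S\<close> at integers.\<close>
  have part: "(\<Sum>n\<le>N. f n) = S (real N)" for N
    unfolding S_def f_def by (intro sum.mono_neutral_cong_right) auto
  have "(\<lambda>N. S (real N)) \<longlonglongrightarrow> 0" by (rule filterlim_compose[OF lim filterlim_real_sequentially])
  hence "f sums 0" by (simp add: sums_def_le part)
  thus ?thesis using big by (simp add: S_def f_def)
qed

end
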